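(* In energy games, the Nash-checking problem, the subgame-perfect-checking problem and the deterministic subgame-perfect-checking problem are all $\mathsf{coNP}$-complete.
   Context: Games. A game $G=(\Pi,V,(V_i)_{i\in\Pi},E,\mu)$ consists of a finite set $\Pi$ of players, a finite directed graph $(V,E)$ in which every vertex has at least one outgoing edge, a partition $(V_i)_{i\in\Pi}$ of $V$ (parts may be empty; $V_i$ is controlled by $i$), and a payoff function $\mu=(\mu_i)_{i\in\Pi}$ mapping plays (infinite paths) to $\mathbb R^\Pi$. Histories are finite paths. $G_{\upharpoonright v_0}$ denotes the game with initial vertex $v_0$ (plays and histories start at $v_0$). It is an energy game if each player $i$ has a reward mapping $r_i:E\to\mathbb Q$ (encoded in binary) such that, with $\mathrm{EL}_i(h_0)=0$, and $\mathrm{EL}_i(h_0\dots h_{n+1})=\mathrm{EL}_i(h_0\dots h_n)+r_i(h_nh_{n+1})$ if $\mathrm{EL}_i(h_0\dots h_n)\neq\bot$ and this sum is $\ge0$, and $\mathrm{EL}_i(h_0\dots h_{n+1})=\bot$ otherwise, we have $\mu_i(\pi)=0$ if $\mathrm{EL}_i$ is $\bot$ on some prefix of $\pi$, and $\mu_i(\pi)=1$ otherwise. Strategies and equilibria. A strategy $\sigma_i$ of player $i$ maps each history $hv$ from $v_0$ with $v\in V_i$ to a successor of $v$; a profile $\bar\sigma=(\sigma_i)_{i\in\Pi}$ has a unique compatible play, its outcome $\langle\bar\sigma\rangle$; $\bar\sigma(hv)=\sigma_i(hv)$ for $v\in V_i$. $\bar\sigma$ is a Nash equilibrium (NE) if $\mu_i(\langle\sigma'_i,\bar\sigma_{-i}\rangle)\le\mu_i(\langle\bar\sigma\rangle)$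 for all $i,\sigma'_i$. It is a subgame-perfect equilibrium (SPE) if for each history $hv$ from $v_0$, the profile $h'\mapsto\bar\sigma(hh')$ is an NE in the game on the same arena from $v$ with payoff $\pi\mapsto\mu(h\pi)$. Mealy machines. A multiplayer Mealy machine for $\Pi$ on $G$ is $M=(Q,q_0,\Delta)$ with $Q$ finite, $q_0\in Q$, $\Delta\subseteq Q\times V\times Q\times V$, with $uv\in E$ for every $(p,u,q,v)\in\Delta$, and at least one transition $(p,u,q,v)$ for all $p\in Q$, $u\in V$; it is deterministic if there is exactly one for all $p,u$. $\bar\sigma\in\mathrm{Comp}_{\upharpoonright v_0}(M)$ if there is a map $h\mapsto q_h\in Q$ (on histories from $v_0$ and the empty history, the latter mapped to $q_0$) such that $(q_h,v,q_{hv},\bar\sigma(hv))\in\Delta$ for every history $hv$ from $v_0$. Problems. The Nash-checking (resp. (deterministic) subgame-perfect-checking) problem in energy games: given an energy game $G_{\upharpoonright v_0}$ and a multiplayer (resp. (deterministic) multiplayer) Mealy machine $M$ for $\Pi$ on $G$, is every $\bar\sigma\in\mathrm{Comp}_{\upharpoonright v_0}(M)$ an NE (resp. SPE)? *)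

theory Defs
  imports
    Complex_Main
    "HOL-Library.Disjoint_Sets"
    "HOL-Library.Omega_Words_Fun"
    "HOL-Computational_Algebra.Polynomial"
begin

section \<open>Games on graphs\<close>

text \<open>Plays are infinite words of type \<^typ>\<open>'v word\<close>, that is \<^typ>\<open>nat \<Rightarrow> 'v\<close>; the
  concatenation of a finite and an infinite word is \<open>h \<frown> \<pi>\<close>.\<close>

record ('p, 'v) game =
  players :: "'p set"
  verts :: "'v set"
  owned :: "'p \<Rightarrow> 'v set"
  edges :: "('v \<times> 'v) set"
  payoff :: "'p \<Rightarrow> 'v word \<Rightarrow> real"

definition wf_game :: "('p, 'v) game \<Rightarrow> bool" where
  "wf_game G \<longleftrightarrow>
     finite (players G) \<and> finite (verts G) \<and>
     edges G \<subseteq> verts G \<times> verts G \<and>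
     (\<forall>u\<in>verts G. \<exists>v. (u, v) \<in> edges G) \<and>
     (\<Union>i\<in>players G. owned G i) = verts G \<and>
     disjoint_family_on (owned G) (players G)"

definition owner :: "('p, 'v) game \<Rightarrow> 'v \<Rightarrow> 'p" where
  "owner G v = (THE i. i \<in> players G \<and> v \<in> owned G i)"

definition history :: "('p, 'v) game \<Rightarrow> 'v \<Rightarrow> 'v list \<Rightarrow> bool" where
  "history G v0 h \<longleftrightarrow>
     h \<noteq> [] \<and> hd h = v0 \<and> set h \<subseteq> verts G \<and> successively (\<lambda>u v. (u, v) \<in> edges G) h"

text \<open>Strategies are total functions on lists, but only their values on histories that start
  in \<open>v0\<close> and end in a vertex of the player matter.\<close>

definition strategy :: "('p, 'v) game \<Rightarrow> 'v \<Rightarrow> 'p \<Rightarrow> ('v list \<Rightarrow> 'v) \<Rightarrow> bool" where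
  "strategy G v0 i s \<longleftrightarrow>
     (\<forall>h v. history G v0 (h @ [v]) \<and> v \<in> owned G i \<longrightarrow> (v, s (h @ [v])) \<in> edges G)"

type_synonym ('p, 'v) profile = "'p \<Rightarrow> 'v list \<Rightarrow> 'v"

definition strategy_profile :: "('p, 'v) game \<Rightarrow> 'v \<Rightarrow> ('p, 'v) profile \<Rightarrow> bool" where
  "strategy_profile G v0 \<sigma> \<longleftrightarrow> (\<forall>i\<in>players G. strategy G v0 i (\<sigma> i))"

definition profile_move :: "('p, 'v) game \<Rightarrow> ('p, 'v) profile \<Rightarrow> 'v list \<Rightarrow> 'v" where
  "profile_move G \<sigma> h = \<sigma> (owner G (last h)) h"

primrec outcome_prefix :: "('p, 'v) game \<Rightarrow> 'v \<Rightarrow> ('p, 'v) profile \<Rightarrow> nat \<Rightarrow> 'v list" where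
  "outcome_prefix G v0 \<sigma> 0 = [v0]"
| "outcome_prefix G v0 \<sigma> (Suc n) =
     outcome_prefix G v0 \<sigma> n @ [profile_move G \<sigma> (outcome_prefix G v0 \<sigma> n)]"

definition outcome :: "('p, 'v) game \<Rightarrow> 'v \<Rightarrow> ('p, 'v) profile \<Rightarrow> 'v word" where
  "outcome G v0 \<sigma> n = last (outcome_prefix G v0 \<sigma> n)"

definition Nash_equilibrium :: "('p, 'v) game \<Rightarrow> 'v \<Rightarrow> ('p, 'v) profile \<Rightarrow> bool" where
  "Nash_equilibrium G v0 \<sigma> \<longleftrightarrow>
     (\<forall>i\<in>players G. \<forall>s. strategy G v0 i s \<longrightarrow>
        payoff G i (outcome G v0 (\<sigma>(i := s))) \<le> payoff G i (outcome G v0 \<sigma>))"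

definition subgame :: "('p, 'v) game \<Rightarrow> 'v list \<Rightarrow> ('p, 'v) game" where
  "subgame G h = G\<lparr>payoff := \<lambda>i \<pi>. payoff G i (h \<frown> \<pi>)\<rparr>"

definition subgame_perfect_equilibrium ::
    "('p, 'v) game \<Rightarrow> 'v \<Rightarrow> ('p, 'v) profile \<Rightarrow> bool" where
  "subgame_perfect_equilibrium G v0 \<sigma> \<longleftrightarrow>
     (\<forall>h v. history G v0 (h @ [v]) \<longrightarrow>
        Nash_equilibrium (subgame G h) v (\<lambda>i h'. \<sigma> i (h @ h')))"

section \<open>Energy payoffs\<close>

text \<open>\<open>energy_level r \<pi> n\<close> is the energy level of the history \<open>\<pi> 0 \<dots> \<pi> n\<close>; \<open>None\<close> plays the
  role of \<open>\<bottom>\<close>.\<close>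

primrec energy_level :: "('v \<times> 'v \<Rightarrow> rat) \<Rightarrow> 'v word \<Rightarrow> nat \<Rightarrow> rat option" where
  "energy_level r \<pi> 0 = Some 0"
| "energy_level r \<pi> (Suc n) =
     (case energy_level r \<pi> n of
        None \<Rightarrow> None
      | Some e \<Rightarrow> if e + r (\<pi> n, \<pi> (Suc n)) \<ge> 0 then Some (e + r (\<pi> n, \<pi> (Suc n))) else None)"

definition energy_payoff :: "('v \<times> 'v \<Rightarrow> rat) \<Rightarrow> 'v word \<Rightarrow> real" where
  "energy_payoff r \<pi> = (if \<exists>n. energy_level r \<pi> n = None then 0 else 1)"

section \<open>Multiplayer Mealy machines\<close>

record ('q, 'v) mealy =
  mealy_states :: "'q set"
  mealy_init :: 'q
  mealy_trans :: "('q \<times> 'v \<times> 'q \<times> 'v) set"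

definition wf_mealy :: "('p, 'v) game \<Rightarrow> ('q, 'v) mealy \<Rightarrow> bool" where
  "wf_mealy G M \<longleftrightarrow>
     finite (mealy_states M) \<and> mealy_init M \<in> mealy_states M \<and>
     mealy_trans M \<subseteq> mealy_states M \<times> verts G \<times> mealy_states M \<times> verts G \<and>
     (\<forall>(p, u, q, v)\<in>mealy_trans M. (u, v) \<in> edges G) \<and>
     (\<forall>p\<in>mealy_states M. \<forall>u\<in>verts G. \<exists>q v. (p, u, q, v) \<in> mealy_trans M)"

definition deterministic_mealy :: "('p, 'v) game \<Rightarrow> ('q, 'v) mealy \<Rightarrow> bool" where
  "deterministic_mealy G M \<longleftrightarrow>
     (\<forall>p\<in>mealy_states M. \<forall>u\<in>verts G. \<exists>!(q, v). (p, u, q, v) \<in> mealy_trans M)"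

definition compatible ::
    "('p, 'v) game \<Rightarrow> 'v \<Rightarrow> ('q, 'v) mealy \<Rightarrow> ('p, 'v) profile set" where
  "compatible G v0 M = {\<sigma>. strategy_profile G v0 \<sigma> \<and>
     (\<exists>state :: 'v list \<Rightarrow> 'q. state [] = mealy_init M \<and>
        (\<forall>h v. history G v0 (h @ [v]) \<longrightarrow>
           (state h, v, state (h @ [v]), profile_move G \<sigma> (h @ [v])) \<in> mealy_trans M))}"

section \<open>Instances of the checking problems and their binary encoding\<close>

text \<open>
  In an instance the players, the vertices and the states of the Mealy machine are initial
  segments of the natural numbers. The list \<open>inst_owners\<close> maps every vertex to its owner, and
  its length is the number of vertices. Every entry of \<open>inst_edges\<close> is an edge together with the
  list of the rewards of all players. A reward is a fraction, given by its numerator and its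
  positive denominator and not necessarily in lowest terms.
\<close>

record checking_instance =
  inst_num_players :: nat
  inst_owners :: "nat list"
  inst_edges :: "((nat \<times> nat) \<times> (int \<times> nat) list) list"
  inst_init :: nat
  inst_num_states :: nat
  inst_state :: nat
  inst_trans :: "(nat \<times> nat \<times> nat \<times> nat) list"

definition inst_reward :: "checking_instance \<Rightarrow> nat \<Rightarrow> nat \<times> nat \<Rightarrow> rat" where
  "inst_reward I i e =
     (let (a, b) = the (map_of (inst_edges I) e) ! i in of_int a / of_nat b)"

definition inst_game :: "checking_instance \<Rightarrow> (nat, nat) game" where
  "inst_game I =
     \<lparr>players = {..<inst_num_players I},
      verts = {..<length (inst_owners I)},
      owned = (\<lambda>i. {v. v < length (inst_owners I) \<and> inst_owners I ! v = i}),
      edges = fst ` set (inst_edges I),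
      payoff = (\<lambda>i. energy_payoff (inst_reward I i))\<rparr>"

definition inst_mealy :: "checking_instance \<Rightarrow> (nat, nat) mealy" where
  "inst_mealy I =
     \<lparr>mealy_states = {..<inst_num_states I},
      mealy_init = inst_state I,
      mealy_trans = set (inst_trans I)\<rparr>"

definition wf_instance :: "checking_instance \<Rightarrow> bool" where
  "wf_instance I \<longleftrightarrow>
     wf_game (inst_game I) \<and>
     inst_init I \<in> verts (inst_game I) \<and>
     distinct (map fst (inst_edges I)) \<and>
     (\<forall>(e, ws)\<in>set (inst_edges I).
        length ws = inst_num_players I \<and> (\<forall>(a, b)\<in>set ws. b > 0)) \<and>
     wf_mealy (inst_game I) (inst_mealy I)"

fun binary :: "nat \<Rightarrow> bool list" where
  "binary n = (if n = 0 then [] else odd n # binary (n div 2))"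

declare binary.simps [simp del]

text \<open>All the encodings below are prefix-free: a continuation bit precedes every digit of a
  number and every element of a list, so that the encodings of the components of a tuple can
  simply be concatenated.\<close>

definition enc_list :: "('a \<Rightarrow> bool list) \<Rightarrow> 'a list \<Rightarrow> bool list" where
  "enc_list f xs = concat (map (\<lambda>x. True # f x) xs) @ [False]"

definition enc_nat :: "nat \<Rightarrow> bool list" where
  "enc_nat n = enc_list (\<lambda>b. [b]) (binary n)"

definition enc_int :: "int \<Rightarrow> bool list" where
  "enc_int z = (z < 0) # enc_nat (nat \<bar>z\<bar>)"

definition enc_edge :: "(nat \<times> nat) \<times> (int \<times> nat) list \<Rightarrow> bool list" where
  "enc_edge = (\<lambda>((u, v), ws).
     enc_nat u @ enc_nat v @ enc_list (\<lambda>(a, b). enc_int a @ enc_nat b) ws)"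

definition enc_trans :: "nat \<times> nat \<times> nat \<times> nat \<Rightarrow> bool list" where
  "enc_trans = (\<lambda>(p, u, q, v). enc_nat p @ enc_nat u @ enc_nat q @ enc_nat v)"

definition enc_instance :: "checking_instance \<Rightarrow> bool list" where
  "enc_instance I =
     enc_nat (inst_num_players I) @ enc_list enc_nat (inst_owners I) @
     enc_list enc_edge (inst_edges I) @ enc_nat (inst_init I) @
     enc_nat (inst_num_states I) @ enc_nat (inst_state I) @ enc_list enc_trans (inst_trans I)"

definition Nash_checking :: "bool list set" where
  "Nash_checking = {enc_instance I | I. wf_instance I \<and>
     (\<forall>\<sigma>\<in>compatible (inst_game I) (inst_init I) (inst_mealy I).
        Nash_equilibrium (inst_game I) (inst_init I) \<sigma>)}"

definition subgame_perfect_checking :: "bool list set" where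
  "subgame_perfect_checking = {enc_instance I | I. wf_instance I \<and>
     (\<forall>\<sigma>\<in>compatible (inst_game I) (inst_init I) (inst_mealy I).
        subgame_perfect_equilibrium (inst_game I) (inst_init I) \<sigma>)}"

definition deterministic_subgame_perfect_checking :: "bool list set" where
  "deterministic_subgame_perfect_checking = {enc_instance I | I. wf_instance I \<and>
     deterministic_mealy (inst_game I) (inst_mealy I) \<and>
     (\<forall>\<sigma>\<in>compatible (inst_game I) (inst_init I) (inst_mealy I).
        subgame_perfect_equilibrium (inst_game I) (inst_init I) \<sigma>)}"

section \<open>Deterministic multitape Turing machines\<close>

text \<open>
  States and tape symbols are initial segments of the natural numbers. The symbol 0 is the
  blank, and 1 and 2 represent the bits 0 and 1. Tapes are infinite in both directions; the first
  tape carries the input and the last one (possibly the same) the output, each written from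
  cell 0 on and surrounded by blanks.
\<close>

datatype move = Move_Left | Stay | Move_Right

record turing_machine =
  tm_tapes :: nat
  tm_states :: nat
  tm_symbols :: nat
  tm_start :: nat
  tm_halt :: nat
  tm_delta :: "nat \<Rightarrow> nat list \<Rightarrow> nat \<times> (nat \<times> move) list"

definition wf_tm :: "turing_machine \<Rightarrow> bool" where
  "wf_tm M \<longleftrightarrow>
     tm_tapes M \<ge> 1 \<and> tm_symbols M \<ge> 3 \<and>
     tm_start M < tm_states M \<and> tm_halt M < tm_states M \<and>
     (\<forall>q syms. q < tm_states M \<and> length syms = tm_tapes M \<and> (\<forall>a\<in>set syms. a < tm_symbols M) \<longrightarrow>
        (case tm_delta M q syms of (q', acts) \<Rightarrow>
           q' < tm_states M \<and> length acts = tm_tapes M \<and> (\<forall>(a, m)\<in>set acts. a < tm_symbols M)))"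

text \<open>A tape is given by the contents of its cells and the position of the head.\<close>

type_synonym tape = "(int \<Rightarrow> nat) \<times> int"
type_synonym tm_config = "nat \<times> tape list"

definition word_cells :: "bool list \<Rightarrow> int \<Rightarrow> nat" where
  "word_cells w p =
     (if 0 \<le> p \<and> p < int (length w) then (if w ! nat p then 2 else 1) else 0)"

definition tm_initial :: "turing_machine \<Rightarrow> bool list \<Rightarrow> tm_config" where
  "tm_initial M w =
     (tm_start M, (word_cells w, 0) # replicate (tm_tapes M - 1) (word_cells [], 0))"

fun tape_act :: "nat \<times> move \<Rightarrow> tape \<Rightarrow> tape" where
  "tape_act (a, m) (cs, p) =
     (cs(p := a), case m of Move_Left \<Rightarrow> p - 1 | Stay \<Rightarrow> p | Move_Right \<Rightarrow> p + 1)"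

definition tm_step :: "turing_machine \<Rightarrow> tm_config \<Rightarrow> tm_config" where
  "tm_step M = (\<lambda>(q, ts).
     if q = tm_halt M then (q, ts)
     else case tm_delta M q (map (\<lambda>(cs, p). cs p) ts) of
            (q', acts) \<Rightarrow> (q', map2 tape_act acts ts))"

definition tm_computes_within ::
    "turing_machine \<Rightarrow> (bool list \<Rightarrow> bool list) \<Rightarrow> (nat \<Rightarrow> nat) \<Rightarrow> bool" where
  "tm_computes_within M f T \<longleftrightarrow>
     (\<forall>w. case (tm_step M ^^ T (length w)) (tm_initial M w) of (q, ts) \<Rightarrow>
        q = tm_halt M \<and> fst (last ts) = word_cells (f w))"

section \<open>Polynomial time, coNP and completeness\<close>

definition polytime_computable :: "(bool list \<Rightarrow> bool list) \<Rightarrow> bool" where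
  "polytime_computable f \<longleftrightarrow>
     (\<exists>M (p :: nat poly). wf_tm M \<and> tm_computes_within M f (poly p))"

definition class_P :: "bool list set set" where
  "class_P = {L. polytime_computable (\<lambda>w. [w \<in> L])}"

definition pair_word :: "bool list \<Rightarrow> bool list \<Rightarrow> bool list" where
  "pair_word x y = concat (map (\<lambda>b. [b, b]) x) @ [False, True] @ y"

definition class_NP :: "bool list set set" where
  "class_NP = {L. \<exists>R\<in>class_P. \<exists>p :: nat poly.
     \<forall>x. x \<in> L \<longleftrightarrow> (\<exists>y. length y \<le> poly p (length x) \<and> pair_word x y \<in> R)}"

definition class_coNP :: "bool list set set" where
  "class_coNP = {L. - L \<in> class_NP}"

definition polytime_reducible :: "bool list set \<Rightarrow> bool list set \<Rightarrow> bool" where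
  "polytime_reducible L L' \<longleftrightarrow>
     (\<exists>f. polytime_computable f \<and> (\<forall>x. x \<in> L \<longleftrightarrow> f x \<in> L'))"

definition coNP_complete :: "bool list set \<Rightarrow> bool" where
  "coNP_complete L \<longleftrightarrow> L \<in> class_coNP \<and> (\<forall>L'\<in>class_coNP. polytime_reducible L' L)"

end

theory Submission
  imports Defs "HOL-Library.Multiset"
begin

text \<open>A violation of the equilibrium condition is a losing play together with a profitable deviation. It
  can be witnessed by walks of exponential length that have straight-line derivations of polynomial
  size, which gives membership in coNP. Hardness is a chain of reductions from Turing machines over
  constraint satisfaction to choosing one number from each of several lists with a prescribed sum.\<close>

section \<open>Walks in weighted graphs\<close>

text \<open>Rewards are binary, so a deviation may need exponentially much energy, and neither play
  can be listed in a certificate. What has to be known of a walk is its end points, its weight and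
  its credit. These compose under concatenation, and repeated squaring describes huge repetitions of
  a cycle by few entries. The obstacle is that the two plays share a prefix: its weight must suffice
  for one continuation and fail for the other, while the energy of the deviating player may never
  become negative on it. Without the last condition, a skeleton through all vertices and few cycle
  weights realise the same weight; the condition itself is handled through the signs of cycles.

  Hardness uses that a violation confines the energy at the deviation between two bounds: winning
  against the cost \<open>T\<close> and losing against \<open>T + 1\<close> forces the value
  \<open>T\<close>. Hence the chain ends in a sum problem. As polynomial time refers to actual
  Turing machines, all checks and reductions are assembled from stack programs on self-delimiting
  trees, for which the closure rules \<open>pts\<close> are proved.\<close>

type_synonym 'n wedge = "'n * int * 'n"

abbreviation tgt :: "'n * 'w * 'n => 'n" where "tgt e == snd (snd e)"
abbreviation wt :: "'n * 'w * 'n => 'w" where "wt e == fst (snd e)"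

fun walk :: "('n * 'w * 'n) set => 'n => ('n * 'w * 'n) list => 'n => bool" where
 "walk E u [] v = (u = v)"
| "walk E u (e # es) v = (e : E & fst e = u & walk E (tgt e) es v)"

definition weight :: "'n wedge list => int" where
 "weight p = sum_list (map wt p)"

text \<open>The least initial counter value from which the counter stays nonnegative.\<close>

fun credit :: "'n wedge list => int" where
 "credit [] = 0"
| "credit (e # p) = max 0 (credit p - wt e)"

definition stops :: "'n => ('n * 'w * 'n) list => 'n list" where
 "stops u p = u # map tgt p"

abbreviation seen :: "'n => ('n * 'w * 'n) list => 'n set" where "seen u p == set (stops u p)"

definition simple_cycle :: "'n wedge set => 'n => 'n wedge list => bool" where
 "simple_cycle E u c = (walk E u c u & c ~= [] & distinct (map tgt c))"

abbreviation total :: "('n * 'n wedge list) list => int" where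
 "total cs == sum_list (map (weight o snd) cs)"

lemma weight_simps [simp]:
 "weight [] = 0" "weight (e # p) = wt e + weight p" "weight (p @ q) = weight p + weight q" by (auto simp: weight_def)

lemma weight_concat_replicate [simp]: "weight (concat (replicate k p)) = int k * weight p" by (induction k) (auto simp: algebra_simps)

lemma credit_nonneg [simp]: "credit p >= 0" by (cases p) auto

lemma credit_append: "credit (p @ q) = max (credit p) (credit q - weight p)" by (induction p) auto

lemma credit_ge: "credit p >= - weight p" by (induction p) auto

lemma credit_leI:
 assumes "0 <= x" "!!p1 p2. p = p1 @ p2 ==> 0 <= x + weight p1"
 shows "credit p <= x" using assms
proof (induction p arbitrary: x)
 case (Cons e p)
 have "credit p <= x + wt e"
 proof (rule Cons.IH)
  show "0 <= x + wt e" using Cons.prems(2)[of "[e]" p] by simp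
  fix p1 p2 assume "p = p1 @ p2"
  thus "0 <= x + wt e + weight p1" using Cons.prems(2)[of "e # p1" p2] by simp
 qed
 thus ?case using Cons.prems(1) by simp
qed simp

lemma credit_le_prefix: "credit (p1 @ p2) <= x ==> 0 <= x + weight p1" using credit_ge[of p1] by (auto simp: credit_append)

lemma credit_power:
 assumes "credit c = 0" "weight c >= 0"
 shows "credit (concat (replicate k c)) = 0" using assms by (induction k) (auto simp: credit_append)

lemma credit_power_neg:
 assumes "credit c = - weight c"
 shows "credit (concat (replicate k c)) = - (int k * weight c)"
proof -
 have "weight c <= 0" using assms credit_nonneg[of c] by linarith
 thus ?thesis using assms by (induction k) (auto simp: credit_append algebra_simps mult_nonneg_nonpos)
qed

section \<open>Cutting, joining and restricting walks\<close>

lemma walk_append: "walk E u (p @ q) v = (EX x. walk E u p x & walk E x q v)" by (induction p arbitrary: u) auto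

lemma walk_mono: "walk E u p v ==> set p <= F ==> walk F u p v" by (induction p arbitrary: u) auto

lemma walk_subset: "walk E u p v ==> set p <= E" by (induction p arbitrary: u) auto

lemma walk_self: "walk E u p v ==> walk (set p) u p v" by (rule walk_mono) auto

lemma walk_weaken: "walk E u p v ==> E <= F ==> walk F u p v" using walk_mono walk_subset by (metis order_trans)

lemma walk_power: "walk E u c u ==> walk E u (concat (replicate k c)) u" by (induction k) (auto simp: walk_append)

lemma stops_simps [simp]:
 "stops u [] = [u]" "stops u (e # p) = u # stops (tgt e) p" by (auto simp: stops_def)

lemma stops_append: "seen u (p @ q) = seen u p \<union> tgt ` set q" by (auto simp: stops_def)

lemma set_stops: "seen u p = insert u (tgt ` set p)" by (auto simp: stops_def)

lemma walk_end_stops: "walk E u p v ==> v : seen u p" by (induction p arbitrary: u) auto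

lemma walk_src_stops: "walk E u p v ==> e : set p ==> fst e : seen u p" by (induction p arbitrary: u) auto

lemma walk_stops_split:
 assumes "walk E u p v" "x : seen u p"
 obtains p1 p2 where "p = p1 @ p2" "walk E u p1 x" "walk E x p2 v" using assms
proof (induction p arbitrary: u thesis)
 case (Cons e p) show ?case
 proof (cases "x = u")
  case True thus ?thesis using Cons.prems by (auto intro: Cons.prems(1)[of "[]" "e # p"])
 next case False
  with Cons.prems have "walk E (tgt e) p v" "x : seen (tgt e) p" by auto
  then obtain p1 p2 where "p = p1 @ p2" "walk E (tgt e) p1 x" "walk E x p2 v" using Cons.IH by metis
  thus ?thesis using Cons.prems(2) by (intro Cons.prems(1)[of "e # p1" p2]) auto
 qed
qed auto

lemma walk_last_visit:
 assumes "walk E u p v" "x : seen u p"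
 obtains p1 p2 where "p = p1 @ p2" "walk E u p1 x" "walk E x p2 v" "x ~: tgt ` set p2" using assms
proof (induction p arbitrary: u thesis)
 case (Cons e p) show ?case
 proof (cases "x : seen (tgt e) p")
  case True
  with Cons.prems have "walk E (tgt e) p v" by auto
  then obtain p1 p2 where "p = p1 @ p2" "walk E (tgt e) p1 x" "walk E x p2 v" "x ~: tgt ` set p2" using Cons.IH True by metis
  thus ?thesis using Cons.prems(2) by (intro Cons.prems(1)[of "e # p1" p2]) auto
 next case False
  thus ?thesis using Cons.prems by (intro Cons.prems(1)[of "[]" "e # p"]) (auto simp: set_stops)
 qed
qed auto

lemma simple_cycle_length:
 assumes "simple_cycle E u c" "E <= V \<times> UNIV \<times> V" "finite V"
 shows "length c <= card V"
proof -
 have "set (map tgt c) <= V" using assms walk_subset by (fastforce simp: simple_cycle_def)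
 thus ?thesis using assms(1,3) card_mono[of V "set (map tgt c)"] by (simp add: simple_cycle_def distinct_card del: set_map)
qed

lemma simple_cycle_mono: "simple_cycle E u c ==> E <= F ==> simple_cycle F u c" by (auto simp: simple_cycle_def intro: walk_weaken)

lemma abs_weight_le:
 assumes "set p <= UNIV \<times> {-W..W} \<times> UNIV"
 shows "abs (weight p) <= int (length p) * W" using assms by (induction p) (fastforce simp: algebra_simps)+

lemma credit_le_length:
 assumes "set p <= UNIV \<times> {-W..W} \<times> UNIV" "W >= 0"
 shows "credit p <= int (length p) * W" using assms by (induction p) (fastforce simp: algebra_simps)+

subsection \<open>Loop erasure\<close>

text \<open>If the new edge returns to a stop of \<open>k\<close>, the part of \<open>k\<close>
  after that stop together with the edge is a simple cycle, and only this part is cut off. Otherwise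
  nothing is erased.\<close>

lemma erase_step:
 assumes "walk E x k u" "distinct (stops x k)" "e : E" "fst e = u"
 obtains k' cs where "walk E x k' (tgt e)" "distinct (stops x k')" "seen x k' <= seen x (k @ [e])"
  "length k' <= Suc (length k)"
  "!!y c. (y, c) : set cs ==> simple_cycle E y c & y : seen x k"
  "weight k + wt e = weight k' + total cs"
  "tgt e ~: seen x k ==> k' = k @ [e]"
proof (cases "tgt e : seen x k")
 case False show ?thesis by (rule that[of "k @ [e]" "[]"]) (use assms False in "auto simp: walk_append stops_def")
next case True
 then obtain k1 k2 where k: "k = k1 @ k2" "walk E x k1 (tgt e)" "walk E (tgt e) k2 u" using walk_stops_split assms(1) by metis
 have 1: "tgt e ~: set (map tgt k2)"
 proof
  assume "tgt e : set (map tgt k2)"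
  moreover have "tgt e : seen x k1" using k walk_end_stops by metis
  ultimately show False using assms(2) unfolding k(1) stops_def by auto
 qed
 have "distinct (map tgt k2)" using assms(2) unfolding k(1) stops_def by auto
 hence "simple_cycle E (tgt e) (k2 @ [e])" using 1 k assms unfolding simple_cycle_def by (auto simp: walk_append)
 thus ?thesis using k assms True by (intro that[of k1 "[(tgt e, k2 @ [e])]"]) (auto simp: stops_def)
qed

text \<open>The loop-erased form of the prefix read so far is extended edge by edge, and the erased
  cycles are collected so that no weight is lost. An erased cycle need not meet \<open>k\<close> any
  more, which \<open>skeleton\<close> repairs.\<close>

lemma loop_erasure:
 assumes "walk E a p b"
 obtains k cs where "walk (set p) a k b" "distinct (stops a k)"
  "seen a k <= seen a p"
  "!!y c. (y, c) : set cs ==> simple_cycle (set p) y c & y : seen a p"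
  "weight p = weight k + total cs"
proof -
 have "EX k cs. walk (set p) a k b & distinct (stops a k) & seen a k <= seen a p & (ALL (y, c):set cs. simple_cycle (set p) y c & y : seen a p) &
  weight p = weight k + total cs" using assms
 proof (induction p arbitrary: b rule: rev_induct)
  case Nil thus ?case by (intro exI[of _ "[]"]) auto
 next case (snoc e p)
  then obtain u where u: "walk E a p u" "e : E" "fst e = u" "tgt e = b" by (auto simp: walk_append)
  obtain k cs where k: "walk (set p) a k u" "distinct (stops a k)" "seen a k <= seen a p"
   "ALL (y, c):set cs. simple_cycle (set p) y c & y : seen a p"
   "weight p = weight k + total cs" using snoc.IH[OF u(1)] by blast
  let ?E = "set (p @ [e])"
  have w: "walk ?E a k u" using k(1) by (rule walk_weaken) auto
  have e: "e : ?E" by auto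
  obtain k' cs' where k': "walk ?E a k' (tgt e)" "distinct (stops a k')" "seen a k' <= seen a (k @ [e])"
   "!!y c. (y, c) : set cs' ==> simple_cycle ?E y c & y : seen a k"
   "weight k + wt e = weight k' + total cs'" using erase_step[OF w k(2) e u(3)] by metis
  show ?case
  proof (intro exI[of _ k'] exI[of _ "cs @ cs'"] conjI)
   show "walk ?E a k' b" "distinct (stops a k')" using k' u by auto
   show "seen a k' <= seen a (p @ [e])" using k'(3) k(3) by (auto simp: stops_append)
   have "simple_cycle ?E y c" if "simple_cycle (set p) y c" for y c using that by (rule simple_cycle_mono) auto
   thus "ALL (y, c):set (cs @ cs'). simple_cycle ?E y c & y : seen a (p @ [e])" using k(3,4) k'(4) by (fastforce simp: stops_append)
   show "weight (p @ [e]) = weight k' + total (cs @ cs')" using k(5) k'(5) by simp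
  qed
 qed
 thus ?thesis using that by fast
qed

text \<open>The skeleton of a walk still visits all of its vertices: cycles are only erased in the part
  \<open>k2\<close> that follows the last visit of a new vertex.\<close>

lemma skeleton:
 assumes "walk E a p b" "finite V" "seen a p <= V"
 obtains k cs where "walk (set p) a k b" "seen a k = seen a p"
  "length k <= card V * card V"
  "!!y c. (y, c) : set cs ==> simple_cycle (set p) y c & y : seen a p"
  "weight p = weight k + total cs"
proof -
 have "EX k1 k2 x cs. walk (set p) a k1 x & walk (set p) x k2 b & distinct (stops x k2) &
  seen x k2 <= seen a k1 & seen a k1 = seen a p &
  length k1 <= (card (seen a p) - 1) * card V &
  (ALL (y, c):set cs. simple_cycle (set p) y c & y : seen a p) &
  weight p = weight k1 + weight k2 + total cs" using assms
 proof (induction p arbitrary: b rule: rev_induct)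
  case Nil thus ?case by (intro exI[of _ "[]"] exI[of _ a]) auto
 next case (snoc e p)
  then obtain u where u: "walk E a p u" "e : E" "fst e = u" "tgt e = b" by (auto simp: walk_append)
  have V: "seen a p <= V" using snoc.prems by (auto simp: stops_append)
  obtain k1 k2 x cs where k: "walk (set p) a k1 x" "walk (set p) x k2 u" "distinct (stops x k2)"
   "seen x k2 <= seen a k1" "seen a k1 = seen a p"
   "length k1 <= (card (seen a p) - 1) * card V"
   "ALL (y, c):set cs. simple_cycle (set p) y c & y : seen a p"
   "weight p = weight k1 + weight k2 + total cs" using snoc.IH[OF u(1) assms(2) V] by blast
  let ?E = "set (p @ [e])"
  have w1: "walk ?E a k1 x" using k(1) by (rule walk_weaken) auto
  have w: "walk ?E x k2 u" using k(2) by (rule walk_weaken) auto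
  have e: "e : ?E" by auto
  have mono: "simple_cycle ?E y c" if "simple_cycle (set p) y c" for y c using that by (rule simple_cycle_mono) auto
  show ?case
  proof (cases "tgt e : seen a p")
   case True
   obtain k' cs' where k': "walk ?E x k' (tgt e)" "distinct (stops x k')" "seen x k' <= seen x (k2 @ [e])"
    "!!y c. (y, c) : set cs' ==> simple_cycle ?E y c & y : seen x k2"
    "weight k2 + wt e = weight k' + total cs'" using erase_step[OF w k(3) e u(3)] by metis
   have eq: "seen a (p @ [e]) = seen a p" using True by (auto simp: stops_append)
   show ?thesis unfolding eq
   proof (rule exI[of _ k1], rule exI[of _ k'], rule exI[of _ x], rule exI[of _ "cs @ cs'"], intro conjI)
    show "walk ?E x k' b" using k' u by auto
    show "seen x k' <= seen a k1" using k'(3) k(4,5) True by (auto simp: stops_append)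
    show "ALL (y, c):set (cs @ cs'). simple_cycle ?E y c & y : seen a p" using k(4,5,7) k'(4) mono by fastforce
    show "weight (p @ [e]) = weight k1 + weight k' + total (cs @ cs')" using k(8) k'(5) by simp
   qed (use k k' w1 in auto)
  next case False
   \<comment> \<open>Reaching a new vertex freezes \<open>k2 @ [e]\<close> into the part that is
     never erased again. This costs at most \<open>card V\<close> edges and happens once per further
     vertex.\<close>
   have card: "card (seen a (p @ [e])) = Suc (card (seen a p))" using False by (simp add: stops_append)
   have "length (stops x k2) <= card V" using k(3-5) V snoc.prems(2) by (metis card_mono distinct_card order_trans)
   hence l2: "length k2 + 1 <= card V" by (simp add: stops_def)
   have pos: "card (seen a p) >= 1" by (metis One_nat_def Suc_leI card_gt_0_iff empty_iff list.set(1) list.set_intros(1) set_stops List.finite_set insert_iff)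
   have "length k1 + (length k2 + 1) <= (card (seen a p) - 1) * card V + card V" using k(6) l2 by linarith
   also have "... = (Suc (card (seen a p)) - 1) * card V" using pos by (cases "card (seen a p)") auto
   finally have len: "length (k1 @ k2 @ [e]) <= (card (seen a (p @ [e])) - 1) * card V" by (simp add: card)
   have sub: "tgt ` set k2 <= seen a k1" using k(4) by (auto simp: set_stops)
   show ?thesis
   proof (rule exI[of _ "k1 @ k2 @ [e]"], rule exI[of _ "[]"], rule exI[of _ b], rule exI[of _ cs], intro conjI)
    show "walk ?E a (k1 @ k2 @ [e]) b" using w1 w u by (auto simp: walk_append)
    show "seen a (k1 @ k2 @ [e]) = seen a (p @ [e])" using sub k(5) by (auto simp: stops_append)
    show "seen b [] <= seen a (k1 @ k2 @ [e])" using u by (auto simp: stops_append)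
    show "ALL (y, c):set cs. simple_cycle ?E y c & y : seen a (p @ [e])" using k(7) mono by (fastforce simp: stops_append)
   qed (use k len in "auto simp: o_def")
  qed
 qed
 then obtain k1 k2 x cs where k: "walk (set p) a k1 x" "walk (set p) x k2 b" "distinct (stops x k2)"
   "seen x k2 <= seen a k1" "seen a k1 = seen a p"
   "length k1 <= (card (seen a p) - 1) * card V"
   "ALL (y, c):set cs. simple_cycle (set p) y c & y : seen a p"
   "weight p = weight k1 + weight k2 + total cs" by blast
 have c: "card (seen a p) <= card V" using assms by (auto intro: card_mono)
 have "length (stops x k2) <= card V" using k(3-5) assms by (metis card_mono distinct_card order_trans)
 hence l2: "length k2 + 1 <= card V" by (simp add: stops_def)
 have "length (k1 @ k2) <= (card V - 1) * card V + card V" using k(6) l2 mult_le_mono1[OF diff_le_mono[OF c, of 1], of "card V"] unfolding length_append by linarith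
 also have "... = card V * card V" using l2 by (cases "card V") auto
 finally have "length (k1 @ k2) <= card V * card V" .
 note len = this
 have "tgt ` set k2 <= seen a k1" using k(4) by (auto simp: set_stops)
 hence st: "seen a (k1 @ k2) = seen a p" using k(5) by (auto simp: stops_append)
 have w: "walk (set p) a (k1 @ k2) b" using k(1,2) by (auto simp: walk_append)
 have wt: "weight p = weight (k1 @ k2) + total cs" using k(8) by simp
 have cs: "simple_cycle (set p) y c & y : seen a p" if "(y, c) : set cs" for y c using k(7) that by blast
 show ?thesis by (rule that[OF w st len cs wt])
qed

subsection \<open>An integer Caratheodory bound\<close>

text \<open>Choose multiplicities of least total and, among these, of least support. Disjoint
  subsets of the support with equal sums could then be exchanged, so all subsets of the support have
  different sums. These sums lie in a short interval, which makes the support logarithmic in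
  \<open>M\<close>.\<close>

lemma caratheodory_int:
 fixes l :: "int => nat" and M :: int
 assumes C: "finite C" "C <= {-M..M}" "M >= 0"
 obtains l' :: "int => nat" where
  "(SUM c:C. int (l' c) * c) = (SUM c:C. int (l c) * c)"
  "!!c. c : C ==> l' c > 0 ==> l c > 0"
  "!!c. c : C ==> int (l' c) <= M ^ 3 + abs (SUM c:C. int (l c) * c)"
  "2 ^ card {c:C. l' c > 0} <= 2 * M * int (card {c:C. l' c > 0}) + 1"
proof -
 define S where "S = (SUM c:C. int (l c) * c)"
 define P where "P = (%l' :: int => nat. (SUM c:C. int (l' c) * c) = S & (ALL c:C. l' c > 0 --> l c > 0))"
 define supp where "supp = (%l' :: int => nat. {c:C. l' c > 0})"
 have "wf (measures [%l' :: int => nat. SUM c:C. l' c, %l'. card (supp l')])" by simp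
 moreover have "l : Collect P" by (auto simp: P_def S_def)
 ultimately obtain l' where l': "P l'"
  "!!k. (k, l') : measures [%l'. SUM c:C. l' c, %l'. card (supp l')] ==> ~ P k" by (rule wfE_min) auto
 \<comment> \<open>A perturbation \<open>d\<close> that stays inside the support and has weighted
   sum 0 cannot lower the total and, if it keeps the total, cannot empty an element of the
   support.\<close>
 have min: "(SUM c:C. d c) >= 0 & ((SUM c:C. d c) = 0 --> (ALL c:C. l' c > 0 --> int (l' c) + d c > 0))"
  if d: "!!c. c : C ==> 0 <= int (l' c) + d c" "!!c. c : C ==> l' c = 0 ==> d c = 0"
   "(SUM c:C. d c * c) = 0" for d
 proof -
  define k where "k = (%c. nat (int (l' c) + d c))"
  have k: "int (k c) = int (l' c) + d c" if "c : C" for c using d(1)[OF that] by (simp add: k_def)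
  have kz: "l' c > 0" if "c : C" "k c > 0" for c using that d(2)[OF that(1)] by (cases "l' c = 0") (auto simp: k_def)
  have "(SUM c:C. int (k c) * c) = (SUM c:C. int (l' c) * c) + (SUM c:C. d c * c)" by (simp add: k algebra_simps sum.distrib cong: sum.cong)
  hence "P k" using l'(1) d(3) kz by (auto simp: P_def)
  hence nm: "(k, l') ~: measures [%l'. SUM c:C. l' c, %l'. card (supp l')]" using l'(2) by blast
  have tot: "int (SUM c:C. k c) = int (SUM c:C. l' c) + (SUM c:C. d c)" by (simp add: k sum.distrib cong: sum.cong)
  have 1: "(SUM c:C. l' c) <= (SUM c:C. k c)" using nm by auto
  have 2: "supp l' <= supp k" if "(SUM c:C. d c) = 0"
  proof -
   have "(SUM c:C. l' c) = (SUM c:C. k c)" using tot that by linarith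
   hence "card (supp l') <= card (supp k)" using nm by auto
   moreover have "supp k <= supp l'" using kz by (auto simp: supp_def)
   moreover have "finite (supp l')" using C by (auto simp: supp_def)
   ultimately show ?thesis by (metis card_seteq order_refl)
  qed
  show ?thesis
  proof (intro conjI impI ballI)
   show "(SUM c:C. d c) >= 0" using tot 1 by linarith
   fix c assume "(SUM c:C. d c) = 0" "c : C" "l' c > 0"
   hence "c : supp k" using 2 by (auto simp: supp_def)
   thus "int (l' c) + d c > 0" using k[OF `c : C`] by (simp add: supp_def)
  qed
 qed
 \<comment> \<open>\<open>- b\<close> copies of \<open>c\<close> and \<open>c\<close> copies of
   \<open>b\<close> cancel; removing them would lower the total.\<close>
 have exch: False if "c : C" "b : C" "c > 0" "b < 0" "int (l' c) >= - b" "int (l' b) >= c" for b c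
 proof -
  define d where "d = (%x. (if x = c then b else 0) - (if x = b then c else 0))"
  have "(SUM x:C. d x) = b - c" using that C by (simp add: d_def sum_subtractf)
  moreover have "(SUM x:C. d x * x) = (SUM x:C. (if x = c then b * c else 0) - (if x = b then c * b else 0))" by (rule sum.cong) (auto simp: d_def)
  hence "(SUM x:C. d x * x) = 0" using that C by (simp add: sum_subtractf)
  moreover from this have "0 <= (SUM x:C. d x)" using that by (intro conjunct1[OF min]) (auto simp: d_def)
  ultimately show False using that by linarith
 qed
 have zero: "l' 0 = 0" if "0 : C"
 proof -
  define d where "d = (%x :: int. if x = 0 then - int (l' 0) else 0)"
  have "(SUM x:C. d x) = - int (l' 0)" using that C by (simp add: d_def)
  moreover have "(SUM x:C. d x * x) = 0" by (rule sum.neutral) (auto simp: d_def)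
  moreover from this have "0 <= (SUM x:C. d x)" by (intro conjunct1[OF min]) (auto simp: d_def)
  ultimately show ?thesis by linarith
 qed
 define p where "p = (SUM c:{c:C. c > 0}. int (l' c) * c)"
 define n where "n = (SUM c:{c:C. c < 0}. int (l' c) * (- c))"
 have split: "S = p - n"
 proof -
  have "(SUM c:C. int (l' c) * c) = (SUM c:{c:C. c > 0} \<union> {c:C. c < 0}. int (l' c) * c)" by (rule sum.mono_neutral_right) (use C in auto)
  also have "... = p - n" unfolding p_def n_def using C by (subst sum.union_disjoint) (auto simp: sum_negf)
  finally show ?thesis using l'(1) by (simp add: P_def)
 qed
 have card_half: "card {c:C. c > 0} <= nat M" "card {c:C. c < 0} <= nat M"
 proof -
  have "{c:C. c > 0} <= {1..M}" using C by auto
  from card_mono[OF _ this] show "card {c:C. c > 0} <= nat M" by simp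
  have "{c:C. c < 0} <= {-M..-1}" using C by auto
  from card_mono[OF _ this] show "card {c:C. c < 0} <= nat M" by simp
 qed
 have cube: "int k * (M * M) <= M ^ 3" if "k <= nat M" for k
 proof -
  have "int k * (M * M) <= M * (M * M)" using that C by (intro mult_right_mono) auto
  thus ?thesis by (simp add: power3_eq_cube)
 qed
 \<comment> \<open>If some positive element occurs at least \<open>M\<close> times,
   \<open>exch\<close> keeps every negative one below \<open>M\<close> copies. So one of the two
   sides is small, and the other differs from it by \<open>S\<close>.\<close>
 have "p <= M ^ 3 | n <= M ^ 3"
 proof (cases "EX c:C. c > 0 & int (l' c) >= M")
  case True
  then obtain c where c: "c : C" "c > 0" "int (l' c) >= M" by auto
  have "int (l' b) * (- b) <= M * M" if "b : C" "b < 0" for b using exch[OF c(1) that(1) c(2) that(2)] c C that by (intro mult_mono) force+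
  hence "n <= int (card {c:C. c < 0}) * (M * M)" unfolding n_def by (intro sum_bounded_above) auto
  thus ?thesis using cube[OF card_half(2)] by linarith
 next case False
  hence "int (l' c) * c <= M * M" if "c : C" "c > 0" for c using that C by (intro mult_mono) force+
  hence "p <= int (card {c:C. c > 0}) * (M * M)" unfolding p_def by (intro sum_bounded_above) auto
  thus ?thesis using cube[OF card_half(1)] by linarith
 qed
 moreover have "p >= 0" "n >= 0" unfolding p_def n_def by (auto intro!: sum_nonneg simp: mult_nonneg_nonpos)
 ultimately have pn: "p <= M ^ 3 + abs S" "n <= M ^ 3 + abs S" using split by linarith+
 have bound: "int (l' c) <= M ^ 3 + abs S" if "c : C" for c
 proof (cases c "0 :: int" rule: linorder_cases)
  case greater
  have "int (l' c) * 1 <= int (l' c) * c" using greater by (intro mult_left_mono) auto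
  also have "... <= p" unfolding p_def using that greater C by (intro member_le_sum) auto
  finally show ?thesis using pn by simp
 next case equal
  thus ?thesis using zero that `p >= 0` pn by auto
 next case less
  have "int (l' c) * 1 <= int (l' c) * (- c)" using less by (intro mult_left_mono) auto
  also have "... <= n" unfolding n_def using that less C by (intro member_le_sum) (auto simp: mult_nonneg_nonpos)
  finally show ?thesis using pn by simp
 qed
 \<comment> \<open>Replacing \<open>m\<close> copies of each element of \<open>A\<close> by
   \<open>m\<close> copies of each element of \<open>B\<close> keeps the sum and does not raise the
   total, but empties the element of \<open>A\<close> with multiplicity \<open>m\<close>.\<close>
 have no_pair: False
  if AB: "A <= supp l'" "B <= supp l'" "A \<inter> B = {}" "\<Sum>A = \<Sum>B" "card B <= card A" "A ~= {}" for A B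
 proof -
  have "finite (supp l')" using C by (auto simp: supp_def)
  hence fin: "finite A" "finite B" using finite_subset[OF AB(1)] finite_subset[OF AB(2)] by auto
  define m where "m = Min (l' ` A)"
  have m: "m : l' ` A" "!!a. a : A ==> m <= l' a" using fin AB by (auto simp: m_def)
  define d where "d = (%x. (if x : B then int m else 0) - (if x : A then int m else 0))"
  have sub: "A <= C" "B <= C" using AB by (auto simp: supp_def)
  have *: "(SUM x:C. if x : D then f x else 0) = sum f D" if "D <= C" for D and f :: "int => int" using that C by (simp add: sum.If_cases Int_absorb1)
  have "(SUM x:C. d x * x) = (SUM x:C. (if x : B then int m * x else 0) - (if x : A then int m * x else 0))" by (rule sum.cong) (auto simp: d_def)
  also have "... = 0" unfolding sum_subtractf *[OF sub(1)] *[OF sub(2)] using AB(4) by (simp flip: sum_distrib_left)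
  finally have 1: "(SUM x:C. d x * x) = 0" .
  have 2: "(SUM x:C. d x) = int m * (int (card B) - int (card A))" unfolding d_def sum_subtractf *[OF sub(1)] *[OF sub(2)] by (simp add: algebra_simps)
  have 3: "(SUM x:C. d x) >= 0 & ((SUM x:C. d x) = 0 --> (ALL c:C. l' c > 0 --> int (l' c) + d c > 0))"
  proof (rule min[OF _ _ 1])
   fix c assume "c : C"
   show "0 <= int (l' c) + d c" using m(2)[of c] by (auto simp: d_def)
   show "d c = 0" if "l' c = 0" using that AB by (auto simp: d_def supp_def)
  qed
  obtain a where a: "a : A" "l' a = m" using m(1) by auto
  have "a : C" "l' a > 0" "a ~: B" using a AB by (auto simp: supp_def)
  hence "int (l' a) + d a = 0" using a by (simp add: d_def)
  moreover have "(SUM x:C. d x) <= 0" unfolding 2 using AB(5) by (intro mult_nonneg_nonpos) auto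
  ultimately show False using 3 `a : C` `l' a > 0` by force
 qed
 have fs: "finite (supp l')" using C by (auto simp: supp_def)
 have inj: "inj_on (%A. \<Sum>A) (Pow (supp l'))"
 proof (rule inj_onI, rule ccontr)
  fix A B assume AB: "A : Pow (supp l')" "B : Pow (supp l')" "\<Sum>A = \<Sum>B" "A ~= B"
  have fin: "finite A" "finite B" using AB fs finite_subset by auto
  have "\<Sum>(A - B) + \<Sum>(A \<inter> B) = \<Sum>A" "\<Sum>(B - A) + \<Sum>(A \<inter> B) = \<Sum>B"
   using fin sum.Int_Diff[of A "%x. x" B] sum.Int_Diff[of B "%x. x" A] by (auto simp: Int_commute)
  hence eq: "\<Sum>(A - B) = \<Sum>(B - A)" using AB by simp
  show False
  proof (cases "card (B - A) <= card (A - B)")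
   case True
   have "A - B ~= {}"
   proof
    assume "A - B = {}"
    hence "card (B - A) = 0" using True by (metis card.empty le_zero_eq)
    thus False using `A - B = {}` AB(4) fin by auto
   qed
   thus False using no_pair[of "A - B" "B - A"] eq True AB by auto
  next case False
   hence "B - A ~= {}" by (metis card.empty le0)
   thus False using no_pair[of "B - A" "A - B"] eq False AB by auto
  qed
 qed
 have "\<Sum>A : {- (int (card (supp l')) * M)..int (card (supp l')) * M}" if "A <= supp l'" for A
 proof -
  have fin: "finite A" using that fs finite_subset by auto
  have A: "a <= M" "- a <= M" if "a : A" for a using that `A <= supp l'` C by (auto simp: supp_def)
  have "int (card A) * M <= int (card (supp l')) * M" using card_mono[OF fs that] C by (intro mult_right_mono) auto
  moreover have "\<Sum>A <= int (card A) * M" using A by (intro sum_bounded_above) auto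
  moreover have "(SUM a:A. - a) <= int (card A) * M" using A by (intro sum_bounded_above) auto
  ultimately show ?thesis by (auto simp: sum_negf)
 qed
 hence "(%A. \<Sum>A) ` Pow (supp l') <= {- (int (card (supp l')) * M)..int (card (supp l')) * M}" by auto
 hence "card ((%A. \<Sum>A) ` Pow (supp l')) <= nat (2 * M * int (card (supp l')) + 1)" by (drule_tac card_mono[rotated]) (auto simp: algebra_simps)
 hence "2 ^ card (supp l') <= nat (2 * M * int (card (supp l')) + 1)" using card_image[OF inj] card_Pow[OF fs] by simp
 hence "int (2 ^ card (supp l')) <= int (nat (2 * M * int (card (supp l')) + 1))" by (simp only: of_nat_le_iff)
 hence "2 ^ card (supp l') <= 2 * M * int (card (supp l')) + 1" using C(3) by simp
 thus ?thesis using l'(1) bound by (intro that[of l']) (auto simp: P_def S_def supp_def)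
qed

section \<open>Straight-line derivations of walks\<close>

type_synonym 'n summary = "'n * 'n * int * int"

definition summary :: "'n => 'n wedge list => 'n => 'n summary" where
 "summary u p v = (u, v, weight p, credit p)"

definition edge_summary :: "'n wedge => 'n summary" where
 "edge_summary e = (fst e, tgt e, wt e, max 0 (- wt e))"

definition join :: "'n summary => 'n summary => 'n summary" where
 "join = (%(u, x, w, c) (y, v, w', c'). (u, v, w + w', max c (c' - w)))"

text \<open>Straight-line programs: an entry refers to entries behind it in the list and may be used
  several times, so \<open>n\<close> entries can describe walks of length exponential in
  \<open>n\<close>.\<close>

fun derivation :: "'n wedge set => 'n summary list => bool" where
 "derivation E [] = True"
| "derivation E (s # ss) = (derivation E ss &
   ((EX u. s = (u, u, 0, 0)) | s : edge_summary ` E |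
   (EX s1:set ss. EX s2:set ss. fst (snd s1) = fst s2 & s = join s1 s2)))"

lemma join_summary: "join (summary u p x) (summary x q v) = summary u (p @ q) v" by (auto simp: join_def summary_def credit_append)

lemma derivation_sound:
 assumes "derivation E ss" "s : set ss"
 obtains p where "walk E (fst s) p (fst (snd s))" "s = summary (fst s) p (fst (snd s))" using assms
proof (induction E ss arbitrary: s thesis rule: derivation.induct)
 case (2 E s' ss)
 note IH = 2(1) and that = 2(2) and prems = 2(3,4)
 consider "s : set ss" | u where "s = (u, u, 0, 0)" | e where "e : E" "s = edge_summary e"
  | s1 s2 where "s1 : set ss" "s2 : set ss" "fst (snd s1) = fst s2" "s = join s1 s2" using prems by auto
 thus ?case
 proof cases
  case 1 show ?thesis by (rule IH[OF that _ 1]) (use prems in auto)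
next case 2 thus ?thesis by (intro that[of "[]"]) (auto simp: summary_def)
next case 3 thus ?thesis by (intro that[of "[e]"]) (auto simp: summary_def edge_summary_def)
 next case 4
  obtain p where p: "walk E (fst s1) p (fst (snd s1))" "s1 = summary (fst s1) p (fst (snd s1))" using IH[OF _ _ 4(1)] prems by auto
  obtain q where q: "walk E (fst s2) q (fst (snd s2))" "s2 = summary (fst s2) q (fst (snd s2))" using IH[OF _ _ 4(2)] prems by auto
  have "s = summary (fst s1) (p @ q) (fst (snd s2))" using p(2) q(2) 4(3,4) join_summary by metis
  thus ?thesis using p q 4(3) by (intro that[of "p @ q"]) (auto simp: walk_append summary_def)
 qed
qed simp

lemma derivation_append: "derivation E ss ==> derivation E ts ==> derivation E (ss @ ts)"
proof (induction ss)
 case (Cons s ss)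
 have "set ss <= set (ss @ ts)" by auto
 moreover have "derivation E (ss @ ts)" using Cons by auto
 ultimately show ?case using Cons.prems(1) unfolding append_Cons derivation.simps(2) by blast
qed simp

lemma derivation_mono: "derivation E ss ==> E <= F ==> derivation F ss" by (induction ss) auto

text \<open>The bound \<open>L\<close> on the walks behind all entries later bounds the weights and
  credits that are written into a certificate.\<close>

definition derivable_by :: "'n wedge set => nat => nat => 'n => 'n wedge list => 'n => 'n summary list => bool" where
 "derivable_by E m L u p v ss = (derivation E ss & summary u p v : set ss & length ss <= m &
   (ALL s:set ss. EX x q y. s = summary x q y & walk E x q y & length q <= L))"

definition derivable :: "'n wedge set => nat => nat => 'n => 'n wedge list => 'n => bool" where
 "derivable E m L u p v = (walk E u p v & (EX ss. derivable_by E m L u p v ss))"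

lemma derivable_mono:
 assumes "derivable E m L u p v" "E <= F" "m <= m'" "L <= L'"
 shows "derivable F m' L' u p v"
proof -
 obtain ss where "derivable_by E m L u p v ss" using assms(1) by (auto simp: derivable_def)
 moreover have "walk F x q y" if "walk E x q y" for x q y using that assms(2) by (rule walk_weaken)
 ultimately have "derivable_by F m' L' u p v ss" using derivation_mono[OF _ assms(2)] assms(3,4) unfolding derivable_by_def by (meson order_trans)
 thus ?thesis using assms(1) walk_weaken[OF _ assms(2)] by (auto simp: derivable_def)
qed

lemma derivable_walk: "derivable E m L u p v ==> walk E u p v" by (simp add: derivable_def)

lemma derivable_Nil: "derivable E 1 L u [] u" unfolding derivable_def derivable_by_def
 by (intro conjI exI[of _ "[(u, u, 0, 0)]"]) (auto simp: summary_def intro!: exI[of _ "[]"])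

lemma derivable_edge: "e : E ==> fst e = u ==> 1 <= L ==> derivable E 1 L u [e] (tgt e)" unfolding derivable_def derivable_by_def
 by (intro conjI exI[of _ "[edge_summary e]"]) (auto simp: summary_def edge_summary_def intro!: exI[of _ "[e]"])

lemma derivable_by_join:
 assumes "derivable_by E m L u p x ss" "summary x q v : set ss" "walk E u p x" "walk E x q v"
  "length (p @ q) <= L"
 shows "derivable_by E (Suc m) L u (p @ q) v (summary u (p @ q) v # ss)"
proof -
 have "EX s1:set ss. EX s2:set ss. fst (snd s1) = fst s2 & summary u (p @ q) v = join s1 s2"
  using assms(1,2) unfolding join_summary[of u p x q v, symmetric] by (intro bexI[of _ "summary u p x"] bexI[of _ "summary x q v"])
   (auto simp: derivable_by_def, simp add: summary_def)
 moreover have "EX x' q' y. summary u (p @ q) v = summary x' q' y & walk E x' q' y & length q' <= L"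
  using assms(3-5) by (intro exI[of _ u] exI[of _ "p @ q"] exI[of _ v]) (auto simp: walk_append)
 ultimately show ?thesis using assms(1) unfolding derivable_by_def by simp
qed

lemma derivable_append:
 assumes "derivable E m1 L u p x" "derivable E m2 L x q v" "length (p @ q) <= L"
 shows "derivable E (m1 + m2 + 1) L u (p @ q) v"
proof -
 obtain ss ts where s: "derivable_by E m1 L u p x ss" "derivable_by E m2 L x q v ts" using assms by (auto simp: derivable_def)
 have "derivable_by E (m1 + m2) L u p x (ss @ ts)" using s derivation_append unfolding derivable_by_def by auto
 moreover have "summary x q v : set (ss @ ts)" using s by (auto simp: derivable_by_def)
 ultimately show ?thesis using derivable_by_join[of E "m1 + m2" L u p x "ss @ ts" q v] assms by (auto simp: derivable_def walk_append)
qed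

lemma derivable_list:
 assumes "walk E u p v" "length p <= L"
 shows "derivable E (2 * length p + 1) L u p v" using assms
proof (induction p arbitrary: u)
 case Nil thus ?case using derivable_Nil by auto
next case (Cons e p)
 have "derivable E (1 + (2 * length p + 1) + 1) L u ([e] @ p) v" by (rule derivable_append[OF derivable_edge]) (use Cons in auto)
 thus ?case by simp
qed

text \<open>Repeated squaring: each of the \<open>b\<close> binary digits of \<open>k\<close> costs
  one doubling and at most one further join with \<open>c\<close>.\<close>

lemma derivable_power:
 assumes "derivable E m L x c x" "k < 2 ^ b" "length c * 2 ^ b <= L"
 shows "derivable E (m + 2 * b + 1) L x (concat (replicate k c)) x"
proof -
 have w: "walk E x c x" using assms(1) by (rule derivable_walk)
 obtain ts where ts: "derivable_by E m L x c x ts" using assms(1) by (auto simp: derivable_def)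
 have len: "length (concat (replicate k c)) = k * length c" for k by (induction k) auto
 have "EX ss. derivable_by E (m + 2 * b + 1) L x (concat (replicate k c)) x ss & summary x c x : set ss" using assms(2,3)
 proof (induction b arbitrary: k)
  case 0 hence "k = 0" by simp
  have "derivable_by E (m + 1) L x [] x ((x, x, 0, 0) # ts)" using ts unfolding derivable_by_def by (auto simp: summary_def intro!: exI[of _ "[]"])
  moreover have "summary x c x : set ts" using ts by (auto simp: derivable_by_def)
  ultimately show ?case using `k = 0` by (intro exI[of _ "(x, x, 0, 0) # ts"]) simp
 next case (Suc b)
  define j where "j = k div 2"
  have j: "j < 2 ^ b" "length c * 2 ^ b <= L" using Suc.prems by (auto simp: j_def)
  obtain ss where ss: "derivable_by E (m + 2 * b + 1) L x (concat (replicate j c)) x ss" "summary x c x : set ss" using Suc.IH[OF j] by auto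
  let ?p = "concat (replicate j c)"
  have wj: "walk E x ?p x" using w by (rule walk_power)
  have kc: "k * length c <= length c * 2 ^ Suc b" using Suc.prems(1) by (metis less_imp_le mult.commute mult_le_mono1)
  have lenk: "k * length c <= L" using kc Suc.prems(2) by linarith
  have "2 * j <= k" by (simp add: j_def)
  hence "2 * j * length c <= k * length c" by (rule mult_le_mono1)
  hence len2: "length (?p @ ?p) <= L" using lenk unfolding length_append len by linarith
  have pp: "?p @ ?p = concat (replicate (2 * j) c)" by (simp add: mult_2 replicate_add)
  have s1: "derivable_by E (Suc (m + 2 * b + 1)) L x (?p @ ?p) x (summary x (?p @ ?p) x # ss)"
   using ss wj len2 by (intro derivable_by_join) (auto simp: derivable_by_def)
  show ?case
  proof (cases "even k")
   case True hence "k = 2 * j" by (simp add: j_def)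
   thus ?thesis using s1 ss(2) unfolding pp by (intro exI[of _ "summary x (concat (replicate (2 * j) c)) x # ss"]) (auto simp: derivable_by_def)
  next case False
   hence k: "k = 2 * j + 1" by (simp add: j_def)
   have kk: "(?p @ ?p) @ c = concat (replicate k c)" unfolding k replicate_add pp by simp
   have "derivable_by E (Suc (Suc (m + 2 * b + 1))) L x ((?p @ ?p) @ c) x (summary x ((?p @ ?p) @ c) x # summary x (?p @ ?p) x # ss)"
   proof (rule derivable_by_join[OF s1])
    show "length ((?p @ ?p) @ c) <= L" using lenk unfolding kk len .
   qed (use ss w wj in "auto simp: walk_append")
   thus ?thesis using ss(2) unfolding kk by (intro exI[of _ "summary x (concat (replicate k c)) x # summary x (?p @ ?p) x # ss"]) auto
  qed
 qed
 thus ?thesis using walk_power[OF w] by (auto simp: derivable_def)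
qed

subsection \<open>Concatenations of blocks\<close>

text \<open>Here \<open>bs\<close> is a walk whose labels are themselves walks, the blocks. Each
  block costs its own derivation and one join.\<close>

lemma derivable_concat:
 assumes "walk B a bs b" "!!e. e : set bs ==> derivable E (cost e) L (fst e) (wt e) (tgt e)"
  "length (concat (map wt bs)) <= L"
 shows "derivable E (sum_list (map (%e. cost e + 1) bs) + 1) L a (concat (map wt bs)) b" using assms
proof (induction bs arbitrary: a)
 case Nil thus ?case using derivable_Nil by auto
next case (Cons e bs)
 have "derivable E (cost e + (sum_list (map (%e. cost e + 1) bs) + 1) + 1) L a (wt e @ concat (map wt bs)) b"
 proof (rule derivable_append)
  show "derivable E (cost e) L a (wt e) (tgt e)" using Cons.prems(1) Cons.prems(2)[of e] by (simp add: walk.simps)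
  show "derivable E (sum_list (map (%e. cost e + 1) bs) + 1) L (tgt e) (concat (map wt bs)) b" by (rule Cons.IH) (use Cons.prems in auto)
 qed (use Cons.prems(3) in simp)
 thus ?case by simp
qed

text \<open>A closed block can be inserted at any visit of its vertex and removes no stop, so all
  blocks can be inserted in turn. Only the multiset of blocks is recorded, because weight, length
  and cost are sums over it.\<close>

lemma insert_blocks:
 assumes "walk B a bs b" "!!j. j : set js ==> (x j, q j, x j) : B & x j : seen a bs"
 obtains bs' where "walk B a bs' b" "mset bs' = mset bs + mset (map (%j. (x j, q j, x j)) js)"
proof -
 have "EX bs'. walk B a bs' b & mset bs' = mset bs + mset (map (%j. (x j, q j, x j)) js)" using assms(2)
 proof (induction js)
  case Nil thus ?case using assms(1) by auto
 next case (Cons j js)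
  then obtain bs' where bs': "walk B a bs' b" "mset bs' = mset bs + mset (map (%j. (x j, q j, x j)) js)" by auto
  have "mset bs <=# mset bs'" using bs'(2) by simp
  hence "set bs <= set bs'" by (metis set_mset_mono set_mset_mset)
  moreover have "x j : seen a bs" using Cons.prems by auto
  ultimately have "x j : seen a bs'" by (auto simp: set_stops)
  then obtain p1 p2 where p: "bs' = p1 @ p2" "walk B a p1 (x j)" "walk B (x j) p2 b" using walk_stops_split[OF bs'(1)] by metis
  show ?case using Cons.prems p bs'(2) by (intro exI[of _ "p1 @ (x j, q j, x j) # p2"]) (auto simp: walk_append)
 qed
 thus ?thesis using that by auto
qed

section \<open>Small derivations of walks with a prescribed weight\<close>

lemma sum_list_bound:
 fixes B :: nat
 assumes "!!x. x : set xs ==> f x <= B"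
 shows "sum_list (map f xs) <= length xs * B" using assms by (induction xs) fastforce+

lemma sum_list_map_mset:
 fixes f :: "'a => 'b :: comm_monoid_add"
 assumes "mset xs = mset ys + mset zs"
 shows "sum_list (map f xs) = sum_list (map f ys) + sum_list (map f zs)" using assms by (metis map_append mset_append mset_map sum_list_append sum_mset_sum_list)

lemma sum_list_count:
 fixes xs :: "int list"
 shows "sum_list xs = (SUM x:set xs. int (count_list xs x) * x)"
proof -
 have "sum_list xs = (SUM x:X. int (count_list xs x) * x)" if "finite X" "set xs <= X" for X using that
 proof (induction xs)
  case (Cons y xs)
  have "(SUM x:X. int (count_list (y # xs) x) * x) = (SUM x:X. int (count_list xs x) * x + (if x = y then y else 0))" by (rule sum.cong) (auto simp: algebra_simps)
  thus ?case using Cons by (simp add: sum.distrib)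
 qed simp
 thus ?thesis by simp
qed

text \<open>Since cycle weights are at most \<open>2 ^ (2 * be)\<close>, the inequality of
  \<open>caratheodory_int\<close> becomes a bound on the support that is linear in
  \<open>be\<close>.\<close>

lemma support_bound:
 assumes "2 ^ t <= 2 * 2 ^ (2 * be) * t + (1 :: nat)"
 shows "t < 4 * be + 8"
proof (rule ccontr)
 assume "~ t < 4 * be + 8"
 define s where "s = t - (2 * be + 1)"
 have s: "t = 2 * be + 1 + s" "t + 1 <= 2 * s" "s >= 7" using `~ t < 4 * be + 8` by (auto simp: s_def)
 have "2 * s < 2 ^ s" using s(3) by (induction s rule: dec_induct) auto
 hence "t + 1 < 2 ^ s" using s(2) by linarith
 hence "2 ^ (2 * be + 1) * (t + 1) < 2 ^ (2 * be + 1) * (2 :: nat) ^ s" by (intro mult_strict_left_mono) auto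
 also have "... = 2 ^ t" unfolding s(1) by (simp add: power_add)
 also have "... <= 2 ^ (2 * be + 1) * t + 1" using assms by simp
 also have "... <= 2 ^ (2 * be + 1) * (t + 1)" by simp
 finally show False by simp
qed

text \<open>One exponent \<open>be\<close> bounds both the number of vertices and the weights.
  Energy levels enter later through a second exponent \<open>ga\<close>.\<close>

locale bounded_graph =
 fixes V :: "'n set" and W :: int and be :: nat
 assumes finite_V: "finite V" and card_V: "card V <= 2 ^ be" and W: "0 <= W" "W <= 2 ^ be"
begin

definition K :: "'n wedge set" where "K = V \<times> {- W..W} \<times> V"

text \<open>A skeleton edge costs two entries, one for itself and one for its join. At most
  \<open>4 * be + 8\<close> cycles are used; each is derived edge by edge, raised to a power below
  \<open>2 ^ (6 * be + ga + 2)\<close> and joined.\<close>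

definition step_bound :: "nat => nat" where
 "step_bound ga = 2 * (card V * card V) + (4 * be + 8) * (2 * card V + 2 * (6 * be + ga + 2) + 3) + 1"

text \<open>Half of this is for the skeleton and half for the cycles: at most
  \<open>2 ^ (be + 4)\<close> of them, each of length at most \<open>2 ^ be\<close> and repeated
  less than \<open>2 ^ (6 * be + ga + 2)\<close> times.\<close>

definition length_bound :: "nat => nat" where
 "length_bound ga = 2 ^ (8 * be + ga + 7)"

lemma K_stops: "walk E a p b ==> set p <= K ==> a : V ==> seen a p <= V" by (auto simp: set_stops K_def)

lemma K_cycle: "simple_cycle E y c ==> E <= K ==> length c <= card V" by (rule simple_cycle_length) (auto simp: K_def finite_V)

lemma K_weight: "set p <= K ==> abs (weight p) <= int (length p) * W" by (rule abs_weight_le) (auto simp: K_def)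

lemma K_credit: "set p <= K ==> credit p <= int (length p) * W" by (rule credit_le_length) (auto simp: K_def W)

text \<open>The skeleton keeps every stop of \<open>p\<close>, so each erased cycle can be put back
  with any multiplicity. Only the weights of the cycles count; one representative per weight
  suffices, and \<open>caratheodory_int\<close> selects few weights with small
  multiplicities.\<close>

lemma same_weight_walk:
 assumes p: "walk E a p b" "set p <= K" "a : V" and ga: "abs (weight p) <= 2 ^ ga"
 obtains p' where "derivable (set p) (step_bound ga) (length_bound ga) a p' b" "weight p' = weight p"
  "length p' <= length_bound ga"
proof -
 let ?n = "card V"
 let ?L = "length_bound ga"
 obtain k cs where k: "walk (set p) a k b" "seen a k = seen a p" "length k <= ?n * ?n"
  and cs: "!!y c. (y, c) : set cs ==> simple_cycle (set p) y c & y : seen a p"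
  and wp: "weight p = weight k + total cs" using skeleton[OF p(1) finite_V K_stops[OF p]] by metis
 define ws where "ws = map (weight o snd) cs"
 define C where "C = set ws"
 define M where "M = int ?n * W"
 have M: "0 <= M" "M <= 2 ^ (2 * be)"
 proof -
  have "M <= 2 ^ be * 2 ^ be" unfolding M_def by (rule mult_mono) (use card_V W in "auto intro: order_trans[OF of_nat_mono]")
  thus "M <= 2 ^ (2 * be)" by (simp add: mult_2 power_add)
 qed (simp add: M_def W)
 have clen: "length c <= ?n" "set c <= set p" if "(y, c) : set cs" for y c
  using K_cycle[OF _ p(2)] cs[OF that] walk_subset[of "set p" y c y] by (auto simp: simple_cycle_def)
 have CM: "C <= {-M..M}"
 proof
  fix w assume "w : C"
  then obtain y c where yc: "(y, c) : set cs" "w = weight c" by (auto simp: C_def ws_def)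
  have "abs w <= int (length c) * W" using K_weight clen[OF yc(1)] p(2) yc(2) by blast
  also have "... <= M" unfolding M_def using clen[OF yc(1)] W by (intro mult_right_mono) auto
  finally show "w : {-M..M}" by auto
 qed
 define S where "S = (SUM c:C. int (count_list ws c) * c)"
 have S: "weight p = weight k + S" using wp unfolding S_def C_def sum_list_count[symmetric] ws_def .
 obtain l where l: "(SUM c:C. int (l c) * c) = S" "!!c. c : C ==> int (l c) <= M ^ 3 + abs S"
  "2 ^ card {c:C. l c > 0} <= 2 * M * int (card {c:C. l c > 0}) + 1" by (rule caratheodory_int[of C M "count_list ws", folded S_def]) (use CM M in "auto simp: C_def")
 define T where "T = {c:C. l c > 0}"
 have T: "finite T" "T <= C" by (auto simp: T_def C_def)
 have cardT: "card T < 4 * be + 8"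
 proof (rule support_bound)
  have "2 * M * int (card T) <= 2 * 2 ^ (2 * be) * int (card T)" using M by (intro mult_right_mono) auto
  hence "int (2 ^ card T) <= int (2 * 2 ^ (2 * be) * card T + 1)" using l(3) unfolding T_def by simp
  thus "2 ^ card T <= 2 * 2 ^ (2 * be) * card T + 1" by (simp only: of_nat_le_iff)
 qed
 define b' where "b' = 6 * be + ga + 2"
 have lb: "l c < 2 ^ b'" if "c : T" for c
 proof -
  have "M ^ 3 <= (2 ^ (2 * be)) ^ 3" using M by (intro power_mono) auto
  hence 1: "M ^ 3 <= 2 ^ (6 * be)" by (simp flip: power_mult)
  have kp: "set k <= K" using walk_subset[OF k(1)] p(2) by auto
  have "abs (weight k) <= int (?n * ?n) * W" using K_weight[OF kp] k(3) W(1) mult_right_mono[of "int (length k)" "int (?n * ?n)" W] by linarith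
  also have "int (?n * ?n) * W = int ?n * M" by (simp add: M_def)
  also have "... <= 2 ^ be * 2 ^ (2 * be)" by (rule mult_mono) (use card_V M in "auto intro: order_trans[OF of_nat_mono]")
  also have "... = 2 ^ (3 * be)" by (simp flip: power_add)
  also have "... <= 2 ^ (6 * be)" by (rule power_increasing) auto
  finally have 2: "abs (weight k) <= 2 ^ (6 * be)" .
  have 3: "(2 :: int) ^ (6 * be) <= 2 ^ (6 * be + ga)" "(2 :: int) ^ ga <= 2 ^ (6 * be + ga)" by (rule power_increasing; simp)+
  have "int (l c) <= 2 ^ (6 * be) + (2 ^ ga + 2 ^ (6 * be))" using l(2)[of c] that T 1 2 S ga by force
  also have "... <= 3 * 2 ^ (6 * be + ga)" using 3 by linarith
  also have "... < 4 * 2 ^ (6 * be + ga)" by simp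
  also have "... = int (2 ^ b')" by (simp add: b'_def power_add)
  finally show ?thesis by (simp only: of_nat_less_iff)
 qed
 define rep where "rep = (%c. SOME z. z : set cs & weight (snd z) = c)"
 have rep: "rep c : set cs" "weight (snd (rep c)) = c" if "c : T" for c
 proof -
  have "c : (weight o snd) ` set cs" using that T by (auto simp: C_def ws_def)
  hence "EX z. z : set cs & weight (snd z) = c" by (metis comp_apply imageE)
  from someI_ex[OF this] show "rep c : set cs" "weight (snd (rep c)) = c" by (auto simp: rep_def)
 qed
 have repc: "simple_cycle (set p) (fst (rep c)) (snd (rep c))" "fst (rep c) : seen a p"
  "length (snd (rep c)) <= ?n" if "c : T" for c using cs[of "fst (rep c)" "snd (rep c)"] clen[of "fst (rep c)" "snd (rep c)"] rep[OF that] by auto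
 define B where "B = {(u, q, v). walk (set p) u q v}"
 define bs where "bs = map (%e. (fst e, [e], tgt e)) k"
 define js where "js = sorted_list_of_set T"
 have js: "set js = T" "distinct js" "length js = card T" using T by (auto simp: js_def)
 define q where "q = (%c. concat (replicate (l c) (snd (rep c))))"
 let ?b = "%j. (fst (rep j), q j, fst (rep j))"
 have "walk B u (map (%e. (fst e, [e], tgt e)) k') b" if "walk (set p) u k' b" for u k' using that by (induction k' arbitrary: u) (auto simp: B_def)
 hence wbs: "walk B a bs b" using k(1) by (simp add: bs_def)
 have sbs: "stops a bs = stops a k" by (simp add: stops_def bs_def)
 have ins: "?b j : B & fst (rep j) : seen a bs" if "j : set js" for j
 proof
  have "j : T" using that js by simp
  from repc(1)[OF this] have "walk (set p) (fst (rep j)) (snd (rep j)) (fst (rep j))" by (simp add: simple_cycle_def)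
  thus "?b j : B" unfolding B_def q_def by (simp add: walk_power)
  show "fst (rep j) : seen a bs" unfolding sbs k(2) by (rule repc(2)[OF `j : T`])
 qed
 obtain bs' where bs': "walk B a bs' b"
  "mset bs' = mset bs + mset (map ?b js)" by (rule insert_blocks[OF wbs, of js "%j. fst (rep j)" q, OF ins])
 define p' where "p' = concat (map wt bs')"
 have sums: "sum_list (map f bs') = sum_list (map f bs) + sum_list (map (%j. f (?b j)) js)"
  for f :: "_ => 'z :: comm_monoid_add" using sum_list_map_mset[OF bs'(2), of f] by (simp add: o_def)
 have wcat: "weight (concat xs) = sum_list (map weight xs)" for xs by (induction xs) auto
 have "weight p' = sum_list (map (weight o wt) bs')" by (simp add: p'_def wcat)
 also have "... = weight k + sum_list (map (%c. int (l c) * c) js)" unfolding sums using rep js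
  by (auto simp: bs_def q_def o_def weight_def[of k] intro!: arg_cong[of _ _ sum_list] map_cong)
 also have "sum_list (map (%c. int (l c) * c) js) = (SUM c:T. int (l c) * c)" using js by (metis sum_list_distinct_conv_sum_set)
 also have "... = S" unfolding l(1)[symmetric] using T by (intro sum.mono_neutral_left) (auto simp: T_def C_def)
 finally have w': "weight p' = weight p" using S by simp
 have lenq: "length (q c) = l c * length (snd (rep c))" for c unfolding q_def by (induction "l c") (auto simp: length_concat sum_list_replicate)
 have qb: "length (q c) <= 2 ^ b' * 2 ^ be" "length (snd (rep c)) * 2 ^ b' <= 2 ^ b' * 2 ^ be" if "c : T" for c
  using repc(3)[OF that] card_V lb[OF that] unfolding lenq by (auto intro!: mult_mono)
 have "length p' = sum_list (map (length o wt) bs')" by (simp add: p'_def length_concat)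
 also have "... = length k + sum_list (map (length o q) js)" unfolding sums by (simp add: bs_def o_def sum_list_triv)
 also have "sum_list (map (length o q) js) <= length js * (2 ^ b' * 2 ^ be)" using qb js by (intro sum_list_bound) auto
 also have "... <= 2 ^ (be + 4) * (2 ^ b' * 2 ^ be)"
 proof (rule mult_le_mono1)
  have "Suc be <= (2 :: nat) ^ be" by (rule Suc_leI[OF less_exp])
  moreover have "(2 :: nat) ^ (be + 4) = 16 * 2 ^ be" by (simp add: power_add)
  ultimately show "length js <= 2 ^ (be + 4)" using cardT js(3) by linarith
 qed
 also have "... = 2 ^ (8 * be + ga + 6)" unfolding b'_def power_add[symmetric] by (rule arg_cong[of _ _ "%n. 2 ^ n"]) simp
 also have "length k <= 2 ^ (8 * be + ga + 6)"
 proof -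
  have "length k <= 2 ^ be * 2 ^ be" using k(3) mult_mono[OF card_V card_V] by simp
  also have "... <= 2 ^ (8 * be + ga + 6)" unfolding power_add[symmetric] by (rule power_increasing) auto
  finally show ?thesis .
 qed
 finally have len: "length p' <= ?L" by (simp add: length_bound_def power_add ac_simps)
 define cost where "cost = (%e. if e : set bs then 1 else 2 * ?n + 2 * b' + 2)"
 have Lb: "2 ^ b' * 2 ^ be <= ?L" "1 <= ?L" unfolding length_bound_def power_add[symmetric] b'_def by (rule power_increasing; simp) simp
 have "derivable (set p) (cost e) ?L (fst e) (wt e) (tgt e)" if "e : set bs'" for e
 proof (cases "e : set bs")
  case True
  then obtain e' where e': "e' : set k" "e = (fst e', [e'], tgt e')" by (auto simp: bs_def)
  have "derivable (set p) 1 ?L (fst e') [e'] (tgt e')" by (rule derivable_edge) (use e' walk_subset[OF k(1)] Lb in auto)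
  thus ?thesis using True e'(2) by (simp add: cost_def)
 next case False
  have "e : set (bs @ map ?b js)" using that arg_cong[OF bs'(2), of set_mset] by simp
  then obtain c where c: "c : T" "e = ?b c" using False js by auto
  have "derivable (set p) (2 * ?n + 1) ?L (fst (rep c)) (snd (rep c)) (fst (rep c))"
  proof (rule derivable_mono[OF derivable_list])
   show "walk (set p) (fst (rep c)) (snd (rep c)) (fst (rep c))" using repc(1)[OF c(1)] by (simp add: simple_cycle_def)
   have "length (snd (rep c)) * 1 <= length (snd (rep c)) * 2 ^ b'" by (intro mult_le_mono) auto
   thus "length (snd (rep c)) <= ?L" using qb(2)[OF c(1)] Lb(1) by linarith
  qed (use repc(3)[OF c(1)] in auto)
  hence "derivable (set p) (2 * ?n + 1 + 2 * b' + 1) ?L (fst (rep c)) (q c) (fst (rep c))"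
   unfolding q_def using lb[OF c(1)] order_trans[OF qb(2)[OF c(1)] Lb(1)] by (rule derivable_power)
  thus ?thesis using False c(2) by (simp add: cost_def)
 qed
 hence d: "derivable (set p) (sum_list (map (%e. cost e + 1) bs') + 1) ?L a p' b" unfolding p'_def using bs'(1) len by (intro derivable_concat) (auto simp: p'_def)
 have "sum_list (map (%e. cost e + 1) bs') <= step_bound ga - 1"
 proof -
  have "sum_list (map (%e. cost e + 1) bs) <= length bs * 2" by (rule sum_list_bound) (auto simp: cost_def)
  moreover have "length bs <= ?n * ?n" using k(3) by (simp add: bs_def)
  moreover have "sum_list (map (%j. cost (?b j) + 1) js) <= length js * (2 * ?n + 2 * b' + 3)" by (rule sum_list_bound) (auto simp: cost_def)
  moreover have "length js * (2 * ?n + 2 * b' + 3) <= (4 * be + 8) * (2 * ?n + 2 * b' + 3)" using cardT js by (intro mult_le_mono1) simp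
  ultimately show ?thesis unfolding sums step_bound_def b'_def by linarith
 qed
 hence "derivable (set p) (step_bound ga) ?L a p' b" by (intro derivable_mono[OF d]) (auto simp: step_bound_def)
 thus ?thesis using that w' len by blast
qed

end

section \<open>Small derivations of walks with a nonnegative counter\<close>

definition no_positive :: "'n wedge list => bool" where
 "no_positive p = (ALL y c. walk (set p) y c y --> weight c <= 0)"

definition no_negative :: "'n wedge list => bool" where
 "no_negative p = (ALL y c. walk (set p) y c y --> 0 <= weight c)"

lemma no_positive_mono: "no_positive p ==> set q <= set p ==> no_positive q" unfolding no_positive_def using walk_weaken by metis

lemma no_negative_mono: "no_negative p ==> set q <= set p ==> no_negative q" unfolding no_negative_def using walk_weaken by metis

text \<open>Reversal exchanges prefixes and suffixes, which reduces walks without negative cycles to walks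
  without positive cycles.\<close>

definition flip_edge :: "'n wedge => 'n wedge" where
 "flip_edge e = (tgt e, - wt e, fst e)"

definition flip :: "'n wedge list => 'n wedge list" where
 "flip p = rev (map flip_edge p)"

lemma flip_edge_flip_edge [simp]: "flip_edge (flip_edge e) = e" by (simp add: flip_edge_def)

lemma flip_edge_image [simp]: "flip_edge ` flip_edge ` E = E" by (simp add: image_image)

lemma set_flip: "set (flip p) = flip_edge ` set p" by (simp add: flip_def)

lemma length_flip [simp]: "length (flip p) = length p" by (simp add: flip_def)

lemma weight_flip [simp]: "weight (flip p) = - weight p" by (induction p) (auto simp: flip_def flip_edge_def)

text \<open>The reversal runs through the same counter values backwards, so the least start for it
  is the least final value for \<open>p\<close>.\<close>

lemma credit_flip: "credit (flip p) = credit p + weight p"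
proof (induction p)
 case (Cons e p)
 have "flip (e # p) = flip p @ [flip_edge e]" by (simp add: flip_def)
 thus ?case using Cons credit_nonneg[of p] by (auto simp: credit_append flip_edge_def max_def simp del: credit_nonneg)
qed (simp add: flip_def)

lemma walk_flip: "walk E a p b ==> walk (flip_edge ` E) b (flip p) a" by (induction p arbitrary: a) (auto simp: flip_def walk_append, auto simp: flip_edge_def)

text \<open>Reversal is a map on summaries that exchanges the two arguments of \<open>join\<close>,
  so it can be applied to a derivation entry by entry.\<close>

lemma derivable_flip:
 assumes "derivable E m L a p b"
 shows "derivable (flip_edge ` E) m L b (flip p) a"
proof -
 define f where "f = (%(u :: 'a, v :: 'a, w :: int, c). (v, u, - w, c + w))"
 have f: "f (summary u q v) = summary v (flip q) u" for u q v by (simp add: f_def summary_def credit_flip)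
 have fj: "f (join s t) = join (f t) (f s)" "fst (f s) = fst (snd s)" "fst (snd (f s)) = fst s" for s t by (auto simp: f_def join_def split: prod.splits)
 have fe: "f (edge_summary e) = edge_summary (flip_edge e)" for e by (auto simp: f_def edge_summary_def flip_edge_def)
 have d: "derivation (flip_edge ` E) (map f ss)" if "derivation E ss" for ss using that
 proof (induction ss)
  case (Cons s ss)
  consider u where "s = (u, u, 0, 0)" | e where "e : E" "s = edge_summary e"
   | s1 s2 where "s1 : set ss" "s2 : set ss" "fst (snd s1) = fst s2" "s = join s1 s2" using Cons.prems by auto
  thus ?case
  proof cases
   case 1 thus ?thesis using Cons by (simp add: f_def)
  next case 2 thus ?thesis using Cons by (simp add: fe)
  next case 3
   hence "EX t1:set (map f ss). EX t2:set (map f ss). fst (snd t1) = fst t2 & f s = join t1 t2" by (intro bexI[of _ "f s2"] bexI[of _ "f s1"]) (auto simp: fj)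
   thus ?thesis using Cons by simp
  qed
 qed simp
 obtain ss where ss: "derivable_by E m L a p b ss" using assms by (auto simp: derivable_def)
 have "EX x q y. f s = summary x q y & walk (flip_edge ` E) x q y & length q <= L" if s: "s : set ss" for s
 proof -
  obtain x q y where "s = summary x q y" "walk E x q y" "length q <= L" using ss s unfolding derivable_by_def by blast
  thus ?thesis using f walk_flip by (intro exI[of _ y] exI[of _ "flip q"] exI[of _ x]) simp
 qed
 moreover have "summary b (flip p) a : f ` set ss" using ss unfolding derivable_by_def f[symmetric] by blast
 ultimately have "derivable_by (flip_edge ` E) m L b (flip p) a (map f ss)" using ss d by (auto simp: derivable_by_def)
 thus ?thesis using assms walk_flip by (auto simp: derivable_def)
qed

lemma no_positive_flip: "no_negative p ==> no_positive (flip p)" unfolding no_negative_def no_positive_def using walk_flip[of "set (flip p)"] by (force simp: set_flip)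

lemma minimal_stop:
 assumes p: "walk E a p b"
  and irrefl: "!!y. ~ R y y" and trans: "!!x y z. R x y ==> R y z ==> R x z"
 obtains u where "u : seen a p" "!!y. R y u ==> y ~: seen a p"
proof -
 define X where "X = seen a p"
 define r where "r = {(y, z). y : X & z : X & R y z}"
 have "finite r" by (rule finite_subset[of _ "X \<times> X"]) (auto simp: r_def X_def)
 moreover have "trans r" unfolding r_def by (auto intro!: transI dest: trans)
 hence "acyclic r" using irrefl by (auto simp: acyclic_def trancl_id r_def)
 ultimately have "wf r" by (rule finite_acyclic_wf)
 moreover have "a : X" by (simp add: X_def set_stops)
 ultimately obtain u where "u : X" "!!y. (y, u) : r ==> y ~: X" by (rule wfE_min) auto
 thus ?thesis using that[of u] unfolding r_def X_def by blast
qed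

text \<open>Being connected by a walk of positive weight is a transitive relation, and it is
  irreflexive when no cycle is positive. A minimal stop cannot be reached with positive
  weight.\<close>

lemma sink_stop:
 assumes p: "walk E a p b" "no_positive p"
 obtains u where "u : seen a p" "!!y q. walk (set p) y q u ==> weight q <= 0"
proof -
 define R where "R = (%y z. EX q. walk (set p) y q z & weight q > 0)"
 have "~ R y y" for y using p(2) by (force simp: R_def no_positive_def)
 moreover have "R x z" if R: "R x y" "R y z" for x y z
 proof -
  obtain q r where "walk (set p) x q y" "weight q > 0" "walk (set p) y r z" "weight r > 0" using R unfolding R_def by blast
  thus ?thesis unfolding R_def by (intro exI[of _ "q @ r"]) (auto simp: walk_append)
 qed
 ultimately obtain u where u: "u : seen a p" "!!y. R y u ==> y ~: seen a p" using minimal_stop[OF p(1), of R] by blast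
 have "weight q <= 0" if q: "walk (set p) y q u" for y q
 proof (rule ccontr)
  assume *: "~ weight q <= 0"
  \<comment> \<open>A walk of positive weight is not empty, so its start is the source of an edge of
    \<open>p\<close> and hence a stop of \<open>p\<close>.\<close>
  then obtain e q' where "q = e # q'" by (cases q) auto
  hence "e : set p" "fst e = y" using q by auto
  hence "y : seen a p" using walk_src_stops[OF p(1)] by blast
  thus False using u(2)[of y] q * by (force simp: R_def)
 qed
 thus ?thesis using that u by blast
qed

text \<open>If the cycle is started where its prefix weight is least, the counter falls below its
  start at most by the loss of the whole cycle.\<close>

lemma rotate_cycle:
 assumes "walk F y c y"
 obtains u g where "walk F u g u" "weight g = weight c" "length g = length c"
  "credit g <= max 0 (- weight c)"
proof -
 define f where "f = (%i. weight (take i c))"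
 have "Min (f ` {..length c}) : f ` {..length c}" by (rule Min_in) auto
 then obtain i where i: "Min (f ` {..length c}) = f i" by (rule imageE)
 have min: "f i <= weight c1" if "c = c1 @ c2" for c1 c2
 proof -
  have "f (length c1) : f ` {..length c}" using that by auto
  hence "f i <= f (length c1)" unfolding i[symmetric] by (intro Min_le) auto
  thus ?thesis using that by (simp add: f_def)
 qed
 define c1 c2 where "c1 = take i c" and "c2 = drop i c"
 have c: "c = c1 @ c2" by (simp add: c1_def c2_def)
 have fi: "f i = weight c1" by (simp add: f_def c1_def)
 obtain u where u: "walk F y c1 u" "walk F u c2 y" using assms unfolding c walk_append by auto
 show ?thesis
 proof (rule that[of u "c2 @ c1"])
  show "credit (c2 @ c1) <= max 0 (- weight c)"
  proof (rule credit_leI)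
   fix p1 p2 assume "c2 @ c1 = p1 @ p2"
   then consider r where "c2 = p1 @ r" | r where "p1 = c2 @ r" "c1 = r @ p2" by (auto simp: append_eq_append_conv2)
   thus "0 <= max 0 (- weight c) + weight p1"
   proof cases
    case 1 hence "c = (c1 @ p1) @ r" by (simp add: c)
    thus ?thesis using min[of "c1 @ p1" r] fi by simp
   next case 2
    hence "c = r @ (p2 @ c2)" by (simp add: c)
    thus ?thesis using min[of r "p2 @ c2"] fi 2 by (simp add: c)
   qed
  qed simp
 qed (use u in "auto simp: walk_append c")
qed

text \<open>A closed walk without repeated stops is empty, so loop erasure leaves nothing but the
  cycles.\<close>

lemma closed_simple_cycles:
 assumes "walk E y c y"
 obtains cs where "!!z g. (z, g) : set cs ==> simple_cycle (set c) z g"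
  "weight c = total cs"
proof -
 obtain k cs where k: "walk (set c) y k y" "distinct (stops y k)"
   "!!z g. (z, g) : set cs ==> simple_cycle (set c) z g & z : seen y c"
   "weight c = weight k + total cs" using loop_erasure[OF assms] by metis
 have "k = []"
 proof (cases k rule: rev_cases)
  case (snoc k' e) hence "tgt e = y" using k(1) by (auto simp: walk_append)
  thus ?thesis using k(2) snoc by (simp add: stops_def)
 qed simp
 thus ?thesis using k that[of cs] by auto
qed

lemma sum_list_signs:
 fixes f :: "'a => int"
 shows "(!!x. x : set xs ==> f x <= 0) ==> sum_list (map f xs) <= 0"
  "(!!x. x : set xs ==> 0 <= f x) ==> 0 <= sum_list (map f xs)" by (induction xs) fastforce+

lemma le_mult_add: "1 <= c ==> z <= c * (z + k)" for c z k :: nat by (cases c) auto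

section \<open>Pumpable cycles and weights after erasure\<close>

context bounded_graph begin

lemma pump:
 assumes "simple_cycle F y c" "F <= K"
 obtains u g where "walk F u g u" "g ~= []" "length g <= card V" "weight g = weight c" "credit g = max 0 (- weight c)"
proof -
 obtain u g where g: "walk F u g u" "weight g = weight c" "length g = length c" "credit g <= max 0 (- weight c)"
  by (rule rotate_cycle[of F y c]) (use assms in "auto simp: simple_cycle_def")
 have "credit g = max 0 (- weight c)" using g(2,4) credit_ge[of g] credit_nonneg[of g] by linarith
 moreover have "g ~= []" using g(3) assms(1) by (auto simp: simple_cycle_def)
 ultimately show ?thesis using that[OF g(1)] g K_cycle[OF assms(1)] assms by (auto simp: simple_cycle_def)
qed

text \<open>The weight of \<open>c\<close> is a sum over simple cycles, and one of them has the sign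
  of the sum. Rotated suitably, it has the least credit that its weight permits.\<close>

lemma signed_pump:
 assumes "walk F y c y" "weight c ~= 0" "F <= K"
 obtains u g where "walk F u g u" "g ~= []" "length g <= card V" "sgn (weight g) = sgn (weight c)" "credit g = max 0 (- weight g)"
proof -
 obtain cs where cs: "!!z g. (z, g) : set cs ==> simple_cycle (set c) z g"
  "weight c = total cs" using closed_simple_cycles[OF assms(1)] by metis
 have "EX zg:set cs. sgn (weight (snd zg)) = sgn (weight c)"
  using sum_list_signs[of cs "weight o snd"] cs(2) assms(2) by (cases "0 < weight c") (force simp: sgn_if not_less)+
 then obtain zg where zg: "zg : set cs" "sgn (weight (snd zg)) = sgn (weight c)" by blast
 have "simple_cycle F (fst zg) (snd zg)" using cs(1)[of "fst zg" "snd zg"] zg simple_cycle_mono[OF _ walk_subset[OF assms(1)]] by auto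
 from pump[OF this assms(3)] that zg(2) show ?thesis by metis
qed

lemma erased_weight:
 assumes "walk E a p b" "set p <= K" "a : V"
 obtains k cs where "abs (weight k) <= int (card V) * W" "walk (set p) a k b" "length k <= card V"
  "!!y c. (y, c) : set cs ==> simple_cycle (set p) y c"
  "weight p = weight k + total cs"
proof -
 obtain k cs where k: "walk (set p) a k b" "distinct (stops a k)" "seen a k <= seen a p"
   "!!y c. (y, c) : set cs ==> simple_cycle (set p) y c & y : seen a p"
   "weight p = weight k + total cs" using loop_erasure[OF assms(1)] by metis
 have "length (stops a k) <= card V" using k(2,3) K_stops[OF assms] finite_V by (metis card_mono distinct_card order_trans)
 hence len: "length k <= card V" by (simp add: stops_def)
 have "set k <= K" using walk_subset[OF k(1)] assms(2) by auto
 hence "abs (weight k) <= int (length k) * W" by (rule K_weight)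
 also have "... <= int (card V) * W" using len W by (intro mult_right_mono) auto
 finally show ?thesis using k len that[of k cs] by blast
qed

text \<open>Erasing cycles that are not positive can only raise the weight, and what remains is a
  path of at most \<open>card V\<close> edges.\<close>

lemma no_positive_weight:
 assumes "walk E a p b" "set p <= K" "a : V" "no_positive p"
 shows "weight p <= int (card V) * W"
proof -
 obtain k cs where k: "abs (weight k) <= int (card V) * W" "walk (set p) a k b" "length k <= card V"
  "!!y c. (y, c) : set cs ==> simple_cycle (set p) y c"
  "weight p = weight k + total cs" using erased_weight[OF assms(1-3)] by blast
 have "weight c <= 0" if "(y, c) : set cs" for y c using k(4)[OF that] assms(4) by (auto simp: no_positive_def simple_cycle_def)
 hence "total cs <= 0" by (intro sum_list_signs(1)) auto
 thus ?thesis using k by linarith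
qed

lemma flip_K: "set p <= K ==> set (flip p) <= K" by (force simp: set_flip flip_edge_def K_def)

lemma no_negative_weight:
 assumes "walk E a p b" "set p <= K" "a : V" "no_negative p"
 shows "- (int (card V) * W) <= weight p"
proof -
 have "b : V" using walk_end_stops[OF assms(1)] K_stops[OF assms(1-3)] by auto
 from no_positive_weight[OF walk_flip[OF assms(1)] flip_K[OF assms(2)] this no_positive_flip[OF assms(4)]] show ?thesis by simp
qed

lemma K_tgt: "e : K ==> tgt e : V" "e : K ==> fst e : V" by (auto simp: K_def)

text \<open>The bounds are proportional to the number of stops because each recursive step of
  \<open>derivable_no_positive\<close> drops a stop and adds one part and one edge.\<close>

definition tame :: "nat => 'n => 'n wedge list => 'n => int => bool" where
 "tame ga a p b x = (EX p'. derivable (set p) (card (seen a p) * (step_bound ga + 3)) (card V * (length_bound ga + 1)) a p' b &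
  weight p' = weight p & credit p' <= x & length p' <= card (seen a p) * (length_bound ga + 1))"

lemma derivable_join:
 assumes "derivable F1 m1 l1 a q1 u" "derivable F2 m2 l2 (tgt e) q2 b" "F1 <= F" "F2 <= F" "e : F" "fst e = u"
  "m1 + m2 + 3 <= m" "l1 <= l" "l2 <= l" "length (q1 @ [e] @ q2) <= l"
 shows "derivable F m l a (q1 @ [e] @ q2) b"
proof -
 have "derivable F (m1 + (1 + m2 + 1) + 1) l a (q1 @ [e] @ q2) b"
  by (rule derivable_append[OF derivable_mono[OF assms(1)] derivable_append[OF derivable_edge derivable_mono[OF assms(2)]]]) (use assms in auto)
 thus ?thesis by (rule derivable_mono) (use assms(7) in auto)
qed

text \<open>If no cycle is positive, the walks that end in \<open>u\<close> have nonpositive weight for some stop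
  \<open>u\<close>. Up to the last visit of \<open>u\<close> the counter is never below its value there, so that any walk of
  the same weight will do. The rest of the walk avoids \<open>u\<close>.\<close>

lemma derivable_no_positive:
 assumes "walk E a p b" "set p <= K" "a : V" "no_positive p" "credit p <= x"
  "!!r q s. p = r @ q @ s ==> abs (weight q) <= 2 ^ ga"
 shows "tame ga a p b x" using assms
proof (induction "card (seen a p)" arbitrary: a p x rule: less_induct)
 case less
 let ?m = "step_bound ga" and ?L = "length_bound ga" and ?c = "card (seen a p)"
 obtain u where u: "u : seen a p" "!!y q. walk (set p) y q u ==> weight q <= 0" using sink_stop[OF less.prems(1,4)] by metis
 obtain p1 p2 where p: "p = p1 @ p2" "walk E a p1 u" "walk E u p2 b" "u ~: tgt ` set p2" using walk_last_visit[OF less.prems(1) u(1)] by metis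
 have cV: "?c <= card V" using K_stops[OF less.prems(1-3)] finite_V by (rule card_mono[rotated])
 have c1: "1 <= ?c" using u(1) by (metis List.finite_set One_nat_def Suc_leI card_gt_0_iff empty_iff)
 have LV: "?L <= card V * (?L + 1)" "?L <= ?c * (?L + 1)" "?m <= ?c * (?m + 3)" using le_mult_add[OF order_trans[OF c1 cV]] le_mult_add[OF c1] by blast+
 obtain p1' where p1': "derivable (set p1) ?m ?L a p1' u" "weight p1' = weight p1" "length p1' <= ?L"
  by (rule same_weight_walk[OF p(2)]) (use p less.prems(2,3) less.prems(6)[of "[]" p1 p2] in auto)
 have cr: "credit p1' <= x"
 proof (rule credit_leI)
  show "0 <= x" using less.prems(5) credit_nonneg order_trans by blast
  fix q1 q2 assume q: "p1' = q1 @ q2"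
  then obtain y where "walk (set p1) y q2 u" using derivable_walk[OF p1'(1)] by (auto simp: walk_append)
  hence "weight q2 <= 0" using u(2) p(1) walk_weaken[of "set p1" y q2 u "set p"] by auto
  thus "0 <= x + weight q1" using credit_le_prefix[of p1 p2 x] less.prems(5) p1'(2) q p(1) by simp
 qed
 show ?case
 proof (cases p2)
  case Nil
  thus ?thesis using p p1' cr LV by (auto simp: tame_def intro!: exI[of _ p1'] intro: derivable_mono[of "set p1" ?m ?L])
 next case (Cons e p3)
  have e: "e : E" "fst e = u" and p3: "walk E (tgt e) p3 b" using p(3) Cons by auto
  have sub: "seen (tgt e) p3 <= seen a p - {u}" using p(4) unfolding p(1) Cons by (auto simp: set_stops)
  have lt: "card (seen (tgt e) p3) < ?c" using u(1) by (intro psubset_card_mono) (use sub in auto)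
  have "tame ga (tgt e) p3 b (x + weight p1 + wt e)"
  proof (rule less.hyps[OF lt p3])
   show "set p3 <= K" "tgt e : V" using less.prems(2) K_tgt(1)[of e] unfolding p(1) Cons by auto
   show "no_positive p3" by (rule no_positive_mono[OF less.prems(4)]) (auto simp: p(1) Cons)
   show "credit p3 <= x + weight p1 + wt e" using less.prems(5) by (auto simp: p(1) Cons credit_append max_def split: if_splits)
   show "abs (weight q) <= 2 ^ ga" if "p3 = r @ q @ s" for r q s using less.prems(6)[of "p1 @ e # r" q s] p(1) Cons that by simp
  qed
  then obtain p3' where p3': "derivable (set p3) (card (seen (tgt e) p3) * (?m + 3)) (card V * (?L + 1)) (tgt e) p3' b"
   "weight p3' = weight p3" "credit p3' <= x + weight p1 + wt e"
   "length p3' <= card (seen (tgt e) p3) * (?L + 1)" by (auto simp: tame_def)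
  have sum: "(card (seen (tgt e) p3) + 1) * z <= ?c * z" for z using lt by (intro mult_le_mono1) auto
  have len: "length (p1' @ [e] @ p3') <= ?c * (?L + 1)" using p1'(3) p3'(4) sum[of "?L + 1"] by simp
  hence len': "length (p1' @ [e] @ p3') <= card V * (?L + 1)" using mult_le_mono1[OF cV, of "?L + 1"] by linarith
  have "derivable (set p) (?c * (?m + 3)) (card V * (?L + 1)) a (p1' @ [e] @ p3') b"
   by (rule derivable_join[OF p1'(1) p3'(1)]) (use e len' LV sum[of "?m + 3"] in "auto simp: p(1) Cons")
  moreover have "credit (p1' @ [e] @ p3') <= x"
  proof -
   have "0 <= x + weight p1" using credit_le_prefix[of p1 "e # p3" x] less.prems(5) p(1) Cons by simp
   moreover have "0 <= x + weight p1 + wt e" using credit_le_prefix[of "p1 @ [e]" p3 x] less.prems(5) p(1) Cons by simp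
   ultimately show ?thesis using cr p1'(2) p3'(3) by (auto simp: credit_append max_def)
  qed
  ultimately show ?thesis using len p1'(2) p3'(2) unfolding tame_def by (intro exI[of _ "p1' @ [e] @ p3'"]) (simp add: p(1) Cons)
 qed
qed

text \<open>The walk assembled in \<open>small_derivation\<close> has five parts: a beginning
  without positive cycles, a pumped positive cycle, a middle part of the right weight, a pumped
  negative cycle, and an end without negative cycles. The number of repetitions of a cycle has at
  most \<open>11 * be + ga + 8\<close> bits, and four joins are added.\<close>

definition final_steps :: "nat => nat" where
 "final_steps ga = 2 * (card V * (step_bound ga + 3)) + step_bound ga +
   2 * (2 * card V + 1 + 2 * (11 * be + ga + 8) + 1) + 4"

text \<open>Each of the five parts is at most \<open>2 ^ (12 * be + ga + 8)\<close> long; four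
  further bits leave room for their concatenation.\<close>

definition len_max :: "nat => nat" where
 "len_max ga = 2 ^ (12 * be + ga + 12)"

lemma part_length: "card V * (length_bound ga + 1) <= 2 ^ (9 * be + ga + 8)"
proof -
 have "length_bound ga + 1 <= 2 ^ (8 * be + ga + 8)" using one_le_power[of "2 :: nat" "8 * be + ga + 7"] by (simp add: length_bound_def power_add)
 hence "card V * (length_bound ga + 1) <= 2 ^ be * 2 ^ (8 * be + ga + 8)" by (intro mult_le_mono card_V)
 also have "2 ^ be * 2 ^ (8 * be + ga + 8) = (2 :: nat) ^ (9 * be + ga + 8)" unfolding power_add[symmetric] by (rule arg_cong[of _ _ "%n. 2 ^ n"]) simp
 finally show ?thesis .
qed

lemma powers_le:
 "(2 :: nat) ^ (9 * be + ga + 8) <= len_max ga"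
 "length_bound ga <= len_max ga" unfolding len_max_def length_bound_def by (rule power_increasing; simp)+

lemma tame_finish:
 assumes p: "walk E a p b" "set p <= K" "a : V" "tame ga a p b x"
 obtains p' where "derivable E (card V * (step_bound ga + 3)) (len_max ga) a p' b"
  "weight p' = weight p" "credit p' <= x" "length p' <= 2 ^ (9 * be + ga + 8)"
proof -
 obtain p' where p': "derivable (set p) (card (seen a p) * (step_bound ga + 3)) (card V * (length_bound ga + 1)) a p' b"
  "weight p' = weight p" "credit p' <= x" "length p' <= card (seen a p) * (length_bound ga + 1)" using p(4) unfolding tame_def by blast
 have c: "card (seen a p) <= card V" using K_stops[OF p(1-3)] finite_V by (rule card_mono[rotated])
 show ?thesis
 proof (rule that[OF _ p'(2,3)])
  show "length p' <= 2 ^ (9 * be + ga + 8)"  using p'(4) mult_le_mono1[OF c] part_length by (meson order_trans)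
  show "derivable E (card V * (step_bound ga + 3)) (len_max ga) a p' b"
   using walk_subset[OF p(1)] mult_le_mono1[OF c] order_trans[OF part_length powers_le(1)] by (intro derivable_mono[OF p'(1)])
 qed
qed

text \<open>The prefix weights lie between \<open>- x\<close> and \<open>card V * W\<close>, so
  every infix weighs at most \<open>x + card V * W\<close> in absolute value. This discharges the
  bound on infixes in \<open>derivable_no_positive\<close>.\<close>

lemma derivable_no_positive':
 assumes p: "walk E a p b" "set p <= K" "a : V" "no_positive p" "credit p <= x" "x + int (card V) * W <= 2 ^ ga"
 obtains p' where "derivable E (card V * (step_bound ga + 3)) (len_max ga) a p' b"
  "weight p' = weight p" "credit p' <= x" "length p' <= 2 ^ (9 * be + ga + 8)"
proof -
 have seg: "abs (weight q) <= 2 ^ ga" if eq: "p = r @ q @ s" for r q s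
 proof -
  have bd: "0 <= x + weight p1 & weight p1 <= int (card V) * W" if d: "p = p1 @ p2" for p1 p2
  proof
   show "0 <= x + weight p1" using p(5) d credit_le_prefix by blast
   obtain y where "walk E a p1 y" using p(1) d by (auto simp: walk_append)
   thus "weight p1 <= int (card V) * W" by (rule no_positive_weight) (use p d no_positive_mono[OF p(4), of p1] in auto)
  qed
  have "0 <= x + weight r" "0 <= x + (weight r + weight q)" using bd[of r "q @ s"] bd[of "r @ q" s] eq by auto
  moreover have "weight r <= int (card V) * W" "weight r + weight q <= int (card V) * W" using bd[of r "q @ s"] bd[of "r @ q" s] eq by auto
  moreover have "x + int (card V) * W <= 2 ^ ga" using p(6) by (auto simp: eq)
  ultimately show ?thesis unfolding abs_le_iff by linarith
 qed
 show ?thesis by (rule tame_finish[OF p(1-3) derivable_no_positive[OF p(1-5)]]) (use seg that in auto)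
qed

lemma derivable_no_negative':
 assumes p: "walk E a p b" "set p <= K" "a : V" "no_negative p" "credit p <= x" "x + weight p + int (card V) * W <= 2 ^ ga"
 obtains p' where "derivable E (card V * (step_bound ga + 3)) (len_max ga) a p' b"
  "weight p' = weight p" "credit p' <= x" "length p' <= 2 ^ (9 * be + ga + 8)"
proof -
 have "b : V" using walk_end_stops[OF p(1)] K_stops[OF p(1-3)] by auto
 then obtain q where q: "derivable (flip_edge ` E) (card V * (step_bound ga + 3)) (len_max ga) b q a"
  "weight q = weight (flip p)" "credit q <= x + weight p" "length q <= 2 ^ (9 * be + ga + 8)"
  using derivable_no_positive'[OF walk_flip[OF p(1)] flip_K[OF p(2)] _ no_positive_flip[OF p(4)], of "x + weight p" ga] p(5,6) by (auto simp: credit_flip)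
 show ?thesis using that[of "flip q"] derivable_flip[OF q(1)] q(2-4) by (simp add: credit_flip)
qed

lemma split_prefix:
 assumes "P []" "~ P p"
 obtains p1 e p2 where "p = p1 @ e # p2" "P p1" "~ P (p1 @ [e])" using assms(2)
proof (induction p arbitrary: thesis rule: rev_induct)
 case (snoc e p) show ?case
 proof (cases "P p")
  case False
  then obtain p1 f p2 where "p = p1 @ f # p2" "P p1" "~ P (p1 @ [f])" using snoc.IH by blast
  thus ?thesis using snoc.prems(1)[of p1 f "p2 @ [e]"] by simp
 qed (use snoc.prems in auto)
qed (use assms in auto)

lemma split_suffix:
 assumes "P []" "~ P p"
 obtains p1 e p2 where "p = p1 @ e # p2" "P p2" "~ P (e # p2)" using assms(2)
proof (induction p arbitrary: thesis)
 case (Cons e p) show ?case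
 proof (cases "P p")
  case False
  then obtain p1 f p2 where "p = p1 @ f # p2" "P p2" "~ P (f # p2)" using Cons.IH by blast
  thus ?thesis using Cons.prems(1)[of "e # p1" f p2] by simp
 next case True
  thus ?thesis using Cons.prems(1)[of "[]" e p] Cons.prems(2) by simp
 qed
qed (use assms in auto)

lemma cyclic_power:
 assumes "walk E u g u" "length g <= card V" "k < 2 ^ (11 * be + ga + 8)"
 shows "derivable E (2 * card V + 1 + 2 * (11 * be + ga + 8) + 1) (len_max ga) u (concat (replicate k g)) u"
  "length (concat (replicate k g)) <= 2 ^ (12 * be + ga + 8)"
proof -
 have gl: "length g <= 2 ^ be" using assms(2) card_V by linarith
 have "(2 :: nat) ^ be <= len_max ga" unfolding len_max_def by (rule power_increasing) auto
 hence gf: "length g <= len_max ga" using gl by linarith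
 have "length g * 2 ^ (11 * be + ga + 8) <= 2 ^ be * 2 ^ (11 * be + ga + 8)" by (rule mult_le_mono1[OF gl])
 also have "... = 2 ^ (12 * be + ga + 8)" unfolding power_add[symmetric] by (rule arg_cong[of _ _ "%n. 2 ^ n"]) simp
 finally have gp: "length g * 2 ^ (11 * be + ga + 8) <= 2 ^ (12 * be + ga + 8)" .
 also have "... <= len_max ga" unfolding len_max_def by (rule power_increasing) auto
 finally have gp': "length g * 2 ^ (11 * be + ga + 8) <= len_max ga" .
 have "derivable E (2 * card V + 1) (len_max ga) u g u" by (rule derivable_mono[OF derivable_list[OF assms(1) gf]]) (use assms(2) in auto)
 from derivable_power[OF this assms(3) gp']
 show "derivable E (2 * card V + 1 + 2 * (11 * be + ga + 8) + 1) (len_max ga) u (concat (replicate k g)) u" .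
 have "length (concat (replicate k g)) = k * length g" by (induction k) auto
 also have "... <= length g * 2 ^ (11 * be + ga + 8)" using assms(3) by (subst mult.commute) simp
 finally show "length (concat (replicate k g)) <= 2 ^ (12 * be + ga + 8)" using gp by linarith
qed

text \<open>Either the walk has a prefix without positive cycles followed by a suffix without negative
  cycles, or a positive cycle can be pumped before a negative one, and between them only the weight
  of the walk matters.\<close>

lemma small_derivation:
 assumes p: "walk E a p b" "set p <= K" "a : V" "credit p <= x"
  and x: "x + int (card V) * W <= 2 ^ ga" "x + weight p + int (card V) * W <= 2 ^ ga"
 obtains p' where "derivable E (final_steps ga) (len_max ga) a p' b" "weight p' = weight p" "credit p' <= x"
proof -
 let ?T = "card V * (step_bound ga + 3)" and ?L = "len_max ga"
 note result = that
 have *: "?thesis" if p1: "p = p1 @ p2" "no_positive p1" "no_negative p2" for p1 p2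
 proof -
  obtain y where y: "walk E a p1 y" "walk E y p2 b" using p(1) p1 by (auto simp: walk_append)
  have yV: "y : V" using walk_end_stops[OF y(1)] K_stops[OF y(1)] p p1 by auto
  have cr: "credit p1 <= x" "credit p2 <= x + weight p1" using p(4) p1(1) by (auto simp: credit_append)
  obtain p1' where p1': "derivable E ?T ?L a p1' y" "weight p1' = weight p1" "credit p1' <= x" "length p1' <= 2 ^ (9 * be + ga + 8)"
   by (rule derivable_no_positive'[OF y(1) _ p(3) p1(2) cr(1) x(1)]) (use p p1 in auto)
  obtain p2' where p2': "derivable E ?T ?L y p2' b" "weight p2' = weight p2" "credit p2' <= x + weight p1" "length p2' <= 2 ^ (9 * be + ga + 8)"
   by (rule derivable_no_negative'[OF y(2) _ yV p1(3) cr(2), where ga = ga]) (use p p1 x in auto)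
  have "length (p1' @ p2') <= 2 ^ (9 * be + ga + 9)" using p1'(4) p2'(4) by (simp add: power_add)
  also have "... <= ?L" unfolding len_max_def by (rule power_increasing) auto
  finally have "length (p1' @ p2') <= ?L" .
  hence "derivable E (?T + ?T + 1) ?L a (p1' @ p2') b" using p1'(1) p2'(1) by (intro derivable_append)
  hence "derivable E (final_steps ga) ?L a (p1' @ p2') b" by (rule derivable_mono) (auto simp: final_steps_def)
  thus ?thesis using p1' p2' p1(1) by (intro result[of "p1' @ p2'"]) (auto simp: credit_append)
 qed
 have [simp]: "no_positive ([] :: 'n wedge list)" "no_negative ([] :: 'n wedge list)"
 proof -
  have "c = []" if "walk {} y c y" for y :: 'n and c using walk_subset[OF that] by auto
  thus "no_positive ([] :: 'n wedge list)" "no_negative ([] :: 'n wedge list)" unfolding no_positive_def no_negative_def by fastforce+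
 qed
 show ?thesis
 proof (cases "no_positive p | no_negative p")
  case True thus ?thesis using *[of p "[]"] *[of "[]" p] by auto
 next case False
  obtain p1 e p2 where p1: "p = p1 @ e # p2" "no_positive p1" "~ no_positive (p1 @ [e])" by (rule split_prefix[of no_positive p]) (use False in auto)
  obtain s1 f s2 where s1: "p = s1 @ f # s2" "no_negative s2" "~ no_negative (f # s2)" by (rule split_suffix[of no_negative p]) (use False in auto)
  show ?thesis
  proof (cases "length p1 <= length s1")
   case False
   \<comment> \<open>The prefix \<open>p1\<close> reaches past \<open>f\<close>, so what follows it
     lies inside \<open>s2\<close> and has no negative cycle.\<close>
   have "e # p2 = drop (length p1) p" by (simp add: p1(1))
   also have "... = drop (length p1 - length s1 - 1) s2" using False by (simp add: s1(1) drop_Cons')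
   finally have "set (e # p2) <= set s2" using set_drop_subset by metis
   thus ?thesis using * p1 no_negative_mono[OF s1(2)] by blast
  next case True
   have "p1 = take (length p1) p" by (simp add: p1(1))
   also have "... = take (length p1) s1" using True by (simp add: s1(1))
   finally obtain r where r: "s1 = p1 @ r" by (metis append_take_drop_id)
   obtain v where v: "walk E a p1 v" "fst e = v" using p(1) p1(1) by (auto simp: walk_append)
   have wf: "walk E (tgt f) s2 b" using p(1) s1(1) by (auto simp: walk_append)
   obtain y c where c: "walk (set (p1 @ [e])) y c y" "weight c > 0" using p1(3) by (force simp: no_positive_def)
   have sp: "set (p1 @ [e]) <= set p" unfolding p1(1) by auto
   have sp': "set (f # s2) <= set p" unfolding s1(1) by auto
   note sK = order_trans[OF sp p(2)] order_trans[OF sp' p(2)]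
   note sE = order_trans[OF sp walk_subset[OF p(1)]] order_trans[OF sp' walk_subset[OF p(1)]]
   obtain u g where g: "walk (set (p1 @ [e])) u g u" "g ~= []" "length g <= card V" "sgn (weight g) = sgn (weight c)" "credit g = max 0 (- weight g)"
    using signed_pump[OF c(1) _ sK(1)] c(2) by (metis less_irrefl)
   obtain y' c' where c': "walk (set (f # s2)) y' c' y'" "weight c' < 0" using s1(3) by (force simp: no_negative_def)
   obtain u' g' where g': "walk (set (f # s2)) u' g' u'" "g' ~= []" "length g' <= card V" "sgn (weight g') = sgn (weight c')" "credit g' = max 0 (- weight g')"
    using signed_pump[OF c'(1) _ sK(2)] c'(2) by (metis less_irrefl)
   have "weight g > 0" "credit g = 0" "weight g' < 0" "credit g' = - weight g'" using g(4,5) c(2) g'(4,5) c'(2) by (auto simp: sgn_if split: if_splits)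
   note g = g(1-3) this(1,2) and g' = g'(1-3) this(3,4)
   \<comment> \<open>All sources of edges in \<open>p1 @ [e]\<close> are stops of \<open>p1\<close>,
     so \<open>g\<close> can be inserted within \<open>p1\<close>, where no cycle is positive.
     Symmetrically, \<open>g'\<close> ends in a target of \<open>f # s2\<close>, which is a stop of
     \<open>s2\<close>.\<close>
   have "hd g : set (p1 @ [e])" "fst (hd g) = u" using g(1,2) by (cases g; auto)+
   hence "u : seen a p1" using v(2) walk_src_stops[OF v(1), of "hd g"] walk_end_stops[OF v(1)] by (cases "hd g = e") simp_all
   then obtain p0 q0 where p0: "p1 = p0 @ q0" "walk E a p0 u" "walk E u q0 v" using walk_stops_split[OF v(1)] by metis
   have "last g' : set (f # s2)" "tgt (last g') = u'" using g'(1,2) by (cases g' rule: rev_cases; auto simp: walk_append)+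
   hence "u' : seen (tgt f) s2" by (auto simp: set_stops)
   then obtain q3 p3 where p3: "s2 = q3 @ p3" "walk E (tgt f) q3 u'" "walk E u' p3 b" using walk_stops_split[OF wf] by metis
   define m where "m = q0 @ r @ f # q3"
   have pm: "p = p0 @ m @ p3" by (simp add: s1(1) r p0(1) p3(1) m_def)
   obtain z where z: "walk E a s1 z" "f : E" "fst f = z" using p(1) s1(1) by (auto simp: walk_append)
   have "walk E v r z"
   proof -
    obtain v' where "walk E a p1 v'" "walk E v' r z" using z(1) r by (auto simp: walk_append)
    moreover have "v' = v" if "walk E a q v'" "walk E a q v" for q v' using that by (induction q arbitrary: a) auto
    ultimately show ?thesis using v(1) by metis
   qed
   hence wm: "walk E u m u'" unfolding m_def using p0(3) z p3(2) by (auto simp: walk_append)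
   have uV: "u : V" using walk_end_stops[OF p0(2)] K_stops[OF p0(2)] p pm by auto
   have u'V: "u' : V" using walk_end_stops[OF wm] K_stops[OF wm] uV p(2) pm by auto
   have cr: "credit p0 <= x" "0 <= x + weight p0" "0 <= x + weight p0 + weight m" "credit p3 <= x + weight p0 + weight m"
    using p(4) credit_le_prefix[of p0 "m @ p3" x] credit_le_prefix[of "p0 @ m" p3 x] pm by (auto simp: credit_append)
   have np: "no_positive p0" by (rule no_positive_mono[OF p1(2)]) (auto simp: p0(1))
   have nn: "no_negative p3" by (rule no_negative_mono[OF s1(2)]) (auto simp: p3(1))
   obtain p0' where p0': "derivable E ?T ?L a p0' u" "weight p0' = weight p0" "credit p0' <= x" "length p0' <= 2 ^ (9 * be + ga + 8)"
    by (rule derivable_no_positive'[OF p0(2) _ p(3) np cr(1) x(1)]) (use p pm in auto)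
   obtain p3' where p3': "derivable E ?T ?L u' p3' b" "weight p3' = weight p3" "credit p3' <= x + weight p0 + weight m" "length p3' <= 2 ^ (9 * be + ga + 8)"
    by (rule derivable_no_negative'[OF p3(3) _ u'V nn cr(4), where ga = ga]) (use p pm x in auto)
   have up: "x + weight p0 <= 2 ^ ga"
   proof -
    have "weight p0 <= int (card V) * W" by (rule no_positive_weight[OF p0(2) _ p(3) np]) (use p pm in auto)
    thus ?thesis using x(1) by linarith
   qed
   have up': "x + weight p0 + weight m <= 2 ^ ga"
   proof -
    have "- (int (card V) * W) <= weight p3" by (rule no_negative_weight[OF p3(3) _ u'V nn]) (use p pm in auto)
    thus ?thesis using x(2) pm by simp
   qed
   have mb: "abs (weight m) <= 2 ^ ga" using up up' cr(2,3) by linarith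
   obtain m' where m': "derivable (set m) (step_bound ga) (length_bound ga) u m' u'" "weight m' = weight m"
    "length m' <= length_bound ga" by (rule same_weight_walk[OF wm _ uV mb]) (use p pm in auto)
   have dm: "derivable E (step_bound ga) ?L u m' u'" by (rule derivable_mono[OF m'(1)]) (use walk_subset[OF wm] powers_le in auto)
   define j where "j = nat (credit m')"
   have j: "int j = credit m'" by (simp add: j_def)
   have m'K: "set m' <= K" using walk_subset[OF derivable_walk[OF m'(1)]] p(2) pm by auto
   have pw: "int (length q) * W <= 2 ^ (2 * be)" if "length q <= card V" for q :: "'n wedge list"
   proof -
    have "int (length q) * W <= 2 ^ be * 2 ^ be" using that card_V W by (intro mult_mono) (auto intro: order_trans[OF of_nat_mono])
    thus ?thesis by (simp add: mult_2 power_add)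
   qed
   have jb: "int j <= 2 ^ (9 * be + ga + 7)"
   proof -
    have "int j <= int (length m') * W" unfolding j by (rule K_credit[OF m'K])
    also have "... <= int (length_bound ga) * 2 ^ be" using m'(3) W by (intro mult_mono) auto
    also have "... = 2 ^ (9 * be + ga + 7)" by (simp add: length_bound_def flip: power_add)
    finally show ?thesis .
   qed
   \<comment> \<open>\<open>A\<close> copies of \<open>g\<close> and \<open>B\<close> copies of
     \<open>g'\<close> cancel. The first pump gains at least \<open>credit m'\<close>, so the middle
     part may be any walk of the right weight, and the second pump returns exactly to the old
     level.\<close>
   define A where "A = j * nat (- weight g')"
   define B where "B = j * nat (weight g)"
   have AB: "int A * weight g = int j * (- weight g') * weight g" "int B * weight g' = - (int A * weight g)" using g(4) g'(4) by (auto simp: A_def B_def)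
   have small: "j * nat w < 2 ^ (11 * be + ga + 8)" if "w <= 2 ^ (2 * be)" "0 <= w" for w
   proof -
    have "int (j * nat w) = int j * w" using that by simp
    also have "... <= 2 ^ (9 * be + ga + 7) * 2 ^ (2 * be)" using jb that by (intro mult_mono) auto
    also have "... = 2 ^ (11 * be + ga + 7)" by (simp flip: power_add)
    also have "... < 2 ^ (11 * be + ga + 8)" by simp
    finally show ?thesis by (metis of_nat_less_iff of_nat_numeral of_nat_power)
   qed
   have gK: "set g <= K" "set g' <= K" using walk_subset[OF g(1)] walk_subset[OF g'(1)] sK by auto
   have Ab: "A < 2 ^ (11 * be + ga + 8)" "B < 2 ^ (11 * be + ga + 8)"
    unfolding A_def B_def using K_weight[OF gK(1)] K_weight[OF gK(2)] pw[OF g(3)] pw[OF g'(3)] g(4) g'(4) by (intro small; linarith)+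
   note gA = cyclic_power[OF walk_weaken[OF g(1) sE(1)] g(3) Ab(1)]
   note gB = cyclic_power[OF walk_weaken[OF g'(1) sE(2)] g'(3) Ab(2)]
   let ?A = "concat (replicate A g)" and ?B = "concat (replicate B g')"
   let ?p = "p0' @ ?A @ m' @ ?B @ p3'"
   have "length ?p <= 8 * 2 ^ (12 * be + ga + 8)"
   proof -
    have "(2 :: nat) ^ (9 * be + ga + 8) <= 2 ^ (12 * be + ga + 8)" "length_bound ga <= 2 ^ (12 * be + ga + 8)"
     unfolding length_bound_def by (rule power_increasing; simp)+
    thus ?thesis using gA(2) gB(2) p0'(4) p3'(4) m'(3) unfolding length_append by linarith
   qed
   also have "... <= ?L" by (simp add: len_max_def power_add)
   finally have len: "length ?p <= ?L" .
   have "derivable E (?T + (2 * card V + 1 + 2 * (11 * be + ga + 8) + 1 + (step_bound ga +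
    (2 * card V + 1 + 2 * (11 * be + ga + 8) + 1 + ?T + 1) + 1) + 1) + 1) ?L a ?p b"
    using len by (intro derivable_append[OF p0'(1)] derivable_append[OF gA(1)] derivable_append[OF dm]
     derivable_append[OF gB(1) p3'(1)]) (simp_all only: length_append)
   hence d: "derivable E (final_steps ga) ?L a ?p b" by (rule derivable_mono) (auto simp: final_steps_def)
   have w: "weight ?p = weight p" using p0'(2) m'(2) p3'(2) AB by (simp add: pm)
   have "credit m' <= int A * weight g"
   proof -
    have "int j * 1 <= int j * ((- weight g') * weight g)" using g(4) g'(4) mult_mono[of 1 "- weight g'" 1 "weight g"] by (intro mult_left_mono) auto
    thus ?thesis using AB(1) j by (simp add: mult.assoc)
   qed
   moreover have "credit ?A = 0" using g(4,5) by (intro credit_power) auto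
   moreover have "credit ?B = - (int B * weight g')" by (rule credit_power_neg[OF g'(5)])
   ultimately have "credit ?p <= x" using p0'(2,3) m'(2) p3'(3) AB(2) cr(2,3) unfolding credit_append by simp
   thus ?thesis using d w by (intro that)
  qed
 qed
qed

end

section \<open>Bounds for losing and winning continuations\<close>

definition lasso :: "'n wedge set => int => 'n => 'n wedge list => 'n => 'n wedge list => bool" where
 "lasso E y a p x c = (walk E a p x & walk E x c x & c ~= [] & 0 <= weight c & credit (p @ c) <= y)"

lemma distinct_split:
 assumes "~ distinct (map f xs)"
 obtains r q s where "xs = r @ q @ s" "q ~= []" "s ~= []" "f (hd q) = f (hd s)" using assms
proof (induction xs arbitrary: thesis)
 case (Cons x xs) show ?case
 proof (cases "f x : f ` set xs")
  case True
  then obtain y where y: "y : set xs" "f y = f x" by auto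
  then obtain r s where "xs = r @ y # s" by (auto simp: in_set_conv_decomp)
  thus ?thesis using y Cons.prems(1)[of "[]" "x # r" "y # s"] by simp
 next case False
  hence "~ distinct (map f xs)" using Cons.prems(2) by simp
  then obtain r q s where "xs = r @ q @ s" "q ~= []" "s ~= []" "f (hd q) = f (hd s)" using Cons.IH by blast
  thus ?thesis using Cons.prems(1)[of "x # r" q s] by simp
 qed
qed simp

lemma walk_hd: "walk E u p v ==> p ~= [] ==> fst (hd p) = u" by (cases p) auto

text \<open>A repetition inside a lasso of minimal length has negative weight and can be removed; if it
  contains the start of the cycle, the cycle is rotated first.\<close>

lemma minimal_lasso:
 assumes "lasso E y a p x c" "E <= V \<times> UNIV \<times> V" "finite V"
 obtains p' x' c' where "lasso E y a p' x' c'" "length (p' @ c') <= card V"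
proof -
 define P where "P = (%(p', x', c'). lasso E y a p' x' c')"
 have "P (p, x, c)" using assms(1) by (simp add: P_def)
 then obtain t where t: "P t" "!!t'. P t' ==> length (fst t @ snd (snd t)) <= length (fst t' @ snd (snd t'))"
  using ex_has_least_nat[of P _ "%t. length (fst t @ snd (snd t))"] by blast
 obtain p x c where tt: "t = (p, x, c)" by (cases t)
 have l: "lasso E y a p x c" using t(1) by (simp add: tt P_def)
 have min: "length (p @ c) <= length (p' @ c')" if "lasso E y a p' x' c'" for p' x' c' using t(2)[of "(p', x', c')"] that by (simp add: tt P_def)
 have w: "walk E a p x" "walk E x c x" "c ~= []" "0 <= weight c" "credit (p @ c) <= y" using l by (auto simp: lasso_def)
 have "length (p @ c) <= card V"
 proof (rule ccontr)
  assume "~ length (p @ c) <= card V"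
  moreover have "set (p @ c) <= V \<times> UNIV \<times> V" using walk_subset[OF w(1)] walk_subset[OF w(2)] assms(2) by auto
  hence "set (map fst (p @ c)) <= V" by auto
  ultimately have "~ distinct (map fst (p @ c))" using card_mono[OF assms(3)] by (metis distinct_card length_map)
  then obtain r q s where rqs: "p @ c = r @ q @ s" "q ~= []" "s ~= []" "fst (hd q) = fst (hd s)" by (rule distinct_split)
  have "walk E a (p @ c) x" using w(1,2) by (auto simp: walk_append)
  hence "walk E a (r @ q @ s) x" unfolding rqs(1) .
  then obtain z z' where z: "walk E a r z" "walk E z q z'" "walk E z' s x" by (auto simp: walk_append)
  have "z' = z" using walk_hd[OF z(2) rqs(2)] walk_hd[OF z(3) rqs(3)] rqs(4) by simp
  note z = z[unfolded this]
  have cr: "credit r <= y" "credit q <= y + weight r" "credit s <= y + weight r + weight q" using w(5) unfolding rqs(1) by (auto simp: credit_append)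
  \<comment> \<open>Otherwise the stem \<open>r\<close> with the cycle \<open>q\<close> would be a
    shorter lasso.\<close>
  have neg: "weight q < 0"
  proof (rule ccontr)
   assume "~ weight q < 0"
   hence "lasso E y a r z q" using z rqs cr by (auto simp: lasso_def credit_append)
   from min[OF this] rqs(3) show False unfolding rqs(1) by simp
  qed
  from rqs(1) consider (inp) p2 where "p = r @ q @ p2" "s = p2 @ c"
   | (inc) c1 where "r = p @ c1" "c = c1 @ q @ s"
   | (mid) q1 q2 where "p = r @ q1" "c = q2 @ s" "q = q1 @ q2" "q1 ~= []"
  proof -
   assume a1: "!!p2. p = r @ q @ p2 ==> s = p2 @ c ==> thesis"
    and a2: "!!c1. r = p @ c1 ==> c = c1 @ q @ s ==> thesis"
    and a3: "!!q1 q2. p = r @ q1 ==> c = q2 @ s ==> q = q1 @ q2 ==> q1 ~= [] ==> thesis"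
   from rqs(1) consider u where "p = r @ u" "u @ c = q @ s" | u where "r = p @ u" "c = u @ q @ s" by (auto simp: append_eq_append_conv2)
   thus thesis
   proof cases
    case 1
    from 1(2) consider v where "u = q @ v" "v @ c = s" | v where "u @ v = q" "c = v @ s" by (auto simp: append_eq_append_conv2)
    thus ?thesis
    proof cases
     case i: 1 show ?thesis by (rule a1[of v]) (use 1 i in auto)
    next case i: 2
     show ?thesis
     proof (cases "u = []")
      case True show ?thesis by (rule a2[of "[]"]) (use 1 i True in auto)
     next case False
      show ?thesis by (rule a3[of u v]) (use 1 i False in auto)
     qed
    qed
  next case 2 thus ?thesis by (rule a2)
   qed
  qed
  thus False
  proof cases
   case inp
   have "walk E z p2 x" using w(1) z(1,2) inp(1) z(3) w(2) inp(2) by (metis neg order_less_irrefl walk_append walk_hd w(3))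
   hence "lasso E y a (r @ p2) x c" using w z cr neg by (auto simp: lasso_def walk_append credit_append inp(2))
   from min[OF this] rqs(2) show False by (simp add: inp)
  next case inc
   obtain u where u: "walk E x c1 u" "walk E u (q @ s) x" using w(2) inc(2) by (auto simp: walk_append)
   hence "u = z" using walk_hd[OF u(2)] walk_hd[OF z(2)] rqs(2) by simp
   hence "walk E x c1 z" using u by simp
   hence "lasso E y a p x (c1 @ s)" using w z cr neg rqs(3) by (auto simp: lasso_def walk_append credit_append inc)
   from min[OF this] rqs(2) show False by (simp add: inc)
  next case mid
   obtain u where u: "walk E x q2 u" "walk E u s x" using w(2) mid(2) by (auto simp: walk_append)
   hence "u = z" using walk_hd[OF u(2)] walk_hd[OF z(3)] rqs(3) by simp
   hence "walk E x q2 z" using u by simp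
   moreover have "0 <= weight s + weight q2" using w(4) by (simp add: mid)
   moreover have "credit q2 <= y + weight r + weight q1" using cr(2) by (auto simp: mid credit_append)
   ultimately have "lasso E y a r z (s @ q2)" using z cr neg rqs(3) by (auto simp: lasso_def walk_append credit_append mid)
   from min[OF this] mid(4) show False by (simp add: mid)
  qed
 qed
 thus ?thesis using l that by blast
qed

text \<open>Some vertex recurs infinitely often. From its visit with the least counter value to any
  later visit the weight is nonnegative, which gives the cycle.\<close>

lemma infinite_walk_lasso:
 fixes f :: "nat => 'n"
 assumes e: "!!k. (f k, w k, f (Suc k)) : E" and y: "!!k. 0 <= y + (SUM j<k. w j)"
  and V: "E <= V \<times> UNIV \<times> V" "finite V"
 obtains p x c where "lasso E y (f 0) p x c"
proof -
 define S where "S = (%k. SUM j<k. w j)"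
 define seg where "seg = (%i j. map (%k. (f k, w k, f (Suc k))) [i..<j])"
 have seg_walk: "walk E (f i) (seg i j) (f j)" if "i <= j" for i j using that by (induction j rule: dec_induct) (auto simp: seg_def walk_append e)
 have seg_weight: "weight (seg i j) = S j - S i" if "i <= j" for i j using that by (induction j rule: dec_induct) (auto simp: seg_def S_def)
 have "f ` UNIV <= V" using e V(1) by auto
 hence "finite (f ` UNIV)" using V(2) finite_subset by blast
 then obtain i0 where i0: "infinite {i : UNIV. f i = f i0}" using pigeonhole_infinite[of UNIV f] by auto
 define N where "N = {i. f i = f i0}"
 have N: "infinite N" using i0 by (simp add: N_def)
 then obtain i' where "i' : N" using infinite_imp_nonempty by blast
 then obtain i where i: "i : N" "!!j. j : N ==> nat (y + S i) <= nat (y + S j)" using ex_has_least_nat[of "%i. i : N" i' "%i. nat (y + S i)"] by blast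
 obtain j where j: "j : N" "i < j" using N unfolding infinite_nat_iff_unbounded by blast
 have "S i <= S j" using i(2)[OF j(1)] y[of i] y[of j] by (simp add: S_def)
 moreover have "credit (seg 0 i @ seg i j) <= y"
 proof (rule credit_leI)
  show "0 <= y" using y[of 0] by simp
  fix p1 p2 assume "seg 0 i @ seg i j = p1 @ p2"
  moreover have "seg 0 i @ seg i j = seg 0 j" unfolding seg_def map_append[symmetric] using j(2) upt_add_eq_append[of 0 i "j - i"] by simp
  ultimately have eq: "seg 0 j = p1 @ p2" by simp
  have "length (seg 0 j) = j" by (simp add: seg_def)
  hence "length p1 <= j" using arg_cong[OF eq, of length] by simp
  moreover have "p1 = take (length p1) (seg 0 j)" by (simp add: eq)
  ultimately have p1: "p1 = take (length p1) (seg 0 j)" "length p1 <= j" by blast+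
  hence "p1 = seg 0 (length p1)" by (simp add: seg_def take_map)
  hence "weight p1 = S (length p1)" using seg_weight[of 0 "length p1"] by (simp add: S_def)
  thus "0 <= y + weight p1" using y[of "length p1"] by (simp add: S_def)
 qed
 moreover have "f j = f i" using i j by (auto simp: N_def)
 ultimately have "lasso E y (f 0) (seg 0 i) (f i) (seg i j)" using seg_walk[of 0 i] seg_walk[of i j] j(2) seg_weight[of i j] by (auto simp: lasso_def seg_def)
 thus ?thesis by (rule that)
qed

text \<open>The lasso is unrolled. A full turn never loses weight, so in every turn the counter is
  at least as high as at the same place of the first turn.\<close>

lemma lasso_infinite_walk:
 assumes l: "lasso E y a p x c"
 obtains f w where "f 0 = a" "!!k. (f k, w k, f (Suc k)) : E" "!!k. 0 <= y + (SUM j<k. w j)"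
proof -
 define es where "es = (%k. if k < length p then p ! k else c ! ((k - length p) mod length c))"
 have w: "walk E a p x" "walk E x c x" "c ~= []" "0 <= weight c" "credit (p @ c) <= y" using l by (auto simp: lasso_def)
 have nth: "q ! i : E & (Suc i < length q --> tgt (q ! i) = fst (q ! Suc i)) & (Suc i = length q --> tgt (q ! i) = v)"
  if "walk E u q v" "i < length q" for u q v i using that
 proof (induction q arbitrary: u i)
  case (Cons e q) show ?case
  proof (cases i)
   case 0 thus ?thesis using Cons.prems by (cases q) auto
  next case (Suc i')
   have "walk E (tgt e) q v" "i' < length q" using Cons.prems Suc by auto
   thus ?thesis using Cons.IH unfolding Suc nth_Cons_Suc by simp
  qed
 qed simp
 have hd0: "fst (q ! 0) = u" if "walk E u q v" "q ~= []" for u q v using that by (cases q) auto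
 have inE: "es k : E" for k using nth[OF w(1), of k] nth[OF w(2), of "(k - length p) mod length c"] w(3) by (auto simp: es_def)
 have conn: "tgt (es k) = fst (es (Suc k))" for k
 proof -
  consider "Suc k < length p" | "Suc k = length p" | "length p <= k" by linarith
  thus ?thesis
  proof cases
   case 1 thus ?thesis using nth[OF w(1), of k] by (simp add: es_def)
  next case 2
   hence "tgt (es k) = x" using nth[OF w(1), of k] by (simp add: es_def)
   thus ?thesis using 2 hd0[OF w(2,3)] by (simp add: es_def)
  next case 3
   let ?i = "(k - length p) mod length c"
   have i: "?i < length c" using w(3) by simp
   have s: "Suc k - length p = Suc (k - length p)" using 3 by simp
   have m: "Suc (k - length p) mod length c = (if Suc ?i = length c then 0 else Suc ?i)" by (simp add: mod_Suc)
   show ?thesis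
   proof (cases "Suc ?i = length c")
    case True hence "tgt (es k) = x" using nth[OF w(2) i] 3 by (simp add: es_def)
    thus ?thesis using 3 hd0[OF w(2,3)] True by (simp add: es_def s m)
   next case False
    thus ?thesis using nth[OF w(2) i] i 3 by (simp add: es_def s m)
   qed
  qed
 qed
 have sum_take: "(SUM j<k. wt (q ! j)) = weight (take k q)" if "k <= length q" for k and q :: "'a wedge list"
  using that by (induction k) (auto simp: take_Suc_conv_app_nth)
 have tk: "0 <= y + weight (take k p)" "0 <= y + weight p + weight (take k c)" for k
  using credit_le_prefix[of "take k p" "drop k p" y] credit_le_prefix[of "p @ take k c" "drop k c" y] w(5) by (simp_all add: credit_append)
 have late: "EX i<=length c. weight p + weight (take i c) <= (SUM j<length p + k. wt (es j)) & (i = k mod length c)" for k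
 proof (induction k)
  case 0
  have "(SUM j<length p. wt (es j)) = weight p" using sum_take[of "length p" p] by (simp add: es_def)
  thus ?case by (intro exI[of _ 0]) auto
 next case (Suc k)
  let ?i = "k mod length c"
  have i: "?i < length c" using w(3) by simp
  have "wt (es (length p + k)) = wt (c ! ?i)" by (simp add: es_def)
  hence *: "weight p + weight (take (Suc ?i) c) <= (SUM j<length p + Suc k. wt (es j))" using Suc i by (simp add: take_Suc_conv_app_nth)
  show ?case
  proof (cases "Suc ?i = length c")
   case True hence "weight p <= (SUM j<length p + Suc k. wt (es j))" using * w(4) by simp
   thus ?thesis using True by (intro exI[of _ 0]) (auto simp: mod_Suc)
  next case False
   thus ?thesis using * i by (intro exI[of _ "Suc ?i"]) (auto simp: mod_Suc)
  qed
 qed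
 show ?thesis
 proof (rule that[of "%k. fst (es k)" "%k. wt (es k)"])
  show "fst (es 0) = a" using hd0[OF w(1)] hd0[OF w(2,3)] w(1) by (cases "p = []") (auto simp: es_def)
  show "(fst (es k), wt (es k), fst (es (Suc k))) : E" for k using inE[of k] conn[of k] by (metis prod.collapse)
  show "0 <= y + (SUM j<k. wt (es j))" for k
  proof (cases "k <= length p")
   case True hence "(SUM j<k. wt (es j)) = weight (take k p)" using sum_take[of k p] by (simp add: es_def)
   thus ?thesis using tk by simp
  next case False
   then obtain k' where k': "k = length p + k'" by (metis le_Suc_ex nat_le_linear)
   obtain i where "weight p + weight (take i c) <= (SUM j<k. wt (es j))" using late[of k'] unfolding k' by blast
   thus ?thesis using tk(2)[of i] by linarith
  qed
 qed
qed

section \<open>Short losing walks and capped prefixes\<close>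

context bounded_graph begin

text \<open>To lose, only the weight at the end counts, without regard to credits. Either the
  loop-erased walk is already light enough, or one of the erased cycles is negative and is
  repeated.\<close>

lemma losing_derivation:
 assumes p: "walk E a p b" "set p <= K" "a : V" "weight p < - y" and y: "0 <= y" "y <= 2 ^ ga"
 obtains p' b' where "derivable E (final_steps ga) (len_max ga) a p' b'" "weight p' < - y"
proof -
 obtain k cs where k: "walk (set p) a k b" "distinct (stops a k)" "seen a k <= seen a p"
   and cs: "!!z c. (z, c) : set cs ==> simple_cycle (set p) z c & z : seen a p"
   and wk: "weight p = weight k + total cs" using loop_erasure[OF p(1)] by metis
 have pE: "set p <= E" by (rule walk_subset[OF p(1)])
 have nL: "card V <= 2 ^ (12 * be + ga + 8)" using card_V power_increasing[of be "12 * be + ga + 8" "2 :: nat"] by linarith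
 have nL': "2 * 2 ^ (12 * be + ga + 8) <= len_max ga" by (simp add: len_max_def power_add)
 show ?thesis
 proof (cases "ALL zc:set cs. 0 <= weight (snd zc)")
  case True hence "0 <= total cs" by (intro sum_list_signs(2)) auto
  moreover have "length (stops a k) <= card V" using k(2,3) K_stops[OF p(1-3)] finite_V by (metis card_mono distinct_card order_trans)
  hence len: "length k <= card V" by (simp add: stops_def)
  have "derivable E (final_steps ga) (len_max ga) a k b" by (rule derivable_mono[OF derivable_list[OF walk_weaken[OF k(1) pE], of "len_max ga"]])
    (use len nL nL' in "auto simp: final_steps_def")
  ultimately show ?thesis using that[of k b] wk p(4) by linarith
 next case False
  then obtain z c where zc: "(z, c) : set cs" "weight c < 0" by force
  have sc: "walk (set p) z c z" "length c <= card V" "z : seen a p" using cs[OF zc(1)] K_cycle[of "set p" z c] p(2) by (auto simp: simple_cycle_def)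
  obtain p1 p2 where p1: "p = p1 @ p2" "walk E a p1 z" using walk_stops_split[OF p(1) sc(3)] by metis
  obtain k1 where k1: "abs (weight k1) <= int (card V) * W" "walk (set p1) a k1 z" "length k1 <= card V" by (rule erased_weight[OF p1(2) _ p(3)]) (use p(2) p1(1) in auto)
  have wk1: "walk E a k1 z" using k1(2) by (rule walk_weaken) (use pE p1(1) in auto)
  \<comment> \<open>Each repetition weighs at most -1, so \<open>j\<close> of them outweigh both
    \<open>y\<close> and the path \<open>k1\<close>, which gains at most
    \<open>card V * W\<close>.\<close>
  define j where "j = nat (y + int (card V) * W + 1)"
  have nW: "0 <= int (card V) * W" using W by simp
  have "int (card V) * W <= 2 ^ be * 2 ^ be" using card_V W by (intro mult_mono) (auto intro: order_trans[OF of_nat_mono])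
  hence "int j <= 2 ^ ga + 2 ^ (be + be) + 1" using y nW by (simp add: j_def power_add)
  moreover have "(2 :: int) ^ ga <= 2 ^ (11 * be + ga)" "(2 :: int) ^ (be + be) <= 2 ^ (11 * be + ga)" by (rule power_increasing; simp)+
  moreover have "(1 :: int) <= 2 ^ (11 * be + ga)" by simp
  moreover have "(2 :: int) ^ (11 * be + ga + 8) = 256 * 2 ^ (11 * be + ga)" by (simp add: power_add)
  ultimately have "int j < 2 ^ (11 * be + ga + 8)" by linarith
  hence jb: "j < 2 ^ (11 * be + ga + 8)" by (metis of_nat_less_iff of_nat_numeral of_nat_power)
  note cp = cyclic_power[OF walk_weaken[OF sc(1) pE] sc(2) jb]
  let ?p = "k1 @ concat (replicate j c)"
  have l1: "length k1 <= len_max ga" and l2: "length ?p <= len_max ga" using cp(2) k1(3) nL nL' unfolding length_append by linarith+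
  have "derivable E (2 * length k1 + 1 + (2 * card V + 1 + 2 * (11 * be + ga + 8) + 1) + 1) (len_max ga) a ?p z"
   by (rule derivable_append[OF derivable_list[OF wk1 l1] cp(1) l2])
  hence "derivable E (final_steps ga) (len_max ga) a ?p z" by (rule derivable_mono) (use k1(3) in "auto simp: final_steps_def")
  moreover have "weight ?p < - y"
  proof -
   have "int j * weight c <= int j * (- 1)" using zc(2) by (intro mult_left_mono) auto
   thus ?thesis using k1(1) y nW by (simp add: j_def)
  qed
  ultimately show ?thesis by (rule that)
 qed
qed

text \<open>A weight below that of every simple path forces a negative cycle, and repeating it loses
  from any level \<open>y\<close>.\<close>

lemma losing_unbounded:
 assumes p: "walk E a p b" "set p <= K" "a : V" "weight p < - (int (card V) * W)"
 obtains p' b' where "walk (set p) a p' b'" "weight p' < - y"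
proof -
 have "~ no_negative p" using no_negative_weight[OF p(1-3)] p(4) by linarith
 then obtain z c where c: "walk (set p) z c z" "weight c < 0" unfolding no_negative_def by force
 then obtain e c' where "c = e # c'" by (cases c) auto
 hence "z : seen a p" using c(1) walk_src_stops[OF p(1), of e] by auto
 then obtain p1 p2 where p1: "p = p1 @ p2" "walk E a p1 z" using walk_stops_split[OF p(1)] by metis
 define j where "j = nat (max 0 (weight p1 + y + 1))"
 have "walk (set p) a (p1 @ concat (replicate j c)) z" using walk_weaken[OF walk_self[OF p1(2)], of "set p"] walk_power[OF c(1)] p1(1) by (auto simp: walk_append)
 moreover have "int j * weight c <= int j * (- 1)" using c(2) by (intro mult_left_mono) auto
 hence "weight (p1 @ concat (replicate j c)) < - y" by (simp add: j_def)
 ultimately show ?thesis by (rule that)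
qed

text \<open>The walk is followed until its weight first reaches \<open>H\<close> and is then
  completed by a simple path, which changes the weight and needs credit at most
  \<open>card V * W\<close>. This caps the energy available at the deviation.\<close>

lemma bounded_prefix:
 assumes p: "walk E a p b" "set p <= K" "a : V" "credit p <= 0" "H <= weight p" "int (card V) * W <= H" "0 < H"
 obtains p' where "walk E a p' b" "set p' <= K" "credit p' <= 0" "H - int (card V) * W <= weight p'"
  "weight p' <= H + W + int (card V) * W"
proof -
 obtain p1 e p2 where s: "p = p1 @ e # p2" "weight p1 < H" "~ weight (p1 @ [e]) < H" by (rule split_prefix[of "%q. weight q < H" p]) (use p in auto)
 have e: "e : K" using p(2) s(1) by auto
 hence we: "wt e <= W" by (auto simp: K_def)
 obtain z where z: "walk E a (p1 @ [e]) z" "walk E z p2 b" using p(1) s(1) by (auto simp: walk_append)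
 have zV: "z : V" using walk_end_stops[OF z(1)] K_stops[OF z(1)] p(2,3) s(1) by auto
 obtain k where k: "abs (weight k) <= int (card V) * W" "walk (set p2) z k b" "length k <= card V" by (rule erased_weight[OF z(2) _ zV]) (use p(2) s(1) in auto)
 have kK: "set k <= K" using walk_subset[OF k(2)] p(2) s(1) by auto
 have "walk E z k b" using k(2) by (rule walk_weaken) (use walk_subset[OF p(1)] s(1) in auto)
 hence "walk E a ((p1 @ [e]) @ k) b" using z(1) unfolding walk_append by blast
 moreover have "credit k <= int (card V) * W" using K_credit[OF kK] k(3) W(1) mult_right_mono[of "int (length k)" "int (card V)" W] by linarith
 moreover have "credit (p1 @ [e]) <= 0" using p(4) s(1) credit_append[of "p1 @ [e]" p2] by simp
 ultimately show ?thesis using s k(1) p kK e we by (intro that[of "(p1 @ [e]) @ k"]) (auto simp: credit_append[of "p1 @ [e]"] simp del: append_assoc)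
qed

end

section \<open>Violations of the equilibrium conditions\<close>

text \<open>As \<open>None\<close> is absorbing, the level only records whether some prefix sum was
  negative. Energy payoffs thus become conditions on prefix sums.\<close>

lemma energy_level_eq:
 "energy_level r pp n = (if ALL m<=n. 0 <= (SUM k<m. r (pp k, pp (Suc k)))
   then Some (SUM k<n. r (pp k, pp (Suc k))) else None)" by (induction n) (auto simp: le_Suc_eq)

lemma energy_payoff_eq:
 "energy_payoff r pp = (if ALL m. 0 <= (SUM k<m. r (pp k, pp (Suc k))) then 1 else 0)" unfolding energy_payoff_def energy_level_eq by auto

definition true_step :: "('q, 'v) mealy => (('q * 'v) * ('q * 'v)) set" where
 "true_step M = {((p, u), (q, v)). (p, u, q, v) : mealy_trans M}"

text \<open>A history may leave the prescribed moves at any vertex, but the machine still updates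
  its state by some transition. Hence the output \<open>x\<close> is disregarded.\<close>

definition any_step :: "('p, 'v) game => ('q, 'v) mealy => (('q * 'v) * ('q * 'v)) set" where
 "any_step G M = {((p, u), (q, v)). (u, v) : edges G & (EX x. (p, u, q, x) : mealy_trans M)}"

text \<open>The other players follow the output \<open>x\<close>; at vertices of player
  \<open>i\<close> any edge may be taken, while the state follows the same transition.\<close>

definition dev_step :: "('p, 'v) game => ('q, 'v) mealy => 'p => (('q * 'v) * ('q * 'v)) set" where
 "dev_step G M i = {((p, u), (q, v)). (u, v) : edges G &
   (EX x. (p, u, q, x) : mealy_trans M & (v = x | u : owned G i))}"

text \<open>Player \<open>i\<close> profits from leaving the play \<open>f\<close> for the play \<open>g\<close> at position \<open>n\<close>. Both are
  given with the states of the machine; \<open>S\<close> contains the steps that are allowed before \<open>n\<close>.\<close>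

definition violation :: "('p, 'v) game => ('q, 'v) mealy => 'v => ('v * 'v => rat) =>
  (('q * 'v) * ('q * 'v)) set => 'p => bool" where
 "violation G M v0 r S i = (EX n f g. f 0 = (mealy_init M, v0) &
   (ALL k<n. (f k, f (Suc k)) : S) & (ALL k>=n. (f k, f (Suc k)) : true_step M) &
   snd (f n) : owned G i & (ALL k<=n. g k = f k) &
   fst (g (Suc n)) = fst (f (Suc n)) & snd (g (Suc n)) ~= snd (f (Suc n)) &
   (snd (g n), snd (g (Suc n))) : edges G & (ALL k>n. (g k, g (Suc k)) : dev_step G M i) &
   (EX m. (SUM k<m. r (snd (f k), snd (f (Suc k)))) < 0) &
   (ALL m. 0 <= (SUM k<m. r (snd (g k), snd (g (Suc k))))))"

section \<open>Histories and outcomes as prefixes of infinite words\<close>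

abbreviation pfx :: "(nat => 'a) => nat => 'a list" where
 "pfx w k == map w [0..<k]"

lemma pfx_Suc: "pfx w (Suc k) = pfx w k @ [w k]" by simp

lemma pfx_eq: "(pfx w k = pfx w' k) = (ALL j<k. w j = w' j)" by auto

lemma history_pfx:
 assumes "w 0 = v0" "!!k. (w k, w (Suc k)) : edges G" "edges G <= verts G \<times> verts G"
 shows "history G v0 (pfx w (Suc k))"
proof -
 have "w k : verts G" for k using assms(2)[of k] assms(3) by auto
 moreover have "successively (%u v. (u, v) : edges G) (pfx w (Suc k))" using assms(2) by (simp add: successively_conv_nth del: upt_Suc)
 ultimately show ?thesis using assms(1) by (auto simp: history_def hd_map simp del: upt_Suc)
qed

lemma outcome_0: "outcome G v0 si 0 = v0" by (simp add: outcome_def)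

lemma outcome_prefix_eq: "outcome_prefix G v0 si n = pfx (outcome G v0 si) (Suc n)"
proof (induction n)
 case (Suc n)
 have "outcome G v0 si (Suc n) = profile_move G si (outcome_prefix G v0 si n)" by (simp add: outcome_def)
 thus ?case using Suc by simp
qed (simp add: outcome_def)

lemma outcome_Suc: "outcome G v0 si (Suc n) = profile_move G si (pfx (outcome G v0 si) (Suc n))" unfolding outcome_prefix_eq[symmetric] by (simp add: outcome_def)

lemma outcome_eqI:
 assumes "w 0 = v0" "!!n. w (Suc n) = profile_move G si (pfx w (Suc n))"
 shows "outcome G v0 si = w"
proof
 fix n
 have "ALL k<=n. outcome G v0 si k = w k"
 proof (induction n)
  case (Suc n)
  have "pfx (outcome G v0 si) (Suc n) = pfx w (Suc n)" unfolding pfx_eq using Suc by auto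
  hence "outcome G v0 si (Suc n) = w (Suc n)" unfolding outcome_Suc[of G v0 si n] assms(2)[of n] by (rule arg_cong)
  thus ?case using Suc by (auto simp: le_Suc_eq)
 qed (simp add: outcome_0 assms)
 thus "outcome G v0 si n = w n" by simp
qed

lemma pfx_conc: "length h <= k ==> pfx (h \<frown> w) k = h @ pfx w (k - length h)" by (rule nth_equalityI) (auto simp: conc_def nth_append)

lemma conc_pfx: "pfx w m \<frown> (%k. w (m + k)) = w" by (auto simp: conc_def)

lemma subgame_simps [simp]:
 "edges (subgame G h) = edges G" "owned (subgame G h) = owned G" "players (subgame G h) = players G"
 "verts (subgame G h) = verts G" "owner (subgame G h) = owner G" "payoff (subgame G h) i pp = payoff G i (h \<frown> pp)"
 "strategy (subgame G h) v i = strategy G v i" "profile_move (subgame G h) si = profile_move G si"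
 by (auto simp: subgame_def owner_def strategy_def history_def profile_move_def fun_eq_iff)

lemma subgame_Nil: "subgame G [] = G" by (simp add: subgame_def)

section \<open>Equilibria characterised by violations\<close>

locale checked_game =
 fixes G :: "('p, 'v) game" and M :: "('q, 'v) mealy" and v0 :: 'v and r :: "'p => 'v * 'v => rat"
 assumes G: "wf_game G" and v0: "v0 : verts G" and M: "wf_mealy G M"
  and payoff: "payoff G = (%i. energy_payoff (r i))"
begin

lemma edges_verts: "edges G <= verts G \<times> verts G" using G by (simp add: wf_game_def)

lemma trans_states: "(p, u, q, v) : mealy_trans M ==>
  p : mealy_states M & q : mealy_states M & u : verts G & v : verts G & (u, v) : edges G" using M unfolding wf_mealy_def by fastforce

lemma true_any: "true_step M <= any_step G M" using trans_states by (fastforce simp: true_step_def any_step_def)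

lemma trans_total: "p : mealy_states M ==> u : verts G ==> EX qv. (p, u, qv) : mealy_trans M" using M unfolding wf_mealy_def by blast

lemma init_state: "mealy_init M : mealy_states M" using M by (simp add: wf_mealy_def)

lemma owner_eq: "i : players G ==> v : owned G i ==> owner G v = i" unfolding owner_def using G unfolding wf_game_def disjoint_family_on_def
 by (intro the_equality) (auto, metis disjoint_iff)

lemma owner_owned: "v : verts G ==> owner G v : players G & v : owned G (owner G v)" using G owner_eq unfolding wf_game_def by (metis UN_iff)

lemma history_verts: "history G v (h @ [u]) ==> u : verts G" by (auto simp: history_def)

lemma move_edge:
 assumes "strategy_profile G v0 si" "history G v0 (h @ [u])"
 shows "(u, profile_move G si (h @ [u])) : edges G"
proof -
 have "u : verts G" using assms(2) by (rule history_verts)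
 thus ?thesis using assms owner_owned[of u] by (simp add: profile_move_def strategy_profile_def strategy_def)
qed

lemma history_append:
 assumes "history G v0 (h @ [v])" "history G v h'"
 shows "history G v0 (h @ h')"
proof -
 obtain h'' where h': "h' = v # h''" using assms(2) by (cases h') (auto simp: history_def)
 show ?thesis using assms unfolding h' history_def by (cases "h = []") (auto simp: successively_append_iff hd_append successively_Cons)
qed

text \<open>Outcome and deviation in the subgame are prolonged by \<open>h\<close> to the plays
  \<open>w\<close> and \<open>w'\<close>, and \<open>n\<close> is the last position before they
  first differ. An empty history leaves only prescribed steps before \<open>n\<close>; otherwise
  \<open>h\<close> may contain arbitrary ones.\<close>

lemma violation_of_not_Nash:
 assumes si: "si : compatible G v0 M" and h: "history G v0 (h @ [v])"
  and n: "~ Nash_equilibrium (subgame G h) v (%i h'. si i (h @ h'))"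
  and S: "h ~= [] ==> any_step G M <= S" "true_step M <= S"
 shows "EX i:players G. violation G M v0 (r i) S i"
proof -
 let ?si = "%i h'. si i (h @ h')"
 obtain i s where i: "i : players G" and s: "strategy G v i s"
  and pay: "payoff G i (h \<frown> outcome (subgame G h) v ?si) < payoff G i (h \<frown> outcome (subgame G h) v (?si(i := s)))"
  using n by (auto simp: Nash_equilibrium_def not_le)
 define pp where "pp = outcome (subgame G h) v ?si"
 define pp' where "pp' = outcome (subgame G h) v (?si(i := s))"
 define w where "w = h \<frown> pp"
 define w' where "w' = h \<frown> pp'"
 obtain st where st: "st [] = mealy_init M"
  "!!h v. history G v0 (h @ [v]) ==> (st h, v, st (h @ [v]), profile_move G si (h @ [v])) : mealy_trans M"
  and sp: "strategy_profile G v0 si" using si by (auto simp: compatible_def)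
 let ?l = "length h" and ?H = "%z k. history G v0 (pfx z (Suc k))"
 have pi0: "pp 0 = v" "pp' 0 = v" by (simp_all add: pp_def pp'_def outcome_0)
 have move_w: "w (Suc k) = profile_move G si (pfx w (Suc k))" if "?l <= k" for k
 proof -
  have "w (Suc k) = pp (Suc (k - ?l))" using that by (simp add: w_def conc_def Suc_diff_le)
  also have "... = profile_move G ?si (pfx pp (Suc (k - ?l)))" unfolding pp_def by (subst outcome_Suc) simp
  also have "... = profile_move G si (h @ pfx pp (Suc (k - ?l)))" by (simp add: profile_move_def)
  also have "h @ pfx pp (Suc (k - ?l)) = pfx w (Suc k)" unfolding w_def using that by (subst pfx_conc) (auto simp: Suc_diff_le simp del: upt_Suc)
  finally show ?thesis .
 qed
 have move_w': "w' (Suc k) = (if owner G (w' k) = i then s (pfx pp' (Suc (k - ?l))) else profile_move G si (pfx w' (Suc k)))"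
  if "?l <= k" for k
 proof -
  have wk: "w' k = pp' (k - ?l)" using that by (simp add: w'_def conc_def)
  have "w' (Suc k) = pp' (Suc (k - ?l))" using that by (simp add: w'_def conc_def Suc_diff_le)
  also have "... = profile_move G (?si(i := s)) (pfx pp' (Suc (k - ?l)))" unfolding pp'_def by (subst outcome_Suc) simp
  also have "... = (if owner G (w' k) = i then s (pfx pp' (Suc (k - ?l))) else profile_move G si (h @ pfx pp' (Suc (k - ?l))))" by (simp add: profile_move_def wk)
  also have "h @ pfx pp' (Suc (k - ?l)) = pfx w' (Suc k)" unfolding w'_def using that by (subst pfx_conc) (auto simp: Suc_diff_le simp del: upt_Suc)
  finally show ?thesis .
 qed
 have early: "w k = w' k" "pfx w k = take k h" if "k <= ?l" for k using that pi0 by (auto simp: w_def w'_def conc_def intro: nth_equalityI)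
 have hist0: "?H w ?l"
 proof -
  have "pfx w (Suc ?l) = h @ [v]" using early(2)[of ?l] pi0 by (simp add: w_def conc_def)
  thus ?thesis using h by simp
 qed
 have hist_mono: "?H z k" if "?H z l" "k <= l" for z k l
 proof -
  have "pfx z (Suc k) = take (Suc k) (pfx z (Suc l))" using that(2) by (simp add: take_map del: upt_Suc)
  moreover have "set (take (Suc k) (pfx z (Suc l))) <= set (pfx z (Suc l))" by (rule set_take_subset)
  ultimately show ?thesis using that unfolding history_def successively_conv_nth by (auto simp: hd_take simp del: upt_Suc set_map set_upt)
 qed
 have hist_step: "?H z (Suc k)"
  if "?H z k" "(z k, z (Suc k)) : edges G" for z k
  using that edges_verts unfolding history_def pfx_Suc[of z "Suc k"] pfx_Suc[of z k] by (auto simp: successively_append_iff hd_append)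
 have hist_w: "?H w k" for k
 proof (induction k)
  case 0 show ?case by (rule hist_mono[OF hist0]) simp
 next case (Suc k)
  show ?case
  proof (cases "?l <= k")
   case True
   have "(w k, w (Suc k)) : edges G" using move_edge[OF sp, of "pfx w k" "w k"] Suc move_w[OF True] by (simp add: pfx_Suc)
   thus ?thesis using Suc hist_step by blast
 next case False thus ?thesis by (intro hist_mono[OF hist0]) simp
  qed
 qed
 have hist_w': "?H w' k" for k
 proof (induction k)
  case 0
  have "pfx w' (Suc 0) = pfx w (Suc 0)" using early(1)[of 0] by simp
  thus ?case using hist_w[of 0] by simp
 next case (Suc k)
  show ?case
  proof (cases "?l <= k")
   case True
   have "(w' k, w' (Suc k)) : edges G"
   proof (cases "owner G (w' k) = i")
    case o: True
    have wk: "w' k = pp' (k - ?l)" using True by (simp add: w'_def conc_def)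
    have "w' k : verts G" using Suc history_verts[of v0 "pfx w' k"] by (simp add: pfx_Suc)
    hence own: "w' k : owned G i" using owner_owned o by metis
    have "pfx w' (Suc k) = h @ pfx pp' (Suc (k - ?l))" unfolding w'_def using True by (subst pfx_conc) (auto simp: Suc_diff_le simp del: upt_Suc)
    hence *: "history G v0 (h @ pfx pp' (Suc (k - ?l)))" using Suc by simp
    hence "history G v (pfx pp' (Suc (k - ?l)))" unfolding history_def using pi0 by (auto simp: successively_append_iff hd_map simp del: upt_Suc)
    thus ?thesis using s own wk o move_w'[OF True] unfolding strategy_def by (auto simp: pfx_Suc)
   next case False
    thus ?thesis using move_edge[OF sp, of "pfx w' k" "w' k"] Suc move_w'[OF True] by (simp add: pfx_Suc)
   qed
   thus ?thesis using Suc hist_step by blast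
  next case False
   hence e: "pfx w' (Suc (Suc k)) = pfx w (Suc (Suc k))" using early(1) by (auto simp: pfx_eq simp del: upt_Suc)
   show ?thesis unfolding e by (rule hist_w)
  qed
 qed
 have edge: "(z k, z (Suc k)) : edges G" if "!!k. ?H z k" for z k
  using that[of "Suc k"] unfolding history_def pfx_Suc[of z "Suc k"] pfx_Suc[of z k] by (auto simp: successively_append_iff)
 have tr: "(st (pfx z k), z k, st (pfx z (Suc k)), profile_move G si (pfx z (Suc k))) : mealy_trans M"
  if "?H z k" for z k using st(2)[of "pfx z k" "z k"] that by (simp add: pfx_Suc)
 have lose: "~ (ALL m. 0 <= (SUM k<m. r i (w k, w (Suc k))))" and win: "ALL m. 0 <= (SUM k<m. r i (w' k, w' (Suc k)))"
  using pay unfolding payoff pp_def[symmetric] pp'_def[symmetric] w_def[symmetric] w'_def[symmetric] energy_payoff_eq by (auto split: if_splits)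
 hence "EX n. w (Suc n) ~= w' (Suc n)"
 proof (rule_tac ccontr)
  assume "~ (EX n. w (Suc n) ~= w' (Suc n))"
  hence "w k = w' k" for k using early(1)[of 0] by (cases k) auto
  thus False using lose win by presburger
 qed
 then obtain n where n: "w (Suc n) ~= w' (Suc n)" "!!k. k < n ==> w (Suc k) = w' (Suc k)" using exists_least_iff[of "%n. w (Suc n) ~= w' (Suc n)"] by blast
 have agree: "w k = w' k" if "k <= n" for k using n(2)[of "k - 1"] early(1)[of 0] that by (cases k) auto
 have ln: "?l <= n" using n(1) early(1)[of "Suc n"] by linarith
 have agree': "pfx w k = pfx w' k" if "k <= Suc n" for k using agree that by (auto simp: pfx_eq)
 \<comment> \<open>Both plays have the same history at \<open>n\<close>, so any other owner would
   make the same move on both.\<close>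
 have own: "owner G (w n) = i"
 proof (rule ccontr)
  assume "owner G (w n) ~= i"
  hence "w' (Suc n) = profile_move G si (pfx w' (Suc n))" using move_w'[OF ln] agree[of n] by simp
  also have "... = w (Suc n)" unfolding move_w[OF ln] agree'[OF order_refl] ..
  finally show False using n(1) by simp
 qed
 have wv: "w k : verts G" "w' k : verts G" for k using edge[OF hist_w, of k] edge[OF hist_w', of k] edges_verts by auto
 define f where "f = (%k. (st (pfx w k), w k))"
 define g where "g = (%k. (st (pfx w' k), w' k))"
 have fT: "(f k, f (Suc k)) : true_step M" if "?l <= k" for k using tr[OF hist_w, of k] move_w[OF that] by (simp add: f_def true_step_def del: upt_Suc)
 have fA: "(f k, f (Suc k)) : any_step G M" for k using tr[OF hist_w, of k] edge[OF hist_w, of k] by (auto simp: f_def any_step_def simp del: upt_Suc)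
 have "violation G M v0 (r i) S i" unfolding violation_def
 proof (rule exI[of _ n], rule exI[of _ f], rule exI[of _ g], intro conjI allI impI)
  show "f 0 = (mealy_init M, v0)" using st(1) hist_w[of 0] by (simp add: f_def history_def)
  show "(f k, f (Suc k)) : S" for k using fA[of k] fT[of k] S by (cases "h = []") auto
  show "(f k, f (Suc k)) : true_step M" if "n <= k" for k using fT[of k] ln that by simp
  show "snd (f n) : owned G i" using own owner_owned[OF wv(1)] by (auto simp: f_def)
  show "g k = f k" if "k <= n" for k
  proof -
   have "pfx w k = pfx w' k" using that by (intro agree') simp
   thus ?thesis unfolding f_def g_def using agree[OF that] by metis
  qed
  show "fst (g (Suc n)) = fst (f (Suc n))" unfolding f_def g_def fst_conv agree'[OF order_refl] ..
  show "snd (g (Suc n)) ~= snd (f (Suc n))" using n(1) by (simp add: f_def g_def)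
  show "(snd (g n), snd (g (Suc n))) : edges G" using edge[OF hist_w', of n] by (simp add: g_def)
  show "(g k, g (Suc k)) : dev_step G M i" if "n < k" for k
  proof -
   have "?l <= k" using that ln by simp
   hence "w' k : owned G i | w' (Suc k) = profile_move G si (pfx w' (Suc k))" using move_w'[of k] owner_owned[OF wv(2)[of k]] by auto
   thus ?thesis using tr[OF hist_w', of k] edge[OF hist_w', of k] by (auto simp: g_def dev_step_def simp del: upt_Suc)
  qed
  show "EX m. (SUM k<m. r i (snd (f k), snd (f (Suc k)))) < 0" using lose by (auto simp: f_def not_le)
  show "0 <= (SUM k<m. r i (snd (g k), snd (g (Suc k))))" for m using win by (simp add: g_def)
 qed
 thus ?thesis using i by blast
qed

text \<open>The histories along the two plays coincide up to \<open>n\<close> and are different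
  afterwards, so a single profile can follow the required transitions on both. Elsewhere it takes
  arbitrary transitions of the machine.\<close>

lemma not_Nash_of_violation:
 assumes viol: "violation G M v0 (r i) S i" and i: "i : players G" and S: "S <= any_step G M"
 obtains si h v where "si : compatible G v0 M" "history G v0 (h @ [v])"
  "~ Nash_equilibrium (subgame G h) v (%i h'. si i (h @ h'))" "S <= true_step M ==> h = []"
proof -
 obtain n f g where f: "f 0 = (mealy_init M, v0)" "!!k. k < n ==> (f k, f (Suc k)) : S"
  "!!k. n <= k ==> (f k, f (Suc k)) : true_step M" "snd (f n) : owned G i"
  and gf: "!!k. k <= n ==> g k = f k" "fst (g (Suc n)) = fst (f (Suc n))" "snd (g (Suc n)) ~= snd (f (Suc n))"
  and g: "(snd (g n), snd (g (Suc n))) : edges G" "!!k. n < k ==> (g k, g (Suc k)) : dev_step G M i"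
  and sums: "EX m. (SUM k<m. r i (snd (f k), snd (f (Suc k)))) < 0" "!!m. 0 <= (SUM k<m. r i (snd (g k), snd (g (Suc k))))" using viol unfolding violation_def by blast
 define w where "w = (%k. snd (f k))"
 define w' where "w' = (%k. snd (g k))"
 \<comment> \<open>If all steps before \<open>n\<close> are prescribed ones, the deviation is
   observed from the initial vertex. Otherwise the subgame starts at the point of deviation.\<close>
 define m where "m = (if S <= true_step M then 0 else n)"
 have mn: "m <= n" by (simp add: m_def)
 have fany: "(f k, f (Suc k)) : any_step G M" for k using f(2)[of k] f(3)[of k] S true_any by (cases "k < n") auto
 have ftrue: "(f k, f (Suc k)) : true_step M" if "m <= k" for k using f(2)[of k] f(3)[of k] that by (cases "k < n") (auto simp: m_def split: if_splits)
 have wedge: "(w k, w (Suc k)) : edges G" for k using fany[of k] by (auto simp: any_step_def w_def)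
 have ww': "w k = w' k" if "k <= n" for k using gf(1)[OF that] by (simp add: w_def w'_def)
 have wedge': "(w' k, w' (Suc k)) : edges G" for k
 proof -
  consider "k < n" | "k = n" | "n < k" by linarith
  thus ?thesis
  proof cases
   case 1 thus ?thesis using wedge[of k] ww'[of k] ww'[of "Suc k"] by simp
next case 2 thus ?thesis using g(1) by (simp add: w'_def)
 next case 3 thus ?thesis using g(2)[of k] by (auto simp: dev_step_def w'_def)
  qed
 qed
 define out where "out = (%k. if m <= k then w (Suc k) else SOME x. (fst (f k), w k, fst (f (Suc k)), x) : mealy_trans M)"
 have out: "(fst (f k), w k, fst (f (Suc k)), out k) : mealy_trans M" for k
 proof (cases "m <= k")
  case True thus ?thesis using ftrue[OF True] by (auto simp: out_def w_def true_step_def)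
 next case False
  have "EX x. (fst (f k), w k, fst (f (Suc k)), x) : mealy_trans M" using fany[of k] by (auto simp: any_step_def w_def)
  from someI_ex[OF this] False show ?thesis by (simp add: out_def)
 qed
 \<comment> \<open>Up to \<open>n\<close> the histories and thus the outputs are the same; the
   second play departs from the output at \<open>n\<close>. Later outputs are witnesses of
   \<open>dev_step\<close>.\<close>
 define out' where "out' = (%k. if k <= n then out k else
   SOME x. (fst (g k), w' k, fst (g (Suc k)), x) : mealy_trans M & (w' (Suc k) = x | w' k : owned G i))"
 have out'_late: "(fst (g k), w' k, fst (g (Suc k)), out' k) : mealy_trans M & (w' (Suc k) = out' k | w' k : owned G i)"
  if "n < k" for k
 proof -
  have "EX x. (fst (g k), w' k, fst (g (Suc k)), x) : mealy_trans M & (w' (Suc k) = x | w' k : owned G i)" using g(2)[OF that] by (auto simp: dev_step_def w'_def)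
  from someI_ex[OF this] that show ?thesis by (simp add: out'_def)
 qed
 have fst_g: "fst (g k) = fst (f k)" if "k <= Suc n" for k using gf(1)[of k] gf(2) that by (cases "k = Suc n") auto
 have out': "(fst (g k), w' k, fst (g (Suc k)), out' k) : mealy_trans M" for k
  using out'_late[of k] out[of k] fst_g[of k] fst_g[of "Suc k"] ww'[of k] by (cases "n < k") (auto simp: out'_def)
 \<comment> \<open>The tests on \<open>p\<close> make the result a transition of the machine for
   every state \<open>p\<close>, even one that does not belong to the history.\<close>
 define T where "T = (%h v p. if p = fst (f (length h)) & h @ [v] = pfx w (Suc (length h))
   then (fst (f (Suc (length h))), out (length h))
  else if p = fst (g (length h)) & h @ [v] = pfx w' (Suc (length h))
   then (fst (g (Suc (length h))), out' (length h))
  else SOME qx. (p, v, qx) : mealy_trans M)"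
 have T: "(p, v, T h v p) : mealy_trans M" if pv: "p : mealy_states M" "v : verts G" for h v p
 proof -
  have l: "v = z (length h)" if "h @ [v] = pfx z (Suc (length h))" for z using that by (simp add: pfx_Suc)
  have "(p, v, SOME qx. (p, v, qx) : mealy_trans M) : mealy_trans M" using trans_total[OF pv] by (rule someI_ex)
  thus ?thesis using out[of "length h"] out'[of "length h"] l[of w] l[of w'] by (auto simp: T_def)
 qed
 define st where "st = (%h. snd (foldl (%(h, p) v. (h @ [v], fst (T h v p))) ([], mealy_init M) h))"
 have st_fst: "fst (foldl (%(h, p) v. (h @ [v], fst (T h v p))) (h0, p0) h) = h0 @ h" for h0 p0 h by (induction h arbitrary: h0 p0) auto
 have st0: "st [] = mealy_init M" by (simp add: st_def)
 have st1: "st (h @ [v]) = fst (T h v (st h))" for h v using st_fst[of "[]" "mealy_init M" h] by (auto simp: st_def split: prod.splits)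
 define si :: "('p, 'v) profile" where "si = (%j h. snd (T (butlast h) (last h) (st (butlast h))))"
 have si: "si j (h @ [v]) = snd (T h v (st h))" "profile_move G si (h @ [v]) = snd (T h v (st h))" for j h v by (simp_all add: si_def profile_move_def)
 have st_states: "st h : mealy_states M" if "set h <= verts G" for h using that
 proof (induction h rule: rev_induct)
  case (snoc v h)
  thus ?case using T[of "st h" v h] trans_states[of "st h" v "fst (T h v (st h))" "snd (T h v (st h))"] by (simp add: st1)
 qed (simp add: st0 init_state)
 have trans: "(st h, v, st (h @ [v]), profile_move G si (h @ [v])) : mealy_trans M" if "history G u (h @ [v])" for u h v
  using T[of "st h" v h] st_states[of h] that by (auto simp: history_def st1 si)
 have comp: "si : compatible G v0 M" unfolding compatible_def strategy_profile_def strategy_def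
 proof (intro CollectI conjI ballI allI impI exI[of _ st])
  fix j h v assume "history G v0 (h @ [v]) & v : owned G j"
  thus "(v, si j (h @ [v])) : edges G" using trans[of v0 h v] trans_states by (fastforce simp: si)
 qed (use st0 trans in auto)
 have st_w: "st (pfx w k) = fst (f k)" for k by (induction k) (auto simp: st0 f(1) st1 T_def)
 have same: "pfx w' (Suc k) = pfx w (Suc k)" if "k <= n" for k using that ww' by (auto simp: pfx_eq simp del: upt_Suc)
 have differ: "pfx w' (Suc k) ~= pfx w (Suc k)" if "~ k <= n" for k using that gf(3) unfolding pfx_eq by (auto simp: w_def w'_def intro!: exI[of _ "Suc n"])
 have st_w': "st (pfx w' k) = fst (g k)" for k
 proof (induction k)
  case 0 thus ?case using gf(1)[of 0] f(1) by (simp add: st0)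
 next case (Suc k)
  show ?case
  proof (cases "k <= n")
   case True note e = same[OF True]
   show ?thesis unfolding e st_w using fst_g[of "Suc k"] True by simp
  next case False note differ[OF False]
  thus ?thesis using Suc by (auto simp: st1 T_def)
  qed
 qed
 have move_w: "profile_move G si (pfx w (Suc k)) = out k" for k using st_w[of k] by (simp add: si T_def)
 have move_w': "profile_move G si (pfx w' (Suc k)) = out' k" for k
 proof (cases "k <= n")
  case True note e = same[OF True]
  show ?thesis unfolding e move_w using True by (simp add: out'_def)
 next case False note differ[OF False]
  thus ?thesis using st_w'[of k] by (auto simp: si T_def)
 qed
 define h where "h = pfx w m"
 have w0: "w 0 = v0" using f(1) by (simp add: w_def)
 have h: "history G v0 (h @ [w m])" using history_pfx[of w v0 G m] w0 wedge edges_verts by (simp add: h_def)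
 have h': "h = pfx w' m" using ww' mn by (auto simp: h_def)
 let ?si = "%i h'. si i (h @ h')"
 let ?v = "%k. w (m + k)" and ?v' = "%k. w' (m + k)"
 have shift: "h @ pfx ?v j = pfx w (m + j)" for j by (rule nth_equalityI) (auto simp: h_def nth_append)
 have shift': "h @ pfx ?v' j = pfx w' (m + j)" for j by (rule nth_equalityI) (auto simp: h' nth_append)
 have pm: "profile_move G ?si u = profile_move G si (h @ u)" if "u ~= []" for u using that by (simp add: profile_move_def)
 have out1: "outcome (subgame G h) (w m) ?si = ?v"
 proof (rule outcome_eqI)
  fix k
  have "profile_move G ?si (pfx ?v (Suc k)) = out (m + k)" using pm shift[of "Suc k"] move_w[of "m + k"] by (simp del: upt_Suc)
  thus "w (m + Suc k) = profile_move (subgame G h) ?si (pfx ?v (Suc k))" by (simp add: out_def del: upt_Suc)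
 qed simp
 define s where "s = (%u. if u = pfx ?v' (length u) then w' (m + length u) else si i (h @ u))"
 have s: "strategy G (w m) i s" unfolding strategy_def
 proof (intro allI impI, elim conjE)
  fix u v assume u: "history G (w m) (u @ [v])" "v : owned G i"
  show "(v, s (u @ [v])) : edges G"
  proof (cases "u @ [v] = pfx ?v' (Suc (length u))")
   case True hence "v = w' (m + length u)" by (simp add: pfx_Suc)
   thus ?thesis using True wedge'[of "m + length u"] by (simp add: s_def)
  next case False
   have "history G v0 ((h @ u) @ [v])" using history_append[OF h u(1)] by simp
   from trans[OF this] have "(v, profile_move G si ((h @ u) @ [v])) : edges G" using trans_states by blast
   hence "(v, si i ((h @ u) @ [v])) : edges G" unfolding si .
   thus ?thesis using False by (auto simp: s_def)
  qed
 qed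
 have out2: "outcome (subgame G h) (w m) (?si(i := s)) = ?v'"
 proof (rule outcome_eqI)
  show "w' (m + 0) = w m" using ww'[OF mn] by simp
  fix k
  let ?u = "pfx ?v' (Suc k)"
  have l: "last ?u = w' (m + k)" by simp
  show "w' (m + Suc k) = profile_move (subgame G h) (?si(i := s)) ?u"
  proof (cases "owner G (w' (m + k)) = i")
   case True hence "profile_move G (?si(i := s)) ?u = s ?u" unfolding profile_move_def l by simp
   also have "... = w' (m + Suc k)" by (simp add: s_def del: upt_Suc)
   finally show ?thesis by simp
  next case False
   hence "profile_move G (?si(i := s)) ?u = profile_move G si (h @ ?u)" unfolding profile_move_def l by (simp add: profile_move_def)
   also have "... = out' (m + k)" using shift'[of "Suc k"] move_w'[of "m + k"] by (simp del: upt_Suc)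
   also have "... = w' (m + Suc k)"
   proof -
    consider "n < m + k" | "m + k = n" | "m + k < n" by linarith
    thus ?thesis
    proof cases
     case 1
     have "w' (m + k) ~: owned G i" using False owner_eq[OF i] by blast
     thus ?thesis using out'_late[OF 1] by simp
    next case 2
     hence "w' (m + k) : owned G i" using f(4) ww'[of n] by (simp add: w_def)
     thus ?thesis using False owner_eq[OF i] by blast
    next case 3
     thus ?thesis using ww'[of "Suc (m + k)"] by (simp add: out'_def out_def)
    qed
   qed
   finally show ?thesis by simp
  qed
 qed
 have "energy_payoff (r i) w = 0" "energy_payoff (r i) w' = 1" using sums unfolding energy_payoff_eq w_def w'_def by (auto simp: not_le)
 moreover have "h \<frown> ?v = w" "h \<frown> ?v' = w'" unfolding h_def conc_pfx by (simp_all add: h_def[symmetric] h' conc_pfx)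
 ultimately have "~ Nash_equilibrium (subgame G h) (w m) ?si" unfolding Nash_equilibrium_def using i s out1 out2 by (auto simp: payoff intro!: bexI[of _ i] exI[of _ s])
 thus ?thesis using that[OF comp h] by (simp add: h_def m_def)
qed

theorem Nash_iff:
 "(ALL si:compatible G v0 M. Nash_equilibrium G v0 si) =
   (ALL i:players G. ~ violation G M v0 (r i) (true_step M) i)"
proof
 assume L: "ALL si:compatible G v0 M. Nash_equilibrium G v0 si"
 show "ALL i:players G. ~ violation G M v0 (r i) (true_step M) i"
 proof (intro ballI notI)
  fix i assume i: "i : players G" "violation G M v0 (r i) (true_step M) i"
  from not_Nash_of_violation[OF i(2,1) true_any] obtain si h v where
   si: "si : compatible G v0 M" "history G v0 (h @ [v])"
   "~ Nash_equilibrium (subgame G h) v (%i h'. si i (h @ h'))" "h = []" by auto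
  moreover have "v = v0" using si(2,4) by (auto simp: history_def)
  ultimately show False using L by (auto simp: subgame_Nil)
 qed
next
 assume R: "ALL i:players G. ~ violation G M v0 (r i) (true_step M) i"
 show "ALL si:compatible G v0 M. Nash_equilibrium G v0 si"
 proof (rule ballI, rule ccontr)
  fix si assume si: "si : compatible G v0 M" "~ Nash_equilibrium G v0 si"
  have "history G v0 ([] @ [v0])" using v0 by (simp add: history_def)
  from violation_of_not_Nash[OF si(1) this, of "true_step M"] si(2) R show False by (auto simp: subgame_Nil)
 qed
qed

theorem subgame_perfect_iff:
 "(ALL si:compatible G v0 M. subgame_perfect_equilibrium G v0 si) =
   (ALL i:players G. ~ violation G M v0 (r i) (any_step G M) i)"
proof
 assume L: "ALL si:compatible G v0 M. subgame_perfect_equilibrium G v0 si"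
 show "ALL i:players G. ~ violation G M v0 (r i) (any_step G M) i"
 proof (intro ballI notI)
  fix i assume i: "i : players G" "violation G M v0 (r i) (any_step G M) i"
  from not_Nash_of_violation[OF i(2,1) order_refl] L show False unfolding subgame_perfect_equilibrium_def by metis
 qed
next
 assume R: "ALL i:players G. ~ violation G M v0 (r i) (any_step G M) i"
 show "ALL si:compatible G v0 M. subgame_perfect_equilibrium G v0 si" unfolding subgame_perfect_equilibrium_def using violation_of_not_Nash true_any R by blast
qed

end

section \<open>Stack programs and their compilation to Turing machines\<close>

datatype com = Push nat bool | Pop nat | Shift nat | Skip | Seq com com (infixr ";;" 60)
 | Case nat com com com | Loop nat "nat set" com

text \<open>A tape holds a stack whose top is under the head; \<open>b\<close> is the cell right of its bottom.\<close>

definition stack_tape :: "bool list => int => tape" where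
 "stack_tape w b = (%x. word_cells w (x - (b - int (length w))), b - int (length w))"

definition bit_symbol :: "bool => nat" where
 "bit_symbol x = (if x then 2 else 1)"

definition top_symbol :: "bool list => nat" where
 "top_symbol w = (case w of [] => 0 | x # _ => bit_symbol x)"

lemma top_symbol_simps [simp]:
 "top_symbol [] = 0" "top_symbol (False # w) = 1" "top_symbol (True # w) = 2" by (auto simp: top_symbol_def bit_symbol_def)

type_synonym state = "(nat => bool list) * (nat => int)"

inductive exec :: "com => state => nat => state => bool" where
 Push: "exec (Push i x) (s, b) 2 (s(i := x # s i), b)"
| Pop: "s i ~= [] ==> exec (Pop i) (s, b) 1 (s(i := tl (s i)), b)"
| Shift: "s i = [] ==> exec (Shift i) (s, b) 1 (s, b(i := b i + 1))"
| Skip: "exec Skip s 1 s"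
| Seq: "exec c s m s' ==> exec d s' n s'' ==> exec (c ;; d) s (m + n) s''"
| Case0: "top_symbol (fst s i) = 0 ==> exec c0 s n s' ==> exec (Case i c0 c1 c2) s (Suc n) s'"
| Case1: "top_symbol (fst s i) = 1 ==> exec c1 s n s' ==> exec (Case i c0 c1 c2) s (Suc n) s'"
| Case2: "top_symbol (fst s i) = 2 ==> exec c2 s n s' ==> exec (Case i c0 c1 c2) s (Suc n) s'"
| Loop_end: "top_symbol (fst s i) ~: S ==> exec (Loop i S c) s 1 s"
| Loop_step: "top_symbol (fst s i) : S ==> exec c s m s' ==> exec (Loop i S c) s' n s'' ==>
  exec (Loop i S c) s (Suc (m + n)) s''"

lemma exec_growth: "exec c s n s' ==> length (fst s' i) <= length (fst s i) + n" by (induction rule: exec.induct) auto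

section \<open>Translation of programs into transition functions\<close>

fun com_tapes :: "com => nat set" where
 "com_tapes (Push i x) = {i}"
| "com_tapes (Pop i) = {i}"
| "com_tapes (Shift i) = {i}"
| "com_tapes Skip = {}"
| "com_tapes (c ;; d) = com_tapes c \<union> com_tapes d"
| "com_tapes (Case i c0 c1 c2) = {i} \<union> com_tapes c0 \<union> com_tapes c1 \<union> com_tapes c2"
| "com_tapes (Loop i S c) = {i} \<union> com_tapes c"

fun com_size :: "com => nat" where
 "com_size (Push i x) = 2"
| "com_size (Pop i) = 1"
| "com_size (Shift i) = 1"
| "com_size Skip = 1"
| "com_size (c ;; d) = com_size c + com_size d"
| "com_size (Case i c0 c1 c2) = Suc (com_size c0 + com_size c1 + com_size c2)"
| "com_size (Loop i S c) = Suc (com_size c)"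

definition idle :: "nat list => (nat \<times> move) list" where
 "idle a = map (%x. (x, Stay)) a"

text \<open>The code of a program occupies the states from \<open>b\<close> on, \<open>b\<close> is its entry and \<open>e\<close> its exit.\<close>

fun code :: "com => nat => nat => nat => nat list => nat * (nat \<times> move) list" where
 "code (Push i x) b e q a = (if q = b then (Suc b, (idle a)[i := (a ! i, Move_Left)])
   else (e, (idle a)[i := (bit_symbol x, Stay)]))"
| "code (Pop i) b e q a = (e, (idle a)[i := (0, Move_Right)])"
| "code (Shift i) b e q a = (e, (idle a)[i := (0, Move_Right)])"
| "code Skip b e q a = (e, idle a)"
| "code (c ;; d) b e q a = (if q < b + com_size c then code c b (b + com_size c) q a
   else code d (b + com_size c) e q a)"
| "code (Case i c0 c1 c2) b e q a = (let b1 = Suc b + com_size c0; b2 = b1 + com_size c1 in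
   if q = b then (if a ! i = 0 then Suc b else if a ! i = 1 then b1 else b2, idle a)
   else if q < b1 then code c0 (Suc b) e q a
   else if q < b2 then code c1 b1 e q a else code c2 b2 e q a)"
| "code (Loop i S c) b e q a = (if q = b then (if a ! i : S then Suc b else e, idle a)
   else code c (Suc b) b q a)"

lemma com_size_pos: "0 < com_size c" by (induction c) auto

lemma code_wf:
 assumes "b <= q" "q < b + com_size c" "ALL x:set a. x < 3" "com_tapes c <= {..<length a}"
 shows "(fst (code c b e q a) = e | fst (code c b e q a) < b + com_size c) &
  length (snd (code c b e q a)) = length a & (ALL x:set (snd (code c b e q a)). fst x < 3)" using assms
proof (induction c arbitrary: b e)
 case (Seq c d) show ?case
 proof (cases "q < b + com_size c")
  case True thus ?thesis using Seq.IH(1)[of b "b + com_size c"] Seq.prems com_size_pos[of d] by auto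
 next case False
  thus ?thesis using Seq.IH(2)[of "b + com_size c" e] Seq.prems by auto
 qed
next case (Case i c0 c1 c2)
 let ?b1 = "Suc b + com_size c0" and ?b2 = "Suc b + com_size c0 + com_size c1"
 consider "q = b" | "b < q" "q < ?b1" | "?b1 <= q" "q < ?b2" | "?b2 <= q" using Case.prems by linarith
 thus ?case
 proof cases
  case 1
  thus ?thesis using Case.prems com_size_pos[of c0] com_size_pos[of c1] com_size_pos[of c2] by (auto simp: idle_def)
next case 2 thus ?thesis using Case.IH(1)[of "Suc b" e] Case.prems by (auto simp: Let_def)
next case 3 thus ?thesis using Case.IH(2)[of ?b1 e] Case.prems by (auto simp: Let_def)
next case 4 thus ?thesis using Case.IH(3)[of ?b2 e] Case.prems by (auto simp: Let_def)
 qed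
next case (Loop i S c)
 thus ?case using Loop.IH[of "Suc b" b] com_size_pos[of c] by (cases "q = b") (auto simp: idle_def)
qed (auto simp: idle_def bit_symbol_def dest!: set_update_subset_insert[THEN subsetD])

definition com_tm :: "nat => com => turing_machine" where
 "com_tm K c = \<lparr>tm_tapes = K, tm_states = Suc (com_size c), tm_symbols = 3, tm_start = 0, tm_halt = com_size c,
   tm_delta = (%q a. if q < com_size c then code c 0 (com_size c) q a else (q, idle a))\<rparr>"

lemma wf_com_tm:
 assumes "com_tapes c <= {..<K}" "1 <= K"
 shows "wf_tm (com_tm K c)"
proof -
 have "case tm_delta (com_tm K c) q a of (q', acts) =>
   q' < tm_states (com_tm K c) & length acts = K & (ALL (x, m):set acts. x < 3)"
  if a: "q < Suc (com_size c)" "length a = K" "ALL x:set a. x < 3" for q a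
 proof (cases "q < com_size c")
  case True
  have "(fst (code c 0 (com_size c) q a) = com_size c | fst (code c 0 (com_size c) q a) < 0 + com_size c) &
   length (snd (code c 0 (com_size c) q a)) = length a & (ALL x:set (snd (code c 0 (com_size c) q a)). fst x < 3)" by (rule code_wf) (use a assms True in auto)
  thus ?thesis using True a by (auto simp: com_tm_def case_prod_beta)
 next case False
  thus ?thesis using a by (auto simp: com_tm_def idle_def)
 qed
 thus ?thesis using assms by (auto simp: wf_tm_def com_tm_def)
qed

section \<open>Simulation of executions by machine steps\<close>

definition tapes_of :: "nat => state => tape list" where
 "tapes_of K s = map (%i. stack_tape (fst s i) (snd s i)) [0..<K]"

lemma word_cells_Cons: "word_cells (x # w) y = (if y = 0 then bit_symbol x else word_cells w (y - 1))"
 by (auto simp: word_cells_def bit_symbol_def nth_Cons split: nat.splits) (simp_all add: nat_diff_distrib')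

lemma stack_tape_top: "(case stack_tape w b of (cs, p) => cs p) = top_symbol w"
 by (cases w) (auto simp: stack_tape_def word_cells_Cons word_cells_def[of "[]"] top_symbol_def)

lemma stack_tape_Stay: "tape_act (top_symbol w, Stay) (stack_tape w b) = stack_tape w b" using stack_tape_top[of w b] by (auto simp: stack_tape_def fun_eq_iff)

lemma stack_tape_push:
 "tape_act (bit_symbol x, Stay) (tape_act (top_symbol w, Move_Left) (stack_tape w b)) = stack_tape (x # w) b"
 using stack_tape_top[of w b] by (auto simp: stack_tape_def fun_eq_iff word_cells_Cons algebra_simps)

lemma word_cells_neg: "y < 0 ==> word_cells w y = 0" by (simp add: word_cells_def)

lemma stack_tape_pop: "w ~= [] ==> tape_act (0, Move_Right) (stack_tape w b) = stack_tape (tl w) b"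
 by (cases w) (auto simp: stack_tape_def fun_eq_iff word_cells_Cons algebra_simps word_cells_neg)

lemma stack_tape_shift: "tape_act (0, Move_Right) (stack_tape [] b) = stack_tape [] (b + 1)" by (auto simp: stack_tape_def fun_eq_iff word_cells_def)

lemma step_idle:
 assumes "q ~= tm_halt M" "tm_delta M q (map (%i. top_symbol (fst s i)) [0..<K]) =
   (q', idle (map (%i. top_symbol (fst s i)) [0..<K]))"
 shows "tm_step M (q, tapes_of K s) = (q', tapes_of K s)"
proof -
 have "map (%(cs, p). cs p) (tapes_of K s) = map (%i. top_symbol (fst s i)) [0..<K]" by (simp add: tapes_of_def stack_tape_top)
 moreover have "map2 tape_act (idle (map (%i. top_symbol (fst s i)) [0..<K])) (tapes_of K s) = tapes_of K s"
  by (rule nth_equalityI) (auto simp: tapes_of_def idle_def stack_tape_Stay)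
 ultimately show ?thesis using assms by (simp add: tm_step_def)
qed

definition tapes_update :: "nat => state => nat => tape => tape list" where
 "tapes_update K s i t = (tapes_of K s)[i := t]"

lemma step_act:
 assumes "q ~= tm_halt M" "i < K" "tp = stack_tape (fst s i) (snd s i)"
  "tm_delta M q (map (%i. top_symbol (fst s i)) [0..<K]) =
   (q', (idle (map (%i. top_symbol (fst s i)) [0..<K]))[i := am])"
 shows "tm_step M (q, tapes_of K s) = (q', tapes_update K s i (tape_act am tp))"
proof -
 have "map (%(cs, p). cs p) (tapes_of K s) = map (%i. top_symbol (fst s i)) [0..<K]" by (simp add: tapes_of_def stack_tape_top)
 moreover have "map2 tape_act ((idle (map (%i. top_symbol (fst s i)) [0..<K]))[i := am]) (tapes_of K s)
  = tapes_update K s i (tape_act am tp)" by (rule nth_equalityI) (use assms(2,3) in "auto simp: tapes_update_def tapes_of_def idle_def stack_tape_Stay nth_list_update")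
 ultimately show ?thesis using assms by (simp add: tm_step_def)
qed

lemma tapes_update_eq:
 assumes "i < K" "t = stack_tape w b"
 shows "tapes_update K s i t = tapes_of K ((fst s)(i := w), (snd s)(i := b))"
 unfolding tapes_update_def by (rule nth_equalityI) (use assms in "auto simp: tapes_of_def nth_list_update")

text \<open>Between the two steps of a push the head stands on the blank left of the top, so the
  tape is momentarily no \<open>stack_tape\<close> and is described by
  \<open>tapes_update\<close>.\<close>

lemma step_push2:
 assumes "q ~= tm_halt M" "i < K"
  "!!a. tm_delta M q a = (q', (idle a)[i := (bit_symbol x, Stay)])"
 shows "tm_step M (q, tapes_update K s i (tape_act (top_symbol (fst s i), Move_Left) (stack_tape (fst s i) (snd s i))))
  = (q', tapes_of K ((fst s)(i := x # fst s i), snd s))"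
proof -
 let ?t = "tape_act (top_symbol (fst s i), Move_Left) (stack_tape (fst s i) (snd s i))"
 let ?ts = "tapes_update K s i ?t"
 let ?a = "map (%(cs, p). cs p) ?ts"
 have "map2 tape_act ((idle ?a)[i := (bit_symbol x, Stay)]) ?ts = tapes_of K ((fst s)(i := x # fst s i), snd s)"
 proof (rule nth_equalityI)
  fix j assume "j < length (map2 tape_act ((idle ?a)[i := (bit_symbol x, Stay)]) ?ts)"
  hence j: "j < K" by (simp add: tapes_update_def tapes_of_def idle_def)
  show "map2 tape_act ((idle ?a)[i := (bit_symbol x, Stay)]) ?ts ! j = tapes_of K ((fst s)(i := x # fst s i), snd s) ! j"
  proof (cases "j = i")
   case True
   thus ?thesis using j stack_tape_push[of x "fst s i" "snd s i"] by (simp add: tapes_update_def tapes_of_def idle_def)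
  next case False
   thus ?thesis using j assms(2) stack_tape_top[of "fst s j" "snd s j"] stack_tape_Stay[of "fst s j" "snd s j"]
    by (simp add: tapes_update_def tapes_of_def idle_def nth_list_update)
  qed
 qed (simp add: tapes_update_def tapes_of_def idle_def)
 thus ?thesis using assms by (simp add: tm_step_def)
qed

lemma funpow_trans: "(f ^^ m) x = y ==> (f ^^ n) y = z ==> (f ^^ (m + n)) x = z" by (subst add.commute) (simp add: funpow_add)

lemma exec_code:
 assumes "exec c s n s'" "com_tapes c <= {..<K}"
  "!!q a. b <= q ==> q < b + com_size c ==> tm_delta M q a = code c b e q a"
  "!!q. b <= q ==> q < b + com_size c ==> q ~= tm_halt M"
 shows "(tm_step M ^^ n) (b, tapes_of K s) = (e, tapes_of K s')" using assms
proof (induction arbitrary: b e rule: exec.induct)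
 case (Push i x s bb)
 let ?t = "tape_act (top_symbol (s i), Move_Left) (stack_tape (s i) (bb i))"
 have "tm_step M (b, tapes_of K (s, bb)) = (Suc b, tapes_update K (s, bb) i ?t)" by (rule step_act) (use Push in auto)
 moreover have "tm_step M (Suc b, tapes_update K (s, bb) i ?t) = (e, tapes_of K (s(i := x # s i), bb))" using step_push2[of "Suc b" M i K e x "(s, bb)"] Push by simp
 ultimately show ?case by (simp add: numeral_2_eq_2)
next case (Pop s i bb)
 have "tm_step M (b, tapes_of K (s, bb)) = (e, tapes_update K (s, bb) i (tape_act (0, Move_Right) (stack_tape (s i) (bb i))))" by (rule step_act) (use Pop in auto)
 thus ?case using Pop tapes_update_eq[of i K _ "tl (s i)" "bb i" "(s, bb)"] stack_tape_pop[of "s i" "bb i"] by simp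
next case (Shift s i bb)
 have "tm_step M (b, tapes_of K (s, bb)) = (e, tapes_update K (s, bb) i (tape_act (0, Move_Right) (stack_tape (s i) (bb i))))" by (rule step_act) (use Shift in auto)
 moreover have "s(i := []) = s" using Shift(1) by auto
 ultimately show ?case using Shift tapes_update_eq[of i K _ "[]" "bb i + 1" "(s, bb)"] stack_tape_shift[of "bb i"] by simp
next case (Skip s)
 have "tm_step M (b, tapes_of K s) = (e, tapes_of K s)" by (rule step_idle) (use Skip in auto)
 thus ?case by simp
next case (Seq c s m s' d n s'')
 have "(tm_step M ^^ m) (b, tapes_of K s) = (b + com_size c, tapes_of K s')" by (rule Seq.IH(1)) (use Seq.prems in auto)
 moreover have "(tm_step M ^^ n) (b + com_size c, tapes_of K s') = (e, tapes_of K s'')" by (rule Seq.IH(2)) (use Seq.prems in auto)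
 ultimately show ?case by (rule funpow_trans)
next case (Case0 s i c0 n s' c1 c2)
 have "tm_step M (b, tapes_of K s) = (Suc b, tapes_of K s)" by (rule step_idle) (use Case0 in auto)
 moreover have "(tm_step M ^^ n) (Suc b, tapes_of K s) = (e, tapes_of K s')" by (rule Case0.IH) (use Case0.prems in "auto simp: Let_def")
 ultimately show ?case by (simp add: funpow_Suc_right del: funpow.simps)
next case (Case1 s i c1 n s' c0 c2)
 have "tm_step M (b, tapes_of K s) = (Suc b + com_size c0, tapes_of K s)" by (rule step_idle) (use Case1 in auto)
 moreover have "(tm_step M ^^ n) (Suc b + com_size c0, tapes_of K s) = (e, tapes_of K s')" by (rule Case1.IH) (use Case1.prems in "auto simp: Let_def")
 ultimately show ?case by (simp add: funpow_Suc_right del: funpow.simps)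
next case (Case2 s i c2 n s' c0 c1)
 have "tm_step M (b, tapes_of K s) = (Suc b + com_size c0 + com_size c1, tapes_of K s)" by (rule step_idle) (use Case2 in auto)
 moreover have "(tm_step M ^^ n) (Suc b + com_size c0 + com_size c1, tapes_of K s) = (e, tapes_of K s')" by (rule Case2.IH) (use Case2.prems in "auto simp: Let_def")
 ultimately show ?case by (simp add: funpow_Suc_right del: funpow.simps)
next case (Loop_end s i S c)
 have "tm_step M (b, tapes_of K s) = (e, tapes_of K s)" by (rule step_idle) (use Loop_end in auto)
 thus ?case by simp
next case (Loop_step s i S c m s' n s'')
 have "tm_step M (b, tapes_of K s) = (Suc b, tapes_of K s)" by (rule step_idle) (use Loop_step in auto)
 moreover have "(tm_step M ^^ m) (Suc b, tapes_of K s) = (b, tapes_of K s')" by (rule Loop_step.IH(1)) (use Loop_step.prems in auto)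
 moreover have "(tm_step M ^^ n) (b, tapes_of K s') = (e, tapes_of K s'')" by (rule Loop_step.IH(2)) (use Loop_step.prems in auto)
 ultimately show ?case using funpow_trans[of m "tm_step M" _ _ n] by (simp add: funpow_Suc_right del: funpow.simps)
qed

lemma tm_step_halted: "q = tm_halt M ==> (tm_step M ^^ n) (q, ts) = (q, ts)" by (induction n) (auto simp: tm_step_def)

theorem com_computes:
 assumes c: "com_tapes c <= {..<K}" "1 <= K"
  and run: "!!w. EX n s b. n <= T (length w) &
   exec c ((%_. [])(0 := w), (%_. 0)(0 := int (length w))) n (s, b) &
   s (K - 1) = f w & b (K - 1) = int (length (f w))"
 shows "tm_computes_within (com_tm K c) f T" unfolding tm_computes_within_def
proof
 fix w
 let ?M = "com_tm K c" and ?s = "((%_. [])(0 := w), (%_. 0)(0 := int (length w))) :: state"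
 obtain n s b where n: "n <= T (length w)" "exec c ?s n (s, b)" "s (K - 1) = f w" "b (K - 1) = int (length (f w))" using run by blast
 have "tm_initial ?M w = (0, tapes_of K ?s)"
 proof -
  obtain K' where K: "K = Suc K'" using c(2) by (cases K) auto
  have "tapes_of K ?s = stack_tape w (int (length w)) # map (%i. stack_tape [] 0) [0..<K']"
   unfolding K tapes_of_def by (simp add: upt_conv_Cons map_Suc_upt[symmetric] del: upt_Suc)
  thus ?thesis by (simp add: tm_initial_def com_tm_def K stack_tape_def map_replicate_trivial)
 qed
 moreover have "(tm_step ?M ^^ n) (0, tapes_of K ?s) = (com_size c, tapes_of K (s, b))" by (rule exec_code[OF n(2) c(1)]) (auto simp: com_tm_def)
 moreover have "(tm_step ?M ^^ (T (length w) - n)) (com_size c, tapes_of K (s, b)) = (com_size c, tapes_of K (s, b))" by (rule tm_step_halted) (simp add: com_tm_def)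
 ultimately have "(tm_step ?M ^^ T (length w)) (tm_initial ?M w) = (com_size c, tapes_of K (s, b))"
  using funpow_trans[of n "tm_step ?M" "(0, tapes_of K ?s)" _ "T (length w) - n"] n(1) by simp
 moreover have "last (tapes_of K (s, b)) = stack_tape (f w) (int (length (f w)))" using c(2) n(3,4) by (cases K) (auto simp: tapes_of_def)
 ultimately show "case (tm_step ?M ^^ T (length w)) (tm_initial ?M w) of (q, ts) =>
   q = tm_halt ?M & fst (last ts) = word_cells (f w)" by (simp add: com_tm_def stack_tape_def)
qed

section \<open>Polynomial bounds\<close>

text \<open>The base \<open>n + 2\<close> is at least 2, so that constants and sums are absorbed
  into the exponent.\<close>

definition pbounded :: "(nat => nat) => bool" where
 "pbounded f = (EX k. ALL n. f n <= (n + 2) ^ k)"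

named_theorems pb_intros

lemma pbounded_const [pb_intros]: "pbounded (%n. c)" unfolding pbounded_def
proof (intro exI allI)
 fix n
 have "c <= 2 ^ c" using less_exp[of c] by simp
 also have "... <= (n + 2) ^ c" by (rule power_mono) auto
 finally show "c <= (n + 2) ^ c" .
qed

lemma pbounded_id [pb_intros]: "pbounded (%n. n)" unfolding pbounded_def by (rule exI[of _ 1]) auto

lemma pbounded_add [pb_intros]: "pbounded f ==> pbounded g ==> pbounded (%n. f n + g n)" unfolding pbounded_def
proof (elim exE)
 fix k l assume k: "ALL n. f n <= (n + 2) ^ k" and l: "ALL n. g n <= (n + 2) ^ l"
 show "EX k. ALL n. f n + g n <= (n + 2) ^ k"
 proof (intro exI allI)
  fix n :: nat
  have "(n + 2) ^ k <= (n + 2) ^ (k + l)" "(n + 2) ^ l <= (n + 2) ^ (k + l)" by (rule power_increasing; simp)+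
  hence "f n + g n <= 2 * (n + 2) ^ (k + l)" using k l by (smt (verit) add_mono mult_2 order_trans)
  also have "... <= (n + 2) * (n + 2) ^ (k + l)" by (rule mult_le_mono1) simp
  finally show "f n + g n <= (n + 2) ^ Suc (k + l)" by simp
 qed
qed

lemma pbounded_mult [pb_intros]: "pbounded f ==> pbounded g ==> pbounded (%n. f n * g n)" unfolding pbounded_def by (metis mult_le_mono power_add)

lemma pbounded_Suc [pb_intros]: "pbounded f ==> pbounded (%n. Suc (f n))" using pbounded_add[of f "%_. 1"] pbounded_const[of 1] by simp

lemma pbounded_power [pb_intros]: "pbounded f ==> pbounded (%n. f n ^ j)" by (induction j) (auto intro: pb_intros)

lemma pbounded_comp: "pbounded f ==> pbounded g ==> pbounded (%n. f (g n))"
proof -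
 assume "pbounded f" "pbounded g"
 then obtain k where k: "!!n. f n <= (n + 2) ^ k" by (auto simp: pbounded_def)
 have "pbounded (%n. (g n + 2) ^ k)" using `pbounded g` by (intro pb_intros)
 then obtain l where "!!n. (g n + 2) ^ k <= (n + 2) ^ l" by (auto simp: pbounded_def)
 thus ?thesis using k unfolding pbounded_def by (meson order_trans)
qed

section \<open>Stack operations on trees\<close>

text \<open>The bottoms \<open>b\<close> of the stacks stay in place. All programs on trees are of
  this kind; bottoms move only when the output is written.\<close>

definition runs :: "com => (nat => bool list) => nat => (nat => bool list) => bool" where
 "runs c s t s' = (EX n<=t. ALL b. exec c (s, b) n (s', b))"

lemma runs_mono: "runs c s t s' ==> t <= t' ==> runs c s t' s'" unfolding runs_def by (meson order_trans)

lemma runs_weaken: "runs c s t s' ==> t <= t' ==> s' = s'' ==> runs c s t' s''" using runs_mono by simp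

lemma runs_Push: "runs (Push i x) s 2 (s(i := x # s i))" unfolding runs_def by (auto intro!: exI[of _ 2] exec.Push)

lemma runs_Pop: "s i = x # w ==> runs (Pop i) s 1 (s(i := w))" unfolding runs_def using exec.Pop[of s i] by (auto intro!: exI[of _ 1])

lemma runs_Skip: "runs Skip s 1 s" unfolding runs_def by (auto intro!: exI[of _ 1] exec.Skip[simplified])

lemma runs_Seq: "runs c s m s' ==> runs d s' n s'' ==> runs (c ;; d) s (m + n) s''" unfolding runs_def by (meson add_mono exec.Seq)

lemma runs_Case_False: "s i = False # w ==> runs c1 s n s' ==> runs (Case i c0 c1 c2) s (n + 1) s'"
 unfolding runs_def using exec.Case1[of "(s, _)" i c1 _ _ c0 c2] by fastforce

lemma runs_Case_True: "s i = True # w ==> runs c2 s n s' ==> runs (Case i c0 c1 c2) s (n + 1) s'"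
 unfolding runs_def using exec.Case2[of "(s, _)" i c2 _ _ c0 c1] by fastforce

lemma runs_Case_Nil: "s i = [] ==> runs c0 s n s' ==> runs (Case i c0 c1 c2) s (n + 1) s'" unfolding runs_def using exec.Case0[of "(s, _)" i c0 _ _ c1 c2] by fastforce

lemma runs_Loop_end: "top_symbol (s i) ~: S ==> runs (Loop i S c) s 1 s" unfolding runs_def using exec.Loop_end[of "(s, _)" i S c] by (auto intro!: exI[of _ 1])

lemma runs_Loop_step:
 assumes "top_symbol (s i) : S" "runs c s m s'" "runs (Loop i S c) s' n s''"
 shows "runs (Loop i S c) s (m + n + 1) s''"
proof -
 obtain m' n' where "m' <= m" "ALL b. exec c (s, b) m' (s', b)" "n' <= n" "ALL b. exec (Loop i S c) (s', b) n' (s'', b)" using assms by (auto simp: runs_def)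
 hence "exec (Loop i S c) (s, b) (Suc (m' + n')) (s'', b)" for b using exec.Loop_step[of "(s, b)" i S c m' "(s', b)" n' "(s'', b)"] assms(1) by simp
 thus ?thesis using `m' <= m` `n' <= n` unfolding runs_def by (intro exI[of _ "Suc (m' + n')"]) auto
qed

lemma top_symbol_Cons: "top_symbol (x # w) : {1, 2}" by (cases x) auto

definition move_all :: "nat => nat => com" where
 "move_all i j = Loop i {1, 2} (Case i Skip (Pop i ;; Push j False) (Pop i ;; Push j True))"

lemma runs_Case_bit:
 assumes "s i = x # w" "runs (C x) s n s'"
 shows "runs (Case i c0 (C False) (C True)) s (n + 1) s'" using assms runs_Case_False[of s i w "C False"] runs_Case_True[of s i w "C True"] by (cases x) auto

lemma runs_Loop_bit:
 fixes C :: "bool => com" and i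
 defines "L == Loop i {1, 2} (Case i Skip (C False) (C True))"
 assumes "s i = x # w" "runs (C x) s m s'" "runs L s' n s''"
 shows "runs L s (m + 1 + n + 1) s''" unfolding L_def by (rule runs_Loop_step[OF _ runs_Case_bit[where C = C, OF assms(2,3)] assms(4)[unfolded L_def]])
  (simp only: assms(2) top_symbol_Cons)

lemma runs_move_all:
 assumes "i ~= j"
 shows "runs (move_all i j) s (5 * length (s i) + 1) (s(i := [], j := rev (s i) @ s j))"
proof (induction "s i" arbitrary: s)
 case Nil hence e: "s(i := [], j := rev (s i) @ s j) = s" by (simp add: fun_upd_idem)
 show ?case unfolding move_all_def e by (rule runs_mono[OF runs_Loop_end]) (simp_all flip: Nil)
next case (Cons x w)
 have si: "s i = x # w" using Cons by simp
 let ?s = "s(i := w, j := x # s j)"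
 have 1: "runs (Pop i ;; Push j x) s (1 + 2) ?s" using runs_Seq[OF runs_Pop[of s i x w] runs_Push[of j x "s(i := w)"]] si assms by simp
 have 2: "runs (move_all i j) ?s (5 * length w + 1) (?s(i := [], j := rev w @ ?s j))" using Cons(1)[of ?s] assms by simp
 show ?case using runs_Loop_bit[where C = "%x. Pop i ;; Push j x", OF si 1 2[unfolded move_all_def]] unfolding move_all_def by (rule runs_weaken) (use si assms in auto)
qed

definition clear :: "nat => com" where
 "clear i = Loop i {1, 2} (Pop i)"

lemma runs_clear: "runs (clear i) s (2 * length (s i) + 1) (s(i := []))"
proof (induction "s i" arbitrary: s)
 case Nil hence e: "s(i := []) = s" by (simp add: fun_upd_idem)
 show ?case unfolding clear_def e by (rule runs_mono[OF runs_Loop_end]) (simp_all flip: Nil)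
next case (Cons x w)
 have si: "s i = x # w" using Cons by simp
 have "runs (clear i) (s(i := w)) (2 * length w + 1) (s(i := []))" using Cons(1)[of "s(i := w)"] by simp
 from runs_Loop_step[OF _ runs_Pop[of s, OF si] this[unfolded clear_def]] show ?case unfolding clear_def by (rule runs_mono) (use si top_symbol_Cons in simp_all)
qed

section \<open>Stack programs on self-delimiting trees\<close>

datatype tree = Leaf | Node tree tree

text \<open>The preorder code is prefix-free, so a program can find the end of the topmost tree
  whatever lies below it. Each value is stored as one such tree.\<close>

primrec bits :: "tree => bool list" where
 "bits Leaf = [False]"
| "bits (Node l r) = True # bits l @ bits r"

lemma bits_prefix: "bits t @ u = bits t' @ u' ==> t = t' & u = u'"
proof (induction t arbitrary: t' u u')
 case Leaf thus ?case by (cases t') auto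
next case (Node l r)
 obtain l' r' where t': "t' = Node l' r'" using Node.prems by (cases t') auto
 hence "bits l @ (bits r @ u) = bits l' @ (bits r' @ u')" using Node.prems by simp
 from Node.IH(1)[OF this] Node.IH(2)[of u r' u'] show ?case by (simp add: t')
qed

definition stk :: "bool list => bool list => bool list => bool list => nat => bool list" where
 "stk a b c d = (%_. [])(0 := a, 1 := b, 2 := c, 3 := d)"

lemma stk_simps [simp]:
 "stk a b c d 0 = a" "stk a b c d (Suc 0) = b" "stk a b c d 2 = c" "stk a b c d 3 = d" "stk a b c d 4 = []"
 "(stk a b c d)(0 := x) = stk x b c d" "(stk a b c d)(Suc 0 := x) = stk a x c d"
 "(stk a b c d)(2 := x) = stk a b x d" "(stk a b c d)(3 := x) = stk a b c x" by (auto simp: stk_def fun_eq_iff)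

lemma runs_stk:
 "runs (Push 0 x) (stk a b c d) 2 (stk (x # a) b c d)" "runs (Push (Suc 0) x) (stk a b c d) 2 (stk a (x # b) c d)"
 "runs (Push 2 x) (stk a b c d) 2 (stk a b (x # c) d)" "runs (Push 3 x) (stk a b c d) 2 (stk a b c (x # d))"
 "runs (Pop 0) (stk (x # a) b c d) 1 (stk a b c d)" "runs (Pop (Suc 0)) (stk a (x # b) c d) 1 (stk a b c d)"
 "runs (Pop 2) (stk a b (x # c) d) 1 (stk a b c d)" "runs (Pop 3) (stk a b c (x # d)) 1 (stk a b c d)" by (rule runs_weaken[OF runs_Push] runs_weaken[OF runs_Pop]; simp)+

text \<open>The third stack counts in unary how many trees have still to be moved.\<close>

definition take_loop :: "nat => com" where
 "take_loop j = Loop 3 {2} (Case 0 Skip (Pop 0 ;; Push j False ;; Pop 3) (Pop 0 ;; Push j True ;; Push 3 True))"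

definition take_tree :: "nat => com" where
 "take_tree j = Push 3 True ;; take_loop j"

text \<open>The statement is in continuation style because one and the same loop runs through both
  subtrees of a node; \<open>n\<close> is the cost of what remains.\<close>

lemma runs_take_loop:
 assumes "j ~= 0" "j ~= 3" "s 0 = bits t @ rest" "s 3 = True # d"
  "runs (take_loop j) (s(0 := rest, j := rev (bits t) @ s j, 3 := d)) n s'"
 shows "runs (take_loop j) s (n + 7 * length (bits t)) s'" using assms
proof (induction t arbitrary: s rest d n)
 case Leaf
 let ?s = "s(0 := rest, j := False # s j, 3 := d)"
 have "runs (Pop 0 ;; Push j False ;; Pop 3) s (1 + (2 + 1)) ?s" by (rule runs_weaken, (rule runs_Seq runs_Push | rule runs_Pop, use Leaf in simp)+) (use Leaf in auto)
 hence "runs (Case 0 Skip (Pop 0 ;; Push j False ;; Pop 3) (Pop 0 ;; Push j True ;; Push 3 True)) s (1 + (2 + 1) + 1) ?s" using Leaf by (intro runs_Case_False) auto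
 moreover have "runs (take_loop j) ?s n s'" using Leaf.prems(5) by (simp only: bits.simps rev.simps append.simps)
 moreover have "top_symbol (s 3) : {2}" using Leaf by simp
 ultimately have "runs (take_loop j) s (1 + (2 + 1) + 1 + n + 1) s'" unfolding take_loop_def by (metis runs_Loop_step)
 thus ?case by (rule runs_mono) simp
next case (Node l r)
 let ?s = "s(0 := bits l @ bits r @ rest, j := True # s j, 3 := True # True # d)"
 have "runs (Pop 0 ;; Push j True ;; Push 3 True) s (1 + (2 + 2)) ?s"
  by (rule runs_weaken, (rule runs_Seq runs_Push | rule runs_Pop, use Node in simp)+) (use Node in auto)
 hence 1: "runs (Case 0 Skip (Pop 0 ;; Push j False ;; Pop 3) (Pop 0 ;; Push j True ;; Push 3 True)) s (1 + (2 + 2) + 1) ?s" using Node by (intro runs_Case_True) auto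
 let ?s1 = "?s(0 := bits r @ rest, j := rev (bits l) @ ?s j, 3 := True # d)"
 have "runs (take_loop j) ?s1 (n + 7 * length (bits r)) s'"
 proof (rule Node.IH(2))
  have e: "?s1(0 := rest, j := rev (bits r) @ ?s1 j, 3 := d) = s(0 := rest, j := rev (bits (Node l r)) @ s j, 3 := d)" using Node.prems(1,2) by (auto simp: fun_eq_iff)
  show "runs (take_loop j) (?s1(0 := rest, j := rev (bits r) @ ?s1 j, 3 := d)) n s'" unfolding e by (rule Node.prems(5))
 qed (use Node.prems in auto)
 note r = this
 have "runs (take_loop j) ?s (n + 7 * length (bits r) + 7 * length (bits l)) s'"
 proof (rule Node.IH(1)[OF Node.prems(1,2) _ _ r])
  show "?s 0 = bits l @ bits r @ rest" "?s 3 = True # True # d" using Node.prems(1,2) by simp_all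
 qed
 moreover have "top_symbol (s 3) : {2}" using Node by simp
 ultimately have "runs (take_loop j) s (1 + (2 + 2) + 1 + (n + 7 * length (bits r) + 7 * length (bits l)) + 1) s'"
  using 1 unfolding take_loop_def by (metis runs_Loop_step)
 thus ?case by (rule runs_mono) simp
qed

lemma runs_take_tree:
 assumes "j ~= 0" "j ~= 3" "s 0 = bits t @ rest" "s 3 = []"
 shows "runs (take_tree j) s (7 * length (bits t) + 3) (s(0 := rest, j := rev (bits t) @ s j))"
proof -
 let ?s = "s(3 := [True])"
 let ?s' = "s(0 := rest, j := rev (bits t) @ s j)"
 have "?s(0 := rest, j := rev (bits t) @ ?s j, 3 := []) = ?s'" using assms by (auto simp: fun_eq_iff)
 moreover have "runs (take_loop j) ?s' 1 ?s'" unfolding take_loop_def by (rule runs_Loop_end) (use assms in auto)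
 ultimately have "runs (take_loop j) ?s (1 + 7 * length (bits t)) ?s'" using assms by (intro runs_take_loop[where d = "[]" and rest = rest]) simp_all
 moreover have "runs (Push 3 True) s 2 ?s" using runs_Push[of 3 True s] assms by simp
 ultimately have "runs (take_tree j) s (2 + (1 + 7 * length (bits t))) ?s'" unfolding take_tree_def by (intro runs_Seq)
 thus ?thesis by (rule runs_mono) simp
qed

abbreviation main :: "bool list => nat => bool list" where
 "main a == stk a [] [] []"

lemma runs_take_stk:
 "runs (take_tree (Suc 0)) (stk (bits t @ a) b c []) (7 * length (bits t) + 3) (stk a (rev (bits t) @ b) c [])"
 "runs (take_tree 2) (stk (bits t @ a) b c []) (7 * length (bits t) + 3) (stk a b (rev (bits t) @ c) [])"
 using runs_take_tree[of "Suc 0" "stk (bits t @ a) b c []" t a] runs_take_tree[of 2 "stk (bits t @ a) b c []" t a] by simp_all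

lemma runs_move_stk:
 "runs (move_all (Suc 0) 0) (stk a b c d) (5 * length b + 1) (stk (rev b @ a) [] c d)"
 "runs (move_all 2 0) (stk a b c d) (5 * length c + 1) (stk (rev c @ a) b [] d)"
 "runs (move_all 2 (Suc 0)) (stk a b c d) (5 * length c + 1) (stk a (rev c @ b) [] d)" using runs_move_all[of "Suc 0" 0 "stk a b c d"] runs_move_all[of 2 0 "stk a b c d"]
  runs_move_all[of 2 "Suc 0" "stk a b c d"] by (simp_all add: fun_upd_twist)

definition swap :: com where
 "swap = take_tree (Suc 0) ;; take_tree 2 ;; move_all (Suc 0) 0 ;; move_all 2 0"

lemma runs_swap:
 "runs swap (main (bits t @ bits u @ a)) (12 * (length (bits t) + length (bits u)) + 8) (main (bits u @ bits t @ a))"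
 unfolding swap_def by (rule runs_weaken, (rule runs_Seq runs_take_stk runs_move_stk)+) simp_all

definition swap_below :: com where
 "swap_below = take_tree (Suc 0) ;; take_tree 2 ;; take_tree (Suc 0) ;; move_all 2 0 ;; move_all (Suc 0) 0"

lemma runs_swap_below:
 "runs swap_below (main (bits t @ bits u @ bits v @ a)) (12 * (length (bits t) + length (bits u) + length (bits v)) + 11)
  (main (bits t @ bits v @ bits u @ a))" unfolding swap_below_def by (rule runs_weaken, (rule runs_Seq runs_take_stk runs_move_stk)+) simp_all

definition drop_tree :: com where
 "drop_tree = take_tree (Suc 0) ;; clear (Suc 0)"

lemma runs_drop: "runs drop_tree (main (bits t @ a)) (9 * length (bits t) + 4) (main a)"
 unfolding drop_tree_def by (rule runs_weaken, (rule runs_Seq runs_take_stk runs_clear)+) simp_all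

definition copy_loop :: com where
 "copy_loop = Loop (Suc 0) {1, 2} (Case (Suc 0) Skip (Pop (Suc 0) ;; Push 0 False ;; Push 2 False)
   (Pop (Suc 0) ;; Push 0 True ;; Push 2 True))"

lemma runs_copy_loop: "runs copy_loop (stk a b c d) (7 * length b + 1) (stk (rev b @ a) [] (rev b @ c) d)"
proof (induction b arbitrary: a c)
 case Nil thus ?case using runs_Loop_end[of "stk a [] c d" "Suc 0" "{1, 2}"] by (simp add: copy_loop_def)
next case (Cons x b)
 have "runs (Pop (Suc 0) ;; Push 0 x ;; Push 2 x) (stk a (x # b) c d) (1 + (2 + 2)) (stk (x # a) b (x # c) d)" by (rule runs_Seq runs_stk)+
 from runs_Loop_bit[where C = "%x. Pop (Suc 0) ;; Push 0 x ;; Push 2 x", OF _ this Cons[unfolded copy_loop_def]]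
 show ?case unfolding copy_loop_def by (auto elim: runs_mono)
qed

definition dup :: com where
 "dup = take_tree (Suc 0) ;; copy_loop ;; move_all 2 (Suc 0) ;; move_all (Suc 0) 0"

lemma runs_dup: "runs dup (main (bits t @ a)) (24 * length (bits t) + 6) (main (bits t @ bits t @ a))"
 unfolding dup_def by (rule runs_weaken, (rule runs_Seq runs_take_stk runs_copy_loop runs_move_stk)+) simp_all

primrec pushes :: "bool list => com" where
 "pushes [] = Skip"
| "pushes (x # w) = pushes w ;; Push 0 x"

lemma runs_pushes: "runs (pushes w) (stk a b c d) (2 * length w + 1) (stk (w @ a) b c d)"
proof (induction w)
 case (Cons x w) show ?case unfolding pushes.simps by (rule runs_weaken, (rule runs_Seq Cons runs_stk)+) simp_all
qed (use runs_Skip in simp)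

text \<open>Stack 3 collects a mark for every mismatch, including missing symbols on stack 2.
  \<open>drain\<close> also turns left-over symbols into marks, so the trees are equal iff no mark
  exists at the end.\<close>

definition eq_loop :: com where
 "eq_loop = Loop (Suc 0) {1, 2} (Case (Suc 0) Skip
   (Case 2 (Push 3 True) (Pop 2) (Pop 2 ;; Push 3 True)) (Case 2 (Push 3 True) (Pop 2 ;; Push 3 True) (Pop 2)) ;; Pop (Suc 0))"

definition drain :: com where
 "drain = Loop 2 {1, 2} (Pop 2 ;; Push 3 True)"

definition eq_trees :: com where
 "eq_trees = take_tree (Suc 0) ;; take_tree 2 ;; eq_loop ;; drain ;;
   Case 3 (pushes [True, False, False]) Skip (clear 3 ;; pushes [False])"

lemma runs_drain: "runs drain (stk a b c d) (4 * length c + 1) (stk a b [] (replicate (length c) True @ d))"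
proof (induction c arbitrary: d)
 case Nil thus ?case using runs_Loop_end[of "stk a b [] d" 2 "{1, 2}"] by (simp add: drain_def)
next case (Cons x c)
 have 1: "runs (Pop 2 ;; Push 3 True) (stk a b (x # c) d) (1 + 2) (stk a b c (True # d))" by (rule runs_Seq runs_stk)+
 show ?case unfolding drain_def by (rule runs_weaken[OF runs_Loop_step[OF _ 1 Cons[unfolded drain_def]]]) (use top_symbol_Cons in "simp_all add: replicate_app_Cons_same")
qed

lemma runs_eq_loop:
 "EX c' m'. runs eq_loop (stk a b c (replicate m True)) (8 * length b + 1) (stk a [] c' (replicate m' True)) &
  (c' = [] & m' = 0 \<longleftrightarrow> b = c & m = 0) & m' + length c' <= m + length b + length c"
proof (induction b arbitrary: c m)
 case Nil
 show ?case using runs_Loop_end[of "stk a [] c (replicate m True)" "Suc 0" "{1, 2}"] unfolding eq_loop_def by (intro exI[of _ c] exI[of _ m]) auto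
next case (Cons x b)
 let ?C = "%x. Case 2 (Push 3 True) (if x then Pop 2 ;; Push 3 True else Pop 2) (if x then Pop 2 else Pop 2 ;; Push 3 True)"
 let ?s = "%u c m. stk a u c (replicate m True)"
 have "EX c1 m1. runs (?C x) (?s (x # b) c m) 4 (?s (x # b) c1 m1) & (b = c1 & m1 = 0 \<longleftrightarrow> x # b = c & m = 0) & m1 + length c1 <= Suc (m + length c)"
 proof (cases c)
  case Nil
  have "runs (?C x) (?s (x # b) c m) 4 (?s (x # b) [] (Suc m))" by (rule runs_weaken[OF runs_Case_Nil[OF _ runs_stk(4)]]) (simp_all add: Nil)
  thus ?thesis using Nil by (intro exI[of _ "[]"] exI[of _ "Suc m"]) auto
 next case (Cons y c1)
  have "runs (?C x) (?s (x # b) c m) 4 (?s (x # b) c1 (if x = y then m else Suc m))" by (cases x; cases y; simp add: Cons;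
    (rule runs_weaken, rule runs_Case_True runs_Case_False, simp, (rule runs_Seq runs_stk)+, simp_all))
  thus ?thesis using Cons by (intro exI[of _ c1] exI[of _ "if x = y then m else Suc m"]) auto
 qed
 then obtain c1 m1 where 1: "runs (?C x) (?s (x # b) c m) 4 (?s (x # b) c1 m1)"
  "(b = c1 & m1 = 0) = (x # b = c & m = 0)" "m1 + length c1 <= Suc (m + length c)" by auto
 have 2: "runs (Case (Suc 0) Skip (?C False) (?C True) ;; Pop (Suc 0)) (?s (x # b) c m) (4 + 1 + 1) (?s b c1 m1)"
  by (rule runs_Seq[OF runs_Case_bit[where C = ?C, OF _ 1(1)] runs_stk(6)]) simp
 obtain c' m' where 3: "runs eq_loop (?s b c1 m1) (8 * length b + 1) (?s [] c' m')"
  "(c' = [] & m' = 0) = (b = c1 & m1 = 0)" "m' + length c' <= m1 + length b + length c1" using Cons.IH[of c1 m1] by blast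
 have "runs eq_loop (?s (x # b) c m) (8 * length (x # b) + 1) (?s [] c' m')" unfolding eq_loop_def
  by (rule runs_mono[OF runs_Loop_step[OF _ 2[unfolded if_True if_False] 3(1)[unfolded eq_loop_def]]]) (use top_symbol_Cons in simp_all)
 moreover have "(c' = [] & m' = 0) = (x # b = c & m = 0)" using 1(2) 3(2) by blast
 moreover have "m' + length c' <= m + length (x # b) + length c" using 1(3) 3(3) by simp
 ultimately show ?case by blast
qed

lemma runs_eq_trees:
 "runs eq_trees (main (bits t @ bits u @ a)) (40 * (length (bits t) + length (bits u)) + 40)
  (main ((if t = u then [True, False, False] else [False]) @ a))"
proof -
 obtain c' m' where 1: "runs eq_loop (stk a (rev (bits t) @ []) (rev (bits u) @ []) []) (8 * length (bits t) + 1) (stk a [] c' (replicate m' True))"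
  "(c' = [] & m' = 0) = (t = u)" "m' + length c' <= length (bits t) + length (bits u)"
  using runs_eq_loop[of a "rev (bits t)" "rev (bits u)" 0] bits_prefix[of t "[]" u "[]"] by auto
 let ?d = "replicate (length c') True @ replicate m' True"
 have 2: "runs drain (stk a [] c' (replicate m' True)) (4 * length c' + 1) (stk a [] [] ?d)" by (rule runs_drain)
 have d: "(?d = []) = (t = u)" using 1(2) by auto
 have "runs (Case 3 (pushes [True, False, False]) Skip (clear 3 ;; pushes [False])) (stk a [] [] ?d)
  (2 * length ?d + 20) (main ((if t = u then [True, False, False] else [False]) @ a))"
 proof (cases "t = u")
  case True hence "?d = []" using d by simp
  thus ?thesis using True runs_Case_Nil[of "main a" 3, OF _ runs_pushes[of "[True, False, False]" a], of Skip "clear 3 ;; pushes [False]"] by (auto elim: runs_mono)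
 next case False
  then obtain d' where d': "?d = True # d'" using d by (metis append_Cons append_Nil neq_Nil_conv replicate.simps(2) replicate_0 replicate_empty gr0_conv_Suc not_gr_zero)
  have cl: "runs (clear 3) (stk a [] [] ?d) (2 * length ?d + 1) (main a)" using runs_clear[of 3 "stk a [] [] ?d"] by simp
  show ?thesis by (rule runs_weaken, rule runs_Case_True[where w = d'], use d' in simp, (rule runs_Seq cl runs_pushes)+) (use False in simp_all)
 qed
 note C = this
 show ?thesis unfolding eq_trees_def by (rule runs_weaken, (rule runs_Seq runs_take_stk 1(1) 2 C)+) (use 1(3) in simp_all)
qed

lemma com_tapes_ops:
 "com_tapes swap <= {..<4}" "com_tapes swap_below <= {..<4}" "com_tapes drop_tree <= {..<4}"
 "com_tapes dup <= {..<4}" "com_tapes eq_trees <= {..<4}" "com_tapes (pushes w) <= {..<4}"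
 by (auto simp: move_all_def clear_def take_tree_def take_loop_def swap_def swap_below_def
  drop_tree_def copy_loop_def dup_def eq_loop_def drain_def eq_trees_def) (induction w; auto)

section \<open>Typed polynomial-time functions\<close>

class treeable =
 fixes to_tree :: "'a => tree"
 assumes to_tree_inj: "to_tree x = to_tree y ==> x = y"

definition encode :: "'a :: treeable => bool list" where
 "encode x = bits (to_tree x)"

definition esize :: "'a :: treeable => nat" where
 "esize x = length (encode x)"

instantiation unit :: treeable begin
definition "to_tree (x :: unit) = Leaf"
instance by standard simp
end

instantiation bool :: treeable begin
definition "to_tree (x :: bool) = (if x then Node Leaf Leaf else Leaf)"
instance by standard (auto simp: to_tree_bool_def split: if_splits)
end

instantiation prod :: (treeable, treeable) treeable begin
definition "to_tree = (%(x, y). Node (to_tree x) (to_tree y))"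
instance by standard (auto simp: to_tree_prod_def to_tree_inj)
end

instantiation list :: (treeable) treeable begin
primrec to_tree_list :: "'a list => tree" where
 "to_tree_list [] = Leaf"
| "to_tree_list (x # xs) = Node (to_tree x) (to_tree_list xs)"
instance
proof
 fix xs ys :: "'a list"
 show "to_tree xs = to_tree ys ==> xs = ys"
 proof (induction xs arbitrary: ys)
  case Nil thus ?case by (cases ys) auto
next case (Cons x xs) thus ?case by (cases ys) (auto simp: to_tree_inj)
 qed
qed
end

lemma encode_simps:
 "encode () = [False]" "encode False = [False]" "encode True = [True, False, False]"
 "encode (x, y) = True # encode x @ encode y"
 "encode ([] :: 'a :: treeable list) = [False]" "encode (z # zs) = True # encode z @ encode zs"
 by (auto simp: encode_def to_tree_unit_def to_tree_bool_def to_tree_prod_def)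

lemma esize_simps [simp]:
 "esize () = 1" "esize False = 1" "esize True = 3" "esize (x, y) = Suc (esize x + esize y)"
 "esize ([] :: 'a :: treeable list) = 1" "esize (z # zs) = Suc (esize z + esize zs)" by (auto simp: esize_def encode_simps)

lemma esize_pos: "1 <= esize x" by (cases "to_tree x") (auto simp: esize_def encode_def)

lemma esize_bool: "esize (b :: bool) <= 3" by (cases b) auto

lemma esize_append [simp]: "esize (xs @ ys) = esize xs + esize ys - 1" using esize_pos[of ys] by (induction xs) auto

lemma esize_mem: "x : set xs ==> esize x < esize xs" by (induction xs) auto

lemma length_esize: "length xs < esize xs" by (induction xs) auto

lemma esize_bools: "esize (xs :: bool list) <= 4 * length xs + 1"
proof (induction xs)
 case (Cons x xs) thus ?case using esize_bool[of x] by simp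
qed simp

text \<open>What lies below the argument on the stack is preserved. This frame property lets
  programs be composed and run on components of larger values.\<close>

definition pt :: "('a :: treeable => 'b :: treeable) => bool" where
 "pt f = (EX c k. com_tapes c <= {..<4} &
   (ALL x rest. runs c (main (encode x @ rest)) ((esize x + 2) ^ k) (main (encode (f x) @ rest))))"

lemma ptI:
 assumes "com_tapes c <= {..<4}" "pbounded T"
  "!!x rest. runs c (main (encode x @ rest)) (T (esize x)) (main (encode (f x) @ rest))"
 shows "pt f"
proof -
 obtain k where "!!n. T n <= (n + 2) ^ k" using assms(2) by (auto simp: pbounded_def)
 thus ?thesis using assms(1,3) runs_mono unfolding pt_def by metis
qed

text \<open>A program cannot push more symbols than it makes steps, so the time bound also bounds
  the size of the result.\<close>

lemma pt_esize:
 assumes "pt f"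
 obtains k where "!!x. esize (f x) <= (esize x + 2) ^ k"
proof -
 obtain c k where c: "!!x rest. runs c (main (encode x @ rest)) ((esize x + 2) ^ k) (main (encode (f x) @ rest))" using assms by (auto simp: pt_def)
 have "esize (f x) <= esize x + (esize x + 2) ^ k" for x
 proof -
  obtain n where "n <= (esize x + 2) ^ k" "exec c (main (encode x), (%_. 0)) n (main (encode (f x)), (%_. 0))" using c[of x "[]"] by (auto simp: runs_def)
  thus ?thesis using exec_growth[of c _ n _ 0] by (fastforce simp: esize_def)
 qed
 moreover have "pbounded (%n. n + (n + 2) ^ k)" by (intro pb_intros)
 then obtain l where "!!n :: nat. n + (n + 2) ^ k <= (n + 2) ^ l" by (auto simp: pbounded_def)
 ultimately show ?thesis by (intro that[of l]) (meson order_trans)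
qed

text \<open>A single monotone bound \<open>S\<close> for time and result size is convenient when
  programs are composed.\<close>

definition computes_pt :: "com => (nat => nat) => ('a :: treeable => 'b :: treeable) => bool" where
 "computes_pt c S f = (com_tapes c <= {..<4} & pbounded S & mono S & (ALL n. n <= S n) &
   (ALL x rest. runs c (main (encode x @ rest)) (S (esize x)) (main (encode (f x) @ rest))) &
   (ALL x. esize (f x) <= S (esize x)))"

lemma computes_ptD:
 assumes "computes_pt c S f"
 shows "com_tapes c <= {..<4}" "pbounded S" "mono S" "!!n. n <= S n"
  "!!x rest. runs c (main (encode x @ rest)) (S (esize x)) (main (encode (f x) @ rest))"
  "!!x. esize (f x) <= S (esize x)" using assms by (auto simp: computes_pt_def)

lemma ptE:
 assumes "pt f"
 obtains c S where "computes_pt c S f"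
proof -
 obtain c k where c: "com_tapes c <= {..<4}"
  "!!x rest. runs c (main (encode x @ rest)) ((esize x + 2) ^ k) (main (encode (f x) @ rest))" using assms by (auto simp: pt_def)
 obtain l where l: "!!x. esize (f x) <= (esize x + 2) ^ l" using pt_esize[OF assms] by blast
 define S where "S = (%n :: nat. (n + 2) ^ k + (n + 2) ^ l + n)"
 have "computes_pt c S f" unfolding computes_pt_def
 proof (intro conjI allI)
  show "pbounded S" unfolding S_def by (intro pb_intros)
  show "mono S" unfolding S_def by (intro monoI add_mono power_mono) auto
  show "n <= S n" for n by (simp add: S_def)
  show "runs c (main (encode x @ rest)) (S (esize x)) (main (encode (f x) @ rest))" for x rest by (rule runs_mono[OF c(2)]) (simp add: S_def)
  show "esize (f x) <= S (esize x)" for x using l[of x] by (simp add: S_def)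
 qed (rule c(1))
 thus ?thesis by (rule that)
qed

lemma runs_tree_ops:
 fixes x :: "'a :: treeable" and y :: "'b :: treeable" and z :: "'c :: treeable"
 shows "runs swap (main (encode x @ encode y @ a)) (12 * (esize x + esize y) + 8) (main (encode y @ encode x @ a))"
  "runs swap_below (main (encode x @ encode y @ encode z @ a)) (12 * (esize x + esize y + esize z) + 11)
   (main (encode x @ encode z @ encode y @ a))"
  "runs drop_tree (main (encode x @ a)) (9 * esize x + 4) (main a)"
  "runs dup (main (encode x @ a)) (24 * esize x + 6) (main (encode x @ encode x @ a))"
 unfolding encode_def esize_def by (rule runs_swap runs_swap_below runs_drop runs_dup)+

section \<open>Closure rules for polynomial-time functions\<close>

named_theorems pts

lemma pt_id [pts]: "pt (%x. x)" by (rule ptI[of Skip "%_. 1"]) (intro pb_intros runs_Skip | simp)+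

lemma pt_const [pts]: "pt (%x. c)"
proof (rule ptI[where c = "drop_tree ;; pushes (encode c)" and T = "%n. 9 * n + 4 + (2 * esize c + 1)"], goal_cases)
 case (3 x rest) show ?case unfolding esize_def[of c] by (rule runs_Seq runs_tree_ops runs_pushes)+
qed (simp add: com_tapes_ops, intro pb_intros)

lemma pt_comp:
 assumes "pt f" "pt g"
 shows "pt (%x. f (g x))"
proof -
 obtain c S where "computes_pt c S (%x. f x)" using ptE[OF assms(1)] by blast
 note c = computes_ptD[OF this]
 obtain d T where "computes_pt d T (%x. g x)" using ptE[OF assms(2)] by blast
 note d = computes_ptD[OF this]
 show ?thesis
 proof (rule ptI)
  show "com_tapes (d ;; c) <= {..<4}" using c d by simp
  show "pbounded (%n. T n + S (T n))" by (intro pbounded_add[OF d(2) pbounded_comp[OF c(2) d(2)]])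
  show "runs (d ;; c) (main (encode x @ rest)) (T (esize x) + S (T (esize x))) (main (encode (f (g x)) @ rest))" for x rest
   using runs_Seq[OF d(5) c(5), of x rest] monoD[OF c(3) d(6)[of x]] by (auto elim: runs_mono)
 qed
qed

text \<open>Only encodings count. A nonempty list is encoded like a pair and a number like its list
  of digits, so functions into one type yield functions into the other.\<close>

lemma pt_recode: "pt f ==> (!!x. encode (f x) = encode (g x)) ==> pt g" unfolding pt_def by simp

lemma pt_Pair [pts]:
 assumes "pt f" "pt g"
 shows "pt (%x. (f x, g x))"
proof -
 obtain c S where "computes_pt c S (%x. f x)" using ptE[OF assms(1)] by blast
 note c = computes_ptD[OF this]
 obtain d T where "computes_pt d T (%x. g x)" using ptE[OF assms(2)] by blast
 note d = computes_ptD[OF this]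
 show ?thesis
 proof (rule ptI[where c = "dup ;; c ;; swap ;; d ;; swap ;; Push 0 True" and T = "%n. 48 * n + 30 + 25 * S n + 25 * T n"], goal_cases)
  case (3 x rest) show ?case unfolding encode_simps append_Cons append_assoc
   by (rule runs_mono, (rule runs_Seq runs_tree_ops c(5) d(5) runs_stk)+) (use c(6)[of x] d(6)[of x] in simp)
 qed (use c d com_tapes_ops in simp, use c d in "intro pb_intros")
qed

lemma pt_fst_raw: "pt fst"
proof (rule ptI[where c = "Pop 0 ;; swap ;; drop_tree" and T = "%n. 21 * n + 13"], goal_cases)
 case (3 x rest)
 obtain a b where x: "x = (a, b)" by (cases x)
 show ?case unfolding x encode_simps append_Cons append_assoc fst_conv by (rule runs_mono, (rule runs_Seq runs_tree_ops runs_stk)+) simp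
qed (simp add: com_tapes_ops, intro pb_intros)

lemma pt_snd_raw: "pt snd"
proof (rule ptI[where c = "Pop 0 ;; drop_tree" and T = "%n. 9 * n + 5"], goal_cases)
 case (3 x rest)
 obtain a b where x: "x = (a, b)" by (cases x)
 show ?case unfolding x encode_simps append_Cons append_assoc snd_conv by (rule runs_mono, (rule runs_Seq runs_tree_ops runs_stk)+) simp
qed (simp add: com_tapes_ops, intro pb_intros)

lemma pt_fst [pts]: "pt f ==> pt (%x. fst (f x))" by (rule pt_comp[OF pt_fst_raw])

lemma pt_snd [pts]: "pt f ==> pt (%x. snd (f x))" by (rule pt_comp[OF pt_snd_raw])

lemma pt_if [pts]:
 assumes "pt b" "pt f" "pt g"
 shows "pt (%x. if b x then f x else g x)"
proof -
 obtain e U where "computes_pt e U (%x. b x)" using ptE[OF assms(1)] by blast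
 note e = computes_ptD[OF this]
 obtain c S where "computes_pt c S (%x. f x)" using ptE[OF assms(2)] by blast
 note c = computes_ptD[OF this]
 obtain d T where "computes_pt d T (%x. g x)" using ptE[OF assms(3)] by blast
 note d = computes_ptD[OF this]
 let ?C = "Case 0 Skip (Pop 0 ;; d) (Pop 0 ;; Pop 0 ;; Pop 0 ;; c)"
 show ?thesis
 proof (rule ptI[where c = "dup ;; e ;; ?C" and T = "%n. 24 * n + 6 + (U n + (S n + T n + 4))"], goal_cases)
  case (3 x rest)
  have "runs ?C (main (encode (b x) @ encode x @ rest)) (S (esize x) + T (esize x) + 4)
   (main (encode (if b x then f x else g x) @ rest))" by (cases "b x"; simp add: encode_simps;
    (rule runs_mono, rule runs_Case_True runs_Case_False, simp, (rule runs_Seq runs_stk c(5) d(5))+, simp))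
  thus ?case by (intro runs_Seq[OF runs_tree_ops(4)] runs_Seq[OF e(5)])
 qed (use c d e com_tapes_ops in simp, use c d e in "intro pb_intros")
qed

lemma pt_eq [pts]:
 fixes f g :: "'a :: treeable => 'b :: treeable"
 assumes "pt f" "pt g"
 shows "pt (%x. f x = g x)"
proof -
 have "pt (%z :: 'b * 'b. fst z = snd z)"
 proof (rule ptI[where c = "Pop 0 ;; eq_trees" and T = "%n. 40 * n + 41"], goal_cases)
  case (3 z rest)
  obtain a b where z: "z = (a, b)" by (cases z)
  have "encode (fst z = snd z) = (if to_tree a = to_tree b then [True, False, False] else [False])" by (cases "a = b") (auto simp: z encode_simps dest: to_tree_inj)
  hence "runs eq_trees (main (encode a @ encode b @ rest)) (40 * (esize a + esize b) + 40) (main (encode (fst z = snd z) @ rest))"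
   using runs_eq_trees[of "to_tree a" "to_tree b" rest] by (simp add: encode_def esize_def)
  note * = runs_Seq[OF runs_stk(5) this]
  show ?case unfolding z encode_simps append_Cons append_assoc by (rule runs_mono[OF *[unfolded z]]) simp
 qed (simp add: com_tapes_ops, intro pb_intros)
 from pt_comp[OF this pt_Pair[OF assms]] show ?thesis by simp
qed

lemma pt_not [pts]: "pt f ==> pt (%x. ~ f x)" using pt_eq[OF _ pt_const[of False], of f] by simp

lemma pt_conj [pts]: "pt f ==> pt g ==> pt (%x. f x & g x)"
proof -
 assume "pt f" "pt g"
 hence "pt (%x. if f x then g x else False)" by (intro pt_if pt_const)
 moreover have "(%x. if f x then g x else False) = (%x. f x & g x)" by auto
 ultimately show ?thesis by (simp only:)
qed

lemma pt_disj [pts]: "pt f ==> pt g ==> pt (%x. f x | g x)"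
proof -
 assume "pt f" "pt g"
 hence "pt (%x. ~ (~ f x & ~ g x))" by (intro pt_not pt_conj)
 thus ?thesis by simp
qed

lemma pt_imp [pts]: "pt f ==> pt g ==> pt (%x. f x --> g x)" unfolding imp_conv_disj by (intro pts)

lemma pt_Cons [pts]: "pt f ==> pt g ==> pt (%x. f x # g x)" by (rule pt_recode[OF pt_Pair[of f g]]) (auto simp: encode_simps)

text \<open>A list is a leaf or a pair; on the leaf the program pushes the encoding of the junk value.\<close>

lemma pt_pair_case:
 fixes d :: "'b :: treeable"
 assumes c: "com_tapes c <= {..<4}" "pbounded T"
  and f: "!!x. encode x = [False] & f x = d |
   (EX u. encode x = True # u & (ALL rest. runs c (main (u @ rest)) (T (esize x)) (main (encode (f x) @ rest))))"
 shows "pt f"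
proof (rule ptI[where c = "Case 0 Skip (Pop 0 ;; pushes (encode d)) (Pop 0 ;; c)" and T = "%n. T n + 2 * esize d + 3"], goal_cases)
 case (3 x rest)
 from f[of x] show ?case
 proof (elim disjE conjE exE)
  assume a: "encode x = [False]" "f x = d"
  show ?thesis unfolding a append_Cons append_Nil by (rule runs_mono, rule runs_Case_False, simp, (rule runs_Seq runs_stk runs_pushes)+) (simp add: esize_def)
 next
  fix u assume a: "encode x = True # u" "ALL rest. runs c (main (u @ rest)) (T (esize x)) (main (encode (f x) @ rest))"
  show ?thesis unfolding a(1) append_Cons by (rule runs_mono, rule runs_Case_True, simp, (rule runs_Seq runs_stk a(2)[rule_format])+) simp
 qed
qed (use c com_tapes_ops in simp, use c in "intro pb_intros")

lemma pt_tl [pts]: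
 fixes f :: "'a :: treeable => 'b :: treeable list"
 assumes "pt f"
 shows "pt (%x. tl (f x))"
proof (rule pt_comp[OF pt_pair_case assms])
 show "encode xs = [False] & tl xs = [] | (EX u. encode xs = True # u &
  (ALL rest. runs drop_tree (main (u @ rest)) (9 * esize xs + 4) (main (encode (tl xs) @ rest))))" for xs :: "'b list"
  by (cases xs) (auto simp: encode_simps intro: runs_mono[OF runs_tree_ops(3)])
qed (rule com_tapes_ops, intro pb_intros)

lemma pt_hd [pts]:
 fixes f :: "'a :: treeable => 'b :: treeable list"
 assumes "pt f"
 shows "pt (%x. hd (f x))"
proof (rule pt_comp[OF pt_pair_case assms])
 show "encode xs = [False] & hd xs = hd [] | (EX u. encode xs = True # u &
  (ALL rest. runs (swap ;; drop_tree) (main (u @ rest)) (21 * esize xs + 12) (main (encode (hd xs) @ rest))))" for xs :: "'b list"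
  by (cases xs) (auto simp: encode_simps intro!: runs_mono[OF runs_Seq[OF runs_tree_ops(1) runs_tree_ops(3)]])
qed (simp add: com_tapes_ops, intro pb_intros)

text \<open>The leading bit of an encoded list tells whether another element follows and controls
  the loop. Iterating a polynomial-time step may blow up the accumulator, so the sizes of all
  intermediate accumulators are bounded in terms of the initial input.\<close>

lemma pt_fold_raw:
 fixes g :: "'a :: treeable => 'b :: treeable => 'b"
 assumes g: "pt (%z. g (fst z) (snd z))"
  and bound: "pbounded B" "!!xs ys zs s. xs = ys @ zs ==> esize (fold g ys s) <= B (esize (xs, s))"
 shows "pt (%z. fold g (fst z) (snd z))"
proof -
 obtain c S where "computes_pt c S (%x. g (fst x) (snd x))" using ptE[OF g] by blast
 note c = computes_ptD[OF this]
 let ?body = "Pop 0 ;; swap_below ;; Push 0 True ;; c ;; swap"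
 define U where "U = (%n. 1 + (12 * (n + n + B n) + 11 + (2 + (S (Suc (n + B n)) + (12 * (B n + n) + 8)))))"
 have SU: "pbounded (%n. S (Suc (n + B n)))" by (rule pbounded_comp[OF c(2)]) (intro pb_intros bound(1))
 have U: "pbounded U" unfolding U_def by (intro pb_intros SU bound(1))
 show ?thesis
 proof (rule ptI)
  show "com_tapes (Pop 0 ;; Loop 0 {2} ?body ;; Pop 0) <= {..<4}" using c com_tapes_ops by simp
  show "pbounded (%n. 1 + (n * (U n + 1) + 1 + 1))" using U by (intro pb_intros)
  fix z :: "'a list * 'b" and rest
  obtain xs s where z: "z = (xs, s)" by (cases z)
  let ?n = "esize z"
  have loop: "runs (Loop 0 {2} ?body) (main (encode zs @ encode (fold g ys s) @ rest)) (length zs * (U ?n + 1) + 1)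
   (main (False # encode (fold g xs s) @ rest))" if "xs = ys @ zs" for ys zs using that
  proof (induction zs arbitrary: ys)
   case Nil
   thus ?case using runs_Loop_end[of "main (encode [] @ encode (fold g ys s) @ rest)" 0 "{2}" ?body] by (simp add: encode_simps)
  next case (Cons x zs)
   let ?s = "fold g ys s" and ?s' = "fold g (ys @ [x]) s"
   have sz: "esize x <= ?n" "esize zs <= ?n" "esize ?s <= B ?n" "esize ?s' <= B ?n"
    using bound(2)[OF Cons.prems, of s] bound(2)[of xs "ys @ [x]" zs s] Cons.prems esize_pos[of ys] esize_pos[of zs] unfolding z by auto
   have c5: "runs c (main (True # encode x @ encode ?s @ encode zs @ rest)) (S (esize (x, ?s))) (main (encode ?s' @ encode zs @ rest))"
    using c(5)[of "(x, ?s)" "encode zs @ rest"] by (simp add: encode_simps)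
   have "S (esize (x, ?s)) <= S (Suc (?n + B ?n))" by (rule monoD[OF c(3)]) (use sz in simp)
   hence "runs ?body (main (True # encode x @ encode zs @ encode ?s @ rest)) (U ?n) (main (encode zs @ encode ?s' @ rest))"
    by - (rule runs_mono, (rule runs_Seq runs_tree_ops runs_stk c5)+, use sz in "simp add: U_def")
   moreover have "runs (Loop 0 {2} ?body) (main (encode zs @ encode ?s' @ rest)) (length zs * (U ?n + 1) + 1) (main (False # encode (fold g xs s) @ rest))"
    by (rule Cons.IH) (use Cons.prems in simp)
   ultimately have "runs (Loop 0 {2} ?body) (main (True # encode x @ encode zs @ encode ?s @ rest)) (U ?n + (length zs * (U ?n + 1) + 1) + 1)
    (main (False # encode (fold g xs s) @ rest))" by (intro runs_Loop_step) auto
   thus ?case by (auto simp: encode_simps elim: runs_mono)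
  qed
  have "length xs * (U ?n + 1) <= ?n * (U ?n + 1)" using length_esize[of xs] by (intro mult_le_mono1) (simp add: z)
  thus "runs (Pop 0 ;; Loop 0 {2} ?body ;; Pop 0) (main (encode z @ rest)) (1 + (?n * (U ?n + 1) + 1 + 1)) (main (encode (fold g (fst z) (snd z)) @ rest))"
   unfolding z encode_simps append_Cons append_assoc fst_conv snd_conv
   by - (rule runs_mono, (rule runs_Seq runs_stk loop[of "[]" xs, unfolded fold_simps z append_Nil, OF refl])+, simp)
 qed
qed

text \<open>The parameter on which the step function depends is carried along unchanged in the
  accumulator.\<close>

lemma pt_fold_bounded:
 fixes h :: "'a :: treeable => 'b :: treeable => 'c :: treeable => 'c"
 assumes h: "pt (%z. h (fst z) (fst (snd z)) (snd (snd z)))" and "pt F" "pt S"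
  and bound: "pbounded B" "!!p xs ys zs s. xs = ys @ zs ==> esize (fold (h p) ys s) <= B (esize p + esize xs + esize s)" "mono B"
 shows "pt (%w. fold (h w) (F w) (S w))"
proof -
 let ?g = "%x ps. (fst ps, h (fst ps) x (snd ps))"
 have fold: "fold ?g xs ps = (fst ps, fold (h (fst ps)) xs (snd ps))" for xs ps by (induction xs arbitrary: ps) auto
 have "pt (%z. (fst (snd z), (fst z, snd (snd z))))" by (intro pts)
 from pt_comp[OF h this] have "pt (%z. (fst (snd z), h (fst (snd z)) (fst z) (snd (snd z))))" by (intro pts) simp
 hence "pt (%z. fold ?g (fst z) (snd z))"
 proof (rule pt_fold_raw)
  show "pbounded (%n. Suc (n + B n))" using bound by (intro pb_intros)
  fix ps and xs ys zs :: "'b list" assume "xs = ys @ zs"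
  hence "esize (fold (h (fst ps)) ys (snd ps)) <= B (esize (fst ps) + esize xs + esize (snd ps))" by (rule bound(2))
  also have "... <= B (esize (xs, ps))" by (rule monoD[OF bound(3)]) (cases ps; simp)
  finally show "esize (fold ?g ys ps) <= Suc (esize (xs, ps) + B (esize (xs, ps)))" unfolding fold by (cases ps) auto
 qed
 from pt_comp[OF pt_snd[OF this], of "%w. (F w, (w, S w))"] show ?thesis using assms(2,3) by (simp add: fold pts)
qed

text \<open>If each step adds an amount that does not depend on the accumulator, the sizes stay
  polynomial.\<close>

lemma pt_fold:
 fixes h :: "'a :: treeable => 'b :: treeable => 'c :: treeable => 'c"
 assumes h: "pt (%z. h (fst z) (fst (snd z)) (snd (snd z)))"
  and bound: "pbounded B" "mono B" "!!p x s. esize (h p x s) <= esize s + B (esize p + esize x)"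
  and "pt F" "pt S"
 shows "pt (%w. fold (h w) (F w) (S w))"
proof (rule pt_fold_bounded[OF h assms(5,6)])
 show "pbounded (%n. n + n * B n)" using bound by (intro pb_intros)
 show "mono (%n. n + n * B n)" using bound(2) by (auto intro!: monoI add_mono mult_mono dest: monoD)
 fix p s and xs ys zs :: "'b list" assume "xs = ys @ zs"
 have "esize (fold (h p) us s) <= esize s + length us * B (esize p + esize xs)" if "set us <= set xs" for us using that
 proof (induction us arbitrary: s)
  case (Cons u us)
  have "esize (h p u s) <= esize s + B (esize p + esize u)" by (rule bound(3))
  also have "B (esize p + esize u) <= B (esize p + esize xs)" using esize_mem[of u xs] Cons.prems by (intro monoD[OF bound(2)]) auto
  finally show ?case using Cons.IH[of "h p u s"] Cons.prems by simp
 qed simp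
 hence "esize (fold (h p) ys s) <= esize s + length ys * B (esize p + esize xs)" using `xs = ys @ zs` by simp
 also have "... <= (esize p + esize xs + esize s) + (esize p + esize xs + esize s) * B (esize p + esize xs + esize s)"
  using `xs = ys @ zs` length_esize[of xs] by (intro add_mono[of "esize s"] mult_mono monoD[OF bound(2)]) (simp_all del: esize_append)
 finally show "esize (fold (h p) ys s) <= (esize p + esize xs + esize s) + (esize p + esize xs + esize s) * B (esize p + esize xs + esize s)" .
qed

section \<open>List functions as folds\<close>

lemma fold_Cons_rev: "fold (#) xs ys = rev xs @ ys" by (induction xs arbitrary: ys) auto

lemma pt_fold_Cons: "pt f ==> pt g ==> pt (%x. rev (f x) @ g x)"
proof -
 assume "pt f" "pt g"
 hence "pt (%x. fold (%y s. y # s) (f x) (g x))" by (intro pt_fold[where B = "%n. Suc n"] pts) (auto intro: pb_intros simp: mono_def)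
 thus ?thesis unfolding fold_Cons_rev .
qed

lemma pt_rev [pts]: "pt f ==> pt (%x. rev (f x))" using pt_fold_Cons[OF _ pt_const[of "[]"], of f] by simp

lemma pt_append [pts]: "pt f ==> pt g ==> pt (%x. f x @ g x)" using pt_fold_Cons[OF pt_rev, of f g] by simp

lemma pt_map [pts]:
 assumes "pt (%z. h (fst z) (snd z))" "pt f"
 shows "pt (%x. map (h x) (f x))"
proof -
 obtain c S where "computes_pt c S (%x. h (fst x) (snd x))" using ptE[OF assms(1)] by blast
 note S = computes_ptD[OF this]
 have "esize (h p y # s) <= esize s + Suc (S (Suc (esize p + esize y)))" for p y s using S(6)[of "(p, y)"] by simp
 moreover have "pt (%z. (fst z, fst (snd z)))" by (intro pts)
 from pt_comp[OF assms(1) this] have "pt (%z. h (fst z) (fst (snd z)) # snd (snd z))" by (intro pts) simp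
 moreover have "pbounded (%n. Suc (S (Suc n)))" by (rule pbounded_Suc[OF pbounded_comp[OF S(2)]]) (intro pb_intros)
 moreover have "mono (%n. Suc (S (Suc n)))" using S(3) by (auto intro!: monoI dest: monoD)
 ultimately have "pt (%x. fold (%y s. h x y # s) (f x) [])" by (intro pt_fold[where B = "%n. Suc (S (Suc n))"] assms(2) pt_const)
 moreover have "fold (%y s. h x y # s) ys s = rev (map (h x) ys) @ s" for x ys s by (induction ys arbitrary: s) auto
 ultimately have "pt (%x. rev (map (h x) (f x)))" by simp
 from pt_rev[OF this] show ?thesis by simp
qed

lemma pt_concat [pts]:
 fixes f :: "'a :: treeable => 'b :: treeable list list"
 assumes "pt f"
 shows "pt (%x. concat (f x))"
proof -
 have "pt (%x. fold (%y s. s @ y) (f x) [])" using assms by (intro pt_fold[where B = "%n. n"]) (auto intro!: pts pb_intros monoI)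
 moreover have "fold (%y s. s @ y) ys s = s @ concat ys" for ys :: "'b list list" and s by (induction ys arbitrary: s) auto
 ultimately show ?thesis by simp
qed

lemma pt_filter [pts]:
 fixes f :: "'a :: treeable => 'b :: treeable list"
 assumes "pt (%z. h (fst z) (snd z))" "pt f"
 shows "pt (%x. filter (h x) (f x))"
proof -
 have eq: "filter P xs = concat (map (%y. if P y then [y] else []) xs)" for P and xs :: "'b list" by (induction xs) auto
 show ?thesis unfolding eq by (intro pts assms)
qed

lemma pt_ball [pts]:
 fixes f :: "'a :: treeable => 'b :: treeable list"
 assumes "pt (%z. h (fst z) (snd z))" "pt f"
 shows "pt (%x. ALL y:set (f x). h x y)"
proof -
 have eq: "(ALL y:set ys. P y) = (filter (%y. ~ P y) ys = [])" for P and ys :: "'b list" by (auto simp: filter_empty_conv)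
 show ?thesis unfolding eq by (intro pts assms)
qed

lemma pt_bex [pts]:
 fixes f :: "'a :: treeable => 'b :: treeable list"
 assumes "pt (%z. h (fst z) (snd z))" "pt f"
 shows "pt (%x. EX y:set (f x). h x y)"
proof -
 have eq: "(EX y:set ys. P y) = (filter P ys ~= [])" for P and ys :: "'b list" by (auto simp: filter_empty_conv)
 show ?thesis unfolding eq by (intro pts assms)
qed

lemma pt_mem [pts]: "pt f ==> pt g ==> pt (%x. f x : set (g x))"
proof -
 assume fg: "pt f" "pt g"
 have "pt (%x. EX y:set (g x). f x = y)" by (rule pt_bex[OF pt_eq[OF pt_comp[OF fg(1) pt_fst[OF pt_id]] pt_snd[OF pt_id]] fg(2)])
 thus ?thesis by simp
qed

lemma pt_zip [pts]:
 fixes f :: "'c :: treeable => 'a :: treeable list" and g :: "'c => 'b :: treeable list"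
 assumes "pt f" "pt g"
 shows "pt (%x. zip (f x) (g x))"
proof -
 let ?h = "%(p :: 'c) (x :: 'a) (s :: 'b list * ('a * 'b) list).
  if fst s = [] then s else (tl (fst s), (x, hd (fst s)) # snd s)"
 have "pt (%w. fold (?h w) (f w) (g w, []))"
 proof (rule pt_fold)
  show "pbounded (%n. n + 2)" "mono (%n :: nat. n + 2)" by (auto intro!: pb_intros monoI)
  show "esize (?h p x s) <= esize s + (esize p + esize x + 2)" for p x s by (cases s; cases "fst s") auto
  show "pt (%z. ?h (fst z) (fst (snd z)) (snd (snd z)))" by (intro pts)
 qed (intro pts assms)+
 hence "pt (%w. rev (snd (fold (?h w) (f w) (g w, []))))" by (intro pts)
 moreover have nil: "fold (?h w) xs ([], acc) = ([], acc)" for xs acc by (induction xs) auto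
 have "snd (fold (?h w) xs (ys, acc)) = rev (zip xs ys) @ acc" for w :: 'c and xs ys acc
 proof (induction xs arbitrary: ys acc)
  case (Cons x xs) show ?case
  proof (cases ys)
   case Nil thus ?thesis using nil[of "x # xs" acc] by simp
 next case (Cons y ys') thus ?thesis using Cons.IH[of ys' "(x, y) # acc"] by simp
  qed
 qed simp
 hence "rev (snd (fold (?h w) (f w) (g w, []))) = zip (f w) (g w)" for w by simp
 ultimately show ?thesis by simp
qed

section \<open>Polynomial-time functions on words\<close>

definition load :: com where
 "load = move_all 0 (Suc 0) ;; Push 0 False ;; Loop (Suc 0) {1, 2} (Case (Suc 0) Skip
   (Pop (Suc 0) ;; pushes [True, False]) (Pop (Suc 0) ;; pushes [True, True, False, False]))"

lemma runs_load: "runs load (main w) (20 * length w + 10) (main (encode w))"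
proof -
 let ?C = "%b. Pop (Suc 0) ;; pushes (True # encode b)"
 let ?L = "Loop (Suc 0) {1, 2} (Case (Suc 0) Skip (?C False) (?C True))"
 have L: "runs ?L (stk (encode u) w' [] []) (12 * length w' + 1) (stk (encode (rev w' @ u)) [] [] [])" for u w' :: "bool list"
 proof (induction w' arbitrary: u)
  case Nil thus ?case using runs_Loop_end[of "stk (encode u) [] [] []" "Suc 0" "{1, 2}"] by simp
 next case (Cons b w')
  have "runs (?C b) (stk (encode u) (b # w') [] []) 10 (stk (encode (b # u)) w' [] [])"
   by (rule runs_weaken, (rule runs_Seq runs_stk runs_pushes)+) (cases b; simp add: encode_simps)+
  from runs_Loop_bit[where C = ?C, OF _ this Cons[of "b # u"]] show ?case by (auto elim: runs_mono)
 qed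
 have 1: "runs (move_all 0 (Suc 0)) (main w) (5 * length w + 1) (stk [] (rev w) [] [])" using runs_move_all[of 0 "Suc 0" "main w"] by simp
 have 2: "runs ?L (stk [False] (rev w) [] []) (12 * length w + 1) (main (encode w))" using L[of "[]" "rev w"] by (simp add: encode_simps)
 have e: "load = move_all 0 (Suc 0) ;; Push 0 False ;; ?L" by (simp add: load_def encode_simps)
 show ?thesis unfolding e by (rule runs_mono, (rule runs_Seq runs_stk 1 2)+) simp
qed

text \<open>The output has to start at cell 0, but a stack grows to the left. So the bottom of the
  still empty stack 4, the last tape, is moved right once per output bit before the bits are
  pushed.\<close>

definition store :: com where
 "store = Loop 0 {2} (Shift 4 ;; Pop 0 ;; Case 0 Skip (Pop 0 ;; Push (Suc 0) False)
   (Pop 0 ;; Pop 0 ;; Pop 0 ;; Push (Suc 0) True)) ;; Pop 0 ;; move_all (Suc 0) 4"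

lemma runs_exec: "runs c s t s' ==> EX n<=t. exec c (s, b) n (s', b)" by (auto simp: runs_def)

lemma exec_store: "EX n<=20 * length w + 10. EX s. exec store (main (encode w), b) n (s, b(4 := b 4 + int (length w))) & s 4 = w"
proof -
 let ?B = "Pop 0 ;; Case 0 Skip (Pop 0 ;; Push (Suc 0) False) (Pop 0 ;; Pop 0 ;; Pop 0 ;; Push (Suc 0) True)"
 let ?L = "Loop 0 {2} (Shift 4 ;; ?B)"
 have B: "runs ?B (stk (encode (x # v)) u [] []) 7 (stk (encode v) (x # u) [] [])" for x v u
  by (cases x; simp add: encode_simps; (rule runs_mono, rule runs_Seq, rule runs_stk,
   rule runs_Case_True runs_Case_False, simp, (rule runs_Seq runs_stk)+, simp))
 have L: "EX n<=10 * length v + 1. exec ?L (stk (encode v) u [] [], b) n (stk [False] (rev v @ u) [] [], b(4 := b 4 + int (length v)))" for v u b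
 proof (induction v arbitrary: u b)
  case Nil
  have "exec ?L (stk [False] u [] [], b) 1 (stk [False] u [] [], b)" by (rule exec.Loop_end) simp
  thus ?case by (intro exI[of _ 1]) (auto simp: encode_simps)
 next case (Cons x v)
  let ?b = "b(4 := b 4 + 1)"
  obtain n1 where n1: "n1 <= 7" "exec ?B (stk (encode (x # v)) u [] [], ?b) n1 (stk (encode v) (x # u) [] [], ?b)" using runs_exec[OF B] by blast
  obtain n2 where n2: "n2 <= 10 * length v + 1"
   "exec ?L (stk (encode v) (x # u) [] [], ?b) n2 (stk [False] (rev v @ x # u) [] [], ?b(4 := ?b 4 + int (length v)))" using Cons by blast
  have "exec (Shift 4) (stk (encode (x # v)) u [] [], b) 1 (stk (encode (x # v)) u [] [], ?b)" by (rule exec.Shift) simp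
  from exec.Loop_step[OF _ exec.Seq[OF this n1(2)] n2(2)] show ?case using n1(1) n2(1)
   by (intro exI[of _ "Suc (1 + n1 + n2)"]) (auto simp: encode_simps add.assoc simp del: fun_upd_apply simp: fun_upd_same)
 qed
 let ?b = "b(4 := b 4 + int (length w))"
 obtain n1 where n1: "n1 <= 10 * length w + 1" "exec ?L (main (encode w), b) n1 (stk [False] (rev w) [] [], ?b)" using L[of w "[]" b] by auto
 obtain n2 where n2: "n2 <= 1 + (5 * length w + 1)"
  "exec (Pop 0 ;; move_all (Suc 0) 4) (stk [False] (rev w) [] [], ?b) n2 ((main [])(4 := w), ?b)"
  using runs_exec[OF runs_Seq[OF runs_stk(5)[of False "[]" "rev w" "[]" "[]"] runs_move_all[of "Suc 0" 4]], of ?b] by auto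
 have "exec store (main (encode w), b) (n1 + n2) ((main [])(4 := w), ?b)" unfolding store_def by (rule exec.Seq[OF n1(2) n2(2)])
 thus ?thesis using n1(1) n2(1) by (intro exI[of _ "n1 + n2"]) auto
qed

theorem pt_polytime:
 fixes f :: "bool list => bool list"
 assumes "pt f"
 shows "polytime_computable f"
proof -
 obtain c S where "computes_pt c S (%x. f x)" using ptE[OF assms] by blast
 note c = computes_ptD[OF this]
 let ?c = "load ;; c ;; store"
 let ?T = "%n. 20 * n + 10 + (S (4 * n + 1) + (20 * S (4 * n + 1) + 10))"
 have "pbounded (%n. S (4 * n + 1))" by (rule pbounded_comp[OF c(2)]) (intro pb_intros)
 hence "pbounded ?T" by (intro pb_intros)
 then obtain k where k: "!!n. ?T n <= (n + 2) ^ k" by (auto simp: pbounded_def)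
 have tapes: "com_tapes ?c <= {..<5}" using c(1) by (auto simp: load_def store_def move_all_def)
 have "tm_computes_within (com_tm 5 ?c) f (poly ([:2, 1:] ^ k))"
 proof (rule com_computes[OF tapes])
  fix w :: "bool list"
  let ?b = "(%_. 0)(0 := int (length w)) :: nat => int"
  have sw: "S (esize w) <= S (4 * length w + 1)" by (rule monoD[OF c(3) esize_bools])
  obtain n1 where n1: "n1 <= 20 * length w + 10" "exec load (main w, ?b) n1 (main (encode w), ?b)" using runs_exec[OF runs_load] by blast
  obtain n2 where n2: "n2 <= S (esize w)" "exec c (main (encode w), ?b) n2 (main (encode (f w)), ?b)" using runs_exec[OF c(5)[of w "[]"]] by auto
  obtain n3 s where n3: "n3 <= 20 * length (f w) + 10" "exec store (main (encode (f w)), ?b) n3 (s, ?b(4 := ?b 4 + int (length (f w))))" "s 4 = f w"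
   using exec_store by blast
  have "exec ?c (main w, ?b) (n1 + (n2 + n3)) (s, ?b(4 := ?b 4 + int (length (f w))))" by (intro exec.Seq[OF n1(2)] exec.Seq[OF n2(2)] n3(2))
  moreover have "main w = (%_. [])(0 := w)" by (auto simp: stk_def)
  moreover have "length (f w) <= S (4 * length w + 1)" using length_esize[of "f w"] c(6)[of w] sw by linarith
  hence "n1 + (n2 + n3) <= ?T (length w)" using n1(1) n2(1) n3(1) sw by linarith
  hence "n1 + (n2 + n3) <= poly ([:2, 1:] ^ k) (length w)" using k[of "length w"] by (simp add: add.commute)
  ultimately show "EX n s b. n <= poly ([:2, 1:] ^ k) (length w) & exec ?c ((%_. [])(0 := w), ?b) n (s, b) &
    s (5 - 1) = f w & b (5 - 1) = int (length (f w))" using n3(3) by (intro exI[of _ "n1 + (n2 + n3)"] exI[of _ s] exI[of _ "?b(4 := ?b 4 + int (length (f w)))"]) auto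
 qed simp
 moreover have "wf_tm (com_tm 5 ?c)" using tapes by (rule wf_com_tm) simp
 ultimately show ?thesis unfolding polytime_computable_def by blast
qed

section \<open>Arithmetic in polynomial time\<close>

primrec val :: "bool list => nat" where
 "val [] = 0"
| "val (b # bs) = of_bool b + 2 * val bs"

lemma binary_0 [simp]: "binary 0 = []" by (simp add: binary.simps)

lemma binary_step: "binary (of_bool b + 2 * n) = (if b | binary n ~= [] then b # binary n else [])"
proof (cases "b | n ~= 0")
 case True
 have "binary n ~= []" if "n ~= 0" using that by (subst binary.simps) simp
 thus ?thesis using True by (subst binary.simps) auto
qed simp

lemma val_binary [simp]: "val (binary n) = n"
proof (induction n rule: less_induct)
 case (less n) show ?case
 proof (cases "n = 0")
  case False hence "val (binary (n div 2)) = n div 2" by (intro less) auto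
  moreover have "binary n = odd n # binary (n div 2)" using False by (subst binary.simps) simp
  ultimately show ?thesis by (simp add: odd_two_times_div_two_succ of_bool_def)
 qed simp
qed

lemma binary_inj: "(binary m = binary n) = (m = n)" by (metis val_binary)

lemma binary_val: "binary (val bs) = foldr (%b s. if b | s ~= [] then b # s else []) bs []"
 by (induction bs) (simp_all only: val.simps binary_step binary_0 foldr.simps comp_apply id_apply)

lemma val_append [simp]: "val (xs @ ys) = val xs + 2 ^ length xs * val ys" by (induction xs) (auto simp: algebra_simps)

lemma val_replicate_False [simp]: "val (replicate k False) = 0" by (induction k) auto

lemma val_less: "val bs < 2 ^ length bs" by (induction bs) (auto simp: of_bool_def)

lemma length_binary: "(length (binary n) <= k) = (n < 2 ^ k)"
proof (induction k arbitrary: n)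
 case 0 thus ?case by (cases "n = 0") (auto simp: binary.simps[of n])
next case (Suc k)
 show ?case
 proof (cases "n = 0")
  case False hence "length (binary n) = Suc (length (binary (n div 2)))" by (subst binary.simps) simp
  hence "(length (binary n) <= Suc k) = (n div 2 < 2 ^ k)" using Suc[of "n div 2"] by simp
  thus ?thesis by auto
 qed simp
qed

instantiation nat :: treeable begin
definition "to_tree n = to_tree (binary n)"
instance by standard (metis to_tree_inj to_tree_nat_def binary_inj)
end

instantiation int :: treeable begin
definition "to_tree z = to_tree (z < 0, nat (abs z))"
instance
proof
 fix x y :: int assume "to_tree x = to_tree y"
 hence "(x < 0, nat (abs x)) = (y < 0, nat (abs y))" by (simp only: to_tree_int_def to_tree_inj)
 thus "x = y" by auto
qed
end

lemma encode_nat: "encode (n :: nat) = encode (binary n)" by (simp add: encode_def to_tree_nat_def)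

lemma encode_int: "encode (z :: int) = encode (z < 0, nat (abs z))" by (simp add: encode_def to_tree_int_def)

lemma esize_nat_binary: "esize (n :: nat) = esize (binary n)" by (simp add: esize_def encode_nat)

lemma esize_nat: "(n :: nat) < 2 ^ k ==> esize n <= 4 * k + 1" using esize_bools[of "binary n"] length_binary[of n k] by (simp add: esize_nat_binary)

lemma less_esize: "(n :: nat) < 2 ^ esize n" using length_binary[of n "esize n"] length_esize[of "binary n"] by (simp add: esize_nat_binary)

lemma esize_int: "abs (z :: int) < 2 ^ k ==> esize z <= 4 * k + 5"
proof -
 assume "abs (z :: int) < 2 ^ k"
 hence "nat (abs z) < 2 ^ k" by (simp add: nat_less_iff)
 hence "esize (nat (abs z)) <= 4 * k + 1" by (rule esize_nat)
 moreover have "esize z = Suc (esize (z < 0) + esize (nat (abs z)))" by (simp add: esize_def encode_int encode_simps)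
 ultimately show ?thesis using esize_bool[of "z < 0"] by simp
qed

lemma pt_binary [pts]: "pt f ==> pt (%x. binary (f x))" by (erule pt_recode) (rule encode_nat)

lemma pt_val [pts]:
 assumes "pt f"
 shows "pt (%x. val (f x))"
proof -
 let ?h = "%(p :: 'a) b s. if b | s ~= [] then b # s else []"
 have "pt (%x. fold (?h x) (rev (f x)) [])"
 proof (rule pt_fold)
  show "pbounded (%n. n + 4)" "mono (%n :: nat. n + 4)" by (auto intro!: pb_intros monoI)
  show "pt (%z. ?h (fst z) (fst (snd z)) (snd (snd z)))" by (intro pts)
  show "esize (?h p x s) <= esize s + (esize p + esize x + 4)" for p x s by auto
 qed (intro pts assms)+
 hence "pt (%x. binary (val (f x)))" by (simp add: binary_val foldr_conv_fold)
 thus ?thesis by (rule pt_recode) (simp add: encode_nat)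
qed

lemma pt_negative [pts]: "pt f ==> pt (%x. f x < (0 :: int))"
 and pt_nat_abs [pts]: "pt f ==> pt (%x. nat (abs (f x)))"
proof -
 assume "pt f"
 hence "pt (%x. (f x < 0, nat (abs (f x))))" by (rule pt_recode) (rule encode_int)
 from pt_fst[OF this] pt_snd[OF this] show "pt (%x. f x < (0 :: int))" "pt (%x. nat (abs (f x)))" by simp_all
qed

lemma pt_int [pts]: "pt f ==> pt (%x. int (f x))" by (rule pt_recode[OF pt_Pair[OF pt_const[of False], of f]]) (auto simp: encode_int)

lemma pt_uminus_int [pts]: "pt f ==> pt (%x. - int (f x))"
proof -
 assume f: "pt f"
 show ?thesis by (rule pt_recode[OF pt_Pair[OF pt_not[OF pt_eq[OF f pt_const[of 0]]] f]]) (auto simp: encode_int)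
qed

subsection \<open>Ripple-carry addition\<close>

text \<open>The state consists of the carry and of the digits of the sum so far, most recent
  first.\<close>

definition adder :: "(bool * bool) list => bool * bool list => bool * bool list" where
 "adder = fold (%z s. (if fst z then snd z | fst s else snd z & fst s, (fst z ~= (snd z ~= fst s)) # snd s))"

lemma adder_val: "adder zs (c, u) = (c', u') ==> length u' = length u + length zs &
  val (rev u') + 2 ^ (length u + length zs) * of_bool c' =
  val (rev u) + 2 ^ length u * (of_bool c + val (map fst zs) + val (map snd zs))"
proof (induction zs arbitrary: c u)
 case (Cons z zs)
 obtain x y where z: "z = (x, y)" by (cases z)
 let ?c = "if x then y | c else y & c" and ?u = "(x ~= (y ~= c)) # u"
 have "adder zs (?c, ?u) = (c', u')" using Cons.prems by (simp only: adder_def z fold_simps(2) fst_conv snd_conv)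
 note IH = Cons.IH[OF this]
 have "of_bool (x ~= (y ~= c)) + 2 * of_bool ?c = (of_bool c + of_bool x + of_bool y :: nat)" by auto
 hence "2 ^ length u * (of_bool (x ~= (y ~= c)) + 2 * of_bool ?c) = 2 ^ length u * (of_bool c + of_bool x + of_bool y :: nat)" by simp
 thus ?case using IH by (simp add: z algebra_simps)
qed (simp add: adder_def)

lemma pt_adder [pts]:
 assumes "pt f" "pt g"
 shows "pt (%x. adder (f x) (g x))"
proof -
 let ?h = "%(p :: 'a) (z :: bool * bool) (s :: bool * bool list).
  (if fst z then snd z | fst s else snd z & fst s, (fst z ~= (snd z ~= fst s)) # snd s)"
 have "pt (%x. fold (?h x) (f x) (g x))"
 proof (rule pt_fold)
  show "pbounded (%n. n + 8)" "mono (%n :: nat. n + 8)" by (auto intro!: pb_intros monoI)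
  show "pt (%z. ?h (fst z) (fst (snd z)) (snd (snd z)))" by (intro pts)
  show "esize (?h p x s) <= esize s + (esize p + esize x + 8)" for p x s
   using esize_bool[of "if fst x then snd x | fst s else snd x & fst s"] esize_bool[of "fst x ~= (snd x ~= fst s)"] unfolding esize_simps by (cases s) auto
 qed (intro assms)+
 thus ?thesis by (simp add: adder_def)
qed

text \<open>Padding each operand by the length of the other one makes them equally long without
  comparing lengths.\<close>

definition pad :: "bool list => bool list => bool list" where
 "pad xs ys = xs @ map (%_. False) ys"

lemma pt_pad [pts]: "pt f ==> pt g ==> pt (%x. pad (f x) (g x))" unfolding pad_def by (intro pts)

lemma pad: "val (pad xs ys) = val xs" "length (pad xs ys) = length xs + length ys" by (auto simp: pad_def map_replicate_const)

lemma zip_pad: "map fst (zip (pad xs ys) (pad ys xs)) = pad xs ys" "map snd (zip (pad xs ys) (pad ys xs)) = pad ys xs" by (auto simp: pad)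

lemma pt_nat_add [pts]:
 fixes f g :: "'a :: treeable => nat"
 assumes "pt f" "pt g"
 shows "pt (%x. f x + g x)"
proof -
 let ?r = "%x. adder (zip (pad (binary (f x)) (binary (g x))) (pad (binary (g x)) (binary (f x)))) (False, [])"
 have "pt (%x. val (rev (snd (?r x)) @ [fst (?r x)]))" by (intro pts assms)
 moreover have "val (rev (snd (?r x)) @ [fst (?r x)]) = f x + g x" for x using adder_val[OF surjective_pairing[of "?r x"]] by (simp add: zip_pad pad)
 ultimately show ?thesis by simp
qed

lemma val_map_Not: "val (map Not bs) + val bs = 2 ^ length bs - 1"
proof (induction bs)
 case (Cons b bs)
 have "1 <= (2 :: nat) ^ length bs" by simp
 hence "2 * val (map Not bs) + 2 * val bs + 2 = 2 ^ length (b # bs)" using Cons by (simp only: power_Suc length_Cons)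
 thus ?case by (cases b) auto
qed simp

text \<open>Adding the complement of the subtrahend and a carry subtracts modulo a power of two, and the
  final carry tells whether the difference is nonnegative.\<close>

definition subtracter :: "bool list => bool list => bool * bool list" where
 "subtracter xs ys = adder (zip (pad xs ys) (map Not (pad ys xs))) (True, [])"

lemma pt_subtracter [pts]: "pt f ==> pt g ==> pt (%x. subtracter (f x) (g x))" unfolding subtracter_def by (intro pts)

lemma subtracter_val:
 "fst (subtracter xs ys) = (val ys <= val xs)"
 "val ys <= val xs ==> val (rev (snd (subtracter xs ys))) = val xs - val ys"
proof -
 obtain c u where r: "subtracter xs ys = (c, u)" by fastforce
 let ?N = "2 ^ (length xs + length ys) :: nat"
 have p: "map fst (zip (pad xs ys) (map Not (pad ys xs))) = pad xs ys"
  "map snd (zip (pad xs ys) (map Not (pad ys xs))) = map Not (pad ys xs)" by (auto simp: pad)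
 have n: "val (map Not (pad ys xs)) + val ys = ?N - 1" using val_map_Not[of "pad ys xs"] by (simp add: pad add.commute)
 have l: "length u = length xs + length ys" and eq: "val (rev u) + ?N * of_bool c = 1 + val xs + val (map Not (pad ys xs))"
  using adder_val[OF r[unfolded subtracter_def]] by (simp_all add: p pad)
 have u: "val (rev u) < ?N" using val_less[of "rev u"] l by simp
 have "val (rev u) + ?N * of_bool c + val ys = ?N + val xs" using n eq by simp
 thus "fst (subtracter xs ys) = (val ys <= val xs)"
  "val ys <= val xs ==> val (rev (snd (subtracter xs ys))) = val xs - val ys" using u by (cases c; simp add: r)+
qed

lemma pt_nat_le [pts]: "pt f ==> pt g ==> pt (%x. f x <= (g x :: nat))"
proof -
 assume "pt f" "pt g"
 hence "pt (%x. fst (subtracter (binary (g x)) (binary (f x))))" by (intro pts)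
 thus ?thesis by (simp add: subtracter_val)
qed

lemma pt_nat_less [pts]: "pt f ==> pt g ==> pt (%x. f x < (g x :: nat))" unfolding not_le[symmetric] by (intro pts)

lemma pt_nat_diff [pts]:
 fixes f g :: "'a :: treeable => nat"
 assumes "pt f" "pt g"
 shows "pt (%x. f x - g x)"
proof -
 have "pt (%x. if g x <= f x then val (rev (snd (subtracter (binary (f x)) (binary (g x))))) else 0)" by (intro pts assms)
 moreover have "(if g x <= f x then val (rev (snd (subtracter (binary (f x)) (binary (g x))))) else 0) = f x - g x" for x by (simp add: subtracter_val)
 ultimately show ?thesis by simp
qed

lemma pt_Suc [pts]: "pt f ==> pt (%x. Suc (f x))" using pt_nat_add[OF _ pt_const[of 1], of f] by simp

lemma pt_length [pts]:
 assumes "pt f"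
 shows "pt (%x. length (f x))"
proof -
 have "pt (%x. fold (%_. Suc) (f x) 0)"
 proof (rule pt_fold)
  show "pbounded (%n. n + 8)" "mono (%n :: nat. n + 8)" by (auto intro!: pb_intros monoI)
  show "pt (%z :: 'a * 'b * nat. Suc (snd (snd z)))" by (intro pts)
  fix p :: 'a and x :: 'b and s :: nat
  \<comment> \<open>An increment turns some digits \<open>True\<close> into \<open>False\<close>,
    which shortens the encoding, and then turns one \<open>False\<close> into \<open>True\<close> or
    appends a \<open>True\<close>.\<close>
  have s: "binary (Suc s) = [] | esize (binary (Suc s)) <= esize (binary s) + 4"
  proof (induction s rule: less_induct)
   case (less s)
   have "binary (Suc 0) = [True]" by (subst binary.simps) simp
   show ?case
   proof (cases "even s")
    case True
    then obtain t where t: "s = 2 * t" by blast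
    have "binary (Suc s) = True # binary t" using binary_step[of True t] t by simp
    moreover have "esize (binary s) = (if binary t = [] then 1 else Suc (1 + esize (binary t)))" using binary_step[of False t] t by simp
    ultimately show ?thesis by auto
   next case False
    then obtain t where t: "s = 2 * t + 1" by (elim oddE)
    have "Suc t ~= 0" by simp
    hence "binary (Suc t) ~= []" by (subst binary.simps) simp
    hence "binary (Suc s) = False # binary (Suc t)" using binary_step[of False "Suc t"] t by simp
    moreover have "binary s = True # binary t" using binary_step[of True t] t by simp
    moreover have "esize (binary (Suc t)) <= esize (binary t) + 4" using less[of t] t `binary (Suc t) ~= []` by auto
    ultimately show ?thesis by auto
   qed
  qed
  show "esize (Suc s) <= esize s + (esize p + esize x + 8)" using s by (auto simp: esize_nat_binary)
 qed (intro pts assms)+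
 moreover have "fold (%_. Suc) xs n = n + length xs" for xs :: "'b list" and n by (induction xs arbitrary: n) auto
 ultimately show ?thesis by simp
qed

text \<open>Only ranges up to the length of a list are available, since \<open>[0..<n]\<close> can
  be exponentially long for a binary number \<open>n\<close>. The reductions therefore keep such
  bounds in unary, as lists of \<open>()\<close>.\<close>

lemma pt_upt_length [pts]:
 fixes f :: "'a :: treeable => 'b :: treeable list"
 assumes "pt f"
 shows "pt (%x. [0..<length (f x)])"
proof -
 let ?g = "%x (s :: nat list). length s # s"
 let ?h = "%(p :: 'a * 'b list) (x :: 'b) (s :: nat list). length s # s"
 have "pt (%x. fold ?g (f x) [])"
 proof (rule pt_fold_bounded)
  show "pt (%z :: 'a * 'b * nat list. length (snd (snd z)) # snd (snd z))" by (intro pts)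
  let ?B = "%n :: nat. n + n * (4 * (n + n) + 2)"
  show "pbounded ?B" by (intro pb_intros)
  show "mono ?B" by (intro monoI add_mono mult_mono) auto
  fix p :: 'a and xs ys zs :: "'b list" and s :: "nat list" assume xs: "xs = ys @ zs"
  define L where "L = length xs + length s"
  have "length us + length s <= L ==> esize (fold ?g us s) <= esize s + length us * (4 * L + 2)"
   for us :: "'b list" and s :: "nat list"
  proof (induction us arbitrary: s)
   case (Cons u us)
   have "length s < L" using Cons.prems by simp
   also have "L < 2 ^ L" by (rule less_exp)
   finally have "esize (length s) <= 4 * L + 1" by (rule esize_nat)
   thus ?case using Cons.IH[of "length s # s"] Cons.prems by simp
  qed simp
  hence "esize (fold ?g ys s) <= esize s + length ys * (4 * L + 2)" by (simp add: L_def xs)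
  also have "... <= ?B (esize p + esize xs + esize s)" using length_esize[of xs] length_esize[of s] xs unfolding L_def
   by (intro add_mono[of "esize s"] mult_mono) (simp_all del: esize_append)
  finally show "esize (fold ?g ys s) <= ?B (esize p + esize xs + esize s)" .
 qed (intro pts assms)+
 hence "pt (%x. rev (fold ?g (f x) []))" by (intro pts)
 moreover have "fold ?g us (rev [0..<k]) = rev [0..<k + length us]" for us :: "'b list" and k
 proof (induction us arbitrary: k)
  case (Cons u us) show ?case using Cons[of "Suc k"] by simp
 qed simp
 from this[of _ 0] have "rev (fold ?g us []) = [0..<length us]" for us :: "'b list" by simp
 ultimately show ?thesis by simp
qed

text \<open>Horner's scheme from the highest digit on. The accumulator doubles in every step, so its
  size is bounded through its value and not by the growth of single steps.\<close>

lemma pt_nat_mult [pts]: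
 fixes f g :: "'a :: treeable => nat"
 assumes "pt f" "pt g"
 shows "pt (%x. f x * g x)"
proof -
 let ?h = "%(m :: nat) b (s :: nat). s + s + (if b then m else 0)"
 have "pt (%w. fold (?h (fst w)) (rev (binary (snd w))) (0 :: nat))"
 proof (rule pt_fold_bounded[where h = "%w. ?h (fst w)"])
  show "pt (%z :: (nat * nat) * bool * nat. ?h (fst (fst z)) (fst (snd z)) (snd (snd z)))" by (intro pts)
  let ?B = "%n :: nat. 4 * (n + n + n + 1) + 1"
  show "pbounded ?B" by (intro pb_intros)
  show "mono ?B" by (intro monoI) auto
  fix p :: "nat * nat" and xs ys zs :: "bool list" and s :: nat assume xs: "xs = ys @ zs"
  have "fold (?h m) us s + m <= 2 ^ length us * (s + m)" for m us and s
  proof (induction us arbitrary: s)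
   case (Cons b us)
   have "2 ^ length us * (?h m b s + m) <= 2 ^ length (b # us) * (s + m)" by (auto simp: algebra_simps)
   with Cons[of "?h m b s"] have "fold (?h m) us (?h m b s) + m <= 2 ^ length (b # us) * (s + m)" by (rule order_trans)
   thus ?case by (simp only: fold_simps(2))
  qed simp
  hence "fold (?h (fst p)) ys s <= 2 ^ length ys * (s + fst p)" using add_leD1 by blast
  also have "s + fst p < 2 ^ (esize s + esize p + 1)"
  proof -
   have "s < 2 ^ (esize s + esize p)" using less_esize[of s] power_increasing[of "esize s" "esize s + esize p" "2 :: nat"] by linarith
   moreover have "esize (fst p) <= esize s + esize p" by (cases p) simp
   hence "fst p < 2 ^ (esize s + esize p)" using less_esize[of "fst p"] power_increasing[of "esize (fst p)" "esize s + esize p" "2 :: nat"] by linarith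
   ultimately show ?thesis by simp
  qed
  hence "2 ^ length ys * (s + fst p) < 2 ^ length ys * 2 ^ (esize s + esize p + 1)" by simp
  also have "... = 2 ^ (length ys + (esize s + esize p + 1))" by (simp only: power_add)
  finally have "esize (fold (?h (fst p)) ys s) <= 4 * (length ys + (esize s + esize p + 1)) + 1" by (rule esize_nat)
  also have "... <= ?B (esize p + esize xs + esize s)" using length_esize[of xs] xs by (simp del: esize_append)
  finally show "esize (fold (?h (fst p)) ys s) <= ?B (esize p + esize xs + esize s)" .
 qed (intro pts)+
 moreover have "fold (?h m) (rev bs) 0 = m * val bs" for m bs by (simp only: foldr_conv_fold[symmetric]) (induction bs, auto simp: algebra_simps)
 ultimately have "pt (%w. fst w * snd w :: nat)" by simp
 from pt_comp[OF this pt_Pair[OF assms]] show ?thesis by simp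
qed

section \<open>Integers as sign and absolute value\<close>

lemma pt_int_diff_nat: "pt f ==> pt g ==> pt (%x. int (f x) - int (g x))"
proof -
 assume "pt f" "pt g"
 hence "pt (%x. if g x <= f x then int (f x - g x) else - int (g x - f x))" by (intro pts)
 moreover have "(if b <= a then int (a - b) else - int (b - a)) = int a - int b" for a b by auto
 ultimately show ?thesis by simp
qed

lemma pt_int_add [pts]:
 fixes f g :: "'a :: treeable => int"
 assumes "pt f" "pt g"
 shows "pt (%x. f x + g x)"
proof -
 let ?a = "%x. nat (abs (f x))" and ?b = "%x. nat (abs (g x))"
 have "pt (%x. if f x < 0 then (if g x < 0 then - int (?a x + ?b x) else int (?b x) - int (?a x))
   else (if g x < 0 then int (?a x) - int (?b x) else int (?a x + ?b x)))" by (intro pts pt_int_diff_nat assms)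
 moreover have "(if a < 0 then (if b < 0 then - int (nat (abs a) + nat (abs b)) else int (nat (abs b)) - int (nat (abs a)))
   else (if b < 0 then int (nat (abs a)) - int (nat (abs b)) else int (nat (abs a) + nat (abs b)))) = a + b" for a b by auto
 ultimately show ?thesis by simp
qed

lemma pt_int_minus [pts]: "pt f ==> pt (%x. - f x :: int)"
proof -
 assume "pt f"
 hence "pt (%x. if f x < 0 then int (nat (abs (f x))) else - int (nat (abs (f x))))" by (intro pts)
 moreover have "(if a < 0 then int (nat (abs a)) else - int (nat (abs a))) = - a" for a by auto
 ultimately show ?thesis by simp
qed

lemma pt_int_diff [pts]: "pt f ==> pt g ==> pt (%x. f x - g x :: int)" unfolding diff_conv_add_uminus by (intro pts)

lemma pt_int_less [pts]: "pt f ==> pt g ==> pt (%x. f x < (g x :: int))" by (subst less_iff_diff_less_0) (intro pts)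

lemma pt_int_le [pts]: "pt f ==> pt g ==> pt (%x. f x <= (g x :: int))" unfolding not_less[symmetric] by (intro pts)

lemma pt_int_max [pts]: "pt f ==> pt g ==> pt (%x. max (f x) (g x :: int))" unfolding max_def by (intro pts)

lemma pt_int_mult [pts]:
 fixes f g :: "'a :: treeable => int"
 assumes "pt f" "pt g"
 shows "pt (%x. f x * g x)"
proof -
 have "pt (%x. if (f x < 0) = (g x < 0) then int (nat (abs (f x)) * nat (abs (g x))) else - int (nat (abs (f x)) * nat (abs (g x))))" by (intro pts assms)
 moreover have "(if (a < 0) = (b < 0) then int (nat (abs a) * nat (abs b)) else - int (nat (abs a) * nat (abs b))) = a * b" for a b
  by (auto simp: abs_if nat_mult_distrib[symmetric])
 ultimately show ?thesis by simp
qed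

section \<open>Decoding\<close>

instantiation tree :: treeable begin
definition "to_tree (t :: tree) = t"
instance by standard (simp add: to_tree_tree_def)
end

primrec subtrees :: "tree => tree list" where
 "subtrees Leaf = []"
| "subtrees (Node a b) = a # subtrees b"

definition right :: "tree => tree" where
 "right t = (case t of Leaf => Leaf | Node a b => b)"

text \<open>A tree has the same code as the list of left subtrees along its right spine, so list
  functions can take trees apart.\<close>

lemma encode_subtrees: "encode (subtrees t) = encode t" by (induction t) (auto simp: encode_def to_tree_tree_def)

lemma pt_subtrees [pts]: "pt f ==> pt (%x. subtrees (f x))" by (erule pt_recode) (simp add: encode_subtrees)

lemma pt_right [pts]: "pt f ==> pt (%x. right (f x))"
proof -
 assume "pt f"
 hence "pt (%x. tl (subtrees (f x)))" by (intro pts)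
 moreover have "encode (tl (subtrees t)) = encode (right t)" for t by (cases t) (simp_all add: right_def encode_subtrees, simp add: encode_def to_tree_tree_def)
 ultimately show ?thesis by (rule pt_recode)
qed

lemma pt_Node [pts]: "pt f ==> pt g ==> pt (%x. Node (f x) (g x))" by (rule pt_recode[OF pt_Pair[of f g]]) (auto simp: encode_def to_tree_tree_def to_tree_prod_def)

text \<open>Decoding is total; trees that are not encodings are sent to arbitrary values.\<close>

class decodable = treeable +
 fixes of_tree :: "tree => 'a"
 assumes of_tree [simp]: "of_tree (to_tree x) = x"

instantiation bool :: decodable begin
definition "of_tree t = (t ~= Leaf)"
instance by standard (simp add: of_tree_bool_def to_tree_bool_def)
end

instantiation prod :: (decodable, decodable) decodable begin
definition "of_tree t = (of_tree (hd (subtrees t)), of_tree (right t))"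
instance by standard (auto simp: of_tree_prod_def to_tree_prod_def right_def)
end

instantiation list :: (decodable) decodable begin
definition "of_tree t = map of_tree (subtrees t)"
instance
proof
 show "of_tree (to_tree xs) = xs" for xs :: "'a list" unfolding of_tree_list_def by (induction xs) auto
qed
end

instantiation nat :: decodable begin
definition "of_tree t = val (of_tree t)"
instance by standard (simp add: of_tree_nat_def to_tree_nat_def)
end

instantiation int :: decodable begin
definition "of_tree t = (let p = of_tree t :: bool * nat in if fst p then - int (snd p) else int (snd p))"
instance by standard (simp add: of_tree_int_def to_tree_int_def Let_def)
end

lemma pt_of_tree_bool [pts]: "pt f ==> pt (%x. of_tree (f x) :: bool)" unfolding of_tree_bool_def by (intro pts)

lemma pt_of_tree_prod [pts]:
 "pt (of_tree :: tree => 'a) ==> pt (of_tree :: tree => 'b) ==> pt f ==>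
  pt (%x. of_tree (f x) :: 'a :: decodable \<times> 'b :: decodable)" unfolding of_tree_prod_def
 by (rule pt_Pair[OF pt_comp[of "of_tree :: tree => 'a"] pt_comp[of "of_tree :: tree => 'b"]]; (intro pts)?)

lemma pt_of_tree_list [pts]:
 "pt (of_tree :: tree => 'a) ==> pt f ==> pt (%x. of_tree (f x) :: 'a :: decodable list)"
 unfolding of_tree_list_def by (rule pt_map[OF pt_comp[of "of_tree :: tree => 'a"]]; (intro pts)?)

lemma pt_of_tree_nat [pts]: "pt f ==> pt (%x. of_tree (f x) :: nat)" unfolding of_tree_nat_def by (intro pts)

lemma pt_of_tree_int [pts]: "pt f ==> pt (%x. of_tree (f x) :: int)" unfolding of_tree_int_def Let_def by (intro pts)

text \<open>Read from right to left, a preorder code is evaluated with a stack: \<open>False\<close>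
  pushes a leaf, \<open>True\<close> joins the two topmost trees. Where two trees are missing, the
  stack is emptied.\<close>

definition parse_step :: "bool => tree list => tree list" where
 "parse_step b st = (if b then (if tl st = [] then [] else Node (hd st) (hd (tl st)) # tl (tl st)) else Leaf # st)"

definition parse_tree :: "bool list => tree" where
 "parse_tree w = hd (fold parse_step (rev w) [])"

lemma parse_bits: "fold parse_step (rev (bits t)) st = t # st" by (induction t arbitrary: st) (auto simp: parse_step_def)

lemma parse_tree_encode [simp]: "parse_tree (encode x) = to_tree x" by (simp add: parse_tree_def encode_def parse_bits)

lemma esize_Node: "esize (Node a b) = Suc (esize a + esize b)" "esize Leaf = 1" by (auto simp: esize_def encode_def to_tree_tree_def)

lemma pt_parse_tree [pts]:
 assumes "pt f"
 shows "pt (%x. parse_tree (f x))"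
proof -
 have "pt (%x. fold ((%_. parse_step) x) (rev (f x)) [])"
 proof (rule pt_fold)
  show "pbounded (%n. n + 4)" "mono (%n :: nat. n + 4)" by (auto intro!: pb_intros monoI)
  show "pt (%z :: 'a * bool * tree list. parse_step (fst (snd z)) (snd (snd z)))" unfolding parse_step_def by (intro pts)
  show "esize (parse_step x s) <= esize s + (esize p + esize x + 4)" for p :: 'a and x s by (cases s; cases "tl s") (auto simp: parse_step_def esize_Node)
 qed (intro pts assms)+
 thus ?thesis unfolding parse_tree_def by (intro pts)
qed

text \<open>The state holds the pending first bit of a pair, the two words read so far in reverse,
  and whether the separator, the first pair of unequal bits, has been passed.\<close>

definition unpair_step :: "bool => bool list * bool list * bool list * bool => bool list * bool list * bool list * bool" where
 "unpair_step b s =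
   (if snd (snd (snd s)) then (fst s, fst (snd s), b # fst (snd (snd s)), True)
   else if fst s = [] then ([b], snd s)
   else if hd (fst s) = b then ([], b # fst (snd s), snd (snd s))
   else (fst s, fst (snd s), fst (snd (snd s)), True))"

definition unpair :: "bool list => bool list * bool list" where
 "unpair w = (let s = fold unpair_step w ([], [], [], False) in (rev (fst (snd s)), rev (fst (snd (snd s)))))"

lemma unpair_pair_word [simp]: "unpair (pair_word x y) = (x, y)"
proof -
 have 1: "fold unpair_step (concat (map (%b. [b, b]) x)) ([], u, [], False) = ([], rev x @ u, [], False)" for u by (induction x arbitrary: u) (auto simp: unpair_step_def)
 have 2: "fold unpair_step y (a, u, v, True) = (a, u, rev y @ v, True)" for a u v by (induction y arbitrary: v) (auto simp: unpair_step_def)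
 have 3: "unpair_step True (unpair_step False ([], u, [], False)) = ([False], u, [], True)" for u by (simp add: unpair_step_def)
 show ?thesis by (simp add: unpair_def pair_word_def 1 2 3)
qed

lemma pt_unpair [pts]:
 assumes "pt f"
 shows "pt (%x. unpair (f x))"
proof -
 have "pt (%x. fold ((%_. unpair_step) x) (f x) ([], [], [], False))"
 proof (rule pt_fold)
  show "pbounded (%n. n + 8)" "mono (%n :: nat. n + 8)" by (auto intro!: pb_intros monoI)
  show "pt (%z :: 'a * bool * bool list * bool list * bool list * bool. unpair_step (fst (snd z)) (snd (snd z)))" unfolding unpair_step_def by (intro pts)
  show "esize (unpair_step x s) <= esize s + (esize p + esize x + 8)" for p :: 'a and x s
  proof -
   obtain a u v d where "s = (a, u, v, d)" by (cases s)
   thus ?thesis using esize_pos[of a] by (cases d; cases x) (auto simp: unpair_step_def)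
  qed
 qed (intro pts assms)+
 thus ?thesis unfolding unpair_def Let_def by (intro pts)
qed

subsection \<open>Prefix codes\<close>

text \<open>The decoder returns the unread rest. That the rest is never longer than the input, even
  on malformed words, keeps repeated decoding polynomial.\<close>

definition pcode :: "('a :: treeable => bool list) => (bool list => 'a * bool list) => bool" where
 "pcode e d = (pt e & pt d & (ALL x r. d (e x @ r) = (x, r)) & (ALL w. length (snd (d w)) <= length w))"

lemma pcodeD:
 assumes "pcode e d"
 shows "pt e" "pt d" "d (e x @ r) = (x, r)" "length (snd (d w)) <= length w" using assms by (auto simp: pcode_def)

lemma pcode_bit: "pcode (%b. [b]) (%w. (hd w, tl w))" unfolding pcode_def by (intro conjI pts) auto

lemma pcode_pair:
 assumes 1: "pcode e1 d1" and 2: "pcode e2 d2"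
 shows "pcode (%z. e1 (fst z) @ e2 (snd z)) (%w. ((fst (d1 w), fst (d2 (snd (d1 w)))), snd (d2 (snd (d1 w)))))" unfolding pcode_def
 using pcodeD(3)[OF 1] pcodeD(3)[OF 2] pcodeD(4)[OF 1] pcodeD(4)[OF 2]
 by (intro conjI pts pt_comp[OF pcodeD(1)[OF 1]] pt_comp[OF pcodeD(1)[OF 2]]
   pt_comp[OF pcodeD(2)[OF 1]] pt_comp[OF pcodeD(2)[OF 2]]) (auto intro: order_trans[OF pcodeD(4)[OF 2]])

lemma pcode_map:
 assumes "pcode e d" "pt f" "pt g" "!!x. f (g x) = x"
 shows "pcode (%x. e (g x)) (%w. (f (fst (d w)), snd (d w)))" unfolding pcode_def using assms(4) pcodeD(3,4)[OF assms(1)]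
 by (intro conjI pts pt_comp[OF pcodeD(1)[OF assms(1)] assms(3)] pt_comp[OF assms(2)] pcodeD(2)[OF assms(1)]) auto

definition read_step :: "(bool list => 'a * bool list) => 'a list * bool list * bool => 'a list * bool list * bool" where
 "read_step d s =
   (if snd (snd s) then s
   else if hd (fst (snd s)) then (fst (d (tl (fst (snd s)))) # fst s, snd (d (tl (fst (snd s)))), False)
   else (fst s, tl (fst (snd s)), True))"

text \<open>The word itself serves as loop counter: every element and the end mark consume at least
  one bit, so there are enough rounds.\<close>

definition read_list :: "(bool list => 'a * bool list) => bool list => 'a list * bool list" where
 "read_list d w = (let s = fold (%_ :: bool. read_step d) w ([], w, False) in (rev (fst s), fst (snd s)))"

lemma read_step_length:
 assumes "!!w. length (snd (d w)) <= length w"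
 shows "length (fst (snd (read_step d s))) <= length (fst (snd s))"
proof -
 have "length (snd (d (tl (fst (snd s))))) <= length (fst (snd s))" using assms[of "tl (fst (snd s))"] by simp
 thus ?thesis by (auto simp: read_step_def)
qed

lemma fold_read_step_length:
 assumes "!!w. length (snd (d w)) <= length w"
 shows "length (fst (snd (fold (%_. read_step d) us s))) <= length (fst (snd s))"
proof (induction us arbitrary: s)
 case (Cons u us) show ?case using Cons[of "read_step d s"] read_step_length[of d s, OF assms] by simp
qed simp

lemma read_list_enc_list:
 assumes d: "!!x r. d (e x @ r) = (x, r)"
 shows "read_list d (enc_list e xs @ r) = (xs, r)"
proof -
 have done_: "fold (%_. read_step d) us (a, r, True) = (a, r, True)" for us a by (induction us) (auto simp: read_step_def)
 have "fold (%_. read_step d) us (a, enc_list e xs @ r, False) = (rev xs @ a, r, True)" if "length xs < length us" for us a using that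
 proof (induction xs arbitrary: us a)
  case Nil
  then obtain u us' where "us = u # us'" by (cases us) auto
  moreover have "read_step d (a, enc_list e [] @ r, False) = (a, r, True)" by (simp add: read_step_def enc_list_def)
  ultimately show ?case using done_[of us' a] by simp
 next case (Cons x xs)
  then obtain u us' where us: "us = u # us'" by (cases us) auto
  have "enc_list e (x # xs) @ r = True # e x @ (enc_list e xs @ r)" by (simp add: enc_list_def)
  hence "read_step d (a, enc_list e (x # xs) @ r, False) = (x # a, enc_list e xs @ r, False)" by (simp add: read_step_def d)
  thus ?case using Cons.IH[of us' "x # a"] Cons.prems by (simp add: us)
 qed
 moreover have "length xs < length (enc_list e xs @ r)" by (induction xs) (auto simp: enc_list_def)
 ultimately have "fold (%_. read_step d) (enc_list e xs @ r) ([], enc_list e xs @ r, False) = (rev xs @ [], r, True)" by blast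
 thus ?thesis by (simp only: read_list_def Let_def fst_conv snd_conv append_Nil2 rev_rev_ident)
qed

text \<open>The unread rest never grows, so every round adds an element whose size is bounded in
  terms of the initial rest.\<close>

lemma pt_read_list:
 assumes "pt d" and len: "!!w. length (snd (d w)) <= length w"
 shows "pt (read_list d)"
proof -
 obtain c S where "computes_pt c S (%x. d x)" using ptE[OF assms(1)] by blast
 note S = computes_ptD[OF this]
 have "pt (%w :: bool list. fold ((%_ _. read_step d) w) w ([], w, False))"
 proof (rule pt_fold_bounded)
  show "pt (%z :: bool list * bool * 'a list * bool list * bool. read_step d (snd (snd z)))" unfolding read_step_def by (intro pts pt_comp[OF assms(1)])
  let ?B = "%n :: nat. n + n * Suc (S (4 * n + 1)) + (4 * n + 1) + 5"
  have "pbounded (%n. S (4 * n + 1))" by (rule pbounded_comp[OF S(2)]) (intro pb_intros)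
  thus "pbounded ?B" by (intro pb_intros)
  show "mono ?B"
  proof (rule monoI)
   fix m n :: nat assume "m <= n"
   hence "S (4 * m + 1) <= S (4 * n + 1)" by (intro monoD[OF S(3)]) simp
   hence "m * Suc (S (4 * m + 1)) <= n * Suc (S (4 * n + 1))" using `m <= n` by (intro mult_le_mono) auto
   thus "?B m <= ?B n" using `m <= n` by linarith
  qed
  fix p and xs ys zs :: "bool list" and s :: "'a list * bool list * bool" assume xs: "xs = ys @ zs"
  have "esize (fst (fold (%_. read_step d) us s)) <= esize (fst s) + length us * Suc (S (4 * length (fst (snd s)) + 1))"
   for us :: "bool list" and s :: "'a list * bool list * bool"
  proof (induction us arbitrary: s)
   case (Cons u us)
   let ?t = "tl (fst (snd s))" and ?L = "%s :: 'a list * bool list * bool. S (4 * length (fst (snd s)) + 1)"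
   have "esize (fst (d ?t)) <= esize (d ?t)" by (cases "d ?t") simp
   also have "... <= S (esize ?t)" by (rule S(6))
   also have "... <= ?L s" using esize_bools[of ?t] by (intro monoD[OF S(3)]) auto
   finally have a: "esize (fst (read_step d s)) <= esize (fst s) + Suc (?L s)" by (auto simp: read_step_def)
   have b: "?L (read_step d s) <= ?L s" using read_step_length[of d s, OF len] by (intro monoD[OF S(3)]) auto
   have "esize (fst (fold (%_. read_step d) (u # us) s)) <= esize (fst (read_step d s)) + length us * Suc (?L (read_step d s))" using Cons[of "read_step d s"] by simp
   also have "... <= (esize (fst s) + Suc (?L s)) + length us * Suc (?L s)" using a b by (intro add_mono mult_mono) auto
   finally show ?case by simp
  qed simp
  note acc = this[of ys s]
  let ?F = "fold (%_. read_step d) ys s" and ?n = "esize p + esize xs + esize s"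
  have sz: "esize t = Suc (esize (fst t) + Suc (esize (fst (snd t)) + esize (snd (snd t))))" for t :: "'a list * bool list * bool" by (cases t) simp
  have l: "length (fst (snd s)) <= esize s" using length_esize[of "fst (snd s)"] sz[of s] by simp
  have "length ys * Suc (S (4 * length (fst (snd s)) + 1)) <= ?n * Suc (S (4 * ?n + 1))"
   using length_esize[of xs] xs l by (intro mult_mono Suc_leI le_imp_less_Suc monoD[OF S(3)]) (auto simp del: esize_append)
  hence 1: "esize (fst ?F) <= esize (fst s) + ?n * Suc (S (4 * ?n + 1))" using acc by linarith
  have 2: "esize (fst (snd ?F)) <= 4 * esize s + 1" using esize_bools[of "fst (snd ?F)"] fold_read_step_length[of d ys s, OF len] l by linarith
  have gen: "f <= n + C + (4 * n + 1) + 5"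
   if "f = Suc (a + Suc (b + c))" "a <= t + C" "t < z" "b <= 4 * z + 1" "c <= 3" "z <= n" for a b c f n t z C :: nat using that by linarith
  show "esize ?F <= ?B ?n" by (rule gen[OF sz 1 _ 2 esize_bool]) (simp_all add: sz[of s])
 qed (intro pts)+
 thus ?thesis unfolding read_list_def Let_def by (intro pts)
qed

lemma pcode_list:
 assumes "pcode e d"
 shows "pcode (enc_list e) (read_list d)" unfolding pcode_def
proof (intro conjI allI)
 note D = pcodeD[OF assms]
 have "pt (%xs. concat (map (%x. True # e x) xs) @ [False])" by (intro pts pt_comp[OF D(1)])
 thus "pt (enc_list e)" by (simp add: enc_list_def[abs_def])
 show "pt (read_list d)" using D(2,4) by (rule pt_read_list)
 show "read_list d (enc_list e x @ r) = (x, r)" for x r using D(3) by (rule read_list_enc_list)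
 show "length (snd (read_list d w)) <= length w" for w using fold_read_step_length[of d w "([], w, False)", OF D(4)] by (simp add: read_list_def Let_def)
qed

lemma pcode_nat: "EX d. pcode enc_nat d"
proof -
 have "pcode (%n. enc_list (%b. [b]) (binary n)) (%w. (val (fst (read_list (%w. (hd w, tl w)) w)), snd (read_list (%w. (hd w, tl w)) w)))"
  by (rule pcode_map[OF pcode_list[OF pcode_bit], of val binary]) (intro pts | simp)+
 thus ?thesis by (auto simp: enc_nat_def[abs_def])
qed

lemma pcode_int: "EX d. pcode enc_int d"
proof -
 obtain d where d: "pcode enc_nat d" using pcode_nat by blast
 let ?f = "%z :: bool * nat. if fst z then - int (snd z) else int (snd z)"
 have "pt ?f" "pt (%z. (z < 0, nat (abs z)))" by (intro pts)+
 from pcode_map[OF pcode_pair[OF pcode_bit d] this]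
 have "EX d. pcode (%z. [z < 0] @ enc_nat (nat (abs z))) d" by fastforce
 thus ?thesis by (simp add: enc_int_def[abs_def])
qed

section \<open>A prefix code for instances\<close>

lemma pcode_pairs: "EX d. pcode e1 d ==> EX d. pcode e2 d ==> EX d. pcode (%z. e1 (fst z) @ e2 (snd z)) d" using pcode_pair by blast

lemma pcode_lists: "EX d. pcode e d ==> EX d. pcode (enc_list e) d" using pcode_list by blast

lemma pcode_edge: "EX d. pcode enc_edge d"
proof -
 have "EX d. pcode (%z. (%z. enc_nat (fst z) @ enc_nat (snd z)) (fst z) @ enc_list (%z. enc_int (fst z) @ enc_nat (snd z)) (snd z)) d"
  by (intro pcode_pairs pcode_lists pcode_nat pcode_int)
 thus ?thesis by (simp add: enc_edge_def case_prod_unfold)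
qed

lemma pcode_trans: "EX d. pcode enc_trans d"
proof -
 have "EX d. pcode (%z. enc_nat (fst z) @ (%z. enc_nat (fst z) @ (%z. enc_nat (fst z) @ enc_nat (snd z)) (snd z)) (snd z)) d"
  by (intro pcode_pairs pcode_nat)
 thus ?thesis by (simp add: enc_trans_def case_prod_unfold)
qed

type_synonym instance_tuple =
 "nat * nat list * ((nat * nat) * (int * nat) list) list \<times> nat * nat * nat * (nat * nat * nat * nat) list"

text \<open>Nested tuples are covered by the \<open>treeable\<close> instances, so the computations
  work on tuples in place of records.\<close>

definition of_tuple :: "instance_tuple => checking_instance" where
 "of_tuple = (%(n, os, es, v, k, s, ts).
   \<lparr>inst_num_players = n, inst_owners = os, inst_edges = es, inst_init = v, inst_num_states = k,
   inst_state = s, inst_trans = ts\<rparr>)"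

lemma of_tuple_surj: "EX t. I = of_tuple t"
 by (rule exI[of _ "(inst_num_players I, inst_owners I, inst_edges I, inst_init I, inst_num_states I, inst_state I, inst_trans I)"]) (simp add: of_tuple_def)

lemma pcode_instance: "EX d. pcode (%t. enc_instance (of_tuple t)) d"
proof -
 have "EX d. pcode (%z. enc_nat (fst z) @ (%z. enc_list enc_nat (fst z) @ (%z. enc_list enc_edge (fst z) @
   (%z. enc_nat (fst z) @ (%z. enc_nat (fst z) @ (%z. enc_nat (fst z) @ enc_list enc_trans (snd z)) (snd z)) (snd z)) (snd z)) (snd z)) (snd z)) d"
  by (intro pcode_pairs pcode_lists pcode_nat pcode_edge pcode_trans)
 thus ?thesis by (simp add: enc_instance_def of_tuple_def case_prod_unfold)
qed

section \<open>Certificates for violations\<close>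

definition cum :: "('v * 'v => 'a :: comm_monoid_add) => (nat => 'q * 'v) => nat => 'a" where
 "cum w f m = (SUM k<m. w (snd (f k), snd (f (Suc k))))"

definition weighted :: "('v * 'v => int) => (('q * 'v) * ('q * 'v)) set => ('q * 'v) wedge set" where
 "weighted w S = {(a, w (snd a, snd b), b) | a b. (a, b) : S}"

definition glue :: "nat => (nat => 'a) => (nat => 'a) => nat => 'a" where
 "glue n f g k = (if k <= n then f k else g (k - n))"

lemma glue_simps:
 assumes "f n = g 0"
 shows "glue n f g 0 = f 0" "glue n f g (n + k) = g k" "k <= n ==> glue n f g k = f k" using assms by (auto simp: glue_def)

lemma cum_cong: "(!!k. k <= m ==> f k = g k) ==> cum w f m = cum w g m" by (auto simp: cum_def intro!: sum.cong)

lemma cum_0 [simp]: "cum w f 0 = 0" by (simp add: cum_def)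

lemma cum_Suc: "cum w f (Suc m) = cum w f m + w (snd (f m), snd (f (Suc m)))" by (simp add: cum_def)

lemma cum_shift: "cum w f (n + m) = cum w f n + cum w (%k. f (n + k)) m" by (induction m) (simp_all add: cum_Suc add.assoc)

lemma cum_case_nat: "cum w (case_nat a f) (Suc m) = w (snd a, snd (f 0)) + cum w f m" using cum_shift[of w "case_nat a f" 1 m] by (simp add: cum_def)

lemma weighted_iff [simp]: "((a, x, b) : weighted w S) = ((a, b) : S & x = w (snd a, snd b))" by (cases a; cases b) (auto simp: weighted_def)

lemma cum_glue:
 assumes "f n = g 0"
 shows "m <= n ==> cum w (glue n f g) m = cum w f m" "cum w (glue n f g) (n + m) = cum w f n + cum w g m"
proof -
 show 1: "cum w (glue n f g) m = cum w f m" if "m <= n" for m using that by (intro cum_cong) (simp add: glue_def)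
 show "cum w (glue n f g) (n + m) = cum w f n + cum w g m" unfolding cum_shift using 1[of n] by (simp add: glue_simps(2)[of f n g, OF assms])
qed

section \<open>Finite walks and sequences of configurations\<close>

lemma walk_sequence:
 assumes "walk (weighted w S) a p b"
 obtains f where "f 0 = a" "f (length p) = b" "!!k. k < length p ==> (f k, f (Suc k)) : S"
  "!!m. m <= length p ==> cum w f m = weight (take m p)" using assms
proof (induction p arbitrary: a thesis)
 case Nil show ?case by (rule Nil(1)[of "%_. a"]) (use Nil(2) in auto)
next case (Cons e p)
 have e: "(a, tgt e) : S" "wt e = w (snd a, snd (tgt e))" "walk (weighted w S) (tgt e) p b" using Cons.prems(2) by (auto simp: weighted_def)
 obtain f where f: "f 0 = tgt e" "f (length p) = b" "!!k. k < length p ==> (f k, f (Suc k)) : S"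
  "!!m. m <= length p ==> cum w f m = weight (take m p)" using Cons.IH[OF _ e(3)] by blast
 let ?g = "case_nat a f"
 show ?case
 proof (rule Cons.prems(1)[of ?g])
  show "(?g k, ?g (Suc k)) : S" if "k < length (e # p)" for k using that e(1) f(1,3) by (cases k) auto
  show "cum w ?g m = weight (take m (e # p))" if "m <= length (e # p)" for m
  proof (cases m)
   case (Suc m')
   have "cum w ?g (1 + m') = cum w ?g 1 + cum w (%k. ?g (1 + k)) m'" by (rule cum_shift)
   also have "cum w ?g 1 = wt e" using f(1) e(2) by (simp add: cum_def)
   finally show ?thesis using f(4)[of m'] that Suc by simp
  qed simp
 qed (use f(2) in auto)
qed

definition trace :: "('v * 'v => int) => (nat => 'q * 'v) => nat => ('q * 'v) wedge list" where
 "trace w f n = map (%k. (f k, w (snd (f k), snd (f (Suc k))), f (Suc k))) [0..<n]"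

lemma trace_Suc: "trace w f (Suc n) = trace w f n @ [(f n, w (snd (f n), snd (f (Suc n))), f (Suc n))]" by (simp add: trace_def)

lemma trace_walk: "(!!k. k < n ==> (f k, f (Suc k)) : S) ==> walk (weighted w S) (f 0) (trace w f n) (f n)"
proof (induction n)
 case (Suc n)
 have "walk (weighted w S) (f 0) (trace w f n) (f n)" using Suc by simp
 moreover have "(f n, w (snd (f n), snd (f (Suc n))), f (Suc n)) : weighted w S" using Suc.prems[of n] by simp
 ultimately show ?case unfolding trace_Suc walk_append by (intro exI[of _ "f n"]) simp
qed (simp add: trace_def)

lemma trace_weight: "weight (trace w f n) = cum w f n" by (induction n) (simp_all add: trace_Suc cum_Suc, simp add: trace_def)

lemma trace_credit:
 assumes "0 <= x" "!!m. m <= n ==> 0 <= x + cum w f m"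
 shows "credit (trace w f n) <= x"
proof (rule credit_leI[OF assms(1)])
 fix p1 p2 assume eq: "trace w f n = p1 @ p2"
 have l: "length p1 <= n" using arg_cong[OF eq, of length] by (simp add: trace_def)
 have "p1 = take (length p1) (trace w f n)" by (simp add: eq)
 also have "... = trace w f (length p1)" using l by (simp add: trace_def take_map)
 finally show "0 <= x + weight p1" using assms(2)[OF l] by (metis trace_weight)
qed

text \<open>\<open>t\<close> is the transition at the deviation and \<open>v'\<close> the move of
  player \<open>i\<close>. \<open>s0\<close> summarises the common prefix and \<open>s1\<close> a
  losing continuation. \<open>s2\<close> is the stem of a lasso, and its cycle consists of the edge
  \<open>e\<close> and the walk of \<open>s3\<close>; the separate edge makes the cycle nonempty,
  since summaries may stem from empty walks.\<close>

definition certificate :: "('p, 'v) game => ('q, 'v) mealy => 'v => ('v * 'v => int) => (('q * 'v) * ('q * 'v)) set => 'p =>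
  'q * 'v * 'q * 'v => 'v => ('q * 'v) summary list => ('q * 'v) summary list => ('q * 'v) summary list =>
  ('q * 'v) summary => ('q * 'v) summary => ('q * 'v) summary => ('q * 'v) summary => ('q * 'v) wedge => bool" where
 "certificate G M v0 w S i t v' ss1 ss2 ss3 s0 s1 s2 s3 e =
   (t : mealy_trans M & fst (snd t) : owned G i & (fst (snd t), v') : edges G & v' ~= snd (snd (snd t)) &
   derivation (weighted w S) ss1 & s0 : set ss1 & fst s0 = (mealy_init M, v0) &
   fst (snd s0) = (fst t, fst (snd t)) & snd (snd (snd s0)) <= 0 &
   derivation (weighted w (true_step M)) ss2 & s1 : set ss2 & fst s1 = snd (snd t) &
   fst (snd (snd s0)) + w (fst (snd t), snd (snd (snd t))) + fst (snd (snd s1)) < 0 &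
   derivation (weighted w (dev_step G M i)) ss3 & s2 : set ss3 & fst s2 = (fst (snd (snd t)), v') &
   fst (snd s2) = fst e & e : weighted w (dev_step G M i) &
   s3 : set ss3 & fst s3 = tgt e & fst (snd s3) = fst e & 0 <= wt e + fst (snd (snd s3)) &
   snd (snd (snd s2)) <= fst (snd (snd s0)) + w (fst (snd t), v') &
   max 0 (snd (snd (snd s3)) - wt e) <= fst (snd (snd s0)) + w (fst (snd t), v') + fst (snd (snd s2)))"

definition small_summary :: "'n set => int => 'n summary => bool" where
 "small_summary V B s = (fst s : V & fst (snd s) : V & abs (fst (snd (snd s))) <= B & abs (snd (snd (snd s))) <= B)"

text \<open>Derivations may contain empty walks at foreign vertices, whose names could be
  arbitrarily large. Removing them is safe because joins never mix them with walks inside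
  \<open>V\<close>.\<close>

lemma derivation_restrict:
 assumes "derivation E ss" "E <= V \<times> UNIV \<times> V"
 shows "derivation E (filter (%s. fst s : V) ss)" using assms(1)
proof (induction ss)
 case (Cons s ss)
 let ?ss = "filter (%s. fst s : V) ss"
 have IH: "derivation E ?ss" using Cons by simp
 show ?case
 proof (cases "fst s : V")
  case True
  have "(EX s1:set ?ss. EX s2:set ?ss. fst (snd s1) = fst s2 & s = join s1 s2)"
   if "s1 : set ss" "s2 : set ss" "fst (snd s1) = fst s2" "s = join s1 s2" for s1 s2
  proof -
   have 1: "fst s1 : V" using that(4) True by (cases s1; cases s2) (simp add: join_def)
   have d: "derivation E ss" "s1 : set ss" using Cons.prems that(1) by auto
   obtain p where p: "walk E (fst s1) p (fst (snd s1))" by (rule derivation_sound[of E ss s1]) (use d in auto)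
   have "walk E u q v ==> u : V ==> v : V" for u q v using assms(2) by (induction q arbitrary: u) auto
   hence "fst s2 : V" using p 1 that(3) by metis
   thus ?thesis using 1 that by (intro bexI[of _ s1] bexI[of _ s2]) simp_all
  qed
  thus ?thesis using True IH Cons.prems by (simp del: set_filter) blast
 qed (use IH in simp)
qed simp

section \<open>Soundness and completeness of certificates\<close>

context checked_game
begin

lemma step_facts:
 assumes "S = true_step M | S = any_step G M | S = dev_step G M i" "(a, b) : S"
 shows "a : mealy_states M \<times> verts G" "b : mealy_states M \<times> verts G" "(snd a, snd b) : edges G"
 using assms trans_states edges_verts by (auto simp: true_step_def any_step_def dev_step_def)

lemma true_extend:
 assumes "a : mealy_states M \<times> verts G"
 obtains f where "f 0 = a" "!!k. (f k, f (Suc k)) : true_step M"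
proof -
 define nx where "nx = (%a. SOME b. (a, b) : true_step M)"
 have nx: "(a, nx a) : true_step M" if "a : mealy_states M \<times> verts G" for a
 proof -
  have "EX qv. (fst a, snd a, qv) : mealy_trans M" using trans_total[of "fst a" "snd a"] that by (cases a) simp
  then obtain q v where "(fst a, snd a, q, v) : mealy_trans M" by (metis prod.collapse)
  hence "EX b. (a, b) : true_step M" by (intro exI[of _ "(q, v)"]) (auto simp: true_step_def split: prod.splits)
  thus ?thesis unfolding nx_def by (rule someI_ex)
 qed
 have "(nx ^^ k) a : mealy_states M \<times> verts G" for k
 proof (induction k)
  case (Suc k) show ?case using step_facts(2)[of "true_step M", OF _ nx[OF Suc]] by simp
 qed (use assms in simp)
 thus ?thesis using nx by (intro that[of "%k. (nx ^^ k) a"]) auto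
qed

end

text \<open>Only the signs of prefix sums matter, so the rational rewards of player \<open>i\<close>
  may be replaced by integers after multiplication with a positive \<open>D\<close>.\<close>

locale scaled_game = checked_game +
 fixes i and w :: "'c * 'c => int" and D :: int
 assumes D: "0 < D" and scale: "e : edges G ==> of_int (w e) = of_int D * r i e"
begin

lemma cum_scale:
 assumes "!!k. k < m ==> (snd (f k), snd (f (Suc k))) : edges G"
 shows "of_int (cum w f m) = of_int D * cum (r i) f m" using assms by (induction m) (simp_all add: cum_Suc scale algebra_simps)

lemma cum_sign:
 assumes "!!k. k < m ==> (snd (f k), snd (f (Suc k))) : edges G"
 shows "(cum (r i) f m < 0) = (cum w f m < 0)"
proof -
 have e: "of_int (cum w f m) = of_int D * cum (r i) f m" by (rule cum_scale) (rule assms)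
 have "(of_int (cum w f m) < (0 :: rat)) = (of_int D * cum (r i) f m < 0)" by (simp only: e)
 also have "... = (cum (r i) f m < 0)" using D by (simp add: mult_less_0_iff)
 finally show ?thesis by simp
qed

text \<open>The walks are glued together at the deviation. A lost play stays lost, so it continues
  arbitrarily along true steps, while the lasso is unrolled into an infinite play that keeps its
  energy.\<close>

lemma certificate_sound:
 assumes c: "certificate G M v0 w S i t v' ss1 ss2 ss3 s0 s1 s2 s3 e"
  and S: "S = true_step M | S = any_step G M"
 shows "violation G M v0 (r i) S i"
proof -
 let ?t = "weighted w (true_step M)"
 obtain p u q v where t: "t = (p, u, q, v)" by (cases t)
 note c = c[unfolded certificate_def t fst_conv snd_conv]
 have tr: "(p, u, q, v) : mealy_trans M" "u : owned G i" "(u, v') : edges G" "v' ~= v" using c by blast+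
 define x where "x = fst (snd (snd s0))"
 obtain p0 where p0: "walk (weighted w S) (fst s0) p0 (fst (snd s0))" "s0 = summary (fst s0) p0 (fst (snd s0))"
  by (rule derivation_sound[of "weighted w S" ss1 s0]) (use c in auto)
 have x: "x = weight p0" "credit p0 <= 0" using c p0(2) unfolding x_def by (metis summary_def fst_conv snd_conv)+
 have w0: "walk (weighted w S) (mealy_init M, v0) p0 (p, u)" using p0(1) c by simp
 obtain p1 where p1: "walk ?t (fst s1) p1 (fst (snd s1))" "s1 = summary (fst s1) p1 (fst (snd s1))" by (rule derivation_sound[of "?t" ss2 s1]) (use c in auto)
 have w1: "walk ?t (q, v) p1 (fst (snd s1))" using p1(1) c by simp
 have lose: "x + w (u, v) + weight p1 < 0" using c p1(2) unfolding x_def by (metis summary_def fst_conv snd_conv)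
 let ?d = "weighted w (dev_step G M i)"
 obtain p2 where p2: "walk ?d (fst s2) p2 (fst (snd s2))" "s2 = summary (fst s2) p2 (fst (snd s2))" by (rule derivation_sound[of ?d ss3 s2]) (use c in auto)
 obtain p3 where p3: "walk ?d (fst s3) p3 (fst (snd s3))" "s3 = summary (fst s3) p3 (fst (snd s3))" by (rule derivation_sound[of ?d ss3 s3]) (use c in auto)
 have s2: "fst (snd (snd s2)) = weight p2" "snd (snd (snd s2)) = credit p2"
  and s3: "fst (snd (snd s3)) = weight p3" "snd (snd (snd s3)) = credit p3" using p2(2) p3(2) by (metis summary_def fst_conv snd_conv)+
 have lasso: "lasso ?d (x + w (u, v')) (q, v') p2 (fst e) (e # p3)" using c p2(1) p3(1) unfolding lasso_def x_def s2 s3 by (auto simp: credit_append s2 s3)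
 obtain g2 w2 where g2: "g2 0 = (q, v')" "!!k. (g2 k, w2 k, g2 (Suc k)) : ?d" "!!k. 0 <= x + w (u, v') + (SUM j<k. w2 j)" using lasso_infinite_walk[OF lasso] by metis
 have g2d: "(g2 k, g2 (Suc k)) : dev_step G M i" "w2 k = w (snd (g2 k), snd (g2 (Suc k)))" for k using g2(2)[of k] by (auto simp: weighted_def)
 have g2c: "0 <= x + w (u, v') + cum w g2 k" for k using g2(3)[of k] unfolding cum_def g2d(2) .
 let ?n = "length p0" and ?l = "length p1"
 obtain f0 where f0: "f0 0 = (mealy_init M, v0)" "f0 ?n = (p, u)" "!!k. k < ?n ==> (f0 k, f0 (Suc k)) : S"
  "!!m. m <= ?n ==> cum w f0 m = weight (take m p0)" using walk_sequence[OF w0] by metis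
 obtain f1 where f1: "f1 0 = (q, v)" "f1 ?l = fst (snd s1)" "!!k. k < ?l ==> (f1 k, f1 (Suc k)) : true_step M"
  "!!m. m <= ?l ==> cum w f1 m = weight (take m p1)" using walk_sequence[OF w1] by metis
 have "(q, v) : mealy_states M \<times> verts G" using trans_states[OF tr(1)] by simp
 hence "f1 k : mealy_states M \<times> verts G" if "k <= ?l" for k using that f1(1) step_facts(2)[of "true_step M", OF _ f1(3)] by (cases k) auto
 then obtain f2 where f2: "f2 0 = f1 ?l" "!!k. (f2 k, f2 (Suc k)) : true_step M" using true_extend by (metis order_refl)
 define f' where "f' = case_nat (p, u) (glue ?l f1 f2)"
 define g' where "g' = case_nat (p, u) g2"
 define f where "f = glue ?n f0 f'"
 define g where "g = glue ?n f0 g'"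
 have eq: "f0 ?n = f' 0" "f0 ?n = g' 0" by (simp_all add: f0(2) f'_def g'_def)
 note ff = glue_simps[of f0 ?n f', OF eq(1), folded f_def] and gg = glue_simps[of f0 ?n g', OF eq(2), folded g_def]
 have f's: "(f' k, f' (Suc k)) : true_step M" for k
 proof (cases k)
  case 0 thus ?thesis using tr(1) f1(1) f2(1) glue_simps(1)[of f1 ?l f2] by (simp add: f'_def true_step_def)
 next case (Suc k')
  have "(glue ?l f1 f2 k', glue ?l f1 f2 (Suc k')) : true_step M"
  proof (cases "k' < ?l")
   case True thus ?thesis using f1(3)[of k'] by (simp add: glue_def)
  next case False
   define k'' where "k'' = k' - ?l"
   have k: "k' = ?l + k''" using False by (simp add: k''_def)
   show ?thesis using glue_simps(2)[of f1 ?l f2, OF f2(1)[symmetric], of k''] glue_simps(2)[of f1 ?l f2, OF f2(1)[symmetric], of "Suc k''"] f2(2)[of k''] by (simp add: k)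
  qed
  thus ?thesis by (simp add: f'_def Suc)
 qed
 have Sedges: "(snd a, snd b) : edges G" if "(a, b) : S" for a b using step_facts(3)[of S undefined] S that by blast
 have fs: "(f k, f (Suc k)) : S" if "k < ?n" for k using f0(3)[OF that] ff(3)[of k] ff(3)[of "Suc k"] that by simp
 have fs': "(f k, f (Suc k)) : true_step M" if "?n <= k" for k
 proof -
  define k' where "k' = k - ?n"
  have "k = ?n + k'" using that by (simp add: k'_def)
  thus ?thesis using ff(2)[of k'] ff(2)[of "Suc k'"] f's[of k'] by simp
 qed
 have gf: "g k = f k" if "k <= ?n" for k using that ff(3) gg(3) by simp
 have gs: "(g k, g (Suc k)) : dev_step G M i" if "?n < k" for k
 proof -
  define k' where "k' = k - Suc ?n"
  have "k = ?n + Suc k'" using that by (simp add: k'_def)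
  thus ?thesis using gg(2)[of "Suc k'"] gg(2)[of "Suc (Suc k')"] g2d(1)[of k'] by (simp add: g'_def)
 qed
 have fn: "f ?n = (p, u)" "f (Suc ?n) = (q, v)" "g (Suc ?n) = (q, v')" "g ?n = (p, u)"
  using ff(2)[of 0] ff(2)[of 1] gg(2)[of 1] gg(2)[of 0] f1(1) g2(1) f2(1) glue_simps(1)[of f1 ?l f2] by (simp_all add: f'_def g'_def)
 have fe: "(snd (f k), snd (f (Suc k))) : edges G" for k using fs[of k] fs'[of k] Sedges step_facts(3)[of "true_step M"] by (metis not_le)
 have ge: "(snd (g k), snd (g (Suc k))) : edges G" for k
 proof -
  consider "k < ?n" | "k = ?n" | "?n < k" by linarith
  thus ?thesis
  proof cases
   case 1 thus ?thesis using fe[of k] gf[of k] gf[of "Suc k"] by simp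
next case 2 thus ?thesis using fn tr(3) by simp
 next case 3 thus ?thesis using gs[of k] step_facts(3)[of "dev_step G M i" i] by blast
  qed
 qed
 have c0: "cum w f0 ?n = x" using f0(4)[of ?n] x by simp
 have "cum w f (?n + Suc ?l) = x + (w (u, v) + cum w f1 ?l)"
  using cum_glue(2)[of f0 ?n f' w "Suc ?l", OF eq(1)] f1(1) f2(1) glue_simps(1)[of f1 ?l f2] cum_glue(1)[of f1 ?l f2 ?l w] by (simp add: f_def c0 f'_def cum_case_nat)
 hence "cum w f (?n + Suc ?l) < 0" using f1(4)[of ?l] lose by simp
 hence 1: "cum (r i) f (?n + Suc ?l) < 0" using cum_sign[of "?n + Suc ?l" f] fe by blast
 have "0 <= cum w g m" for m
 proof (cases "m <= ?n")
  case True
  have "cum w g m = weight (take m p0)" using cum_glue(1)[of f0 ?n g' m w, OF eq(2) True] f0(4)[OF True] by (simp add: g_def)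
  thus ?thesis using credit_le_prefix[of "take m p0" "drop m p0" 0] x(2) by simp
 next case False
  then obtain m' where m: "m = ?n + Suc m'" using less_imp_Suc_add[of ?n m] by auto
  have "cum w g m = x + (w (u, v') + cum w g2 m')" using cum_glue(2)[of f0 ?n g' w "Suc m'", OF eq(2)] by (simp add: m g_def c0 g'_def cum_case_nat g2(1))
  thus ?thesis using g2c[of m'] by simp
 qed
 hence 2: "0 <= cum (r i) g m" for m using cum_sign[of m g] ge by (metis not_less)
 show ?thesis unfolding violation_def by (rule exI[of _ ?n], rule exI[of _ f], rule exI[of _ g])
   (use 1 2 fs fs' gf gs fn tr ff(1) f0(1) in "auto simp: cum_def[symmetric]")
qed

end

context bounded_graph
begin

lemma derivable_small:
 assumes d: "derivable E m L u p v" and E: "E <= K" and u: "u : V"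
 obtains ss where "derivation E ss" "summary u p v : set ss" "length ss <= m"
  "ALL s:set ss. small_summary V (int L * W) s"
proof -
 obtain ss where ss: "derivable_by E m L u p v ss" using d by (auto simp: derivable_def)
 let ?ss = "filter (%s. fst s : V) ss"
 have EV: "E <= V \<times> UNIV \<times> V" using E by (auto simp: K_def)
 show ?thesis
 proof (rule that[of ?ss])
  show "derivation E ?ss" using derivation_restrict[OF _ EV] ss by (simp add: derivable_by_def)
  show "summary u p v : set ?ss" using ss u by (simp add: derivable_by_def summary_def)
  show "length ?ss <= m" by (rule order_trans[OF length_filter_le]) (use ss in "simp add: derivable_by_def")
  show "ALL s:set ?ss. small_summary V (int L * W) s"
  proof
  fix s assume "s : set ?ss"
  then obtain x q y where s: "s = summary x q y" "walk E x q y" "length q <= L" "x : V" using ss unfolding derivable_by_def by (force simp: summary_def)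
  have q: "set q <= K" using walk_subset[OF s(2)] E by simp
  have "y : V" using s(2,4) EV by (induction q arbitrary: x) auto
  moreover have "int (length q) * W <= int L * W" using s(3) W(1) by (simp add: mult_right_mono)
  ultimately show "small_summary V (int L * W) s" using K_weight[OF q] K_credit[OF q] s(4) by (simp add: small_summary_def s(1) summary_def)
  qed
 qed
qed

end

context scaled_game
begin

text \<open>If the energy \<open>x\<close> at the deviation is moderate, the given prefix and losing
  continuation are only compressed. If it is large, the prefix is cut down to a level that still
  suffices for a minimal lasso; the losing continuation then weighs so little that it has a negative
  cycle and can be made to lose from the new level.\<close>

lemma certificate_complete:
 assumes viol: "violation G M v0 (r i) S i" and S: "S = true_step M | S = any_step G M"
  and W: "0 <= W" "W <= 2 ^ be" "!!e. e : edges G ==> abs (w e) <= W"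
  and V_def: "V = mealy_states M \<times> verts G" and card: "card V <= 2 ^ be"
 obtains t v' ss1 ss2 ss3 s0 s1 s2 s3 e where
  "certificate G M v0 w S i t v' ss1 ss2 ss3 s0 s1 s2 s3 e"
  "length ss1 <= bounded_graph.final_steps V be (2 * be + 3)" "length ss2 <= bounded_graph.final_steps V be (2 * be + 3)"
  "length ss3 <= 4 * card V + 2" "!!s. s : set (ss1 @ ss2 @ ss3) ==> small_summary V (2 ^ (15 * be + 15)) s"
  "fst e : V" "tgt e : V" "abs (wt e) <= 2 ^ (15 * be + 15)"
proof -
 have finV: "finite V" unfolding V_def using G M by (simp add: wf_game_def wf_mealy_def)
 interpret B: bounded_graph V W be by unfold_locales (use finV card W in auto)
 let ?ga = "2 * be + 3" and ?n = "int (card V)"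
 let ?D = "weighted w (dev_step G M i)"
 let ?T = "weighted w (true_step M)"
 let ?P = "weighted w S"
 let ?l = "B.len_max ?ga"
 let ?m = "B.final_steps ?ga"
 let ?a = "(mealy_init M, v0)"
 let ?L = "int ?l * W"
 let ?B = "2 ^ (15 * be + 15)"
 define N where "N = ?n * W"
 have N: "0 <= N" "N <= 2 ^ (2 * be)"
 proof -
  show "0 <= N" using W(1) by (simp add: N_def)
  have "?n <= 2 ^ be" using card by (metis of_nat_le_iff of_nat_numeral of_nat_power)
  hence "N <= 2 ^ be * 2 ^ be" unfolding N_def using W by (intro mult_mono) auto
  thus "N <= 2 ^ (2 * be)" by (simp add: mult_2 power_add)
 qed
 \<comment> \<open>The level at the deviation will be at most \<open>3 * N + 2 * W + 1\<close>, and
   another \<open>N\<close> or \<open>W\<close> must fit as well. As \<open>N\<close>,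
   \<open>W\<close> and 1 are at most \<open>2 ^ (2 * be)\<close>, the eight summands explain the 3
   in \<open>ga\<close>.\<close>
 have big: "4 * N + 3 * W + 1 <= 2 ^ ?ga"
 proof -
  have "(2 :: int) ^ be <= 2 ^ (2 * be)" "1 <= (2 :: int) ^ (2 * be)" by (auto intro: power_increasing)
  moreover have "(2 :: int) ^ ?ga = 8 * 2 ^ (2 * be)" by (simp add: power_add)
  ultimately show ?thesis using N(2) W(2) by linarith
 qed
 have sub: "weighted w T <= B.K" if "T = true_step M | T = any_step G M | T = dev_step G M i" for T
 proof
  fix x assume "x : weighted w T"
  then obtain a b where x: "x = (a, w (snd a, snd b), b)" "(a, b) : T" by (force simp: weighted_def)
  from step_facts[OF that x(2)] W(3)[of "(snd a, snd b)"] show "x : B.K" unfolding x(1) B.K_def unfolding V_def by auto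
 qed
 have subS: "?P <= B.K" and subT: "?T <= B.K" and subD: "?D <= B.K" using sub S by blast+
 obtain n f g where f: "f 0 = ?a" "!!k. k < n ==> (f k, f (Suc k)) : S"
   "!!k. n <= k ==> (f k, f (Suc k)) : true_step M" "snd (f n) : owned G i"
  and g: "!!k. k <= n ==> g k = f k" "fst (g (Suc n)) = fst (f (Suc n))" "snd (g (Suc n)) ~= snd (f (Suc n))"
   "(snd (g n), snd (g (Suc n))) : edges G" "!!k. n < k ==> (g k, g (Suc k)) : dev_step G M i"
  and pay: "EX m. cum (r i) f m < 0" "!!m. 0 <= cum (r i) g m" using viol unfolding violation_def cum_def by blast
 obtain p u where pu: "f n = (p, u)" by (cases "f n")
 obtain q v where qv: "f (Suc n) = (q, v)" by (cases "f (Suc n)")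
 obtain v' where v': "g (Suc n) = (q, v')" using g(2) qv by (cases "g (Suc n)") auto
 have tr: "(p, u, q, v) : mealy_trans M" using f(3)[of n] pu qv by (simp add: true_step_def)
 have ow: "u : owned G i" "(u, v') : edges G" "v' ~= v" using f(4) g(1)[of n] g(3,4) pu qv v' by simp_all
 have uv: "(u, v) : edges G" using trans_states[OF tr] by simp
 have fe: "(snd (f k), snd (f (Suc k))) : edges G" for k using f(2,3) step_facts(3)[of _ i "f k" "f (Suc k)"] S by (metis not_le)
 have ge: "(snd (g k), snd (g (Suc k))) : edges G" for k
 proof -
  consider "k < n" | "k = n" | "n < k" by linarith
  thus ?thesis
  proof cases
   case 1 thus ?thesis using fe[of k] g(1) by simp
next case 2 thus ?thesis using g(4) by simp
 next case 3 thus ?thesis using step_facts(3)[of "dev_step G M i" i, OF _ g(5)[OF 3]] by simp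
  qed
 qed
 have gc: "0 <= cum w g m" for m using cum_sign[of m g] ge pay(2)[of m] by (meson not_less)
 obtain m where m: "cum w f m < 0" using pay(1) cum_sign fe by blast
 have fg: "cum w f k = cum w g k" if "k <= n" for k using that g(1) by (intro cum_cong) simp
 define x where "x = cum w f n"
 have nm: "n < m" using m gc[of m] fg[of m] by (cases "m <= n") auto
 define d where "d = m - Suc n"
 have md: "m = Suc n + d" using nm by (simp add: d_def)
 let ?f = "%k. f (Suc n + k)" and ?g = "%k. g (Suc n + k)"
 have pre: "walk ?P ?a (trace w f n) (p, u)" using trace_walk[of n f S w] f(1,2) pu by simp
 have cpre: "credit (trace w f n) <= 0" by (rule trace_credit) (use gc fg in simp_all)
 have lw: "walk ?T (q, v) (trace w ?f d) (?f d)" using trace_walk[of d ?f "true_step M" w] f(3) qv by simp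
 have lose: "x + w (u, v) + weight (trace w ?f d) < 0" using m cum_shift[of w f "Suc n" d] pu qv by (simp add: md trace_weight cum_Suc x_def)
 have init: "?a : V" "(q, v) : V" "(q, v') : V" "(p, u) : V" using init_state v0 trans_states[OF tr] ow(2) edges_verts by (auto simp: V_def)
 have wW: "abs (w (u, v)) <= W" "abs (w (u, v')) <= W" using W(3) uv ow(2) by auto
 have winc: "0 <= x + w (u, v') + cum w ?g k" for k using gc[of "Suc n + k"] cum_shift[of w g "Suc n" k] fg[of n] pu v' g(1)[of n] by (simp add: cum_Suc x_def)
 have gV: "?D <= V \<times> UNIV \<times> V" using subD by (auto simp: B.K_def)
 obtain pl xl cl where "lasso ?D (x + w (u, v')) (?g 0) pl xl cl" by (rule infinite_walk_lasso[of ?g "%k. w (snd (?g k), snd (?g (Suc k)))" "?D" "x + w (u, v')" V])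
   (use g(5) winc gV finV in "auto simp: cum_def")
 hence "lasso ?D (x + w (u, v')) (q, v') pl xl cl" using v' by simp
 then obtain p2 x2 c2 where l2: "lasso ?D (x + w (u, v')) (q, v') p2 x2 c2"
  "length (p2 @ c2) <= card V" using minimal_lasso[OF _ gV finV] by metis
 have "walk ?D (q, v') (p2 @ c2) x2" using l2(1) unfolding lasso_def walk_append by blast
 hence "set (p2 @ c2) <= B.K" using walk_subset[of "?D"] subD by (metis order_trans)
 hence "credit (p2 @ c2) <= int (length (p2 @ c2)) * W" by (rule B.K_credit)
 also have "... <= N" unfolding N_def using l2(2) W(1) by (intro mult_right_mono) auto
 finally have c2N: "credit (p2 @ c2) <= N" .
 obtain pre' l' b where pre': "walk ?P ?a pre' (p, u)" "credit pre' <= 0" "weight pre' <= 3 * N + 2 * W + 1"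
  and l': "walk ?T (q, v) l' b" "weight pre' + w (u, v) + weight l' < 0"
  and c2: "credit (p2 @ c2) <= weight pre' + w (u, v')"
 proof (cases "x <= 3 * N + 2 * W + 1")
  case True
  show ?thesis by (rule that[OF pre cpre _ lw]) (use True lose l2(1) in "auto simp: trace_weight x_def lasso_def")
 next case False
  have pK: "set (trace w f n) <= B.K" using walk_subset[OF pre] subS by simp
  have b: "2 * N + W + 1 <= weight (trace w f n)" "?n * W <= 2 * N + W + 1" "0 < 2 * N + W + 1" using False N(1) W(1) unfolding trace_weight x_def N_def by linarith+
  obtain pre' where a: "walk ?P ?a pre' (p, u)" "credit pre' <= 0"
   "2 * N + W + 1 - ?n * W <= weight pre'" "weight pre' <= 2 * N + W + 1 + W + ?n * W" using B.bounded_prefix[OF pre pK init(1) cpre b] by blast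
  have "weight (trace w ?f d) < - (?n * W)" using lose wW(1) False N(1) W(1) unfolding N_def by linarith
  from B.losing_unbounded[OF lw _ init(2) this] walk_subset[OF lw] subT
  obtain l' b where l': "walk (set (trace w ?f d)) (q, v) l' b" "weight l' < - (weight pre' + w (u, v))" by (metis order_trans)
  have l'w: "walk ?T (q, v) l' b" using walk_weaken[OF l'(1) walk_subset[OF lw]] .
  have "weight pre' <= 3 * N + 2 * W + 1" "weight pre' + w (u, v) + weight l' < 0"
   "credit (p2 @ c2) <= weight pre' + w (u, v')" using a(3,4) l'(2) c2N wW(2) unfolding N_def by linarith+
  from that[OF a(1,2) this(1) l'w this(2,3)] show ?thesis .
 qed
 have x0: "0 <= weight pre'" using credit_ge[of pre'] pre'(2) by linarith
 have pK: "set pre' <= B.K" using walk_subset[OF pre'(1)] subS by simp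
 have xga: "0 + ?n * W <= 2 ^ ?ga" "0 + weight pre' + ?n * W <= 2 ^ ?ga" using big pre'(3) N(1) W(1) unfolding N_def by linarith+
 obtain p0 where p0: "derivable ?P ?m ?l ?a p0 (p, u)"
  "weight p0 = weight pre'" "credit p0 <= 0" using B.small_derivation[OF pre'(1) pK init(1) pre'(2) xga] by metis
 define y where "y = weight pre' + w (u, v)"
 \<comment> \<open>If the step at the deviation already makes the energy negative, the empty walk
   completes the loss.\<close>
 obtain p1 b1 where p1: "derivable ?T ?m ?l (q, v) p1 b1"
  "y + weight p1 < 0"
 proof (cases "y < 0")
  case True
  have "1 <= ?m" by (simp add: B.final_steps_def)
  from derivable_mono[OF derivable_Nil order_refl this order_refl] show ?thesis by (rule that) (use True in simp)
 next case False
  have lK: "set l' <= B.K" using walk_subset[OF l'(1)] subT by simp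
  have b: "weight l' < - y" "0 <= y" "y <= 2 ^ ?ga" using False l'(2) big pre'(3) wW(1) N(1) W(1) unfolding y_def by linarith+
  obtain p' b' where "derivable ?T ?m ?l (q, v) p' b'" "weight p' < - y" using B.losing_derivation[OF l'(1) lK init(2) b] by metis
  thus ?thesis by (intro that[of p' b']) auto
 qed
 obtain e c3 where c3: "c2 = e # c3" using l2(1) by (cases c2) (auto simp: lasso_def)
 have e: "e : ?D" "fst e = x2" and w2: "walk ?D (q, v') p2 x2"
  and w3: "walk ?D (tgt e) c3 x2" and cyc: "0 <= wt e + weight c3" using l2(1) by (auto simp: lasso_def c3)
 have eV: "fst e : V" "tgt e : V" "abs (wt e) <= W" using e(1) subD by (force simp: B.K_def)+
 have d2: "derivable ?D (2 * card V + 1) ?l (q, v') p2 x2"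
  and d3: "derivable ?D (2 * card V + 1) ?l (tgt e) c3 x2"
 proof -
  have "card V <= ?l" using card power_increasing[of be "12 * be + ?ga + 12" "2 :: nat"] unfolding B.len_max_def by linarith
  hence "length p2 <= ?l" "length c3 <= ?l" using l2(2) by (auto simp: c3)
  from derivable_list[OF w2 this(1)] derivable_list[OF w3 this(2)]
  show "derivable ?D (2 * card V + 1) ?l (q, v') p2 x2"
   "derivable ?D (2 * card V + 1) ?l (tgt e) c3 x2" by (auto elim!: derivable_mono) (use l2(2) in "auto simp: c3")
 qed
 \<comment> \<open>Lengths up to \<open>2 ^ (12 * be + ga + 12)\<close> with
   \<open>ga = 2 * be + 3\<close>, times weights up to \<open>2 ^ be\<close>.\<close>
 have B: "?L <= ?B"
 proof -
  have "?L <= int ?l * 2 ^ be" using W(2) by (intro mult_left_mono) auto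
  also have "... = 2 ^ (12 * be + ?ga + 12 + be)" unfolding B.len_max_def by (simp only: of_nat_power of_nat_numeral of_nat_mult power_add)
  also have "12 * be + ?ga + 12 + be = 15 * be + 15" by simp
  finally show ?thesis .
 qed
 have small: "small_summary V ?B s" if "small_summary V ?L s" for s using that B unfolding small_summary_def by linarith
 obtain ss1 where ss1: "derivation ?P ss1" "summary ?a p0 (p, u) : set ss1"
  "length ss1 <= ?m" "ALL s:set ss1. small_summary V ?L s" by (rule B.derivable_small[OF p0(1) subS init(1)])
 obtain ss2 where ss2: "derivation ?T ss2" "summary (q, v) p1 b1 : set ss2"
  "length ss2 <= ?m" "ALL s:set ss2. small_summary V ?L s" by (rule B.derivable_small[OF p1(1) subT init(2)])
 obtain ss3 where ss3: "derivation ?D ss3" "summary (q, v') p2 x2 : set ss3"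
  "length ss3 <= 2 * card V + 1" "ALL s:set ss3. small_summary V ?L s" by (rule B.derivable_small[OF d2 subD init(3)])
 obtain ss4 where ss4: "derivation ?D ss4" "summary (tgt e) c3 x2 : set ss4"
  "length ss4 <= 2 * card V + 1" "ALL s:set ss4. small_summary V ?L s" by (rule B.derivable_small[OF d3 subD eV(2)])
 have c3': "credit p2 <= weight pre' + w (u, v')" "max 0 (credit c3 - wt e) <= weight pre' + w (u, v') + weight p2" using c2 by (auto simp: credit_append c3)
 show ?thesis
 proof (rule that[of "(p, u, q, v)" v' ss1 ss2 "ss3 @ ss4" "summary ?a p0 (p, u)" "summary (q, v) p1 b1"
    "summary (q, v') p2 x2" "summary (tgt e) c3 x2" e])
  show "certificate G M v0 w S i (p, u, q, v) v' ss1 ss2 (ss3 @ ss4) (summary ?a p0 (p, u)) (summary (q, v) p1 b1)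
    (summary (q, v') p2 x2) (summary (tgt e) c3 x2) e" unfolding certificate_def summary_def fst_conv snd_conv p0(2)
   using tr ow ss1(1,2) ss2(1,2) ss3(1,2) ss4(1,2) derivation_append[OF ss3(1) ss4(1)] p0(3) p1(2) e cyc c3' unfolding summary_def y_def p0(2) by (intro conjI) auto
  show "small_summary V ?B s" if "s : set (ss1 @ ss2 @ ss3 @ ss4)" for s using that ss1(4) ss2(4) ss3(4) ss4(4) by (intro small) auto
  show "abs (wt e) <= ?B"
  proof -
   have "(2 :: int) ^ be <= ?B" by (rule power_increasing) auto
   thus ?thesis using eV(3) W(2) by linarith
  qed
 qed (use ss1(3) ss2(3) ss3(3) ss4(3) eV in auto)
qed

end

section \<open>Membership in coNP\<close>

subsection \<open>Polynomial-time checks\<close>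

lemma pt_if_const: "pt f ==> pt g ==> pt (%x. if b then f x else g x)" by (cases b) auto

lemma pt_distinct [pts]:
 fixes f :: "'a :: treeable => 'b :: treeable list"
 assumes "pt f"
 shows "pt (%x. distinct (f x))"
proof -
 let ?h = "%(p :: 'a) (x :: 'b) (s :: 'b list * bool). (x # fst s, snd s & x ~: set (fst s))"
 have "pt (%x. fold (?h x) (f x) ([], True))"
 proof (rule pt_fold)
  show "pbounded (%n. n + 8)" "mono (%n :: nat. n + 8)" by (auto intro!: pb_intros monoI)
  show "pt (%z. ?h (fst z) (fst (snd z)) (snd (snd z)))" by (intro pts)
  show "esize (?h p x s) <= esize s + (esize p + esize x + 8)" for p x s using esize_bool[of "snd s & x ~: set (fst s)"] by (cases s) (auto simp del: esize_simps(2,3))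
 qed (intro pts assms)+
 hence "pt (%x. snd (fold (?h x) (f x) ([], True)))" by (intro pts)
 moreover have "snd (fold (?h p) xs (ys, c)) = (c & distinct xs & set xs \<inter> set ys = {})" for p xs ys c by (induction xs arbitrary: ys c) auto
 ultimately show ?thesis by simp
qed

definition derives :: "'n wedge list => 'n summary list => bool" where
 "derives es ss = (derivation (set es) ss)"

definition derive_step :: "'n wedge list => 'n summary => 'n summary list \<times> bool => 'n summary list \<times> bool" where
 "derive_step es s st = (s # fst st, snd st &
   (fst s = fst (snd s) & snd (snd s) = (0, 0) | s : set (map edge_summary es) |
   (EX s1:set (fst st). EX s2:set (fst st). fst (snd s1) = fst s2 & s = join s1 s2)))"

lemma fold_derive_step: "fold (derive_step es) (rev ss) ([], True) = (ss, derives es ss)"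
proof (induction ss)
 case (Cons s ss)
 have "(EX u. s = (u, u, 0, 0)) = (fst s = fst (snd s) & snd (snd s) = (0, 0))" by (cases s) auto
 thus ?case using Cons by (simp add: derive_step_def derives_def)
qed (simp add: derives_def)

lemma pt_derives [pts]:
 fixes f :: "'a :: treeable => ('n :: treeable) wedge list"
 assumes "pt f" "pt g"
 shows "pt (%x. derives (f x) (g x))"
proof -
 have "pt (%w :: 'n wedge list \<times> 'n summary list. fold (derive_step (fst w)) (rev (snd w)) ([], True))"
 proof (rule pt_fold[where h = "%w. derive_step (fst w)"])
  show "pbounded (%n. n + 8)" "mono (%n :: nat. n + 8)" by (auto intro!: pb_intros monoI)
  show "pt (%z :: ('n wedge list \<times> 'n summary list) \<times> 'n summary \<times> 'n summary list \<times> bool. derive_step (fst (fst z)) (fst (snd z)) (snd (snd z)))"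
   unfolding derive_step_def edge_summary_def join_def case_prod_unfold by (intro pts)
  show "esize (derive_step (fst p) x s) <= esize s + (esize p + esize x + 8)"
   for p :: "'n wedge list \<times> 'n summary list" and x s
   using esize_bool[of "snd (derive_step (fst p) x s)"] by (cases s) (auto simp: derive_step_def simp del: esize_simps(2,3))
 qed (intro pts)+
 from pt_comp[OF pt_snd[OF this] pt_Pair[OF assms]] show ?thesis by (simp add: fold_derive_step)
qed

section \<open>Step relations and well-formedness on explicit lists\<close>

definition true_list :: "(nat * nat * nat * nat) list => ((nat * nat) * int) list => (nat * nat) wedge list" where
 "true_list ts ew = concat (map (%(p, u, q, v). map (%(k, x). ((p, u), x, (q, v))) (filter (%(k, x). k = (u, v)) ew)) ts)"

definition any_list :: "(nat * nat * nat * nat) list => ((nat * nat) * int) list => (nat * nat) wedge list" where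
 "any_list ts ew = concat (map (%(p, u, q, v). map (%(k, x). ((p, u), x, (q, snd k))) (filter (%(k, x). fst k = u) ew)) ts)"

definition dev_list :: "nat list * nat => (nat * nat * nat * nat) list => ((nat * nat) * int) list => (nat * nat) wedge list" where
 "dev_list = (%(os, i) ts ew. concat (map (%(p, u, q, v). map (%(k, x). ((p, u), x, (q, snd k)))
   (filter (%(k, x). fst k = u & (snd k = v | (u, i) : set (zip [0..<length os] os))) ew)) ts))"

lemma pt_graph_lists [pts]:
 assumes "pt f" "pt g"
 shows "pt (%x. true_list (f x) (g x))" "pt (%x. any_list (f x) (g x))" "pt h ==> pt (%x. dev_list (h x) (f x) (g x))"
proof -
 have "pt (%z. true_list (fst z) (snd z))" "pt (%z. any_list (fst z) (snd z))"
  "pt (%z. dev_list (fst z) (fst (snd z)) (snd (snd z)))" unfolding true_list_def any_list_def dev_list_def case_prod_unfold by (intro pts)+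
 from pt_comp[OF this(1) pt_Pair[OF assms]] pt_comp[OF this(2) pt_Pair[OF assms]] pt_comp[OF this(3) pt_Pair[OF _ pt_Pair[OF assms]]]
 show "pt (%x. true_list (f x) (g x))" "pt (%x. any_list (f x) (g x))" "pt h ==> pt (%x. dev_list (h x) (f x) (g x))" by simp_all
qed

text \<open>Turns indexing into membership, for which there are polynomial-time rules.\<close>

lemma mem_nth: "((j, y) : set (zip [0..<length xs] xs)) = (j < length xs & xs ! j = y)" by (force simp: set_zip)

text \<open>The number \<open>k\<close> of states is given in binary and could be exponential. As
  every state needs a transition, \<open>k <= length ts\<close> holds in well-formed instances, and
  states can be enumerated below \<open>length ts\<close>.\<close>

definition well_formed :: "instance_tuple => bool" where
 "well_formed = (%(n, os, es, v0, k, s, ts).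
   (ALL ((u, v), ws):set es. u < length os & v < length os) &
   (ALL u:set [0..<length os]. EX ((u', v), ws):set es. u' = u) & (ALL j:set os. j < n) &
   v0 < length os & distinct (map fst es) &
   (ALL (e, ws):set es. length ws = n & (ALL (a, b):set ws. 0 < b)) &
   s < k & (ALL (p, u, q, v):set ts. p < k & u < length os & q < k & v < length os & (u, v) : set (map fst es)) &
   k <= length ts &
   (ALL p:set [0..<length ts]. p < k --> (ALL u:set [0..<length os]. EX (p', u', q, v):set ts. p' = p & u' = u)))"

definition deterministic :: "instance_tuple => bool" where
 "deterministic = (%(n, os, es, v0, k, s, ts).
   ALL (p, u, x):set ts. ALL (p', u', x'):set ts. p = p' & u = u' --> x = x')"

lemma pt_well_formed [pts]: "pt f ==> pt (%x. well_formed (f x))" by (rule pt_comp[of well_formed]) (unfold well_formed_def case_prod_unfold, intro pts)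

lemma pt_deterministic [pts]: "pt f ==> pt (%x. deterministic (f x))" by (rule pt_comp[of deterministic]) (unfold deterministic_def case_prod_unfold, intro pts)

lemma well_formed: "well_formed t = (wf_instance (of_tuple t))"
proof -
 obtain n os es v0 k s ts where t: "t = (n, os, es, v0, k, s, ts)" by (cases t)
 have k: "k <= length ts" if "0 < length os" "!!p u. p < k ==> u < length os ==> EX q v. (p, u, q, v) : set ts"
 proof -
  have "{..<k} <= fst ` set ts" using that by force
  hence "card {..<k} <= card (fst ` set ts)" by (intro card_mono) auto
  also have "... <= length ts" using card_image_le[of "set ts" fst] card_length[of ts] by simp
  finally show ?thesis by simp
 qed
 have own: "((UN i:{..<n}. {v. v < length os & os ! v = i}) = {..<length os}) = (ALL j:set os. j < n)" by (fastforce simp: in_set_conv_nth)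
 have disj: "disjoint_family_on (%i. {v. v < length os & os ! v = i}) A" for A :: "nat set" by (auto simp: disjoint_family_on_def)
 have "wf_instance (of_tuple t) =
   ((fst ` set es <= {..<length os} \<times> {..<length os} & (ALL u:{..<length os}. EX v. (u, v) : fst ` set es) & (ALL j:set os. j < n)) &
   v0 < length os & distinct (map fst es) &
   (ALL (e, ws):set es. length ws = n & (ALL (a, b):set ws. 0 < b)) &
   (s < k & set ts <= {..<k} \<times> {..<length os} \<times> {..<k} \<times> {..<length os} &
   (ALL (p, u, q, v):set ts. (u, v) : fst ` set es) & (ALL p:{..<k}. ALL u:{..<length os}. EX q v. (p, u, q, v) : set ts)))"
  by (simp add: wf_instance_def wf_game_def wf_mealy_def inst_game_def inst_mealy_def t of_tuple_def own disj conj_assoc)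
 also have "... = well_formed t"
 proof -
  have 1: "(fst ` set es <= {..<length os} \<times> {..<length os}) = (ALL ((u, v), ws):set es. u < length os & v < length os)"
   by (simp add: image_subset_iff case_prod_unfold mem_Times_iff)
  have 2: "(ALL u:{..<length os}. EX v. (u, v) : fst ` set es) = (ALL u:set [0..<length os]. EX ((u', v), ws):set es. u' = u)"
  proof -
   have "(EX v. (u, v) : fst ` set es) = (EX ((u', v), ws):set es. u' = u)" for u by (simp add: image_iff case_prod_unfold Bex_def)
   thus ?thesis by (simp add: atLeast0LessThan)
  qed
  have 3: "(set ts <= {..<k} \<times> {..<length os} \<times> {..<k} \<times> {..<length os} & (ALL (p, u, q, v):set ts. (u, v) : fst ` set es)) =
    (ALL (p, u, q, v):set ts. p < k & u < length os & q < k & v < length os & (u, v) : set (map fst es))"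
   by (simp add: subset_iff case_prod_unfold mem_Times_iff ball_conj_distrib Ball_def) blast
  have ex: "(EX q v. (p, u, q, v) : set ts) = (EX (p', u', q, v):set ts. p' = p & u' = u)" for p u by (simp add: case_prod_unfold Bex_def)
  have 4: "(ALL p:{..<k}. ALL u:{..<length os}. EX q v. (p, u, q, v) : set ts) = (k <= length ts &
    (ALL p:set [0..<length ts]. p < k --> (ALL u:set [0..<length os]. EX (p', u', q, v):set ts. p' = p & u' = u)))" (is "?l = (_ & ?r)")
   if "v0 < length os"
  proof -
   have "0 < length os" using that by linarith
   moreover have "?l = ?r" if "k <= length ts"
   proof -
    have "(ALL p:{..<k}. Q p) = (ALL p:set [0..<length ts]. p < k --> Q p)" for Q using that by auto
    thus ?thesis by (simp only: ex[symmetric] set_upt atLeast0LessThan)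
   qed
   moreover have "k <= length ts" if ?l using k[OF `0 < length os`] that by simp
   ultimately show ?thesis by blast
  qed
  have gen: "((A & B & C) & D & E & F & H & X & Y & Z) = (A & B & C & D & E & F & H & XY & Z1 & Z2)"
   if "(X & Y) = XY" "D ==> Z = (Z1 & Z2)" for A B C D E F H X Y Z XY Z1 Z2 using that by blast
  show ?thesis unfolding well_formed_def t prod.case 1[symmetric] 2[symmetric] by (rule gen[OF 3 4])
 qed
 finally show ?thesis by simp
qed

lemma deterministic:
 assumes "wf_instance (of_tuple t)"
 shows "deterministic t = (deterministic_mealy (inst_game (of_tuple t)) (inst_mealy (of_tuple t)))"
proof -
 obtain n os es v0 k s ts where t: "t = (n, os, es, v0, k, s, ts)" by (cases t)
 have wf: "set ts <= {..<k} \<times> {..<length os} \<times> {..<k} \<times> {..<length os}" "ALL p:{..<k}. ALL u:{..<length os}. EX q v. (p, u, q, v) : set ts"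
  using assms by (simp_all add: wf_instance_def wf_mealy_def inst_game_def inst_mealy_def t of_tuple_def)
 have "deterministic_mealy (inst_game (of_tuple t)) (inst_mealy (of_tuple t)) = (ALL p:{..<k}. ALL u:{..<length os}. EX! x. (p, u, x) : set ts)"
  by (simp add: deterministic_mealy_def inst_game_def inst_mealy_def t of_tuple_def case_prod_unfold)
 also have "... = (ALL p u x x'. (p, u, x) : set ts & (p, u, x') : set ts --> x = x')"
 proof (intro iffI allI impI ballI)
  fix p u x x' assume L: "ALL p:{..<k}. ALL u:{..<length os}. EX! x. (p, u, x) : set ts" and x: "(p, u, x) : set ts & (p, u, x') : set ts"
  have "p : {..<k}" "u : {..<length os}" using x wf(1) by blast+
  thus "x = x'" using L x by blast
 next
  fix p u assume R: "ALL p u x x'. (p, u, x) : set ts & (p, u, x') : set ts --> x = x'" and "p : {..<k}" "u : {..<length os}"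
  thus "EX! x. (p, u, x) : set ts" using wf(2) by blast
 qed
 also have "... = deterministic t" unfolding deterministic_def t by auto
 finally show ?thesis by simp
qed

type_synonym node = "nat * nat"

type_synonym certificate_tuple =
 "nat * int * int list * (nat * nat * nat * nat) * nat \<times> node summary list \<times> node summary list \<times> node summary list \<times>
  node summary \<times> node summary \<times> node summary \<times> node summary \<times> node wedge"

text \<open>The integer weights \<open>ws\<close> are part of the certificate, and their
  proportionality to the rewards is checked by cross multiplication. Here \<open>b\<close> selects
  the steps allowed before the deviation.\<close>

definition valid_cert :: "bool => instance_tuple => certificate_tuple => bool" where
 "valid_cert b = (%(n, os, es, v0, k, s, ts) (i, D, ws, (p, u, q, v), v', ss1, ss2, ss3, s0, s1, s2, s3, e).
   i < n & 0 < D & length ws = length es &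
   (ALL ((_, rs), x):set (zip es ws). ALL (j, (a, d)):set (zip [0..<length rs] rs). j = i --> x * int d = a * D) &
   (p, u, q, v) : set ts & (u, i) : set (zip [0..<length os] os) & v' ~= v &
   derives (if b then any_list ts (zip (map fst es) ws) else true_list ts (zip (map fst es) ws)) ss1 &
   s0 : set ss1 & fst s0 = (s, v0) & fst (snd s0) = (p, u) & snd (snd (snd s0)) <= 0 &
   derives (true_list ts (zip (map fst es) ws)) ss2 & s1 : set ss2 & fst s1 = (q, v) &
   derives (dev_list (os, i) ts (zip (map fst es) ws)) ss3 & s2 : set ss3 & fst s2 = (q, v') &
   fst (snd s2) = fst e & e : set (dev_list (os, i) ts (zip (map fst es) ws)) &
   s3 : set ss3 & fst s3 = snd (snd e) & fst (snd s3) = fst e & 0 <= fst (snd e) + fst (snd (snd s3)) &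
   (EX (y, x):set (zip (map fst es) ws). EX (y', x'):set (zip (map fst es) ws). y = (u, v) & y' = (u, v') &
    fst (snd (snd s0)) + x + fst (snd (snd s1)) < 0 & snd (snd (snd s2)) <= fst (snd (snd s0)) + x' &
    max 0 (snd (snd (snd s3)) - fst (snd e)) <= fst (snd (snd s0)) + x' + fst (snd (snd s2))))"

lemma pt_valid_cert [pts]: "pt f ==> pt g ==> pt (%x. valid_cert b (f x) (g x))"
proof -
 assume "pt f" "pt g"
 moreover have "pt (%z. valid_cert b (fst z) (snd z))" unfolding valid_cert_def case_prod_unfold by (intro pt_if_const pts)
 ultimately show ?thesis using pt_comp[OF _ pt_Pair[of f g], of "%z. valid_cert b (fst z) (snd z)"] by simp
qed

subsection \<open>Valid certificates\<close>

lemma mem_concat_map: "(y : set (concat (map (%x. map (g x) (filter (P x) ys)) xs))) = (EX x:set xs. EX z:set ys. P x z & y = g x z)" by auto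

locale wf_tuple =
 fixes n os es v0 k s ts and I
 assumes I: "I = of_tuple (n, os, es, v0, k, s, ts)" and wf: "wf_instance I"
begin

abbreviation "G == inst_game I"
abbreviation "M == inst_mealy I"

lemma inst [simp]:
 "players G = {..<n}" "verts G = {..<length os}" "owned G i = {v. v < length os & os ! v = i}" "edges G = fst ` set es"
 "mealy_states M = {..<k}" "mealy_init M = s" "mealy_trans M = set ts" "inst_init I = v0" "inst_edges I = es"
 by (simp_all add: inst_game_def inst_mealy_def I of_tuple_def)

lemma wf': "distinct (map fst es)" "!!e rs. (e, rs) : set es ==> length rs = n" "!!e rs a b. (e, rs) : set es ==> (a, b) : set rs ==> 0 < b"
proof -
 have d: "distinct (map fst es)" "ALL (e, rs):set es. length rs = n & (ALL (a, b):set rs. 0 < b)" using wf unfolding wf_instance_def by (simp_all add: I of_tuple_def)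
 show "distinct (map fst es)" by (rule d(1))
 show "(e, rs) : set es ==> length rs = n" for e rs using d(2) by blast
 show "(e, rs) : set es ==> (a, b) : set rs ==> 0 < b" for e rs a b using d(2) by blast
qed

sublocale checked_game G M v0 "inst_reward I" using wf by unfold_locales (auto simp: wf_instance_def inst_game_def I of_tuple_def)

lemma reward: "(e, rs) : set es ==> inst_reward I i e = of_int (fst (rs ! i)) / of_nat (snd (rs ! i))"
 using wf'(1) by (simp add: inst_reward_def map_of_is_SomeI case_prod_unfold Let_def)

context
 fixes ws :: "int list" and ew and w
 assumes ws: "length ws = length es" and ew: "ew = zip (map fst es) ws" and w: "w = (%e. the (map_of ew e))"
begin

lemma ew_iff: "((e, x) : set ew) = (e : fst ` set es & x = w e)"
proof -
 have m: "map fst ew = map fst es" using ws by (simp add: ew)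
 hence d: "distinct (map fst ew)" using wf'(1) by simp
 have "(e : fst ` set es) = (EX x. map_of ew e = Some x)" using m by (metis domD domI dom_map_of_conv_image_fst list.set_map)
 thus ?thesis using d unfolding w by (metis map_of_eq_Some_iff option.sel)
qed

lemma set_true_list: "set (true_list ts ew) = weighted w (true_step M)"
proof -
 have "((a, x, b) : set (true_list ts ew)) = ((a, b) : true_step M & x = w (snd a, snd b))" for a x b
 proof -
  have "((a, x, b) : set (true_list ts ew)) = ((fst a, snd a, fst b, snd b) : set ts & ((snd a, snd b), x) : set ew)"
   by (cases a; cases b) (simp only: true_list_def case_prod_unfold mem_concat_map, simp add: Bex_def split_paired_Ex)
  thus ?thesis using trans_states by (cases a; cases b) (auto simp: ew_iff true_step_def)
 qed
 thus ?thesis by (auto simp: set_eq_iff)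
qed

lemma set_any_list: "set (any_list ts ew) = weighted w (any_step G M)"
proof -
 have "((a, x, b) : set (any_list ts ew)) = ((a, b) : any_step G M & x = w (snd a, snd b))" for a x b
 proof -
  have "((a, x, b) : set (any_list ts ew)) = ((EX v. (fst a, snd a, fst b, v) : set ts) & ((snd a, snd b), x) : set ew)"
   by (cases a; cases b) (simp only: any_list_def case_prod_unfold mem_concat_map, simp add: Bex_def split_paired_Ex)
  thus ?thesis by (cases a; cases b) (auto simp: ew_iff any_step_def)
 qed
 thus ?thesis by (auto simp: set_eq_iff)
qed

lemma set_dev_list: "set (dev_list (os, i) ts ew) = weighted w (dev_step G M i)"
proof -
 have "((a, x, b) : set (dev_list (os, i) ts ew)) = ((a, b) : dev_step G M i & x = w (snd a, snd b))" for a x b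
 proof -
  have "((a, x, b) : set (dev_list (os, i) ts ew)) = ((EX v. (fst a, snd a, fst b, v) : set ts & (snd b = v | snd a : owned G i)) & ((snd a, snd b), x) : set ew)"
   by (cases a; cases b) (simp only: dev_list_def case_prod_unfold mem_concat_map, simp add: mem_nth Bex_def split_paired_Ex, blast?)
  thus ?thesis by (cases a; cases b) (auto simp: ew_iff dev_step_def)
 qed
 thus ?thesis by (auto simp: set_eq_iff)
qed

lemma scaling:
 assumes "i < n" "0 < D"
 shows "(ALL ((_, rs), x):set (zip es ws). ALL (j, (a, d)):set (zip [0..<length rs] rs). j = i --> x * int d = a * D) =
  (ALL e:edges G. of_int (w e) = of_int D * inst_reward I i e)" (is "?L = _")
proof -
 let ?z = "%rs. zip [0..<length rs] rs"
 have 1: "(x * int (snd (rs ! i)) = fst (rs ! i) * D) = (of_int x = of_int D * inst_reward I i e)" if "(e, rs) : set es" for e rs x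
 proof -
  have "length rs = n" using wf'(2) that by blast
  hence "rs ! i : set rs" using assms(1) by simp
  hence "0 < snd (rs ! i)" using wf'(3)[OF that] by (metis prod.collapse)
  hence "(of_int x = of_int D * inst_reward I i e) = (of_int x * of_int (int (snd (rs ! i))) = (of_int (fst (rs ! i)) * of_int D :: rat))"
   by (simp add: reward[OF that] field_simps)
  thus ?thesis by (simp only: of_int_mult[symmetric] of_int_eq_iff)
 qed
 have "?L = (ALL ((e, rs), x):set (zip es ws). x * int (snd (rs ! i)) = fst (rs ! i) * D)"
 proof (rule ball_cong[OF refl])
  fix z assume "z : set (zip es ws)"
  moreover obtain e rs x where z: "z = ((e, rs), x)" by (metis prod.collapse)
  ultimately have "(e, rs) : set es" by (auto dest: set_zip_leftD)
  hence l: "length rs = n" using wf'(2) by blast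
  have a: "(i, rs ! i) : set (?z rs)" using l assms(1) mem_nth[of i "rs ! i" rs] by blast
  have b: "snd y = rs ! i" if "y : set (?z rs)" "fst y = i" for y
  proof -
   have "(i, snd y) : set (?z rs)" using that by (metis prod.collapse)
   thus ?thesis using mem_nth[of i "snd y" rs] by metis
  qed
  have "(ALL y:set (?z rs). fst y = i --> x * int (snd (snd y)) = fst (snd y) * D) = (x * int (snd (rs ! i)) = fst (rs ! i) * D)"
  proof
   assume "ALL y:set (?z rs). fst y = i --> x * int (snd (snd y)) = fst (snd y) * D"
   from bspec[OF this a] show "x * int (snd (rs ! i)) = fst (rs ! i) * D" by simp
  next
   assume "x * int (snd (rs ! i)) = fst (rs ! i) * D"
   thus "ALL y:set (?z rs). fst y = i --> x * int (snd (snd y)) = fst (snd y) * D" by (intro ballI impI) (simp only: b)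
  qed
  thus "(case z of (x, xa) => (case x of (uu, rs) => %x. ALL (j, a, d):set (?z rs). j = i --> x * int d = a * D) xa) =
    (case z of (x, xa) => (case x of (e, rs) => %x. x * int (snd (rs ! i)) = fst (rs ! i) * D) xa)" by (simp add: z case_prod_unfold)
 qed
 also have "... = (ALL ((e, rs), x):set (zip es ws). of_int x = of_int D * inst_reward I i e)" by (intro ball_cong refl) (use 1 in "auto dest!: set_zip_leftD")
 also have "... = (ALL (e, x):set ew. of_int x = of_int D * inst_reward I i e)" unfolding ew zip_map1 by (simp add: case_prod_unfold)
 also have "... = (ALL e:edges G. of_int (w e) = of_int D * inst_reward I i e)" unfolding inst(4) Ball_def split_paired_All prod.case ew_iff by blast
 finally show ?thesis .
qed

lemma valid_cert_iff:
 "valid_cert b (n, os, es, v0, k, s, ts) (i, D, ws, t, v', ss1, ss2, ss3, s0, s1, s2, s3, e) =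
   (i < n & 0 < D & (ALL e:edges G. of_int (w e) = of_int D * inst_reward I i e) &
   certificate G M v0 w (if b then any_step G M else true_step M) i t v' ss1 ss2 ss3 s0 s1 s2 s3 e)"
proof -
 obtain p u q v where t: "t = (p, u, q, v)" by (cases t)
 have u: "(p, u, q, v) : set ts ==> u < length os & (u, v) : fst ` set es" using trans_states[of p u q v] by simp
 have ex: "(EX (y, x):set ew. EX (y', x'):set ew. y = (u, v) & y' = (u, v') & P x x') = ((u, v) : fst ` set es & (u, v') : fst ` set es & P (w (u, v)) (w (u, v')))" for P
 proof -
  have "(EX (y, x):set ew. EX (y', x'):set ew. y = (u, v) & y' = (u, v') & P x x') =
    (EX x x'. ((u, v), x) : set ew & ((u, v'), x') : set ew & P x x')" by (auto simp: Bex_def)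
  thus ?thesis by (auto simp only: ew_iff)
 qed
 show ?thesis
 proof (cases "i < n & 0 < D")
  case True hence "i < n" "0 < D" by simp_all
  show ?thesis unfolding valid_cert_def prod.case t ew[symmetric] ex certificate_def derives_def fst_conv snd_conv
    scaling[OF `i < n` `0 < D`] mem_nth using True u ws by (cases b) (auto simp: set_true_list set_any_list set_dev_list)
 next case False
  thus ?thesis unfolding valid_cert_def prod.case t by blast
 qed
qed

end

end

subsection \<open>Certificates of polynomial size\<close>

lemma length_enc_list: "length xs < length (enc_list f xs)" "x : set xs ==> length (f x) < length (enc_list f xs)" by (induction xs) (auto simp: enc_list_def)

lemma enc_nat_bound: "length (enc_nat m) <= N ==> m < 2 ^ N" using length_enc_list(1)[of "binary m" "%b. [b]"] length_binary[of m N] by (simp add: enc_nat_def)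

lemma enc_int_bound: "length (enc_int a) <= N ==> abs a < 2 ^ N" using enc_nat_bound[of "nat (abs a)" N] by (simp add: enc_int_def nat_less_iff)

lemma esize_list: "(!!x. x : set xs ==> esize x <= b) ==> length xs <= m ==> esize xs <= m * (b + 1) + 1"
proof -
 assume b: "!!x. x : set xs ==> esize x <= b" and m: "length xs <= m"
 have "esize xs <= length xs * (b + 1) + 1" using b
 proof (induction xs)
  case (Cons x xs)
  have "esize x <= b" "esize xs <= length xs * (b + 1) + 1" using Cons by auto
  thus ?case by simp
 qed simp
 also have "... <= m * (b + 1) + 1" using m by (intro add_mono mult_mono) auto
 finally show ?thesis .
qed

text \<open>This is \<open>final_steps\<close> at \<open>ga = 2 * be + 3\<close> with
  \<open>n\<close> in place of \<open>card V\<close>, hence an explicit polynomial.\<close>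

definition step_count :: "nat => nat => nat" where
 "step_count n be = (let ga = 2 * be + 3; sb = 2 * (n * n) + (4 * be + 8) * (2 * n + 2 * (6 * be + ga + 2) + 3) + 1
   in 2 * (n * (sb + 3)) + sb + 2 * (2 * n + 1 + 2 * (11 * be + ga + 8) + 1) + 4)"

lemma final_steps_le:
 assumes "finite V" "0 <= (W :: int)" "W <= 2 ^ be" "card V <= 2 ^ be" "card V <= n"
 shows "bounded_graph.final_steps V be (2 * be + 3) <= step_count n be"
proof -
 interpret bounded_graph V W be using assms by unfold_locales auto
 have "step_bound (2 * be + 3) <= 2 * (n * n) + (4 * be + 8) * (2 * n + 2 * (6 * be + (2 * be + 3) + 2) + 3) + 1"
  unfolding step_bound_def using assms(5) by (intro add_mono mult_mono order_refl) auto
 thus ?thesis unfolding final_steps_def step_count_def Let_def using assms(5) by (intro add_mono mult_mono order_refl) auto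
qed

text \<open>The bit length \<open>15 * be + 15\<close> of \<open>certificate_complete\<close> at
  \<open>be = N * N + N\<close>, plus one for a strict inequality.\<close>

definition number_size :: "nat => nat" where
 "number_size N = 15 * (N * N + N) + 16"

definition entry_size :: "nat => nat" where
 "entry_size N = 2 * (8 * N + 3) + 2 * (4 * number_size N + 5) + 3"

definition certificate_size :: "nat => nat" where
 "certificate_size N = (4 * N + 1) + (4 * number_size N + 5) + (N * (4 * number_size N + 5 + 1) + 1) + (16 * N + 7) + (4 * N + 1) +
   2 * (step_count (N * N) (N * N + N) * (entry_size N + 1) + 1) + ((4 * (N * N) + 2) * (entry_size N + 1) + 1) +
   5 * entry_size N + 12"

context wf_tuple
begin

context
 fixes N assumes N: "N = length (enc_instance I)"
begin

lemma N_bounds: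
 "length os <= N" "length es <= N" "length ts <= N" "k <= N" "n < 2 ^ N"
 "!!e rs a d. (e, rs) : set es ==> (a, d) : set rs ==> abs a < 2 ^ N & d < 2 ^ N"
proof -
 note enc = enc_instance_def[of I, unfolded I of_tuple_def prod.case checking_instance.simps, folded I]
 have l: "length (enc_nat n) <= N" "length (enc_list enc_nat os) <= N" "length (enc_list enc_edge es) <= N" "length (enc_list enc_trans ts) <= N"
  unfolding N I of_tuple_def enc_instance_def by simp_all
 show "length os <= N" "length es <= N" "length ts <= N"
  using l length_enc_list(1)[of os enc_nat] length_enc_list(1)[of es enc_edge] length_enc_list(1)[of ts enc_trans] by simp_all
 have "well_formed (n, os, es, v0, k, s, ts)" using wf I well_formed by simp
 thus "k <= N" using `length ts <= N` by (simp add: well_formed_def)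
 show "n < 2 ^ N" using l(1) by (rule enc_nat_bound)
 fix e rs a d assume m: "(e, rs) : set es" "(a, d) : set rs"
 have "length (enc_int a @ enc_nat d) <= length (enc_list (%(a, b). enc_int a @ enc_nat b) rs)"
  using length_enc_list(2)[OF m(2), of "%(a, b). enc_int a @ enc_nat b"] by simp
 also have "... <= length (enc_edge (e, rs))" by (simp add: enc_edge_def split: prod.split)
 also have "... <= N" using length_enc_list(2)[OF m(1), of enc_edge] l(3) by simp
 finally show "abs a < 2 ^ N & d < 2 ^ N" by (intro conjI enc_int_bound enc_nat_bound) simp_all
qed

text \<open>As common denominator serves the product of the denominators of player \<open>i\<close>.
  Each of at most \<open>N\<close> edges contributes a factor below \<open>2 ^ N\<close>, and
  numerators are below \<open>2 ^ N\<close>, so the scaled weights are at most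
  \<open>2 ^ (N * N + N)\<close>.\<close>

lemma small_certificate:
 assumes i: "i < n" and viol: "violation G M v0 (inst_reward I i) (if b then any_step G M else true_step M) i"
 obtains c where "valid_cert b (n, os, es, v0, k, s, ts) c" "esize c <= certificate_size N"
proof -
 define be where "be = N * N + N"
 define D where "D = (PROD x:set es. int (snd (snd x ! i)))"
 define ws where "ws = map (%(e, rs). fst (rs ! i) * (D div int (snd (rs ! i)))) es"
 define ew where "ew = zip (map fst es) ws"
 define w where "w = (%e. the (map_of ew e))"
 have ws: "length ws = length es" by (simp add: ws_def)
 have mem: "(fst (rs ! i), snd (rs ! i)) : set rs" if "(e, rs) : set es" for e rs using wf'(2)[OF that] i by simp
 have pos: "0 < snd (rs ! i)" if "(e, rs) : set es" for e rs using wf'(3)[OF that mem[OF that]] .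
 have D: "0 < D" unfolding D_def using pos by (intro prod_pos) auto
 have D2: "D <= 2 ^ (N * N)"
 proof -
  have "D <= (PROD x:set es. 2 ^ N)" unfolding D_def
  proof (rule prod_mono)
   fix x assume "x : set es"
   moreover obtain e rs where x: "x = (e, rs)" by (cases x)
   ultimately have "snd (rs ! i) < 2 ^ N" using N_bounds(6) mem by blast
   hence "int (snd (rs ! i)) < int (2 ^ N)" by (simp only: of_nat_less_iff)
   thus "0 <= int (snd (snd x ! i)) & int (snd (snd x ! i)) <= 2 ^ N" by (simp add: x)
  qed
  also have "... = 2 ^ (N * card (set es))" by (simp add: power_mult)
  also have "... <= 2 ^ (N * N)" using N_bounds(2) card_length[of es] by (intro power_increasing mult_le_mono2) auto
  finally show ?thesis .
 qed
 have dv: "int (snd (rs ! i)) dvd D" if "(e, rs) : set es" for e rs unfolding D_def using dvd_prodI[of "set es" "(e, rs)" "%x. int (snd (snd x ! i))"] that by simp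
 have wmem: "x * int (snd (rs ! i)) = fst (rs ! i) * D & abs x <= 2 ^ be" if "((e, rs), x) : set (zip es ws)" for e rs x
 proof -
  have m: "(e, rs) : set es" using that by (rule set_zip_leftD)
  have "zip es ws = map (%y. (y, (%(e, rs). fst (rs ! i) * (D div int (snd (rs ! i)))) y)) es" by (simp add: ws_def zip_map2 zip_same_conv_map)
  hence x: "x = fst (rs ! i) * (D div int (snd (rs ! i)))" using that by auto
  have "D div int (snd (rs ! i)) <= D" "0 <= D div int (snd (rs ! i))" using D pos[OF m] zdiv_mono2[of D 1 "int (snd (rs ! i))"] by (auto simp: pos_imp_zdiv_nonneg_iff)
  moreover have "abs (fst (rs ! i)) <= 2 ^ N" using N_bounds(6)[OF m mem[OF m]] by simp
  ultimately have "abs (fst (rs ! i)) * (D div int (snd (rs ! i))) <= 2 ^ N * 2 ^ (N * N)" using D2 by (intro mult_mono) auto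
  also have "... = 2 ^ be" by (simp add: be_def power_add)
  finally have "abs x <= 2 ^ be" unfolding x using `0 <= D div int (snd (rs ! i))` by (simp add: abs_mult)
  moreover have "x * int (snd (rs ! i)) = fst (rs ! i) * D" using dv[OF m] by (simp add: x)
  ultimately show ?thesis by simp
 qed
 note iff = valid_cert_iff[OF ws ew_def w_def] and ew_iff = ew_iff[OF ws ew_def w_def]
 have scale: "ALL e:edges G. of_int (w e) = of_int D * inst_reward I i e"
 proof (subst scaling[OF ws ew_def w_def i D, symmetric], clarify)
  fix e rs x j a d assume z: "((e, rs), x) : set (zip es ws)" "(i, a, d) : set (zip [0..<length rs] rs)"
  have "rs ! i = (a, d)" using z(2) mem_nth[of i "(a, d)" rs] by metis
  thus "x * int d = a * D" using wmem[OF z(1)] by simp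
 qed
 have wb: "abs (w e) <= 2 ^ be" if "e : edges G" for e
 proof -
  have "(e, w e) : set ew" using that ew_iff by simp
  then obtain rs where "((e, rs), w e) : set (zip es ws)" unfolding ew_def zip_map1 by auto
  thus ?thesis using wmem by blast
 qed
 interpret scaled_game G M v0 "inst_reward I" i w D by unfold_locales (use D scale in auto)
 define V where "V = mealy_states M \<times> verts G"
 have cV: "card V <= N * N" using N_bounds(1,4) by (simp add: V_def mult_le_mono)
 have "N * N <= 2 ^ be" using less_exp[of "N * N"] power_increasing[of "N * N" be "2 :: nat"] unfolding be_def by linarith
 hence cV2: "card V <= 2 ^ be" using cV by simp
 let ?S = "if b then any_step G M else true_step M" and ?B = "2 ^ (15 * be + 15) :: int"
 have S: "?S = true_step M | ?S = any_step G M" by simp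
 obtain t v' ss1 ss2 ss3 s0 s1 s2 s3 e where c: "certificate G M v0 w ?S i t v' ss1 ss2 ss3 s0 s1 s2 s3 e"
  and len: "length ss1 <= bounded_graph.final_steps V be (2 * be + 3)" "length ss2 <= bounded_graph.final_steps V be (2 * be + 3)"
   "length ss3 <= 4 * card V + 2"
  and small: "!!s. s : set (ss1 @ ss2 @ ss3) ==> small_summary V ?B s"
  and e: "fst e : V" "tgt e : V" "abs (wt e) <= ?B" using certificate_complete[OF viol S _ order_refl wb V_def cV2] by (metis zero_le_numeral zero_le_power)
 let ?c = "(i, D, ws, t, v', ss1, ss2, ss3, s0, s1, s2, s3, e)"
 have valid: "valid_cert b (n, os, es, v0, k, s, ts) ?c" unfolding iff using i D scale c by blast
 have steps: "bounded_graph.final_steps V be (2 * be + 3) <= step_count (N * N) be" by (rule final_steps_le[of V "2 ^ be"]) (use cV cV2 in "auto simp: V_def")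
 have num: "esize m <= 4 * N + 1" if "m <= N" for m using that less_exp[of N] by (intro esize_nat) linarith
 have int: "esize z <= 4 * number_size N + 5" if "abs z <= ?B" for z :: int
 proof (rule esize_int)
  have "?B < 2 ^ number_size N" unfolding number_size_def be_def by (intro power_strict_increasing) auto
  thus "abs z < 2 ^ number_size N" using that by linarith
 qed
 have node: "esize a <= 8 * N + 3" if "a : V" for a
 proof -
  obtain p u where a: "a = (p, u)" by (cases a)
  hence "p <= N" "u <= N" using that N_bounds(1,4) by (auto simp: V_def)
  thus ?thesis using num[of p] num[of u] by (simp add: a)
 qed
 have entry: "esize x <= entry_size N" if x: "small_summary V ?B x" for x
 proof -
  obtain a b' c d where "x = (a, b', c, d)" by (cases x)
  thus ?thesis using x node[of a] node[of b'] int[of c] int[of d] by (simp add: small_summary_def entry_size_def)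
 qed
 have es: "esize s0 <= entry_size N" "esize s1 <= entry_size N" "esize s2 <= entry_size N" "esize s3 <= entry_size N"
  using c by (auto simp: certificate_def intro!: entry small)
 have ee: "esize e <= entry_size N"
 proof -
  obtain a x b' where e': "e = (a, x, b')" by (cases e)
  thus ?thesis using e node[of a] node[of b'] int[of x] by (simp add: entry_size_def)
 qed
 have l1: "esize ss1 <= step_count (N * N) be * (entry_size N + 1) + 1" by (rule esize_list) (use len(1) steps in "auto intro!: entry small")
 have l2: "esize ss2 <= step_count (N * N) be * (entry_size N + 1) + 1" by (rule esize_list) (use len(2) steps in "auto intro!: entry small")
 have l3: "esize ss3 <= (4 * (N * N) + 2) * (entry_size N + 1) + 1" by (rule esize_list) (use len(3) cV in "auto intro!: entry small")
 have bB: "(2 :: int) ^ be <= ?B" by (rule power_increasing) auto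
 have lw: "esize ws <= N * (4 * number_size N + 5 + 1) + 1"
 proof (rule esize_list)
  fix x assume "x : set ws"
  then obtain y where "(y, x) : set (zip es ws)" using ws by (metis in_set_impl_in_set_zip2)
  hence "abs x <= 2 ^ be" using wmem by (metis prod.collapse)
  thus "esize x <= 4 * number_size N + 5" using bB by (intro int) linarith
 qed (use ws N_bounds(2) in simp)
 have tt: "t : set ts" "(fst (snd t), v') : edges G" using c by (auto simp: certificate_def)
 obtain p u q v where t: "t = (p, u, q, v)" by (cases t)
 have "p < k" "u < length os" "q < k" "v < length os" "v' < length os" using trans_states[of p u q v] tt edges_verts by (auto simp: t)
 hence te: "esize t <= 16 * N + 7" and ve: "esize v' <= 4 * N + 1" using num[of p] num[of u] num[of q] num[of v] num[of v'] N_bounds(1,4) by (simp_all add: t)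
 have De: "esize D <= 4 * number_size N + 5"
 proof (rule int)
  have "(2 :: int) ^ (N * N) <= ?B" by (rule power_increasing) (auto simp: be_def)
  thus "abs D <= ?B" using D D2 by linarith
 qed
 have ie: "esize i <= 4 * N + 1" using i N_bounds(5) by (intro esize_nat) simp
 have "esize ?c <= certificate_size N"
 proof -
  have gen: "Suc (a1 + Suc (a2 + Suc (a3 + Suc (a4 + Suc (a5 + Suc (a6 + Suc (a7 + Suc (a8 + Suc (e1 + Suc (e2 + Suc (e3 + Suc (e4 + e5)))))))))))) <=
    b1 + b2 + b3 + b4 + b1 + 2 * b6 + b8 + 5 * x + 12"
   if "a1 <= b1" "a2 <= b2" "a3 <= b3" "a4 <= b4" "a5 <= b1" "a6 <= b6" "a7 <= b6" "a8 <= b8"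
    "e1 <= x" "e2 <= x" "e3 <= x" "e4 <= x" "e5 <= x"
   for a1 a2 a3 a4 a5 a6 a7 a8 e1 e2 e3 e4 e5 b1 b2 b3 b4 b6 b8 x :: nat using that by linarith
  show ?thesis unfolding certificate_size_def esize_simps be_def[symmetric] by (rule gen[OF ie De lw te ve l1 l2 l3 es ee])
 qed
 with valid show ?thesis by (rule that)
qed

end

lemma violation_iff:
 assumes "i < n" "S = (if b then any_step G M else true_step M)"
  "valid_cert b (n, os, es, v0, k, s, ts) c" "fst c = i"
 shows "violation G M v0 (inst_reward I i) S i"
proof -
 obtain D ws t v' ss1 ss2 ss3 s0 s1 s2 s3 e where c: "c = (i, D, ws, t, v', ss1, ss2, ss3, s0, s1, s2, s3, e)" using assms(4) by (cases c) auto
 have ws: "length ws = length es" using assms(3) by (simp add: c valid_cert_def split: prod.splits)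
 define w where "w = (%e. the (map_of (zip (map fst es) ws) e))"
 note v = assms(3)[unfolded c valid_cert_iff[OF ws refl w_def]]
 interpret scaled_game G M v0 "inst_reward I" i w D by unfold_locales (use v in auto)
 show ?thesis by (rule certificate_sound) (use v assms(2) in "auto split: if_splits")
qed

end

lemma pbounded_poly:
 assumes "pbounded f"
 obtains p :: "nat poly" where "!!n. f n <= poly p n"
proof -
 obtain k where "!!n. f n <= (n + 2) ^ k" using assms by (auto simp: pbounded_def)
 thus ?thesis by (intro that[of "[:2, 1:] ^ k"]) (simp add: add.commute)
qed

lemma pbounded_certificate_size: "pbounded certificate_size" unfolding certificate_size_def entry_size_def number_size_def step_count_def Let_def by (intro pb_intros)

abbreviation violates :: "bool => checking_instance => nat => bool" where
 "violates b I i == violation (inst_game I) (inst_mealy I) (inst_init I) (inst_reward I i)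
   (if b then any_step (inst_game I) (inst_mealy I) else true_step (inst_mealy I)) i"

text \<open>The flag \<open>b\<close> distinguishes subgame-perfect from Nash equilibria, and
  \<open>d\<close> adds determinism. Words that encode no suitable instance belong to the complement
  and are accepted there with any certificate.\<close>

theorem checking_coNP:
 "{enc_instance I | I. wf_instance I & (d --> deterministic_mealy (inst_game I) (inst_mealy I)) &
   (ALL i<inst_num_players I. ~ violates b I i)} : class_coNP"
 (is "?L : _")
proof -
 obtain dec where "pcode (%t. enc_instance (of_tuple t)) dec" using pcode_instance by blast
 note dec = pcodeD[OF this]
 let ?t = "%x. fst (dec x)"
 \<comment> \<open>The decoder is total, so malformed words are recognised by encoding the decoded
   tuple again.\<close>
 let ?ok = "%x. enc_instance (of_tuple (?t x)) = x & well_formed (?t x) & (d --> deterministic (?t x))"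
 define R where "R = {z. ~ ?ok (fst (unpair z)) | valid_cert b (?t (fst (unpair z))) (of_tree (parse_tree (snd (unpair z))))}"
 have "pt (%z. [~ ?ok (fst (unpair z)) | valid_cert b (?t (fst (unpair z))) (of_tree (parse_tree (snd (unpair z))))])"
  by (intro pts pt_comp[OF dec(1)] pt_comp[OF dec(2)])
 hence "R : class_P" unfolding class_P_def R_def mem_Collect_eq by (rule pt_polytime)
 moreover obtain p where p: "!!n. certificate_size n <= poly p n" using pbounded_poly[OF pbounded_certificate_size] by blast
 moreover have "(x : - ?L) = (EX y. length y <= poly p (length x) & pair_word x y : R)" for x
 proof (cases "?ok x")
  case False
  have "x ~: ?L"
  proof
   assume "x : ?L"
   then obtain I where I: "x = enc_instance I" "wf_instance I" "d --> deterministic_mealy (inst_game I) (inst_mealy I)" by blast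
   obtain t where t: "I = of_tuple t" using of_tuple_surj by blast
   have "dec (enc_instance (of_tuple t) @ []) = (t, [])" by (rule dec(3))
   hence "?t x = t" unfolding I(1) t by (simp only: append_Nil2 fst_conv)
   thus False using False I t well_formed[of t] deterministic[of t] by simp
  qed
  moreover have "pair_word x [] : R" using False by (simp add: R_def)
  ultimately show ?thesis by (intro iffI) (auto intro!: exI[of _ "[]"])
 next case True
  obtain n os es v0 k s ts where t: "?t x = (n, os, es, v0, k, s, ts)" by (metis prod.collapse)
  define I where "I = of_tuple (?t x)"
  have wf: "wf_instance I" using True well_formed by (simp add: I_def)
  have det: "d --> deterministic_mealy (inst_game I) (inst_mealy I)" using True deterministic wf by (simp add: I_def)
  interpret wf_tuple n os es v0 k s ts I by unfold_locales (use wf in "simp_all add: I_def t")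
  have x: "x = enc_instance I" using True by (simp add: I_def)
  have inj: "J = I" if "enc_instance J = enc_instance I" for J
  proof -
   obtain t' where t': "J = of_tuple t'" using of_tuple_surj by blast
   have "dec (enc_instance (of_tuple t') @ []) = (t', [])" by (rule dec(3))
   moreover have "enc_instance (of_tuple t') = x" using that x t' by (simp only:)
   ultimately have "fst (dec x) = t'" by (simp only: append_Nil2 fst_conv)
   thus ?thesis unfolding t' I_def by (simp only:)
  qed
  let ?v = "%i. violation G M v0 (inst_reward I i) (if b then any_step G M else true_step M) i"
  have n: "inst_num_players I = n" by (simp add: I_def t of_tuple_def)
  have "(x : ?L) = (ALL i<n. ~ ?v i)"
  proof
   assume "x : ?L"
   then obtain J where J: "x = enc_instance J" "ALL i<inst_num_players J. ~ violates b J i" by blast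
   have JI: "J = I" by (rule inj) (simp only: J(1)[symmetric] x[symmetric])
   show "ALL i<n. ~ ?v i" by (rule J(2)[unfolded JI n inst(8)])
  next
   assume "ALL i<n. ~ ?v i"
   thus "x : ?L" using x wf det n by auto
  qed
  hence L: "(x : - ?L) = (EX i<n. ?v i)" by auto
  have R: "(pair_word x y : R) = (valid_cert b (n, os, es, v0, k, s, ts) (of_tree (parse_tree y)))" for y using True by (auto simp: R_def t)
  show ?thesis
  proof
   assume "x : - ?L"
   then obtain i where i: "i < n" "?v i" using L by blast
   obtain c where c: "valid_cert b (n, os, es, v0, k, s, ts) c" "esize c <= certificate_size (length x)" using small_certificate[OF _ i] x by blast
   have "pair_word x (encode c) : R" using c(1) R by simp
   moreover have "length (encode c) <= poly p (length x)" using c(2) p[of "length x"] by (simp add: esize_def)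
   ultimately show "EX y. length y <= poly p (length x) & pair_word x y : R" by blast
  next
   assume "EX y. length y <= poly p (length x) & pair_word x y : R"
   then obtain c where c: "valid_cert b (n, os, es, v0, k, s, ts) c" using R by blast
   have "fst c < n" using c by (simp add: valid_cert_def split: prod.splits)
   thus "x : - ?L" using violation_iff[OF _ refl c refl] L by blast
  qed
 qed
 ultimately show ?thesis unfolding class_coNP_def class_NP_def by blast
qed

lemma
 shows Nash_checking_coNP: "Nash_checking : class_coNP"
  and subgame_perfect_checking_coNP: "subgame_perfect_checking : class_coNP"
  and deterministic_subgame_perfect_checking_coNP: "deterministic_subgame_perfect_checking : class_coNP"
proof -
 have g: "checked_game (inst_game I) (inst_mealy I) (inst_init I) (inst_reward I)" if "wf_instance I" for I
  using that by unfold_locales (auto simp: wf_instance_def inst_game_def)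
 have p: "players (inst_game I) = {..<inst_num_players I}" for I by (simp add: inst_game_def)
 have 1: "(ALL si:compatible (inst_game I) (inst_init I) (inst_mealy I). Nash_equilibrium (inst_game I) (inst_init I) si) =
   (ALL i<inst_num_players I. ~ violates False I i)"
  if "wf_instance I" for I unfolding checked_game.Nash_iff[OF g[OF that]] p by auto
 have 2: "(ALL si:compatible (inst_game I) (inst_init I) (inst_mealy I). subgame_perfect_equilibrium (inst_game I) (inst_init I) si) =
   (ALL i<inst_num_players I. ~ violates True I i)"
  if "wf_instance I" for I unfolding checked_game.subgame_perfect_iff[OF g[OF that]] p by auto
 have eq: "{enc_instance I |I. wf_instance I & A I} : class_coNP"
  if "{enc_instance I |I. wf_instance I & B I} : class_coNP" "!!I. wf_instance I ==> A I = B I" for A B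
 proof -
  have "{enc_instance I |I. wf_instance I & A I} = {enc_instance I |I. wf_instance I & B I}" by (intro Collect_cong ex_cong1 conj_cong refl) (rule that(2))
  thus ?thesis using that(1) by (simp only:)
 qed
 show "Nash_checking : class_coNP" unfolding Nash_checking_def by (rule eq[OF checking_coNP[of False False, unfolded simp_thms]]) (rule 1)
 show "subgame_perfect_checking : class_coNP" unfolding subgame_perfect_checking_def by (rule eq[OF checking_coNP[of False True, unfolded simp_thms]]) (rule 2)
 show "deterministic_subgame_perfect_checking : class_coNP" unfolding deterministic_subgame_perfect_checking_def
  by (rule eq[OF checking_coNP[of True True, unfolded simp_thms]]) (simp only: 2)
qed

section \<open>Hardness for coNP\<close>

subsection \<open>From sums of weights to games\<close>

text \<open>A multiple-choice variant of subset sum, with one entry taken from each list.\<close>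

definition solvable :: "nat list list => nat => bool" where
 "solvable ws T = (EX c. (ALL l<length ws. c l < length (ws ! l)) & (SUM l<length ws. ws ! l ! c l) = T)"

definition nth_or :: "'a => 'a list => nat => 'a" where
 "nth_or d xs i = (if i < length xs then xs ! i else d)"

lemma nth_or_filter: "nth_or d xs i = (if i < length xs then snd (hd (filter (%z. fst z = i) (zip [0..<length xs] xs))) else d)"
proof (cases "i < length xs")
 case True
 let ?z = "zip [0..<length xs] xs"
 let ?f = "filter (%z. fst z = i) ?z"
 have "(i, xs ! i) : set ?f" using mem_nth[of i "xs ! i" xs] True by auto
 hence "hd ?f : set ?f" by (metis empty_iff empty_set hd_in_set)
 hence "hd ?f : set ?z"
  "fst (hd ?f) = i" by auto
 hence "(i, snd (hd ?f)) : set ?z" by (metis prod.collapse)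
 thus ?thesis using True mem_nth unfolding nth_or_def by metis
qed (simp add: nth_or_def)

lemma pt_nth_or [pts]:
 fixes f :: "'b :: treeable => 'a :: treeable list"
 assumes "pt f" "pt g"
 shows "pt (%x. nth_or d (f x) (g x))"
proof -
 have "pt (%z :: 'a list * nat. nth_or d (fst z) (snd z))" unfolding nth_or_filter by (intro pts)
 from pt_comp[OF this pt_Pair[OF assms]] show ?thesis by simp
qed

text \<open>Vertex \<open>l \<le> N\<close> starts stage \<open>l\<close>, vertex \<open>off ws l + c\<close> is choice \<open>c\<close> in stage \<open>l\<close>. From \<open>N\<close> the
  play moves to the sink \<open>N + 1\<close> or to the sink \<open>N + 2\<close>.\<close>

definition off :: "nat list list => nat => nat" where
 "off ws l = length ws + 3 + l * length (concat ws)"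

text \<open>A range up to the length of a list, as required by \<open>pt_upt_length\<close>.\<close>

definition vertices :: "nat list list => nat list" where
 "vertices ws = [0..<length (map (%_. ()) ws @ [(), (), ()] @ concat (map (%_. map (%_. ()) (concat ws)) ws))]"

text \<open>Every stage reserves \<open>length (concat ws)\<close> choice vertices, so that offsets
  need no partial sums. Surplus ones lead to the next stage but are never entered.\<close>

definition is_edge :: "nat list list => nat => nat => bool" where
 "is_edge ws a b =
   (a < length ws & off ws a <= b & b < off ws a + length (nth_or [] ws a) |
   0 < b & b <= length ws & off ws (b - 1) <= a & a < off ws b |
   a = length ws & (b = Suc a | b = Suc (Suc a)) | a = Suc (length ws) & b = a | a = Suc (Suc (length ws)) & b = a)"

text \<open>The machine always moves from \<open>N\<close> to \<open>N + 2\<close> at cost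
  \<open>T + 1\<close>, and player 1 may deviate to \<open>N + 1\<close> at cost \<open>T\<close>.
  The former loses and the latter wins exactly if the energy collected before is
  \<open>T\<close>.\<close>

definition edge_weight :: "nat list list => nat => nat * nat => int" where
 "edge_weight ws T = (%(a, b).
   if a < length ws then int (nth_or 0 (nth_or [] ws a) (b - off ws a))
   else if a = length ws then (if b = Suc a then - int T else - int (Suc T)) else 0)"

definition edge_pairs :: "nat list list => (nat * nat) list" where
 "edge_pairs ws = filter (%(a, b). is_edge ws a b) (concat (map (%a. map (%b. (a, b)) (vertices ws)) (vertices ws)))"

text \<open>For Nash equilibria the choices must occur on outcomes: every path that avoids the
  excluded edge can be the outcome of a compatible profile.\<close>

definition all_moves :: "nat list list => (nat * nat * nat * nat) list" where
 "all_moves ws = map (%(a, b). (0, a, 0, b)) (filter (%e. e ~= (length ws, Suc (length ws))) (edge_pairs ws))"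

text \<open>One move per vertex makes the machine deterministic. Subgame perfection ranges over all
  histories, so all choices still occur before the deviation.\<close>

definition first_moves :: "nat list list => (nat * nat * nat * nat) list" where
 "first_moves ws = map (%a. (0, a, 0, if a = length ws then Suc (Suc a) else hd (filter (is_edge ws a) (vertices ws)))) (vertices ws)"

definition sum_instance :: "(nat list list => (nat * nat * nat * nat) list) => nat list list => nat => instance_tuple" where
 "sum_instance moves ws T =
   (2, map (%v. if v = length ws then 1 else 0) (vertices ws),
   map (%e. (e, [(0, 1), (edge_weight ws T e, 1)])) (edge_pairs ws), 0, 1, 0, moves ws)"

lemma pt_off [pts]: "pt f ==> pt g ==> pt (%x. off (f x) (g x))" unfolding off_def by (intro pts)

lemma pt_vertices [pts]: "pt f ==> pt (%x. vertices (f x))" by (rule pt_comp[of vertices]) (unfold vertices_def, intro pts)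

lemma pt_is_edge [pts]: "pt f ==> pt g ==> pt h ==> pt (%x. is_edge (f x) (g x) (h x))" unfolding is_edge_def by (intro pts)

lemma pt_edge_pairs [pts]: "pt f ==> pt (%x. edge_pairs (f x))" by (rule pt_comp[of edge_pairs]) (unfold edge_pairs_def case_prod_unfold, intro pts)

lemma pt_moves: "pt all_moves" "pt first_moves" unfolding all_moves_def first_moves_def case_prod_unfold by (intro pts)+

lemma pt_sum_instance:
 assumes "pt moves" "pt f" "pt g"
 shows "pt (%x. sum_instance moves (f x) (g x))"
proof -
 have "pt (%z. sum_instance moves (fst z) (snd z))" unfolding sum_instance_def edge_weight_def case_prod_unfold by (intro pts pt_comp[OF assms(1)])
 from pt_comp[OF this pt_Pair[OF assms(2,3)]] show ?thesis by simp
qed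

section \<open>Violations in the sum game\<close>

locale sum_game =
 fixes ws :: "nat list list" and T :: nat and moves
 assumes nonempty: "!!l. l < length ws ==> ws ! l ~= []" and moves: "moves = all_moves | moves = first_moves"
begin

abbreviation "N == length ws"
abbreviation "nv == N + 3 + N * length (concat ws)"
abbreviation "I == of_tuple (sum_instance moves ws T)"

lemma vertices: "vertices ws = [0..<nv]" unfolding vertices_def by (rule arg_cong[of _ _ "%k. [0..<k]"]) (simp add: length_concat comp_def sum_list_triv)

lemma length_stage: "l < N ==> length (ws ! l) <= length (concat ws)" by (simp add: length_concat member_le_sum_list)

lemma off_less: "off ws l + length (concat ws) = off ws (Suc l)" "l <= N ==> off ws l <= nv" "N + 3 <= off ws l" by (auto simp: off_def)

lemma edge_verts: "is_edge ws a b ==> a < nv & b < nv"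
proof -
 assume e: "is_edge ws a b"
 have "off ws a + length (nth_or [] ws a) <= nv" if "a < N" using length_stage[OF that] off_less(1)[of a] off_less(2)[of "Suc a"] that by (simp add: nth_or_def)
 moreover have "off ws b <= nv" if "b <= N" using off_less(2) that by simp
 ultimately show ?thesis using e unfolding is_edge_def by fastforce
qed

lemma edge_pairs: "set (edge_pairs ws) = {(a, b). is_edge ws a b}"
 unfolding edge_pairs_def vertices product_concat_map[symmetric] set_filter set_product by (auto dest: edge_verts)

lemma distinct_edge_pairs: "distinct (edge_pairs ws)" unfolding edge_pairs_def vertices product_concat_map[symmetric]
 by (intro distinct_filter distinct_product distinct_upt)

lemma edge_cases:
 assumes "is_edge ws a b"
 obtains (pick) c where "a < N" "c < length (ws ! a)" "b = off ws a + c"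
 | (next_) l c where "l < N" "c < length (concat ws)" "a = off ws l + c" "b = Suc l"
 | (final) "a = N" "b = N + 1 | b = N + 2" | (sink) "a = N + 1 | a = N + 2" "b = a"
proof -
 have "a < N & off ws a <= b & b < off ws a + length (nth_or [] ws a) |
   0 < b & b <= N & off ws (b - 1) <= a & a < off ws b |
   a = N & (b = Suc a | b = Suc (Suc a)) | a = Suc N & b = a | a = Suc (Suc N) & b = a" using assms by (simp only: is_edge_def)
 thus ?thesis
 proof (elim disjE conjE)
  assume "a < N" "off ws a <= b" "b < off ws a + length (nth_or [] ws a)"
  thus ?thesis by (intro pick[of "b - off ws a"]) (auto simp: nth_or_def)
 next
  assume b: "0 < b" "b <= N" "off ws (b - 1) <= a" "a < off ws b"
  thus ?thesis using off_less(1)[of "b - 1"] by (intro next_[of "b - 1" "a - off ws (b - 1)"]) auto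
 qed (use final sink in auto)
qed

lemma edge_N: "is_edge ws N b ==> b = N + 1 | b = N + 2"
proof -
 assume "is_edge ws N b"
 thus ?thesis
 proof (cases rule: edge_cases)
  case (next_ l c) thus ?thesis using off_less(3)[of l] by linarith
 qed simp_all
qed

lemma edge_sink: "is_edge ws a b ==> a = N + 1 | a = N + 2 ==> b = a"
proof -
 assume e: "is_edge ws a b" and a: "a = N + 1 | a = N + 2"
 from e show ?thesis
 proof (cases rule: edge_cases)
  case (next_ l c) thus ?thesis using a off_less(3)[of l] by linarith
 qed (use a in linarith)+
qed

lemma edge_pick: "l < N ==> c < length (ws ! l) ==> is_edge ws l (off ws l + c)" by (simp add: is_edge_def nth_or_def)

lemma edge_next: "l < N ==> c < length (concat ws) ==> is_edge ws (off ws l + c) (Suc l)" using off_less(1)[of l] by (auto simp: is_edge_def)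

lemma edge_total: "a < nv ==> EX b. is_edge ws a b"
proof -
 assume a: "a < nv"
 consider "a < N" | "a = N" | "a = N + 1 | a = N + 2" | "N + 3 <= a" by linarith
 thus ?thesis
 proof cases
  case 1 thus ?thesis using edge_pick[of a 0] nonempty[of a] by auto
 next case 4
  let ?L = "length (concat ws)" and ?x = "a - (N + 3)"
  have "?x < N * ?L" using a 4 by linarith
  moreover from this have "0 < ?L" by (cases "?L = 0") (simp_all only: mult_0_right not_less_zero not_gr_zero)
  ultimately have "0 < ?L" "?x div ?L < N" by (auto simp: less_mult_imp_div_less)
  hence "is_edge ws (off ws (?x div ?L) + ?x mod ?L) (Suc (?x div ?L))" by (intro edge_next) auto
  moreover have "off ws (?x div ?L) + ?x mod ?L = a" using 4 by (simp add: off_def)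
  ultimately show ?thesis by auto
 qed (auto simp: is_edge_def)
qed

lemma set_moves: "(p, a, q, b) : set (moves ws) ==> p = 0 & q = 0 & is_edge ws a b & (a = N --> b = N + 2)"
proof -
 assume m: "(p, a, q, b) : set (moves ws)"
 let ?f = "filter (is_edge ws a) (vertices ws)"
 show ?thesis
 proof (cases "moves = all_moves")
  case True
  hence "p = 0" "q = 0" "is_edge ws a b" "(a, b) ~= (N, Suc N)" using m edge_pairs by (auto simp: all_moves_def)
  moreover have "b = N + 2" if "a = N" using `is_edge ws a b` by (cases rule: edge_cases) (use that `(a, b) ~= (N, Suc N)` in "simp_all add: off_def")
  ultimately show ?thesis by blast
 next case False
  hence m: "p = 0" "q = 0" "a < nv" "b = (if a = N then Suc (Suc a) else hd ?f)" using m moves by (auto simp: first_moves_def vertices)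
  show ?thesis
  proof (cases "a = N")
   case False
   obtain b' where "is_edge ws a b'" using edge_total[OF m(3)] by blast
   hence "b' : set ?f" using edge_verts by (auto simp: vertices)
   hence "hd ?f : set ?f" by (metis empty_iff empty_set hd_in_set)
   thus ?thesis using m False by simp
  qed (use m in "auto simp: is_edge_def")
 qed
qed

lemma moves_total: "a < nv ==> EX b. (0, a, 0, b) : set (moves ws)"
proof -
 assume a: "a < nv"
 show ?thesis
 proof (cases "moves = all_moves")
  case True
  have "EX b. is_edge ws a b & (a, b) ~= (N, Suc N)"
  proof (cases "a = N")
   case True thus ?thesis by (intro exI[of _ "N + 2"]) (auto simp: is_edge_def)
 next case False thus ?thesis using edge_total[OF a] by auto
  qed
  then obtain b where "is_edge ws a b" "(a, b) ~= (N, Suc N)" by blast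
  thus ?thesis using True edge_pairs by (intro exI[of _ b]) (force simp: all_moves_def)
 next case False
  hence m: "moves = first_moves" using moves by simp
  have "a : set (vertices ws)" using a by (simp add: vertices)
  thus ?thesis by (subst m) (unfold first_moves_def set_map, blast)
 qed
qed

lemma wf: "wf_instance I"
proof -
 have "well_formed (sum_instance moves ws T)" unfolding well_formed_def sum_instance_def prod.case
 proof (intro conjI)
  let ?os = "map (%v. if v = N then 1 else 0 :: nat) (vertices ws)"
  let ?es = "map (%e. (e, [(0, 1), (edge_weight ws T e, 1 :: nat)])) (edge_pairs ws)"
  have os: "length ?os = nv" by (simp add: vertices)
  show "ALL ((u, v), ws):set ?es. u < length ?os & v < length ?os" unfolding os using edge_verts edge_pairs by auto
  show "ALL u:set [0..<length ?os]. EX ((u', v), ws):set ?es. u' = u"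
  proof
   fix u assume "u : set [0..<length ?os]"
   then obtain b where "is_edge ws u b" using edge_total os by auto
   hence "(u, b) : set (edge_pairs ws)" using edge_pairs by simp
   thus "EX ((u', v), ws):set ?es. u' = u" by force
  qed
  show "ALL j:set ?os. j < 2" by auto
  show "0 < length ?os" using os by simp
  show "distinct (map fst ?es)" using distinct_edge_pairs by (simp add: comp_def)
  show "ALL (e, ws):set ?es. length ws = 2 & (ALL (a, b):set ws. 0 < b)" by auto
  have es: "set (map fst ?es) = set (edge_pairs ws)" by (simp add: comp_def)
  show "ALL (p, u, q, v):set (moves ws). p < 1 & u < length ?os & q < 1 & v < length ?os & (u, v) : set (map fst ?es)"
   unfolding os es edge_pairs using set_moves edge_verts by fastforce
  obtain b where "(0, 0, 0, b) : set (moves ws)" using moves_total[of 0] by auto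
  thus "1 <= length (moves ws)" by (cases "moves ws") auto
  show "ALL p:set [0..<length (moves ws)]. p < 1 --> (ALL u:set [0..<length ?os]. EX (p', u', q, v):set (moves ws). p' = p & u' = u)"
  proof (intro ballI impI)
   fix p u assume "p < (1 :: nat)" "u : set [0..<length ?os]"
   then obtain b where "(p, u, 0, b) : set (moves ws)" using moves_total[of u] os by auto
   thus "EX (p', u', q, v):set (moves ws). p' = p & u' = u" by force
  qed
 qed simp
 thus ?thesis using well_formed by simp
qed

lemma det: "moves = first_moves ==> deterministic_mealy (inst_game I) (inst_mealy I)"
proof -
 assume "moves = first_moves"
 hence "deterministic (sum_instance moves ws T)" by (auto simp: deterministic_def sum_instance_def first_moves_def)
 thus ?thesis using deterministic[OF wf] by simp
qed

abbreviation "G == inst_game I"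
abbreviation "M == inst_mealy I"

lemma game:
 "players G = {..<2}" "edges G = {(a, b). is_edge ws a b}" "owned G (Suc 0) = {N}" "mealy_init M = 0" "inst_init I = 0"
 "mealy_trans M = set (moves ws)" "inst_num_players I = 2"
proof -
 show "owned G (Suc 0) = {N}" by (auto simp: inst_game_def of_tuple_def sum_instance_def vertices split: if_splits)
 show "edges G = {(a, b). is_edge ws a b}" unfolding edge_pairs[symmetric] by (simp add: inst_game_def of_tuple_def sum_instance_def image_image)
qed (simp_all add: inst_game_def inst_mealy_def of_tuple_def sum_instance_def)

lemma reward:
 assumes "is_edge ws a b"
 shows "inst_reward I 0 (a, b) = 0" "inst_reward I (Suc 0) (a, b) = of_int (edge_weight ws T (a, b))"
proof -
 have "(a, b) : set (edge_pairs ws)" using assms edge_pairs by simp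
 hence "map_of (inst_edges I) (a, b) = Some [(0, 1), (edge_weight ws T (a, b), 1)]" by (simp add: of_tuple_def sum_instance_def map_of_map_restrict)
 thus "inst_reward I 0 (a, b) = 0" "inst_reward I (Suc 0) (a, b) = of_int (edge_weight ws T (a, b))" by (simp_all add: inst_reward_def)
qed

abbreviation "ew == edge_weight ws T"

lemma weights:
 "l < N ==> c < length (ws ! l) ==> ew (l, off ws l + c) = int (ws ! l ! c)" "ew (off ws l + c, b) = 0"
 "ew (N, N + 1) = - int T" "ew (N, N + 2) = - int (Suc T)" "ew (N + 1, b) = 0" "ew (N + 2, b) = 0" using off_less(3)[of l] by (auto simp: edge_weight_def nth_or_def)

definition partial :: "nat => nat => bool" where
 "partial l x = (EX c. (ALL j<l. c j < length (ws ! j)) & (SUM j<l. ws ! j ! c j) = x)"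

lemma partial_Suc: "partial l x ==> c < length (ws ! l) ==> partial (Suc l) (x + ws ! l ! c)"
proof -
 assume "partial l x" and c: "c < length (ws ! l)"
 then obtain d where "ALL j<l. d j < length (ws ! j)" "(SUM j<l. ws ! j ! d j) = x" by (auto simp: partial_def)
 thus ?thesis using c unfolding partial_def by (intro exI[of _ "d(l := c)"]) (auto simp: less_Suc_eq)
qed

text \<open>The invariant of all paths from vertex 0: the weight is a sum of one entry for each
  choice made so far. At a choice vertex of stage \<open>l\<close> this includes stage
  \<open>l\<close>; the two sinks are unconstrained.\<close>

definition path_weight :: "nat => int => bool" where
 "path_weight a x = ((a <= N --> (EX y. x = int y & partial a y)) &
   (ALL l c. l < N & c < length (concat ws) & a = off ws l + c --> (EX y. x = int y & partial (Suc l) y)))"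

lemma off_inj: "off ws l + c = off ws l' + c' ==> c < length (concat ws) ==> c' < length (concat ws) ==> l = l' & c = c'"
proof -
 let ?L = "length (concat ws)"
 assume "off ws l + c = off ws l' + c'" and c: "c < ?L" "c' < ?L"
 hence e: "c + l * ?L = c' + l' * ?L" by (simp add: off_def)
 have gen: "(x + y * z) div z = y" if "x < z" for x y z :: nat using that by simp
 have "(c + l * ?L) div ?L = l" "(c' + l' * ?L) div ?L = l'" by (rule gen[OF c(1)] gen[OF c(2)])+
 thus ?thesis using e by auto
qed

lemma path_weight_step:
 assumes "path_weight a x" "is_edge ws a b"
 shows "path_weight b (x + ew (a, b))" using assms(2)
proof (cases rule: edge_cases)
 case (pick c)
 then obtain y where y: "x = int y" "partial a y" using assms(1) by (auto simp: path_weight_def)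
 have "c < length (concat ws)" using pick length_stage[of a] by linarith
 hence "l = a" if "l < N" "c' < length (concat ws)" "b = off ws l + c'" for l c' using off_inj[of a c l c'] pick that by simp
 moreover have "EX z. x + ew (a, b) = int z & partial (Suc a) z"
  using y partial_Suc[OF y(2) pick(2)] weights(1)[OF pick(1,2)] pick(3) by (intro exI[of _ "y + ws ! a ! c"]) simp
 moreover have "N < b" using pick(3) off_less(3)[of a] by simp
 ultimately show ?thesis unfolding path_weight_def by (metis not_le)
next case (next_ l c)
 then obtain y where "x = int y" "partial (Suc l) y" using assms(1) unfolding path_weight_def by blast
 moreover have "b < off ws l'" for l' using next_ off_less(3)[of l'] by simp
 ultimately show ?thesis using next_ weights(2)[of l c b] unfolding path_weight_def by (metis add.right_neutral le_add1 not_le)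
next case final
 have "b < off ws l'" "N < b" for l' using final off_less(3)[of l'] by auto
 thus ?thesis unfolding path_weight_def by (metis le_add1 not_le)
next case sink
 have "b < off ws l'" "N < b" for l' using sink off_less(3)[of l'] by auto
 thus ?thesis unfolding path_weight_def by (metis le_add1 not_le)
qed

lemma path_weight_path:
 assumes "snd (f 0) = 0" "!!k. k < n ==> is_edge ws (snd (f k)) (snd (f (Suc k)))"
 shows "path_weight (snd (f n)) (cum ew f n)" using assms(2)
proof (induction n)
 case 0
 have "0 ~= off ws l + c" for l c using off_less(3)[of l] by simp
 moreover have "EX y. (0 :: int) = int y & partial 0 y" by (rule exI[of _ 0]) (simp add: partial_def)
 ultimately show ?case unfolding path_weight_def cum_0 assms(1) by blast
next case (Suc n)
 hence "path_weight (snd (f n)) (cum ew f n)" by simp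
 from path_weight_step[OF this] Suc.prems[of n] show ?case by (simp add: cum_Suc)
qed

lemma partial_solvable: "partial N T = solvable ws T" by (simp add: partial_def solvable_def)

text \<open>Player 0 has rewards 0 and never loses. Player 1 can deviate only at \<open>N\<close>;
  there the winning play needs energy at least \<open>T\<close> and the losing play energy below
  \<open>T + 1\<close>.\<close>

lemma violation_solvable:
 assumes S: "S = true_step M | S = any_step G M" and i: "i < 2" and v: "violation G M 0 (inst_reward I i) S i"
 shows "solvable ws T"
proof -
 have Se: "is_edge ws (snd a) (snd b)" if "(a, b) : S" for a b using that S set_moves game by (cases a; cases b) (auto simp: true_step_def any_step_def)
 have te: "is_edge ws (snd a) (snd b) & (snd a = N --> snd b = N + 2)" if "(a, b) : true_step M" for a b
  using that set_moves game by (cases a; cases b) (auto simp: true_step_def)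
 have de: "is_edge ws (snd a) (snd b)" if "(a, b) : dev_step G M i" for a b using that game by (cases a; cases b) (auto simp: dev_step_def)
 obtain n f g where f: "f 0 = (0, 0)" "!!k. k < n ==> (f k, f (Suc k)) : S"
   "!!k. n <= k ==> (f k, f (Suc k)) : true_step M" "snd (f n) : owned G i"
  and g: "!!k. k <= n ==> g k = f k" "snd (g (Suc n)) ~= snd (f (Suc n))" "(snd (g n), snd (g (Suc n))) : edges G"
  and pay: "EX m. cum (inst_reward I i) f m < 0" "!!m. 0 <= cum (inst_reward I i) g m" using v unfolding violation_def cum_def game by blast
 have fe: "is_edge ws (snd (f k)) (snd (f (Suc k)))" for k using f(2,3) Se te by (metis not_le)
 have i1: "i = 1"
 proof (rule ccontr)
  assume "i ~= 1"
  hence "i = 0" using i by simp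
  hence "cum (inst_reward I i) f m = 0" for m by (induction m) (simp_all add: cum_Suc reward(1)[OF fe])
  thus False using pay(1) by simp
 qed
 have cf: "cum (inst_reward I i) f m = of_int (cum ew f m)" for m by (induction m) (simp_all add: cum_Suc reward(2)[OF fe] i1)
 have fn: "snd (f n) = N" using f(4) by (simp add: i1 game)
 have f1: "snd (f (Suc n)) = N + 2" using te[OF f(3)[of n]] fn by simp
 have ge: "is_edge ws (snd (g k)) (snd (g (Suc k)))" if "k <= n" for k using that fe[of k] g(1)[of k] g(1)[of "Suc k"] g(3) by (cases "k = n") (auto simp: game)
 have g1: "snd (g (Suc n)) = N + 1" using edge_N[of "snd (g (Suc n))"] ge[of n] g(1)[of n] fn f1 g(2) by simp
 have cg: "cum (inst_reward I i) g m = of_int (cum ew g m)" if "m <= Suc n" for m using that by (induction m) (simp_all add: cum_Suc reward(2)[OF ge] i1)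
 have gf: "cum ew g k = cum ew f k" if "k <= n" for k using that g(1) by (intro cum_cong) simp
 have "0 <= cum ew g (Suc n)" using pay(2)[of "Suc n"] cg[of "Suc n"] by simp
 hence ge_T: "int T <= cum ew f n" using gf[of n] g(1)[of n] fn g1 weights(3) by (simp add: cum_Suc)
 obtain m where "cum (inst_reward I i) f m < 0" using pay(1) by blast
 hence m: "cum ew f m < 0" using cf by simp
 have "n < m"
 proof (rule ccontr)
  assume "~ n < m"
  thus False using pay(2)[of m] cg[of m] gf[of m] m by simp
 qed
 then obtain d where d: "m = Suc n + d" by (metis Suc_leI le_Suc_ex)
 have lose: "snd (f (Suc n + k)) = N + 2" for k
 proof (induction k)
  case (Suc k) thus ?case using edge_sink[OF fe[of "Suc n + k"]] by simp
 qed (use f1 in simp)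
 have "cum ew (%k. f (Suc n + k)) k = 0" for k by (induction k) (use lose weights(6) in "simp_all add: cum_Suc")
 hence "cum ew f m = cum ew f n + ew (N, N + 2)" unfolding d cum_shift using fn f1 by (simp add: cum_Suc)
 hence "cum ew f n < int (Suc T)" using m weights(4) by simp
 hence "cum ew f n = int T" using ge_T by simp
 moreover have "path_weight (snd (f n)) (cum ew f n)" by (rule path_weight_path) (use f(1) fe in simp_all)
 ultimately have "partial N T" using fn by (auto simp: path_weight_def)
 thus ?thesis by (simp add: partial_solvable)
qed

lemma solvable_violation:
 assumes S: "S = true_step M & moves = all_moves | S = any_step G M" and sol: "solvable ws T"
 shows "violation G M 0 (inst_reward I 1) S 1"
proof -
 let ?r = "inst_reward I 1"
 let ?u = "case_nat (0, N) (%_. (0, N + 2))"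
 let ?u' = "case_nat (0, N) (%_. (0, N + 1))"
 have Se: "((0, a), (0, b)) : S" if "is_edge ws a b" "a ~= N" for a b
 proof -
  have "(a, b) : set (edge_pairs ws)" using that edge_pairs by simp
  hence "((0, a), (0, b)) : true_step M" if "moves = all_moves" using that `a ~= N` game unfolding true_step_def all_moves_def by force
  moreover have "a < nv" using edge_verts[OF that(1)] by simp
  then obtain b' where "(0, a, 0, b') : set (moves ws)" using moves_total by blast
  hence "((0, a), (0, b)) : any_step G M" using that(1) game by (auto simp: any_step_def)
  ultimately show ?thesis using S by auto
 qed
 obtain c where c: "!!l. l < N ==> c l < length (ws ! l)" "(SUM l<N. ws ! l ! c l) = T" using sol by (auto simp: solvable_def)
 \<comment> \<open>Even positions are stage vertices, odd positions the choices made by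
   \<open>c\<close>.\<close>
 define h where "h = (%k. (0 :: nat, if even k then k div 2 else off ws (k div 2) + c (k div 2)))"
 have he: "is_edge ws (snd (h k)) (snd (h (Suc k)))" if "k < 2 * N" for k
 proof (cases "even k")
  case True thus ?thesis using that edge_pick[of "k div 2" "c (k div 2)"] c(1)[of "k div 2"] by (auto simp: h_def)
 next case False
  hence "k div 2 < N" using that by auto
  hence "c (k div 2) < length (concat ws)" using c(1)[of "k div 2"] length_stage[of "k div 2"] by simp
  thus ?thesis using False `k div 2 < N` edge_next[of "k div 2" "c (k div 2)"] by (auto simp: h_def)
 qed
 have hN: "snd (h k) ~= N" if "k < 2 * N" for k using that off_less(3)[of "k div 2"] by (auto simp: h_def)
 have hc: "cum ew h (2 * l) = int (SUM j<l. ws ! j ! c j)" if "l <= N" for l using that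
 proof (induction l)
  case (Suc l)
  have "cum ew h (2 * Suc l) = cum ew h (2 * l) + ew (l, off ws l + c l) + ew (off ws l + c l, Suc l)" by (simp add: cum_Suc h_def)
  thus ?case using Suc weights(1)[of l "c l"] weights(2)[of l "c l"] c(1)[of l] by simp
 qed simp
 have pos: "0 <= cum ew h m" if "m <= 2 * N" for m using that
 proof (induction m)
  case (Suc m)
  have "0 <= ew (snd (h m), snd (h (Suc m)))" using he[of m] hN[of m] Suc.prems by (auto elim!: edge_cases simp: weights(1,2,5,6)[simplified])
  thus ?case using Suc by (simp add: cum_Suc)
 qed simp
 define f where "f = glue (2 * N) h ?u"
 define g where "g = glue (2 * N) h ?u'"
 have h0: "h (2 * N) = case_nat (0, N) (%_. (0, b)) 0" for b by (simp add: h_def)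
 note ff = glue_simps[of h "2 * N" "?u", OF h0, folded f_def] and gg = glue_simps[of h "2 * N" "?u'", OF h0, folded g_def]
 have step: "((0, N), (0, N + 2)) : true_step M" "((0, N + 2), (0, N + 2)) : true_step M" "((0, N + 1), (0, N + 1)) : true_step M"
 proof -
  have "EX b. (0, a, 0, b) : set (moves ws)" if "a : {N, N + 1, N + 2}" for a using that by (intro moves_total) auto
  then obtain b1 b2 b3 where b: "(0, N, 0, b1) : set (moves ws)" "(0, N + 1, 0, b2) : set (moves ws)" "(0, N + 2, 0, b3) : set (moves ws)" by (metis insertI1 insertI2)
  have "b1 = N + 2" using set_moves[OF b(1)] by simp
  moreover have "b2 = N + 1" using set_moves[OF b(2)] edge_sink[of "N + 1" b2] by simp
  moreover have "b3 = N + 2" using set_moves[OF b(3)] edge_sink[of "N + 2" b3] by simp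
  ultimately show "((0, N), (0, N + 2)) : true_step M" "((0, N + 2), (0, N + 2)) : true_step M" "((0, N + 1), (0, N + 1)) : true_step M"
   using b game by (simp_all add: true_step_def)
 qed
 have e: "is_edge ws N (N + 1)" "is_edge ws N (N + 2)" "is_edge ws (N + 1) (N + 1)" by (auto simp: is_edge_def)
 have fs: "(f k, f (Suc k)) : true_step M" if "2 * N <= k" for k
 proof -
  define j where "j = k - 2 * N"
  have k: "k = 2 * N + j" using that by (simp add: j_def)
  show ?thesis using ff(2)[of j] ff(2)[of "Suc j"] step by (cases j) (simp_all add: k)
 qed
 have gs: "(g k, g (Suc k)) : dev_step G M 1" if "2 * N < k" for k
 proof -
  define j where "j = k - Suc (2 * N)"
  have k: "k = 2 * N + Suc j" using that by (simp add: j_def)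
  have "((0, N + 1), (0, N + 1)) : dev_step G M 1" using step(3) e(3) game by (auto simp: dev_step_def true_step_def)
  thus ?thesis using gg(2)[of "Suc j"] gg(2)[of "Suc (Suc j)"] by (simp add: k)
 qed
 have S1: "(f k, f (Suc k)) : S" if "k < 2 * N" for k
 proof -
  have "f k = (0, snd (h k))" "f (Suc k) = (0, snd (h (Suc k)))" using ff(3)[of k] ff(3)[of "Suc k"] that by (simp_all add: h_def)
  thus ?thesis using Se[OF he[OF that] hN[OF that]] by simp
 qed
 have n: "f (2 * N) = (0, N)" "f (Suc (2 * N)) = (0, N + 2)" "g (Suc (2 * N)) = (0, N + 1)" "g (2 * N) = (0, N)"
  using ff(2)[of 0] ff(2)[of 1] gg(2)[of 0] gg(2)[of 1] by simp_all
 have fe: "is_edge ws (snd (f k)) (snd (f (Suc k)))" if "k <= 2 * N" for k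
 proof (cases "k = 2 * N")
  case False thus ?thesis using he[of k] that ff(3)[of k] ff(3)[of "Suc k"] by simp
 qed (use n e in simp)
 have gN: "snd (g k) = N + 1" if "2 * N < k" for k
 proof -
  define j where "j = k - Suc (2 * N)"
  have k: "k = 2 * N + Suc j" using that by (simp add: j_def)
  show ?thesis using gg(2)[of "Suc j"] by (simp add: k)
 qed
 have ge: "is_edge ws (snd (g k)) (snd (g (Suc k)))" for k
 proof -
  consider "k < 2 * N" | "k = 2 * N" | "2 * N < k" by linarith
  thus ?thesis
  proof cases
   case 1 thus ?thesis using he[of k] gg(3)[of k] gg(3)[of "Suc k"] by simp
next case 2 thus ?thesis using n e by simp
 next case 3 thus ?thesis using gN[of k] gN[of "Suc k"] e by simp
  qed
 qed
 have cf: "cum ?r f m = of_int (cum ew f m)" if "m <= Suc (2 * N)" for m using that by (induction m) (simp_all add: cum_Suc reward(2)[OF fe])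
 have cg: "cum ?r g m = of_int (cum ew g m)" for m by (induction m) (simp_all add: cum_Suc reward(2)[OF ge])
 have hT: "cum ew h (2 * N) = int T" using hc[of N] c(2) by simp
 have fh: "cum ew f (2 * N) = int T" using hT ff(3) cum_cong[of "2 * N" f h ew] by simp
 have 1: "cum ?r f (Suc (2 * N)) < 0" using cf[of "Suc (2 * N)"] fh n weights(4) by (simp add: cum_Suc)
 have gh: "cum ew g m = cum ew h m" if "m <= 2 * N" for m using that gg(3) by (intro cum_cong) simp
 have g0: "cum ew g (Suc (2 * N) + j) = 0" for j
 proof (induction j)
  case 0 thus ?case using gh[of "2 * N"] hT n weights(3) by (simp add: cum_Suc)
 next case (Suc j)
  have "ew (snd (g (Suc (2 * N) + j)), snd (g (Suc (Suc (2 * N) + j)))) = 0" using gN[of "Suc (2 * N) + j"] weights(5) by simp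
  thus ?case using Suc by (simp add: cum_Suc)
 qed
 have 2: "0 <= cum ?r g m" for m
 proof (cases "m <= 2 * N")
  case True thus ?thesis using pos[of m] gh[of m] cg[of m] by simp
 next case False
  hence "m = Suc (2 * N) + (m - Suc (2 * N))" by simp
  thus ?thesis using g0[of "m - Suc (2 * N)"] cg[of m] by simp
 qed
 have f0: "f 0 = (0, 0)" using ff(1) by (simp add: h_def)
 have gf: "g k = f k" if "k <= 2 * N" for k using that ff(3) gg(3) by simp
 show ?thesis unfolding violation_def One_nat_def
 proof (rule exI[of _ "2 * N"], rule exI[of _ f], rule exI[of _ g], intro conjI)
  show "EX m. (SUM k<m. inst_reward I (Suc 0) (snd (f k), snd (f (Suc k)))) < 0" using 1[unfolded One_nat_def cum_def] by blast
  show "ALL m. 0 <= (SUM k<m. inst_reward I (Suc 0) (snd (g k), snd (g (Suc k))))" using 2[unfolded One_nat_def cum_def] by blast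
  show "ALL k<2 * N. (f k, f (Suc k)) : S" using S1 by blast
  show "ALL k>=2 * N. (f k, f (Suc k)) : true_step M" using fs by blast
  show "ALL k>2 * N. (g k, g (Suc k)) : dev_step G M (Suc 0)" using gs[unfolded One_nat_def] by blast
  show "f 0 = (mealy_init M, 0)" by (simp only: f0 game(4))
 qed (use e(1) in "simp_all add: n game(2,3) gf")
qed

theorem sum_game:
 "moves = all_moves ==> (ALL si:compatible G (inst_init I) M. Nash_equilibrium G (inst_init I) si) = (~ solvable ws T)" (is "_ ==> ?N")
 "(ALL si:compatible G (inst_init I) M. subgame_perfect_equilibrium G (inst_init I) si) = (~ solvable ws T)" (is ?S)
proof -
 interpret checked_game G M 0 "inst_reward I" using wf game by unfold_locales (auto simp: wf_instance_def inst_game_def)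
 have 1: "(1 :: nat) < 2" by simp
 show "moves = all_moves ==> ?N"
  unfolding game Nash_iff using violation_solvable[of "true_step M"] solvable_violation[of "true_step M"] 1 unfolding Ball_def lessThan_iff by metis
 show ?S unfolding game subgame_perfect_iff using violation_solvable[of "any_step G M"] solvable_violation[of "any_step G M"] 1 unfolding Ball_def lessThan_iff by metis
qed

end

subsection \<open>From constraint satisfaction to sums of weights\<close>

type_synonym 'v constr = "'v list * nat list list"

definition satisfiable :: "nat => 'v constr list => bool" where
 "satisfiable K cs = (EX al. (ALL v. al v < K) & (ALL (vs, tab):set cs. map al vs : set tab))"

section \<open>Sums chosen list by list\<close>

lemma solvable_Nil: "solvable [] T = (T = 0)" by (auto simp: solvable_def)

lemma solvable_Cons: "solvable (w # ws) T = (EX x:set w. EX T'. T = x + T' & solvable ws T')"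
proof
 assume "solvable (w # ws) T"
 then obtain c where c: "ALL l<length (w # ws). c l < length ((w # ws) ! l)" "(SUM l<length (w # ws). (w # ws) ! l ! c l) = T" by (auto simp: solvable_def)
 have "solvable ws (SUM l<length ws. ws ! l ! c (Suc l))" using c(1) by (auto simp: solvable_def intro!: exI[of _ "%l. c (Suc l)"])
 moreover have "T = w ! c 0 + (SUM l<length ws. ws ! l ! c (Suc l))" using c(2) by (simp only: length_Cons sum.lessThan_Suc_shift nth_Cons_0 nth_Cons_Suc comp_def)
 moreover have "w ! c 0 : set w" using c(1) by (metis length_Cons nth_Cons_0 nth_mem zero_less_Suc)
 ultimately show "EX x:set w. EX T'. T = x + T' & solvable ws T'" by blast
next
 assume "EX x:set w. EX T'. T = x + T' & solvable ws T'"
 then obtain i c where i: "i < length w" and c: "ALL l<length ws. c l < length (ws ! l)" "T = w ! i + (SUM l<length ws. ws ! l ! c l)"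
  by (auto simp: solvable_def in_set_conv_nth)
 have "(case_nat i c) l < length ((w # ws) ! l)" if "l < length (w # ws)" for l using that i c(1) by (cases l) auto
 moreover have "(SUM l<length (w # ws). (w # ws) ! l ! case_nat i c l) = T"
  unfolding c(2) by (simp only: length_Cons sum.lessThan_Suc_shift nth_Cons_0 nth_Cons_Suc comp_def nat.case)
 ultimately show "solvable (w # ws) T" unfolding solvable_def by blast
qed

lemma solvable_append: "solvable (ws @ ws') T = (EX T1 T2. T = T1 + T2 & solvable ws T1 & solvable ws' T2)"
proof (induction ws arbitrary: T)
 case (Cons w ws) show ?case unfolding append_Cons solvable_Cons Cons by (metis add.assoc)
qed (simp add: solvable_Nil)

lemma solvable_map:
 assumes "distinct Z"
 shows "solvable (map (%z. map (ph z) (C z)) Z) T = (EX h. (ALL z:set Z. h z : set (C z)) & (SUM z:set Z. ph z (h z)) = T)" using assms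
proof (induction Z arbitrary: T)
 case (Cons z Z)
 have z: "z ~: set Z" "distinct Z" using Cons.prems by auto
 show ?case
 proof
  assume "solvable (map (%z. map (ph z) (C z)) (z # Z)) T"
  then obtain y h where "y : set (C z)" "ALL z:set Z. h z : set (C z)" "T = ph z y + (SUM z:set Z. ph z (h z))" unfolding list.map solvable_Cons Cons.IH[OF z(2)] by auto
  moreover have "(SUM z':set Z. ph z' ((h(z := y)) z')) = (SUM z:set Z. ph z (h z))" using z by (intro sum.cong) auto
  ultimately show "EX h. (ALL z:set (z # Z). h z : set (C z)) & (SUM z:set (z # Z). ph z (h z)) = T"
   using z by (intro exI[of _ "h(z := y)"]) (auto simp del: fun_upd_apply, auto)
 next
  assume "EX h. (ALL z:set (z # Z). h z : set (C z)) & (SUM z:set (z # Z). ph z (h z)) = T"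
  then obtain h where h: "ALL z:set (z # Z). h z : set (C z)" "(SUM z:set (z # Z). ph z (h z)) = T" by blast
  have "ph z (h z) : set (map (ph z) (C z))" using h by simp
  moreover have "T = ph z (h z) + (SUM z:set Z. ph z (h z))" using h(2) z by simp
  ultimately show "solvable (map (%z. map (ph z) (C z)) (z # Z)) T" unfolding list.map solvable_Cons Cons.IH[OF z(2)] using h(1) by auto
 qed
qed (auto simp: solvable_Nil)

section \<open>Numbers with independent digits\<close>

primrec num :: "nat => ('o => nat) => 'o list => nat" where
 "num b f [] = 0"
| "num b f (x # xs) = f x + 2 ^ b * num b f xs"

lemma num_sum: "(SUM z:Z. num b (ph z) xs) = num b (%x. SUM z:Z. ph z x) xs" by (induction xs) (simp_all add: sum.distrib sum_distrib_left[symmetric])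

lemma num_add: "num b f xs + num b g xs = num b (%x. f x + g x) xs"
proof (induction xs)
 case (Cons x xs) thus ?case by (simp only: num.simps Cons[symmetric]) (simp add: distrib_left)
qed simp

text \<open>Digits below the base \<open>2 ^ b\<close> are determined by the number. Since
  \<open>num_add\<close> and \<open>num_sum\<close> add digitwise, an equation between sums without
  carries splits into one equation per position.\<close>

lemma num_eq_iff:
 assumes "!!x. x : set xs ==> f x < 2 ^ b" "!!x. x : set xs ==> g x < 2 ^ b"
 shows "(num b f xs = num b g xs) = (ALL x:set xs. f x = g x)" using assms
proof (induction xs)
 case (Cons x xs)
 have "f x = g x & num b f xs = num b g xs" if "num b f (x # xs) = num b g (x # xs)"
 proof -
  have l: "f x < 2 ^ b" "g x < 2 ^ b" using Cons.prems by auto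
  have "(f x + 2 ^ b * num b f xs) mod 2 ^ b = (g x + 2 ^ b * num b g xs) mod 2 ^ b" using that by simp
  hence "f x = g x" using l by simp
  thus ?thesis using that by simp
 qed
 thus ?case using Cons by auto
qed simp

text \<open>Concatenating digits of fixed width yields the bits of a long number directly, without
  computing powers of the base.\<close>

definition fixed_bits :: "nat => nat => bool list" where
 "fixed_bits b n = map fst (zip (binary n @ replicate b False) (replicate b ()))"

lemma fixed_bits: "fixed_bits b n = take b (binary n @ replicate b False)" unfolding fixed_bits_def by (simp add: map_fst_zip_take)

lemma fixed_bits_val: "n < 2 ^ b ==> val (fixed_bits b n) = n" "length (fixed_bits b n) = b"
proof -
 show "length (fixed_bits b n) = b" by (simp add: fixed_bits)
 assume "n < 2 ^ b"
 hence "length (binary n) <= b" using length_binary by blast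
 thus "val (fixed_bits b n) = n" by (simp add: fixed_bits)
qed

lemma num_bits: "(!!x. f x < 2 ^ b) ==> val (concat (map (%x. fixed_bits b (f x)) xs)) = num b f xs" by (induction xs) (simp_all add: fixed_bits_val)

type_synonym 'v occ = "nat * nat * 'v"

definition occurrences :: "'v constr list => 'v occ list" where
 "occurrences cs = concat (map (%(c, vs, tab). map (%(j, v). (c, j, v)) (zip [0..<length vs] vs)) (zip [0..<length cs] cs))"

definition variables :: "'v constr list => 'v list" where
 "variables cs = fold List.insert (concat (map fst cs)) []"

definition var_digit :: "'v => nat => 'v occ => nat" where
 "var_digit v a = (%(c, j, v'). if v' = v then a else 0)"

text \<open>There is one digit for each occurrence of a variable in a constraint. The variable
  contributes its value and the constraint the complement of its entry to \<open>K\<close>, so the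
  digit \<open>K\<close> in the target says that both agree.\<close>

definition constr_digit :: "nat => nat => nat list => 'v occ => nat" where
 "constr_digit K c tup = (%(c', j, v). if c' = c then K - nth_or 0 tup j else 0)"

text \<open>At every position one variable and one constraint contribute, so sums of digits stay
  below \<open>2 * K\<close>, and a width of \<open>2 * K\<close> bits excludes carries.\<close>

definition number :: "nat => ('o => nat) => 'o list => nat" where
 "number K f xs = val (concat (map (%x. fixed_bits (2 * K) (f x)) xs))"

definition stages :: "nat => 'v constr list => nat list list" where
 "stages K cs =
   map (%v. map (%a. number K (var_digit v a) (occurrences cs)) [0..<K]) (variables cs) @
   map (%(c, vs, tab). map (%tup. number K (constr_digit K c tup) (occurrences cs)) tab) (zip [0..<length cs] cs)"

definition target :: "nat => 'v constr list => nat" where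
 "target K cs = number K (%_. K) (occurrences cs)"

lemma less_two_power: "n <= K ==> 0 < K ==> n < 2 ^ (2 * K)" using less_exp[of "2 * K"] by linarith

lemma number_num: "(!!x. f x <= K) ==> 0 < K ==> number K f xs = num (2 * K) f xs" unfolding number_def by (rule num_bits) (rule less_two_power)

lemma variables: "distinct (variables cs)" "set (variables cs) = (UN (vs, tab):set cs. set vs)"
proof -
 have "distinct (fold List.insert xs ys) & set (fold List.insert xs ys) = set xs \<union> set ys" if "distinct ys" for xs ys :: "'a list"
  using that by (induction xs arbitrary: ys) auto
 from this[of "[]"] show "distinct (variables cs)" "set (variables cs) = (UN (vs, tab):set cs. set vs)" by (auto simp: variables_def)
qed

lemma occurrences: "((c, j, v) : set (occurrences cs)) = (c < length cs & j < length (fst (cs ! c)) & fst (cs ! c) ! j = v)"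
proof -
 have "((c, j, v) : set (occurrences cs)) = (EX vs tab. (c, vs, tab) : set (zip [0..<length cs] cs) & (j, v) : set (zip [0..<length vs] vs))"
  by (force simp: occurrences_def)
 also have "... = (c < length cs & j < length (fst (cs ! c)) & fst (cs ! c) ! j = v)" unfolding mem_nth by (metis fst_conv prod.collapse)
 finally show ?thesis .
qed

theorem solvable_stages:
 fixes cs :: "'v constr list"
 assumes K: "0 < K" and len: "!!vs tab tup. (vs, tab) : set cs ==> tup : set tab ==> length tup = length vs"
 shows "solvable (stages K cs) (target K cs) = satisfiable K cs"
proof -
 let ?V = "variables cs" and ?Z = "[0..<length cs]" and ?O = "occurrences cs" and ?b = "2 * K"
 let ?A = "%al. SUM v:set ?V. number K (var_digit v (al v)) ?O" and ?B = "%be. SUM c:set ?Z. number K (constr_digit K c (be c)) ?O"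
 have st: "stages K cs = map (%v. map (%a. number K (var_digit v a) ?O) [0..<K]) ?V @
   map (%c. map (%tup. number K (constr_digit K c tup) ?O) (snd (cs ! c))) ?Z"
 proof -
  have "zip [0..<length cs] cs = map (%c. (c, cs ! c)) [0..<length cs]" by (rule nth_equalityI) auto
  thus ?thesis unfolding stages_def by (simp add: case_prod_unfold comp_def)
 qed
 have v: "number K (var_digit v a) ?O = num ?b (var_digit v a) ?O" if "a < K" for v a using that K by (intro number_num) (auto simp: var_digit_def)
 have c: "number K (constr_digit K c tup) ?O = num ?b (constr_digit K c tup) ?O" for c tup using K by (intro number_num) (auto simp: constr_digit_def)
 have t: "target K cs = num ?b (%_. K) ?O" unfolding target_def using K by (intro number_num) auto
 have digits: "((SUM v:set ?V. num ?b (var_digit v (al v)) ?O) + (SUM c:set ?Z. num ?b (constr_digit K c (be c)) ?O) = target K cs) =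
   (ALL c<length cs. map al (fst (cs ! c)) = be c)" (is "?L = ?R")
  if al: "!!v. v : set ?V ==> al v < K" and be: "!!c. c < length cs ==> length (be c) = length (fst (cs ! c))" for al be
 proof -
  let ?d = "%x. (SUM v:set ?V. var_digit v (al v) x) + (SUM c:set ?Z. constr_digit K c (be c) x)"
  have d: "?d (c, j, v) = al v + (K - nth_or 0 (be c) j) & v : set ?V" if "(c, j, v) : set ?O" for c j v
  proof -
   have cl: "c < length cs" and jv: "j < length (fst (cs ! c))" "fst (cs ! c) ! j = v" using that by (simp_all add: occurrences)
   have "cs ! c : set cs" "v : set (fst (cs ! c))" using cl jv by auto
   hence vV: "v : set ?V" unfolding variables case_prod_unfold by blast
   have "(SUM v':set ?V. var_digit v' (al v') (c, j, v)) = (SUM v':set ?V. if v = v' then al v' else 0)" by (simp add: var_digit_def)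
   also have "... = al v" using vV by simp
   finally have 1: "(SUM v':set ?V. var_digit v' (al v') (c, j, v)) = al v" .
   have "(SUM c':set ?Z. constr_digit K c' (be c') (c, j, v)) = (SUM c':set ?Z. if c = c' then K - nth_or 0 (be c') j else 0)" by (simp add: constr_digit_def)
   also have "... = K - nth_or 0 (be c) j" using cl by simp
   finally show ?thesis using 1 vV by simp
  qed
  have "?L = (num ?b ?d ?O = num ?b (%_. K) ?O)" unfolding num_sum num_add t ..
  also have "... = (ALL x:set ?O. ?d x = K)"
  proof (rule num_eq_iff)
   fix x assume x: "x : set ?O"
   obtain c j v where "x = (c, j, v)" by (cases x)
   hence "?d x < 2 * K" using d[of c j v] x al[of v] by fastforce
   thus "?d x < 2 ^ ?b" using less_exp[of ?b] by linarith
   show "K < 2 ^ ?b" using K by (intro less_two_power) auto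
  qed
  also have "... = (ALL c j v. (c, j, v) : set ?O --> al v = nth_or 0 (be c) j)"
  proof -
   \<comment> \<open>An entry of \<open>K\<close> or more is truncated to the digit 0; as
     \<open>al v < K\<close>, both sides are then false.\<close>
   have "(?d (c, j, v) = K) = (al v = nth_or 0 (be c) j)" if "(c, j, v) : set ?O" for c j v using d[OF that] al[of v] by auto
   thus ?thesis unfolding Ball_def split_paired_All by blast
  qed
  also have "... = ?R"
  proof
   assume L: "ALL c j v. (c, j, v) : set ?O --> al v = nth_or 0 (be c) j"
   show ?R
   proof (intro allI impI nth_equalityI)
    fix c j assume c: "c < length cs" and "j < length (map al (fst (cs ! c)))"
    hence j: "j < length (fst (cs ! c))" by simp
    have "al (fst (cs ! c) ! j) = nth_or 0 (be c) j" using L c j by (simp add: occurrences)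
    thus "map al (fst (cs ! c)) ! j = be c ! j" using j be[OF c] by (simp add: nth_or_def)
   qed (use be in simp)
  next
   assume R: ?R
   show "ALL c j v. (c, j, v) : set ?O --> al v = nth_or 0 (be c) j"
   proof (intro allI impI)
    fix c j v assume "(c, j, v) : set ?O"
    hence o: "c < length cs" "j < length (fst (cs ! c))" "fst (cs ! c) ! j = v" by (simp_all add: occurrences)
    have "be c = map al (fst (cs ! c))" using R o(1) by simp
    thus "al v = nth_or 0 (be c) j" using o by (simp add: nth_or_def)
   qed
  qed
  finally show ?thesis .
 qed
 have mem: "(fst (cs ! c), snd (cs ! c)) : set cs" if "c < length cs" for c using that by simp
 have gen: "(EX T1 T2. T = T1 + T2 & (EX h. A h & F h = T1) & (EX h. B h & H h = T2)) = (EX al be. A al & B be & F al + H be = T)"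
  for T :: nat and A F B H by metis
 have "solvable (stages K cs) (target K cs) = (EX al be. (ALL v:set ?V. al v : set [0..<K]) & (ALL c:set ?Z. be c : set (snd (cs ! c))) &
    ?A al + ?B be = target K cs)" unfolding st solvable_append solvable_map[OF variables(1)] solvable_map[OF distinct_upt] by (rule gen)
 also have "... = satisfiable K cs"
 proof
  assume "EX al be. (ALL v:set ?V. al v : set [0..<K]) & (ALL c:set ?Z. be c : set (snd (cs ! c))) &
    ?A al + ?B be = target K cs"
  then obtain al be where al0: "ALL v:set ?V. al v : set [0..<K]" and be0: "ALL c:set ?Z. be c : set (snd (cs ! c))"
   and sum: "?A al + ?B be = target K cs" by blast
  have al: "!!v. v : set ?V ==> al v < K" and be: "!!c. c < length cs ==> be c : set (snd (cs ! c))" using al0 be0 by auto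
  have l: "length (be c) = length (fst (cs ! c))" if "c < length cs" for c using len[OF mem[OF that] be[OF that]] .
  have "(SUM v:set ?V. num ?b (var_digit v (al v)) ?O) + (SUM c:set ?Z. num ?b (constr_digit K c (be c)) ?O) = target K cs" using sum al by (simp add: v c cong: sum.cong)
  hence eq: "ALL c<length cs. map al (fst (cs ! c)) = be c" using digits[of al be, OF al l] by blast
  \<comment> \<open>Variables without occurrence get 0, because \<open>satisfiable\<close> bounds
    the values of all variables.\<close>
  let ?al = "%v. if v : set ?V then al v else 0"
  have "map ?al vs : set tab" if m: "(vs, tab) : set cs" for vs tab
  proof -
   obtain c where c: "c < length cs" "cs ! c = (vs, tab)" using m by (metis in_set_conv_nth)
   have a: "map ?al vs = map al vs" using m unfolding variables by (intro map_cong) auto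
   have "map al vs : set tab" using eq[rule_format, OF c(1)] c be[OF c(1)] by simp
   thus ?thesis unfolding a .
  qed
  moreover have "?al v < K" for v using al K by simp
  ultimately show "satisfiable K cs" unfolding satisfiable_def by (intro exI[of _ ?al]) auto
 next
  assume "satisfiable K cs"
  then obtain al where al0: "ALL v. al v < K" "ALL (vs, tab):set cs. map al vs : set tab" unfolding satisfiable_def by blast
  have al: "!!v. al v < K" "!!vs tab. (vs, tab) : set cs ==> map al vs : set tab" using al0 by auto
  let ?be = "%c. map al (fst (cs ! c))"
  have "(SUM v:set ?V. num ?b (var_digit v (al v)) ?O) + (SUM c:set ?Z. num ?b (constr_digit K c (?be c)) ?O) = target K cs" using digits[of al ?be] al(1) by simp
  hence "?A al + (SUM c:set ?Z. number K (constr_digit K c (?be c)) ?O) = target K cs" using al(1) by (simp add: v c)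
  moreover have "?be c : set (snd (cs ! c))" if "c < length cs" for c using al(2)[OF mem[OF that]] .
  ultimately show "EX al be. (ALL v:set ?V. al v : set [0..<K]) & (ALL c:set ?Z. be c : set (snd (cs ! c))) &
    ?A al + ?B be = target K cs" using al(1) by (intro exI[of _ al] exI[of _ ?be]) auto
 qed
 finally show ?thesis .
qed

lemma stages_nonempty:
 assumes "0 < K" "!!vs tab. (vs, tab) : set cs ==> tab ~= []" "w : set (stages K cs)"
 shows "w ~= []" using assms by (auto simp: stages_def dest!: set_zip_rightD)

lemma pt_variables:
 assumes "pt f"
 shows "pt (%x. variables (f x :: ('v :: treeable) constr list))"
proof -
 let ?h = "%(p :: 'a) (v :: 'v) s. if v : set s then s else v # s"
 have "pt (%x. fold (?h x) (concat (map fst (f x))) [])"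
 proof (rule pt_fold)
  show "pbounded (%n. n + 8)" "mono (%n :: nat. n + 8)" by (auto intro!: pb_intros monoI)
  show "pt (%z. ?h (fst z) (fst (snd z)) (snd (snd z)))" by (intro pts)
  show "esize (?h p x s) <= esize s + (esize p + esize x + 8)" for p x s by auto
 qed (intro pts assms)+
 thus ?thesis by (simp add: variables_def List.insert_def[abs_def])
qed

lemma pt_fixed_bits [pts]: "pt f ==> pt (%x. fixed_bits b (f x))" unfolding fixed_bits_def by (intro pts)

lemma pt_stages:
 assumes "pt f"
 shows "pt (%x. stages K (f x :: ('v :: treeable) constr list))" "pt (%x. target K (f x))"
proof -
 have "pt (stages K :: 'v constr list => _)" "pt (target K :: 'v constr list => _)"
  unfolding stages_def target_def number_def var_digit_def constr_digit_def occurrences_def case_prod_unfold by (intro pts pt_variables)+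
 thus "pt (%x. stages K (f x))" "pt (%x. target K (f x))" using assms by (auto intro: pt_comp)
qed

subsection \<open>From Turing machines to constraint satisfaction\<close>

text \<open>The contents of tape \<open>j\<close> at distance \<open>d\<close> from the head.\<close>

definition cell :: "tape list => nat => int => nat" where
 "cell ts j d = fst (ts ! j) (snd (ts ! j) + d)"

definition scanned :: "tape list => nat list" where
 "scanned ts = map (%(cs, p). cs p) ts"

definition action :: "turing_machine => nat * nat list => nat * (nat \<times> move) list" where
 "action M = (%(q, syms). if q = tm_halt M then (q, map (%a. (a, Stay)) syms) else tm_delta M q syms)"

text \<open>A control variable holds an index into this list, so that state and scanned symbols form
  a single number.\<close>

definition controls :: "turing_machine => (nat * nat list) list" where
 "controls M = List.product [0..<tm_states M] (List.n_lists (tm_tapes M) [0..<tm_symbols M])"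

text \<open>The new contents of a cell in terms of its old contents and that of its neighbours; \<open>ka\<close> is
  \<open>1\<close>, \<open>2\<close>, or \<open>3\<close> if the cell is the left neighbour of the head, under the head, or the right
  neighbour of the head. The window moves with the head.\<close>

definition new_cell :: "nat => nat \<times> move => nat => nat => nat => nat" where
 "new_cell ka = (%(a, mv) l c r. case mv of
   Move_Left => (if ka = 3 then a else l) | Stay => (if ka = 2 then a else c) | Move_Right => (if ka = 1 then a else r))"

definition scan_table :: "turing_machine => nat => nat list list" where
 "scan_table M j = map (%d. [d, snd (controls M ! d) ! j]) [0..<length (controls M)]"

definition state_table :: "turing_machine => nat list list" where
 "state_table M = filter (%v. fst (controls M ! (v ! 1)) = fst (action M (controls M ! (v ! 0))))
   (List.n_lists 2 [0..<length (controls M)])"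

definition cell_table :: "turing_machine => nat => nat => nat list list" where
 "cell_table M j ka = map (%(d, v). d # v @ [new_cell ka (snd (action M (controls M ! d)) ! j) (v ! 0) (v ! 1) (v ! 2)])
   (List.product [0..<length (controls M)] (List.n_lists 3 [0..<tm_symbols M]))"

definition start_table :: "turing_machine => nat list list" where
 "start_table M = map (%d. [d]) (filter (%d. fst (controls M ! d) = tm_start M) [0..<length (controls M)])"

text \<open>The contents of adjacent cells in the guessed part of the input: a blank is followed by
  a blank, so the cells spell a word of any length up to the bound.\<close>

definition guess_table :: "nat list list" where
 "guess_table = [[0, 0], [1, 0], [1, 1], [1, 2], [2, 0], [2, 1], [2, 2]]"

text \<open>The verifier writes one output bit, and symbol 1 stands for the bit 0. Acceptance thus
  means that no cell of the last tape contains 1.\<close>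

definition accept_table :: "turing_machine => nat list list" where
 "accept_table M = map (%a. [a]) (filter (%a. a ~= 1) [0..<tm_symbols M])"

type_synonym var = "nat * nat * nat"

text \<open>The input cells and the steps together bound how far nonblank cells can be from a head;
  one more cell keeps the border of the window blank throughout.\<close>

definition radius :: "bool list => unit list => unit list => nat" where
 "radius u up ut = Suc (length u + length up + length ut)"

definition window :: "bool list => unit list => unit list => nat list" where
 "window u up ut = [0..<length (() # () # () # map (%_. ()) u @ map (%_. ()) u @ up @ up @ ut @ ut)]"

text \<open>Variable \<open>(t, 0, 0)\<close> stands for the state and the scanned symbols at time \<open>t\<close>, variable
  \<open>(t, Suc j, p)\<close> for the contents of tape \<open>j\<close> at distance \<open>p - radius\<close> from the head.\<close>

definition step_constraints :: "turing_machine => bool list => unit list => unit list => var constr list" where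
 "step_constraints M u up ut = (let R = radius u up ut in
   map (%t. ([(t, 0, 0), (Suc t, 0, 0)], state_table M)) [0..<length ut] @
   concat (map (%t. concat (map (%j. map (%p.
     ([(t, 0, 0), (t, Suc j, p - 1), (t, Suc j, p), (t, Suc j, Suc p), (Suc t, Suc j, p)],
     nth_or [] (nth_or [] (map (%j. map (cell_table M j) [0..<4]) [0..<tm_tapes M]) j)
      (if Suc p = R then 1 else if p = R then 2 else if p = Suc R then 3 else 0)))
    (filter (%p. 0 < p & p < R + R) (window u up ut))) [0..<tm_tapes M])) [0..<length ut]))"

definition row_constraints :: "turing_machine => bool list => unit list => unit list => var constr list" where
 "row_constraints M u up ut = (let R = radius u up ut in
   concat (map (%t. concat (map (%j.
    [([(t, 0, 0), (t, Suc j, R)], nth_or [] (map (scan_table M) [0..<tm_tapes M]) j),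
    ([(t, Suc j, 0)], [[0]]), ([(t, Suc j, R + R)], [[0]])]) [0..<tm_tapes M])) [0..<length (() # ut)]))"

definition end_constraints :: "turing_machine => bool list => unit list => unit list => var constr list" where
 "end_constraints M u up ut = (let R = radius u up ut in
   [([(0, 0, 0)], start_table M)] @
   map (%(i, b). ([(0, 1, R + i)], [[if b then 2 else 1]])) (zip [0..<length u] u) @
   map (%i. ([(0, 1, R + length u + i), (0, 1, R + length u + Suc i)], guess_table)) [0..<length up] @
   concat (map (%j. map (%p. ([(0, Suc j, p)], [[0]]))
    (filter (%p. j ~= 0 | p < R | R + length u + length up <= p) (window u up ut))) [0..<tm_tapes M]) @
   map (%p. ([(length ut, tm_tapes M, p)], accept_table M)) (window u up ut))"

definition tableau :: "turing_machine => bool list => unit list => unit list => var constr list" where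
 "tableau M u up ut = step_constraints M u up ut @ row_constraints M u up ut @ end_constraints M u up ut"

lemma pt_tableau:
 assumes "pt f" "pt g" "pt h"
 shows "pt (%x. tableau M (f x) (g x) (h x))"
proof -
 have "pt (%z. step_constraints M (fst z) (fst (snd z)) (snd (snd z)))" unfolding step_constraints_def Let_def radius_def window_def by (intro pts)
 moreover have "pt (%z. row_constraints M (fst z) (fst (snd z)) (snd (snd z)))" unfolding row_constraints_def Let_def radius_def by (intro pts)
 moreover have "pt (%z. end_constraints M (fst z) (fst (snd z)) (snd (snd z)))"
  unfolding end_constraints_def Let_def radius_def window_def case_prod_unfold by (intro pts)
 ultimately have "pt (%z. tableau M (fst z) (fst (snd z)) (snd (snd z)))" unfolding tableau_def by (intro pts)
 from pt_comp[OF this pt_Pair[OF assms(1) pt_Pair[OF assms(2,3)]]] show ?thesis by simp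
qed

section \<open>Runs of the machine in the frame of its heads\<close>

locale tm_tableau =
 fixes M :: turing_machine and u :: "bool list" and up ut :: "unit list"
 assumes M: "wf_tm M"
begin

abbreviation "k == tm_tapes M"
abbreviation "S == tm_symbols M"
abbreviation "L == length (controls M)"
abbreviation "R == radius u up ut"
abbreviation "ta == length ut"
abbreviation "m == length u + length up"

lemma wf: "1 <= k" "3 <= S" "tm_start M < tm_states M" using M by (auto simp: wf_tm_def)

lemma controls: "((q, syms) : set (controls M)) = (q < tm_states M & length syms = k & (ALL a:set syms. a < S))" by (auto simp: controls_def set_n_lists)

lemma controls_nth: "d < L ==> fst (controls M ! d) < tm_states M & length (snd (controls M ! d)) = k & (ALL a:set (snd (controls M ! d)). a < S)"
 using controls[of "fst (controls M ! d)" "snd (controls M ! d)"] by simp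

lemma action:
 assumes "q < tm_states M" "length syms = k" "ALL a:set syms. a < S"
 shows "fst (action M (q, syms)) < tm_states M" "length (snd (action M (q, syms))) = k"
  "j < k ==> fst (snd (action M (q, syms)) ! j) < S"
proof -
 let ?a = "action M (q, syms)"
 have "fst ?a < tm_states M & length (snd ?a) = k & (ALL x:set (snd ?a). fst x < S)"
 proof (cases "q = tm_halt M")
  case True thus ?thesis using assms by (auto simp: action_def)
 next case False
  obtain q' acts where d: "tm_delta M q syms = (q', acts)" by (cases "tm_delta M q syms")
  have "ALL q syms. q < tm_states M & length syms = k & (ALL a:set syms. a < S) -->
    (case tm_delta M q syms of (q', acts) => q' < tm_states M & length acts = k & (ALL (a, m):set acts. a < S))" using M unfolding wf_tm_def by (elim conjE)
  from this[rule_format, of q syms] assms have "q' < tm_states M & length acts = k & (ALL x:set acts. fst x < S)" by (simp add: d case_prod_unfold)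
  thus ?thesis using False by (simp add: action_def d)
 qed
 note a = this
 show "fst ?a < tm_states M" "length (snd ?a) = k" using a by blast+
 show "fst (snd ?a ! j) < S" if "j < k"
 proof -
  have "snd ?a ! j : set (snd ?a)" by (rule nth_mem) (use a that in simp)
  thus ?thesis using a by blast
 qed
qed

lemma window: "set (window u up ut) = {..R + R}" "R = Suc (m + ta)" by (auto simp: window_def radius_def)

definition conf :: "bool list => nat => nat \<times> tape list" where
 "conf w t = (tm_step M ^^ t) (tm_initial M w)"

definition control :: "bool list => nat => nat * nat list" where
 "control w t = (fst (conf w t), scanned (snd (conf w t)))"

lemma step_action: "tm_step M (q, ts) = (fst (action M (q, scanned ts)), map2 tape_act (snd (action M (q, scanned ts))) ts)"
proof (cases "q = tm_halt M")
 case True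
 have "map2 tape_act (map (%a. (a, Stay)) (scanned ts)) ts = ts" by (rule nth_equalityI) (auto simp: scanned_def split: prod.splits)
 thus ?thesis using True by (simp add: tm_step_def action_def)
next case False thus ?thesis by (simp add: tm_step_def action_def scanned_def split: prod.splits)
qed

lemma scanned_nth: "j < length ts ==> scanned ts ! j = cell ts j 0" by (simp add: scanned_def cell_def split: prod.splits)

lemma scanned_wf:
 assumes "length ts = k" "!!j. j < k ==> cell ts j 0 < S"
 shows "length (scanned ts) = k" "ALL a:set (scanned ts). a < S"
proof -
 show l: "length (scanned ts) = k" using assms(1) by (simp add: scanned_def)
 show "ALL a:set (scanned ts). a < S"
 proof
  fix a assume "a : set (scanned ts)"
  then obtain j where "j < k" "a = scanned ts ! j" using l by (metis in_set_conv_nth)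
  thus "a < S" using assms scanned_nth[of j ts] by simp
 qed
qed

lemma cell_act:
 assumes "j < length ts" "length acts = length ts"
 shows "cell (map2 tape_act acts ts) j d =
  (let w = %e. if e = 0 then fst (acts ! j) else cell ts j e in
   case snd (acts ! j) of Move_Left => w (d - 1) | Stay => w d | Move_Right => w (d + 1))"
proof -
 obtain cs p where ts: "ts ! j = (cs, p)" by (cases "ts ! j")
 obtain a mv where acts: "acts ! j = (a, mv)" by (cases "acts ! j")
 have "map2 tape_act acts ts ! j = tape_act (a, mv) (cs, p)" using assms ts acts by simp
 thus ?thesis unfolding cell_def Let_def ts acts by (cases mv) (auto simp: algebra_simps)
qed

lemma conf_Suc: "conf w (Suc t) = (fst (action M (control w t)), map2 tape_act (snd (action M (control w t))) (snd (conf w t)))"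
 using step_action[of "fst (conf w t)" "snd (conf w t)"] by (simp add: conf_def control_def)

lemma conf_wf: "fst (conf w t) < tm_states M" "length (snd (conf w t)) = k" "!!j d. j < k ==> cell (snd (conf w t)) j d < S"
proof (induction t)
 case 0
 show "fst (conf w 0) < tm_states M" "length (snd (conf w 0)) = k" using wf by (auto simp: conf_def tm_initial_def)
 show "cell (snd (conf w 0)) j d < S" if "j < k" for j d using wf that by (cases j) (auto simp: conf_def tm_initial_def cell_def word_cells_def)
next case (Suc t)
 have sc: "length (scanned (snd (conf w t))) = k" "ALL a:set (scanned (snd (conf w t))). a < S" using scanned_wf[OF Suc(2)] Suc(3) by blast+
 note a = action[OF Suc(1) sc, folded control_def]
 show "fst (conf w (Suc t)) < tm_states M" "length (snd (conf w (Suc t))) = k" using a Suc(2) by (simp_all add: conf_Suc)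
 show "cell (snd (conf w (Suc t))) j d < S" if "j < k" for j d
  using cell_act[of j "snd (conf w t)" "snd (action M (control w t))" d] a(2) a(3)[OF that] Suc(2) Suc(3)[OF that] that by (simp add: conf_Suc Let_def split: move.splits)
qed

lemma control_wf: "length (snd (control w t)) = k" "ALL a:set (snd (control w t)). a < S" "control w t : set (controls M)"
proof -
 show 1: "length (snd (control w t)) = k" "ALL a:set (snd (control w t)). a < S"
  using scanned_wf[OF conf_wf(2), of w t] conf_wf(3)[of _ w t 0] by (simp_all add: control_def)
 show "control w t : set (controls M)" using controls[of "fst (control w t)" "snd (control w t)"] 1 conf_wf(1)[of w t] by (simp add: control_def)
qed

lemma action_control: "length (snd (action M (control w t))) = k" "j < k ==> fst (snd (action M (control w t)) ! j) < S"
 using action[of "fst (control w t)" "snd (control w t)"] control_wf[of w t] conf_wf(1)[of w t] by (simp_all add: control_def)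

definition content :: "bool list => nat => nat => int => nat" where
 "content w t j d = cell (snd (conf w t)) j d"

text \<open>Relative to the head, a head movement shifts the whole tape. So a cell depends only on
  the action and on three old cells, although every tape has its own head.\<close>

lemma content_Suc:
 assumes "j < k"
 shows "content w (Suc t) j d = new_cell (if d = -1 then 1 else if d = 0 then 2 else if d = 1 then 3 else 0)
  (snd (action M (control w t)) ! j) (content w t j (d - 1)) (content w t j d) (content w t j (d + 1))"
proof -
 obtain a mv where a: "snd (action M (control w t)) ! j = (a, mv)" by (cases "snd (action M (control w t)) ! j")
 show ?thesis using cell_act[of j "snd (conf w t)" "snd (action M (control w t))" d] action_control(1)[of w t] conf_wf(2)[of w t] assms
  unfolding content_def conf_Suc new_cell_def a snd_conv by (cases mv) (auto simp: Let_def a)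
qed

lemma content_0: "j < k ==> content w 0 j d = (if j = 0 then word_cells w d else 0)"
 using wf by (cases j) (auto simp: content_def conf_def tm_initial_def cell_def word_cells_def)

text \<open>The nonblank region begins within distance \<open>m\<close> of the head and spreads by
  at most one cell per step.\<close>

lemma content_blank: "length w <= m ==> j < k ==> int m + int t < abs d ==> content w t j d = 0"
proof (induction t arbitrary: d)
 case 0 thus ?case by (auto simp: content_0 word_cells_def)
next case (Suc t)
 have "content w t j (d - 1) = 0" "content w t j d = 0" "content w t j (d + 1) = 0" using Suc by auto
 moreover have "d ~= -1" "d ~= 0" "d ~= 1" using Suc.prems by auto
 ultimately show ?case unfolding content_Suc[OF Suc.prems(2)] new_cell_def by (auto split: move.splits prod.splits)
qed

lemma content_less: "j < k ==> content w t j d < S" using conf_wf(3) by (simp add: content_def)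

lemma control_nth: "j < k ==> snd (control w t) ! j = content w t j 0" using scanned_nth[of j "snd (conf w t)"] conf_wf(2)[of w t] by (simp add: control_def content_def)

lemma control_Suc: "fst (control w (Suc t)) = fst (action M (control w t))" by (simp add: control_def conf_Suc)

lemma scan_table: "([d, a] : set (scan_table M j)) = (d < L & a = snd (controls M ! d) ! j)" by (auto simp: scan_table_def)

lemma state_table: "([d, d'] : set (state_table M)) = (d < L & d' < L & fst (controls M ! d') = fst (action M (controls M ! d)))"
 by (auto simp: state_table_def set_n_lists)

lemma cell_table: "([d, l, c, r, e] : set (cell_table M j ka)) =
  (d < L & l < S & c < S & r < S & e = new_cell ka (snd (action M (controls M ! d)) ! j) l c r)"
proof
 assume "[d, l, c, r, e] : set (cell_table M j ka)"
 then obtain v where v: "d < L" "length v = 3" "set v <= {0..<S}" "[l, c, r, e] = v @ [new_cell ka (snd (action M (controls M ! d)) ! j) (v ! 0) (v ! 1) (v ! 2)]"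
  by (auto simp: cell_table_def set_n_lists)
 obtain l' c' r' where "v = [l', c', r']" using v(2) by (auto simp: numeral_3_eq_3 length_Suc_conv)
 thus "d < L & l < S & c < S & r < S & e = new_cell ka (snd (action M (controls M ! d)) ! j) l c r" using v by auto
next
 assume a: "d < L & l < S & c < S & r < S & e = new_cell ka (snd (action M (controls M ! d)) ! j) l c r"
 have "(d, [l, c, r]) : set (List.product [0..<L] (List.n_lists 3 [0..<S]))" using a by (auto simp: set_n_lists)
 from imageI[OF this, of "%(d, v). d # v @ [new_cell ka (snd (action M (controls M ! d)) ! j) (v ! 0) (v ! 1) (v ! 2)]"] a
 show "[d, l, c, r, e] : set (cell_table M j ka)" by (simp add: cell_table_def)
qed

lemma start_table: "([d] : set (start_table M)) = (d < L & fst (controls M ! d) = tm_start M)" by (auto simp: start_table_def)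

lemma guess_table: "([a, b] : set guess_table) = (a <= 2 & b <= 2 & (a = 0 --> b = 0))" unfolding guess_table_def by (auto simp: le_Suc_eq numeral_2_eq_2)

lemma accept_table: "([a] : set (accept_table M)) = (a < S & a ~= 1)" by (auto simp: accept_table_def)

end

definition kind :: "nat => nat => nat" where
 "kind R p = (if Suc p = R then 1 else if p = R then 2 else if p = Suc R then 3 else 0)"

section \<open>Consistent assignments and runs\<close>

context tm_tableau
begin

abbreviation steps_ok :: "(var => nat) => bool" where
 "steps_ok al == (ALL t<ta. [al (t, 0, 0), al (Suc t, 0, 0)] : set (state_table M)) &
   (ALL t<ta. ALL j<k. ALL p. 0 < p & p < R + R -->
    [al (t, 0, 0), al (t, Suc j, p - 1), al (t, Suc j, p), al (t, Suc j, Suc p), al (Suc t, Suc j, p)] : set (cell_table M j (kind R p)))"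

abbreviation rows_ok :: "(var => nat) => bool" where
 "rows_ok al == (ALL t<=ta. ALL j<k. [al (t, 0, 0), al (t, Suc j, R)] : set (scan_table M j) & al (t, Suc j, 0) = 0 & al (t, Suc j, R + R) = 0)"

abbreviation ends_ok :: "(var => nat) => bool" where
 "ends_ok al == [al (0, 0, 0)] : set (start_table M) &
   (ALL i<length u. al (0, 1, R + i) = (if u ! i then 2 else 1)) &
   (ALL i<length up. [al (0, 1, R + length u + i), al (0, 1, R + length u + Suc i)] : set guess_table) &
   (ALL j<k. ALL p<=R + R. j ~= 0 | p < R | R + length u + length up <= p --> al (0, Suc j, p) = 0) &
   (ALL p<=R + R. [al (ta, k, p)] : set (accept_table M))"

definition consistent :: "(var => nat) => bool" where
 "consistent al = (steps_ok al & rows_ok al & ends_ok al)"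

lemma consistentD:
 assumes "consistent al"
 shows "t < ta ==> [al (t, 0, 0), al (Suc t, 0, 0)] : set (state_table M)"
  "t < ta ==> j < k ==> 0 < p ==> p < R + R ==>
    [al (t, 0, 0), al (t, Suc j, p - 1), al (t, Suc j, p), al (t, Suc j, Suc p), al (Suc t, Suc j, p)] : set (cell_table M j (kind R p))"
  "t <= ta ==> j < k ==> [al (t, 0, 0), al (t, Suc j, R)] : set (scan_table M j) & al (t, Suc j, 0) = 0 & al (t, Suc j, R + R) = 0"
  "[al (0, 0, 0)] : set (start_table M)"
  "i < length u ==> al (0, 1, R + i) = (if u ! i then 2 else 1)"
  "i < length up ==> [al (0, 1, R + length u + i), al (0, 1, R + length u + Suc i)] : set guess_table"
  "j < k ==> p <= R + R ==> j ~= 0 | p < R | R + length u + length up <= p ==> al (0, Suc j, p) = 0"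
  "p <= R + R ==> [al (ta, k, p)] : set (accept_table M)" using assms unfolding consistent_def by (elim conjE; simp only:)+

lemma ball_concat_map: "(ALL x:set (concat (map f xs)). P x) = (ALL y:set xs. ALL x:set (f y). P x)" by auto

lemma ball_map: "(ALL x:set (map f xs). P x) = (ALL y:set xs. P (f y))" by auto

lemma ball_step: "(ALL c:set (step_constraints M u up ut). map al (fst c) : set (snd c)) = steps_ok al"
proof -
 have n: "nth_or [] (nth_or [] (map (%j. map (cell_table M j) [0..<4]) [0..<k]) j) (kind R p) = cell_table M j (kind R p)"
  if "j < k" for j p using that by (simp add: nth_or_def kind_def)
 have w: "set (filter (%p. 0 < p & p < R + R) (window u up ut)) = {p. 0 < p & p < R + R}" unfolding set_filter window(1) by auto
 show ?thesis unfolding step_constraints_def Let_def kind_def[symmetric] set_append ball_Un ball_concat_map ball_map fst_conv snd_conv w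
  by (simp add: n Ball_def)
qed

lemma ball_row: "(ALL c:set (row_constraints M u up ut). map al (fst c) : set (snd c)) = rows_ok al"
proof -
 have n: "nth_or [] (map (scan_table M) [0..<k]) j = scan_table M j" if "j < k" for j using that by (simp add: nth_or_def)
 have t: "set [0..<length (() # ut)] = {..ta}" by auto
 show ?thesis unfolding row_constraints_def Let_def ball_concat_map t by (auto simp: n)
qed

lemma ball_end: "(ALL c:set (end_constraints M u up ut). map al (fst c) : set (snd c)) = ends_ok al"
proof -
 have z: "(ALL z:set (zip [0..<length u] u). P (fst z) (snd z)) = (ALL i<length u. P i (u ! i))" for P by (fastforce simp: set_zip)
 show ?thesis unfolding end_constraints_def Let_def set_append ball_Un ball_concat_map ball_map case_prod_unfold fst_conv snd_conv
   z[where P = "%i b. map al [(0, 1, R + i)] : set [[if b then 2 else 1]]"] by (simp add: window(1) Ball_def imp_conjL)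
qed

lemma satisfiable_consistent: "satisfiable K (tableau M u up ut) = (EX al. (ALL v. al v < K) & consistent al)"
proof -
 have "(ALL c:set (tableau M u up ut). map al (fst c) : set (snd c)) = consistent al" for al
  unfolding tableau_def set_append ball_Un ball_step ball_row ball_end consistent_def by (simp only: conj_assoc)
 thus ?thesis by (simp add: satisfiable_def case_prod_unfold)
qed

definition agrees :: "(var => nat) => bool list => nat => bool" where
 "agrees al w t = (al (t, 0, 0) < L & controls M ! al (t, 0, 0) = control w t &
   (ALL j<k. ALL p<=R + R. al (t, Suc j, p) = content w t j (int p - int R)))"

lemma kind: "kind R p =
  (if int p - int R = -1 then 1 else if int p - int R = 0 then 2 else if int p - int R = 1 then 3 else 0)" by (auto simp: kind_def)

lemma content_Suc_position:
 assumes "j < k" "0 < p"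
 shows "content w (Suc t) j (int p - int R) = new_cell (kind R p) (snd (action M (control w t)) ! j)
  (content w t j (int (p - 1) - int R)) (content w t j (int p - int R)) (content w t j (int (Suc p) - int R))"
proof -
 have "int (p - 1) - int R = int p - int R - 1" "int (Suc p) - int R = int p - int R + 1" using assms(2) by auto
 thus ?thesis by (simp only: content_Suc[OF assms(1)] kind)
qed

lemma boundary:
 assumes "length w <= m" "t <= ta" "j < k"
 shows "content w t j (int 0 - int R) = 0" "content w t j (int (R + R) - int R) = 0" using content_blank[OF assms(1,3), of t] assms(2) window(2) by simp_all

text \<open>\<open>state_table\<close> and \<open>start_table\<close> fix only the state inside a
  control. Its scanned symbols are tied by \<open>scan_table\<close> to the cells in column
  \<open>R\<close>, the position of the head.\<close>

lemma agrees_control: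
 assumes cells: "!!j p. j < k ==> p <= R + R ==> al (t, Suc j, p) = content w t j (int p - int R)"
  and state: "al (t, 0, 0) < L" "fst (controls M ! al (t, 0, 0)) = fst (control w t)"
  and scan: "!!j. j < k ==> [al (t, 0, 0), al (t, Suc j, R)] : set (scan_table M j)"
 shows "agrees al w t"
proof -
 have "snd (controls M ! al (t, 0, 0)) = snd (control w t)"
 proof (rule nth_equalityI)
  show "length (snd (controls M ! al (t, 0, 0))) = length (snd (control w t))" using controls_nth[OF state(1)] control_wf(1) by simp
  fix j assume "j < length (snd (controls M ! al (t, 0, 0)))"
  hence j: "j < k" using controls_nth[OF state(1)] by simp
  have "snd (controls M ! al (t, 0, 0)) ! j = al (t, Suc j, R)" using scan[OF j] scan_table by simp
  also have "... = snd (control w t) ! j" using cells[OF j, of R] control_nth[OF j] by simp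
  finally show "snd (controls M ! al (t, 0, 0)) ! j = snd (control w t) ! j" .
 qed
 thus ?thesis using state cells unfolding agrees_def by (metis prod.collapse)
qed

lemma agrees_step:
 assumes c: "consistent al" and w: "length w <= m" and t: "t < ta" and a: "agrees al w t"
 shows "agrees al w (Suc t)"
proof (rule agrees_control)
 note c = consistentD[OF c]
 have st: "[al (t, 0, 0), al (Suc t, 0, 0)] : set (state_table M)" using t by (rule c(1))
 show "al (Suc t, 0, 0) < L" "fst (controls M ! al (Suc t, 0, 0)) = fst (control w (Suc t))" using st a unfolding state_table agrees_def control_Suc by auto
 have row: "ALL j<k. [al (Suc t, 0, 0), al (Suc t, Suc j, R)] : set (scan_table M j) & al (Suc t, Suc j, 0) = 0 & al (Suc t, Suc j, R + R) = 0"
  using c(3)[of "Suc t"] t by (simp add: Suc_le_eq)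
 show "[al (Suc t, 0, 0), al (Suc t, Suc j, R)] : set (scan_table M j)" if "j < k" for j using row that by blast
 show "al (Suc t, Suc j, p) = content w (Suc t) j (int p - int R)" if j: "j < k" and p: "p <= R + R" for j p
 proof -
  consider "p = 0" | "p = R + R" | "0 < p" "p < R + R" using p by linarith
  thus ?thesis
  proof cases
   case 1 thus ?thesis using boundary(1)[OF w _ j, of "Suc t"] row j t by simp
next case 2 thus ?thesis using boundary(2)[OF w _ j, of "Suc t"] row j t by simp
  next case 3
   have "[al (t, 0, 0), al (t, Suc j, p - 1), al (t, Suc j, p), al (t, Suc j, Suc p), al (Suc t, Suc j, p)] : set (cell_table M j (kind R p))"
    using t j 3 by (rule c(2))
   hence "al (Suc t, Suc j, p) = new_cell (kind R p) (snd (action M (controls M ! al (t, 0, 0))) ! j)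
     (al (t, Suc j, p - 1)) (al (t, Suc j, p)) (al (t, Suc j, Suc p))" unfolding cell_table by blast
   moreover have "al (t, Suc j, p') = content w t j (int p' - int R)" if "p' <= R + R" for p' using a j that unfolding agrees_def by blast
   moreover have "controls M ! al (t, 0, 0) = control w t" using a unfolding agrees_def by blast
   ultimately show ?thesis using content_Suc_position[OF j 3(1), of w t] 3(2) p by simp
  qed
 qed
qed

text \<open>\<open>guess_table\<close> makes blanks persist to the right, so the certificate
  \<open>y\<close> is read off up to the first blank of the guessed part.\<close>

lemma consistent_guess:
 assumes c: "consistent al"
 obtains y where "length y <= length up" "agrees al (u @ y) 0"
proof -
 note c = consistentD[OF c]
 define g where "g = (%i. al (0, 1, R + length u + i))"
 have gs: "g i <= 2 & g (Suc i) <= 2 & (g i = 0 --> g (Suc i) = 0)" if "i < length up" for i using c(6)[OF that] unfolding g_def guess_table by simp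
 have k0: "0 < k" using wf by simp
 have zero: "al (0, Suc j, p) = 0" if "j < k" "p <= R + R" "j ~= 0 | p < R | R + m <= p" for j p using c(7)[OF that(1,2)] that(3) by (simp add: add.assoc)
 \<comment> \<open>The cell behind the guessed part is forced to be blank, so a first blank
   exists.\<close>
 have "g (length up) = 0" using zero[OF k0, of "R + m"] window(2) by (simp add: g_def add.assoc)
 define l where "l = (LEAST i. g i = 0)"
 have l: "g l = 0" "l <= length up" "!!i. i < l ==> g i ~= 0"
 proof -
  show "g l = 0" unfolding l_def by (rule LeastI) fact
  show "l <= length up" unfolding l_def by (rule Least_le) fact
  show "g i ~= 0" if "i < l" for i using not_less_Least[of i "%i. g i = 0"] that unfolding l_def by blast
 qed
 have after: "g i = 0" if "l <= i" "i <= length up" for i using that by (induction i rule: dec_induct) (use l gs in auto)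
 define y where "y = map (%i. g i = 2) [0..<l]"
 have y: "length y = l" "length y <= length up" using l by (simp_all add: y_def)
 have input: "al (0, Suc 0, p) = word_cells (u @ y) (int p - int R)" if p: "p <= R + R" for p
 proof -
  consider "p < R" | "R <= p" "p < R + length u" | "R + length u <= p" "p < R + m" | "R + m <= p" by linarith
  thus ?thesis
  proof cases
   case 1 thus ?thesis using zero[OF k0 p] by (simp add: word_cells_def)
  next case 2
   define i where "i = p - R"
   have i: "p = R + i" "i < length u" using 2 by (simp_all add: i_def)
   have "al (0, 1, R + i) = (if u ! i then 2 else 1)" using i(2) by (rule c(5))
   thus ?thesis using i by (simp add: word_cells_def nth_append)
  next case 3
   define i where "i = p - (R + length u)"
   have i: "p = R + length u + i" "i < length up" using 3 by (simp_all add: i_def)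
   have nz: "g i = 1 | g i = 2" if "i < l" using l(3)[OF that] gs[OF i(2)] by auto
   have "al (0, Suc 0, p) = g i" using i by (simp add: g_def)
   also have "... = word_cells (u @ y) (int p - int R)" using nz after[of i] i y by (auto simp: word_cells_def nth_append y_def nat_add_distrib)
   finally show ?thesis .
 next case 4 thus ?thesis using zero[OF k0 p] y by (simp add: word_cells_def)
  qed
 qed
 have "agrees al (u @ y) 0"
 proof (rule agrees_control)
  show "al (0, Suc j, p) = content (u @ y) 0 j (int p - int R)" if "j < k" "p <= R + R" for j p using input[OF that(2)] zero[OF that] by (simp add: content_0[OF that(1)])
  have "[al (0, 0, 0)] : set (start_table M)" by (rule c(4))
  thus "al (0, 0, 0) < L" "fst (controls M ! al (0, 0, 0)) = fst (control (u @ y) 0)" unfolding start_table by (simp_all add: control_def conf_def tm_initial_def)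
  show "[al (0, 0, 0), al (0, Suc j, R)] : set (scan_table M j)" if "j < k" for j using c(3)[of 0 j] that by simp
 qed
 with y(2) show ?thesis by (rule that)
qed

definition run_asg :: "bool list => var => nat" where
 "run_asg w = (%(t, j, p). case j of
   0 => (SOME d. d < L & controls M ! d = control w t)
  | Suc j' => if j' < k then content w t j' (int p - int R) else 0)"

lemma run_asg: "run_asg w (t, 0, p) < L" "controls M ! run_asg w (t, 0, p) = control w t"
 "j < k ==> run_asg w (t, Suc j, p) = content w t j (int p - int R)" "run_asg w v < L + S"
proof -
 have "EX d. d < L & controls M ! d = control w t" for t using control_wf(3)[of w t] by (simp add: in_set_conv_nth)
 from someI_ex[OF this] show 1: "run_asg w (t, 0, p) < L" "controls M ! run_asg w (t, 0, p) = control w t" for t p by (simp_all add: run_asg_def)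
 show 2: "run_asg w (t, Suc j, p) = content w t j (int p - int R)" if "j < k" for t j p using that by (simp add: run_asg_def)
 obtain t j p where v: "v = (t, j, p)" by (cases v)
 show "run_asg w v < L + S"
 proof (cases j)
  case 0 thus ?thesis using 1(1)[of t p] by (simp add: v)
next case (Suc j') thus ?thesis using 2[of j' t p] content_less[of j' w t "int p - int R"] wf(2) by (cases "j' < k") (auto simp: v run_asg_def)
 qed
qed

lemma run_consistent:
 assumes y: "length y <= length up" and acc: "!!d. content (u @ y) ta (k - 1) d ~= 1"
 shows "consistent (run_asg (u @ y))"
proof -
 let ?w = "u @ y" and ?al = "run_asg (u @ y)"
 have w: "length ?w <= m" using y by simp
 have k0: "0 < k" "Suc (k - 1) = k" using wf by simp_all
 note r = run_asg[where w = ?w]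
 have in0: "?al (0, Suc j, p) = (if j = 0 then word_cells ?w (int p - int R) else 0)" if "j < k" for j p using r(3)[OF that] content_0[OF that] by simp
 show ?thesis unfolding consistent_def
 proof (intro conjI allI impI)
  show "[?al (t, 0, 0), ?al (Suc t, 0, 0)] : set (state_table M)" for t unfolding state_table using r(1,2) control_Suc by simp
  show "[?al (t, 0, 0), ?al (t, Suc j, p - 1), ?al (t, Suc j, p), ?al (t, Suc j, Suc p), ?al (Suc t, Suc j, p)] : set (cell_table M j (kind R p))"
   if "j < k" "0 < p & p < R + R" for t j p
   unfolding cell_table r(2) r(3)[OF that(1)] using r(1) content_less[OF that(1)] content_Suc_position[OF that(1)] that(2) by simp
  show "[?al (t, 0, 0), ?al (t, Suc j, R)] : set (scan_table M j)" if "j < k" for t j unfolding scan_table r(2) r(3)[OF that] using r(1) control_nth[OF that] by simp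
  show "?al (t, Suc j, 0) = 0" "?al (t, Suc j, R + R) = 0" if "t <= ta" "j < k" for t j unfolding r(3)[OF that(2)] using boundary[OF w that] by simp_all
  show "[?al (0, 0, 0)] : set (start_table M)" unfolding start_table r(2) using r(1) by (simp add: control_def conf_def tm_initial_def)
  show "?al (0, 1, R + i) = (if u ! i then 2 else 1)" if "i < length u" for i using in0[OF k0(1), of "R + i"] that by (simp add: word_cells_def nth_append)
  have g: "?al (0, 1, R + length u + i) = (if i < length y then (if y ! i then 2 else 1) else 0)" for i
   using in0[OF k0(1), of "R + length u + i"] by (simp add: word_cells_def nth_append nat_add_distrib)
  show "[?al (0, 1, R + length u + i), ?al (0, 1, R + length u + Suc i)] : set guess_table" for i by (simp only: guess_table g) simp
  show "?al (0, Suc j, p) = 0" if "j < k" "j ~= 0 | p < R | R + length u + length up <= p" for j p using in0[OF that(1), of p] that(2) y by (auto simp: word_cells_def)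
  show "[?al (ta, k, p)] : set (accept_table M)" for p unfolding accept_table using r(3)[of "k - 1" ta p] acc content_less[of "k - 1" ?w ta] k0 by simp
 qed
qed

theorem satisfiable_tableau:
 "satisfiable (L + S) (tableau M u up ut) = (EX y. length y <= length up & (ALL d. content (u @ y) ta (k - 1) d ~= 1))"
proof
 assume "satisfiable (L + S) (tableau M u up ut)"
 then obtain al where c: "consistent al" unfolding satisfiable_consistent by blast
 obtain y where y: "length y <= length up" "agrees al (u @ y) 0" by (rule consistent_guess[OF c])
 have w: "length (u @ y) <= m" using y(1) by simp
 have "agrees al (u @ y) t" if "t <= ta" for t using that by (induction t) (use y(2) agrees_step[OF c w] in auto)
 hence a: "agrees al (u @ y) ta" by simp
 have k0: "k - 1 < k" "Suc (k - 1) = k" using wf by simp_all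
 have "content (u @ y) ta (k - 1) d ~= 1" for d
 proof (cases "abs d <= int R")
  case True
  define p where "p = nat (d + int R)"
  have p: "p <= R + R" "d = int p - int R" using True by (auto simp: p_def)
  have "[al (ta, k, p)] : set (accept_table M)" using p(1) by (rule consistentD(8)[OF c])
  hence "al (ta, Suc (k - 1), p) ~= 1" unfolding accept_table k0(2) by blast
  thus ?thesis using a k0(1) p unfolding agrees_def by metis
 next case False
  hence "int m + int ta < abs d" using window(2) by simp
  thus ?thesis using content_blank[OF w k0(1), of ta d] by simp
 qed
 thus "EX y. length y <= length up & (ALL d. content (u @ y) ta (k - 1) d ~= 1)" using y(1) by blast
next
 assume "EX y. length y <= length up & (ALL d. content (u @ y) ta (k - 1) d ~= 1)"
 then obtain y where "length y <= length up" "!!d. content (u @ y) ta (k - 1) d ~= 1" by blast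
 from run_consistent[OF this] show "satisfiable (L + S) (tableau M u up ut)" unfolding satisfiable_consistent using run_asg(4) by blast
qed

lemma L_pos: "0 < L" by (rule le_less_trans[OF le0 run_asg(1)])

lemma tables:
 "scan_table M j ~= [] & (ALL v:set (scan_table M j). length v = 2)"
 "state_table M ~= [] & (ALL v:set (state_table M). length v = 2)"
 "cell_table M j ka ~= [] & (ALL v:set (cell_table M j ka). length v = 5)"
 "start_table M ~= [] & (ALL v:set (start_table M). length v = 1)"
 "guess_table ~= [] & (ALL v:set guess_table. length v = 2)"
 "accept_table M ~= [] & (ALL v:set (accept_table M). length v = 1)"
proof -
 note r = run_asg(1,2)[of "[]"]
 have e: "xs ~= []" if "x : set xs" for x and xs :: "nat list list" using that by auto
 show "scan_table M j ~= [] & (ALL v:set (scan_table M j). length v = 2)" using L_pos by (auto simp: scan_table_def)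
 have "[run_asg [] (0, 0, 0), run_asg [] (Suc 0, 0, 0)] : set (state_table M)" unfolding state_table using r control_Suc by simp
 from e[OF this] show "state_table M ~= [] & (ALL v:set (state_table M). length v = 2)" by (rule conjI) (auto simp: state_table_def set_n_lists)
 have "[0, 0, 0, 0, new_cell ka (snd (action M (controls M ! 0)) ! j) 0 0 0] : set (cell_table M j ka)" unfolding cell_table using L_pos wf by simp
 from e[OF this] show "cell_table M j ka ~= [] & (ALL v:set (cell_table M j ka). length v = 5)" by (rule conjI) (auto simp: cell_table_def set_n_lists)
 have "[run_asg [] (0, 0, 0)] : set (start_table M)" unfolding start_table using r by (simp add: control_def conf_def tm_initial_def)
 from e[OF this] show "start_table M ~= [] & (ALL v:set (start_table M). length v = 1)" by (rule conjI) (auto simp: start_table_def)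
 show "guess_table ~= [] & (ALL v:set guess_table. length v = 2)" by (auto simp: guess_table_def)
 have "[0] : set (accept_table M)" unfolding accept_table using wf by simp
 from e[OF this] show "accept_table M ~= [] & (ALL v:set (accept_table M). length v = 1)" by (rule conjI) (auto simp: accept_table_def)
qed

text \<open>Nonempty tables provide an entry in every list of the sum problem and thus an edge out
  of every stage vertex. The matching lengths are a hypothesis of
  \<open>solvable_stages\<close>.\<close>

lemma tableau_tables: "c : set (tableau M u up ut) ==> snd c ~= [] & (ALL v:set (snd c). length v = length (fst c))"
proof -
 let ?P = "%c :: var constr. snd c ~= [] & (ALL v:set (snd c). length v = length (fst c))"
 have n: "nth_or [] (nth_or [] (map (%j. map (cell_table M j) [0..<4]) [0..<k]) j) (kind R p) = cell_table M j (kind R p)"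
  "nth_or [] (map (scan_table M) [0..<k]) j = scan_table M j" if "j < k" for j p using that by (simp_all add: nth_or_def kind_def)
 have step: "ALL c:set (step_constraints M u up ut). ?P c"
  unfolding step_constraints_def Let_def kind_def[symmetric] set_append ball_Un ball_concat_map ball_map fst_conv snd_conv using tables by (simp add: n)
 have row: "ALL c:set (row_constraints M u up ut). ?P c" unfolding row_constraints_def Let_def ball_concat_map using tables by (simp add: n)
 have "ALL c:set (end_constraints M u up ut). ?P c"
  unfolding end_constraints_def Let_def set_append ball_Un ball_concat_map ball_map case_prod_unfold fst_conv snd_conv using tables by simp
 with step row show "c : set (tableau M u up ut) ==> ?P c" unfolding tableau_def by auto
qed

end

subsection \<open>Completeness\<close>

lemma poly_nat_mono: "a <= b ==> poly (p :: nat poly) a <= poly p b" by (induction p) (auto intro: add_mono mult_mono)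

text \<open>Horner's scheme in unary: the list \<open>x\<close> itself serves as the factor of
  length \<open>length x\<close>.\<close>

lemma pt_replicate_poly: "pt (%x. replicate (poly p (length (x :: 'a :: treeable list))) ())"
proof (induction p)
 case 0 show ?case by (simp add: pt_const)
next case (pCons a p)
 have "pt (%x :: 'a list. replicate a () @ concat (map (%_. replicate (poly p (length x)) ()) x))" by (intro pts pt_comp[OF pCons(2)])
 moreover have "concat (map (%_. replicate m ()) x) = replicate (length x * m) ()" for m and x :: "'a list" by (induction x) (simp_all add: replicate_add)
 ultimately show ?case by (simp add: replicate_add)
qed

lemma tm_halted:
 assumes "fst ((tm_step M ^^ t) c) = tm_halt M" "t <= t'"
 shows "(tm_step M ^^ t') c = (tm_step M ^^ t) c" using assms(2)
proof (induction t' rule: dec_induct)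
 case (step n)
 obtain q ts where "(tm_step M ^^ t) c = (q, ts)" by fastforce
 thus ?case using step assms(1) by (simp add: tm_step_def)
qed simp

text \<open>\<open>V\<close> verifies membership in the complement of \<open>L\<close>. The tableau
  fixes the part \<open>pair_word x []\<close> of the verifier's input and leaves the certificate
  behind it open.\<close>

theorem coNP_reduction:
 assumes "L : class_coNP"
 obtains st tg where "pt st" "pt tg" "ALL x. ALL w:set (st x). w ~= []" "ALL x. x : L \<longleftrightarrow> ~ solvable (st x) (tg x)"
proof -
 obtain V p where V: "V : class_P" and cert: "!!x. (x : - L) = (EX y. length y <= poly p (length x) & pair_word x y : V)"
  using assms unfolding class_coNP_def class_NP_def by blast
 obtain M T where M: "wf_tm M" and comp: "tm_computes_within M (%w. [w : V]) (poly T)" using V unfolding class_P_def polytime_computable_def by blast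
 define K where "K = length (controls M) + tm_symbols M"
 define u where "u = (%x. pair_word x [])"
 define up where "up = (%x :: bool list. replicate (poly p (length x)) ())"
 \<comment> \<open>A pair word has length \<open>2 * length x + 2\<close> plus that of the
   certificate, so this is the running time of the verifier on its longest input.\<close>
 define ut where "ut = (%x :: bool list. replicate (poly (pcompose T ([:2, 2:] + p)) (length x)) ())"
 define cs where "cs = (%x. tableau M (u x) (up x) (ut x))"
 have loc: "tm_tableau M" by unfold_locales (rule M)
 have K: "0 < K" using M by (auto simp: K_def wf_tm_def)
 have "pt u" unfolding u_def pair_word_def by (intro pts)
 hence cs: "pt cs" unfolding cs_def by (intro pt_tableau) (simp_all add: up_def ut_def pt_replicate_poly)
 note tab = tm_tableau.tableau_tables[OF loc]
 have ne: "w ~= []" if "w : set (stages K (cs x))" for x w by (rule stages_nonempty[OF K _ that]) (use tab in "fastforce simp: cs_def")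
 have pw: "pair_word x y = u x @ y" for x y by (simp add: u_def pair_word_def)
 have lu: "length (u x) = 2 * length x + 2" for x
 proof -
  have "length (concat (map (%b. [b, b]) x)) = 2 * length x" by (induction x) auto
  thus ?thesis by (simp add: u_def pair_word_def)
 qed
 have acc: "(ALL d. tm_tableau.content M (u x @ y) (length (ut x)) (tm_tapes M - 1) d ~= 1) = (u x @ y : V)"
  if y: "length y <= length (up x)" for x y
 proof -
  interpret tm_tableau M "u x" "up x" "ut x" by (rule loc)
  let ?w = "u x @ y"
  have "poly T (length ?w) <= poly T (poly ([:2, 2:] + p) (length x))" by (rule poly_nat_mono) (use y lu in "simp add: up_def")
  hence t: "poly T (length ?w) <= length (ut x)" by (simp add: ut_def poly_pcompose)
  obtain q ts where c: "conf ?w (poly T (length ?w)) = (q, ts)" by fastforce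
  have h: "q = tm_halt M" "fst (last ts) = word_cells [?w : V]" using comp c unfolding tm_computes_within_def conf_def by (metis (mono_tags, lifting) old.prod.case)+
  have "conf ?w (length (ut x)) = conf ?w (poly T (length ?w))" unfolding conf_def by (rule tm_halted[OF _ t]) (use c h in "simp add: conf_def")
  hence ts: "snd (conf ?w (length (ut x))) = ts" using c by simp
  have "length ts = k" using conf_wf(2)[of ?w "length (ut x)"] ts by simp
  hence "ts ! (k - 1) = last ts" using wf by (metis last_conv_nth list.size(3) not_one_le_zero)
  hence ct: "content ?w (length (ut x)) (k - 1) d = word_cells [?w : V] (snd (last ts) + d)" for d unfolding content_def cell_def ts using h by simp
  show ?thesis
  proof
   assume "ALL d. content ?w (length (ut x)) (k - 1) d ~= 1"
   \<comment> \<open>Contents are relative to the head, so the output bit in cell 0 is found at the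
     negated head position.\<close>
   from this[rule_format, of "- snd (last ts)"] show "?w : V" unfolding ct by (auto simp: word_cells_def split: if_splits)
  next
   assume "?w : V"
   thus "ALL d. content ?w (length (ut x)) (k - 1) d ~= 1" unfolding ct by (auto simp: word_cells_def)
  qed
 qed
 have "(x : L) = (~ solvable (stages K (cs x)) (target K (cs x)))" for x
 proof -
  have "solvable (stages K (cs x)) (target K (cs x)) = (satisfiable K (cs x))" by (rule solvable_stages[OF K]) (use tab in "fastforce simp: cs_def")
  also have "... = (EX y. length y <= length (up x) & (ALL d. tm_tableau.content M (u x @ y) (length (ut x)) (tm_tapes M - 1) d ~= 1))"
   unfolding cs_def K_def by (rule tm_tableau.satisfiable_tableau[OF loc])
  also have "... = (EX y. length y <= length (up x) & pair_word x y : V)" using acc pw by metis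
  also have "... = (x ~: L)" using cert[of x] by (simp add: up_def)
  finally show ?thesis by blast
 qed
 thus ?thesis using that[of "%x. stages K (cs x)" "%x. target K (cs x)"] pt_stages[OF cs] ne by blast
qed

lemma enc_instance_inj: "enc_instance I = enc_instance J ==> I = J"
proof -
 assume e: "enc_instance I = enc_instance J"
 obtain d where d: "pcode (%t. enc_instance (of_tuple t)) d" using pcode_instance by blast
 obtain s t where st: "I = of_tuple s" "J = of_tuple t" using of_tuple_surj by metis
 have "d (enc_instance (of_tuple s) @ []) = (s, [])" "d (enc_instance (of_tuple t) @ []) = (t, [])" by (rule pcodeD(3)[OF d])+
 hence "(s, []) = (t, [] :: bool list)" by (simp only: e[unfolded st])
 thus ?thesis unfolding st by (simp only: prod.inject)
qed

lemma coNP_hard: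
 assumes moves: "moves = all_moves | moves = first_moves"
  and C: "C = {enc_instance I | I. wf_instance I & P I}"
  and P: "!!ws T. sum_game ws moves ==> P (of_tuple (sum_instance moves ws T)) = (~ solvable ws T)"
 shows "ALL L:class_coNP. polytime_reducible L C"
proof
 fix L assume "L : class_coNP"
 then obtain st tg where r: "pt st" "pt tg" "ALL x. ALL w:set (st x). w ~= []" "ALL x. x : L \<longleftrightarrow> ~ solvable (st x) (tg x)" by (rule coNP_reduction)
 let ?I = "%x. of_tuple (sum_instance moves (st x) (tg x))"
 have g: "sum_game (st x) moves" for x by unfold_locales (use r(3) moves nth_mem in blast)+
 obtain d where d: "pcode (%t. enc_instance (of_tuple t)) d" using pcode_instance by blast
 have "pt moves" using moves pt_moves by blast
 hence "pt (%x. enc_instance (?I x))" by (intro pt_comp[OF pcodeD(1)[OF d]] pt_sum_instance r(1,2))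
 hence "polytime_computable (%x. enc_instance (?I x))" by (rule pt_polytime)
 moreover have "(x : L) = (enc_instance (?I x) : C)" for x
 proof -
  have "(enc_instance (?I x) : C) = (wf_instance (?I x) & P (?I x))" unfolding C using enc_instance_inj by blast
  also have "... = (x : L)" using sum_game.wf[OF g] P[OF g] r(4) by blast
  finally show ?thesis by blast
 qed
 ultimately show "polytime_reducible L C" unfolding polytime_reducible_def by blast
qed

theorem theorem19:
  shows "coNP_complete Nash_checking \<and>
    coNP_complete subgame_perfect_checking \<and>
    coNP_complete deterministic_subgame_perfect_checking"
proof -
 have "ALL L:class_coNP. polytime_reducible L Nash_checking" by (rule coNP_hard[OF disjI1[OF refl] Nash_checking_def]) (rule sum_game.sum_game(1)[OF _ refl])
 moreover have "ALL L:class_coNP. polytime_reducible L subgame_perfect_checking"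
  by (rule coNP_hard[OF disjI2[OF refl] subgame_perfect_checking_def]) (rule sum_game.sum_game(2))
 moreover have "ALL L:class_coNP. polytime_reducible L deterministic_subgame_perfect_checking"
  by (rule coNP_hard[OF disjI2[OF refl] deterministic_subgame_perfect_checking_def]) (use sum_game.sum_game(2) sum_game.det[OF _ refl] in blast)
 ultimately show ?thesis using Nash_checking_coNP subgame_perfect_checking_coNP deterministic_subgame_perfect_checking_coNP by (simp add: coNP_complete_def)
qed

end
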